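(* Let $(M,g)$ be a complete non-compact Riemannian manifold with the doubling property and let $(N,h)$ be a Riemannian manifold. Assume $d_F<\infty$. Let $u:(M,g)\to(N,h)$ be a $C^2$ map such that $\mathrm{div}_g\sigma_{F,u}=s$ on $M$, where $s$ is a constant (i.e. parallel, $\tilde\nabla s=0$) section of $u^{-1}TN$. Let $\phi:(0,+\infty)\to(0,+\infty)$ be an increasing function such that $\phi(R)=o(R)$ as $R\to\infty$. If $$\limsup_{R\to\infty}\frac{1}{V(R)}\int_{B(R)}\frac{\|\sigma_{F,u}\|}{\phi(r(x))}\,dv_g<\infty,$$ then $u$ is a stationary map for the functional $\Phi_F$, i.e. $\mathrm{div}_g\sigma_{F,u}=0$ on $M$.
   Context: $F:[0,+\infty)\to[0,+\infty)$ is a $C^2$ function with $F(0)=0$ and $F'>0$ on $(0,+\infty)$; $d_F=\sup_{t>0}\frac{tF'(t)}{F(t)}$. Manifolds are connected. A point $x_0\in M$ is fixed, $r(x)=d_g(x,x_0)$, $B(R)=B(x_0,R)$ is the geodesic ball and $V(R)=\mathrm{Vol}_g(B(R))$. $(M,g)$ has the doubling property if there is a constant $D(M)>0$ such that $\mathrm{Vol}_g(B(x,2R))\le D(M)\,\mathrm{Vol}_g(B(x,R))$ for all $R>0$ and $x\in M$. With $m=\dim M$ and $\{e_i\}_{i=1}^m$ a local orthonormal frame on $M$: $\|u^*h\|^2=\sum_{i,j=1}^m\langle du(e_i),du(e_j)\rangle_h^2$, $\Phi_F(u)=\int_MF\left(\frac{\|u^*h\|^2}{4}\right)dv_g$, $\sigma_u(Y)=\sum_{i=1}^m\langle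 du(Y),du(e_i)\rangle_h\,du(e_i)$, and $\sigma_{F,u}=F'\left(\frac{\|u^*h\|^2}{4}\right)\sigma_u$, a $u^{-1}TN$-valued 1-form on $M$, with Hilbert–Schmidt norm $\|\sigma_{F,u}\|$. $\nabla$ is the Levi-Civita connection of $M$, $\tilde\nabla$ the connection on $u^{-1}TN$ induced by the Levi-Civita connection of $N$, and $\mathrm{div}_g\sigma_{F,u}=\sum_{i=1}^m\left\{\tilde\nabla_{e_i}(\sigma_{F,u}(e_i))-\sigma_{F,u}(\nabla_{e_i}e_i)\right\}$. The map $u$ is stationary for $\Phi_F$ if $\mathrm{div}_g\sigma_{F,u}=0$. *)

theory Defs
  imports "HOL-Analysis.Analysis" "HOL-Library.Landau_Symbols"
begin

text \<open>
  Smooth manifolds live on a whole type \<open>'a\<close>, are modelled on \<open>real ^ 'm\<close> (so the dimension is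
  \<open>CARD('m)\<close>), and are given by an atlas that need not be maximal. A chart is a pair of a domain
  and a coordinate map, whose values outside the domain are irrelevant.
\<close>

subsection \<open>Smooth maps between open sets of Euclidean spaces\<close>

text \<open>Meant for open \<open>S\<close>; continuity of all iterated directional derivatives.\<close>

primrec Ck_on :: "nat \<Rightarrow> 'c::euclidean_space set \<Rightarrow> ('c \<Rightarrow> 'd::real_normed_vector) \<Rightarrow> bool" where
  "Ck_on 0 S f \<longleftrightarrow> continuous_on S f"
| "Ck_on (Suc k) S f \<longleftrightarrow> (\<forall>y\<in>S. f differentiable (at y)) \<and>
     (\<forall>v. Ck_on k S (\<lambda>y. frechet_derivative f (at y) v))"

definition smooth_on :: "'c::euclidean_space set \<Rightarrow> ('c \<Rightarrow> 'd::real_normed_vector) \<Rightarrow> bool" where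
  "smooth_on S f \<longleftrightarrow> (\<forall>k. Ck_on k S f)"

subsection \<open>Manifolds, tangent vectors, Riemannian metrics\<close>

type_synonym ('a, 'm) chart = "'a set \<times> ('a \<Rightarrow> real ^ 'm)"

abbreviation cdom :: "('a, 'm::finite) chart \<Rightarrow> 'a set" where "cdom \<equiv> fst"
abbreviation cmap :: "('a, 'm::finite) chart \<Rightarrow> 'a \<Rightarrow> real ^ 'm" where "cmap \<equiv> snd"

definition cinv :: "('a, 'm::finite) chart \<Rightarrow> real ^ 'm \<Rightarrow> 'a" where
  "cinv c = inv_into (cdom c) (cmap c)"

definition is_chart :: "('a::topological_space, 'm::finite) chart \<Rightarrow> bool" where
  "is_chart c \<longleftrightarrow> open (cdom c) \<and> open (cmap c ` cdom c) \<and>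
     homeomorphism (cdom c) (cmap c ` cdom c) (cmap c) (cinv c)"

definition smooth_atlas :: "('a::topological_space, 'm::finite) chart set \<Rightarrow> bool" where
  "smooth_atlas A \<longleftrightarrow> (\<forall>c\<in>A. is_chart c) \<and> (\<Union>c\<in>A. cdom c) = UNIV \<and>
     (\<forall>c\<in>A. \<forall>d\<in>A. smooth_on (cmap c ` (cdom c \<inter> cdom d)) (cmap d \<circ> cinv c))"

text \<open>A tangent vector at \<open>p\<close> is the family of its components in all charts around \<open>p\<close>, related by
  the Jacobians of the coordinate changes; it is \<open>0\<close> at every other argument, so that
  equality of tangent vectors is equality of functions. The vector space operations are pointwise.\<close>

type_synonym ('a, 'm) tvec = "('a, 'm) chart \<Rightarrow> real ^ 'm"

record ('a, 'm) riem =
  atlas :: "('a, 'm::finite) chart set"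
  metric :: "'a \<Rightarrow> ('a, 'm) tvec \<Rightarrow> ('a, 'm) tvec \<Rightarrow> real"

definition charts_at :: "('a, 'm::finite) riem \<Rightarrow> 'a \<Rightarrow> ('a, 'm) chart set" where
  "charts_at M p = {c \<in> atlas M. p \<in> cdom c}"

definition some_chart :: "('a, 'm::finite) riem \<Rightarrow> 'a \<Rightarrow> ('a, 'm) chart" where
  "some_chart M p = (SOME c. c \<in> charts_at M p)"

definition tangent_space :: "('a, 'm::finite) riem \<Rightarrow> 'a \<Rightarrow> ('a, 'm) tvec set" where
  "tangent_space M p = {v. (\<forall>c. c \<notin> charts_at M p \<longrightarrow> v c = 0) \<and>
     (\<forall>c\<in>charts_at M p. \<forall>d\<in>charts_at M p.
        v d = frechet_derivative (cmap d \<circ> cinv c) (at (cmap c p)) (v c))}"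

definition tzero :: "('a, 'm::finite) tvec" where
  "tzero = (\<lambda>c. 0)"

text \<open>The coordinate vector field \<open>\<partial>/\<partial>x\<^sup>i\<close> of the chart \<open>c\<close>.\<close>

definition coord_vec :: "('a, 'm::finite) riem \<Rightarrow> ('a, 'm) chart \<Rightarrow> 'm \<Rightarrow> 'a \<Rightarrow> ('a, 'm) tvec" where
  "coord_vec M c i p = (\<lambda>d. if d \<in> charts_at M p
     then frechet_derivative (cmap d \<circ> cinv c) (at (cmap c p)) (axis i 1) else 0)"

definition gram :: "('a, 'm::finite) riem \<Rightarrow> ('a, 'm) chart \<Rightarrow> 'a \<Rightarrow> real ^ 'm ^ 'm" where
  "gram M c p = (\<chi> i j. metric M p (coord_vec M c i p) (coord_vec M c j p))"

definition inner_product_on_tangent :: "('a, 'm::finite) riem \<Rightarrow> 'a \<Rightarrow> bool" where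
  "inner_product_on_tangent M p \<longleftrightarrow>
     (\<forall>v\<in>tangent_space M p. \<forall>w\<in>tangent_space M p. metric M p v w = metric M p w v) \<and>
     (\<forall>v\<in>tangent_space M p. \<forall>w\<in>tangent_space M p. \<forall>z\<in>tangent_space M p. \<forall>a b.
        metric M p (\<lambda>c. a *\<^sub>R v c + b *\<^sub>R w c) z = a * metric M p v z + b * metric M p w z) \<and>
     (\<forall>v\<in>tangent_space M p. v \<noteq> tzero \<longrightarrow> metric M p v v > 0)"

text \<open>Manifolds are connected by convention; Hausdorff and second countable come from the sort.\<close>

definition riemannian_manifold ::
    "('a::{t2_space, second_countable_topology}, 'm::finite) riem \<Rightarrow> bool" where
  "riemannian_manifold M \<longleftrightarrow> smooth_atlas (atlas M) \<and> connected (UNIV :: 'a set) \<and>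
     (\<forall>p. inner_product_on_tangent M p) \<and>
     (\<forall>c\<in>atlas M. smooth_on (cmap c ` cdom c) (gram M c \<circ> cinv c))"

subsection \<open>Riemannian distance\<close>

definition C1_curve_on :: "('a, 'm::finite) riem \<Rightarrow> real set \<Rightarrow> (real \<Rightarrow> 'a) \<Rightarrow> bool" where
  "C1_curve_on M I \<gamma> \<longleftrightarrow> (\<forall>c\<in>atlas M. \<exists>D. continuous_on {t \<in> I. \<gamma> t \<in> cdom c} D \<and>
     (\<forall>t\<in>I. \<gamma> t \<in> cdom c \<longrightarrow> (cmap c \<circ> \<gamma> has_vector_derivative D t) (at t within I)))"

text \<open>\<open>T\<close> is the set of break points; on each closed interval between them the curve is \<open>C\<^sup>1\<close>,
  with one-sided derivatives at the end points.\<close>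

definition piecewise_C1_curve ::
    "('a::topological_space, 'm::finite) riem \<Rightarrow> (real \<Rightarrow> 'a) \<Rightarrow> bool" where
  "piecewise_C1_curve M \<gamma> \<longleftrightarrow> continuous_on {0..1} \<gamma> \<and>
     (\<exists>T. finite T \<and> (\<forall>a b. 0 \<le> a \<and> a < b \<and> b \<le> 1 \<and> {a<..<b} \<inter> T = {} \<longrightarrow>
        C1_curve_on M {a..b} \<gamma>))"

definition velocity :: "('a, 'm::finite) riem \<Rightarrow> (real \<Rightarrow> 'a) \<Rightarrow> real \<Rightarrow> ('a, 'm) tvec" where
  "velocity M \<gamma> t = (\<lambda>c. if c \<in> charts_at M (\<gamma> t)
     then vector_derivative (cmap c \<circ> \<gamma>) (at t) else 0)"

definition curve_length :: "('a, 'm::finite) riem \<Rightarrow> (real \<Rightarrow> 'a) \<Rightarrow> real" where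
  "curve_length M \<gamma> =
     integral {0..1} (\<lambda>t. sqrt (metric M (\<gamma> t) (velocity M \<gamma> t) (velocity M \<gamma> t)))"

definition gdist :: "('a::topological_space, 'm::finite) riem \<Rightarrow> 'a \<Rightarrow> 'a \<Rightarrow> real" where
  "gdist M x y = Inf {curve_length M \<gamma> | \<gamma>. piecewise_C1_curve M \<gamma> \<and> \<gamma> 0 = x \<and> \<gamma> 1 = y}"

definition gball :: "('a::topological_space, 'm::finite) riem \<Rightarrow> 'a \<Rightarrow> real \<Rightarrow> 'a set" where
  "gball M x R = {y. gdist M x y < R}"

definition complete_riem :: "('a::topological_space, 'm::finite) riem \<Rightarrow> bool" where
  "complete_riem M \<longleftrightarrow> Metric_space.mcomplete UNIV (gdist M)"

subsection \<open>Riemannian volume\<close>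

text \<open>The unique Borel measure which equals \<open>sqrt (det g\<^sub>i\<^sub>j) dx\<close> in every chart.\<close>

definition vol :: "('a::topological_space, 'm::finite) riem \<Rightarrow> 'a measure" where
  "vol M = (THE \<mu>. sets \<mu> = sets borel \<and>
     (\<forall>c\<in>atlas M. \<forall>A\<in>sets borel. A \<subseteq> cdom c \<longrightarrow>
        emeasure \<mu> A = (\<integral>\<^sup>+y\<in>cmap c ` A. ennreal (sqrt (det (gram M c (cinv c y)))) \<partial>lborel)))"

definition doubling :: "('a::topological_space, 'm::finite) riem \<Rightarrow> bool" where
  "doubling M \<longleftrightarrow> (\<exists>D>0. \<forall>R>0. \<forall>x.
     emeasure (vol M) (gball M x (2 * R)) \<le> ennreal D * emeasure (vol M) (gball M x R))"

subsection \<open>Connections\<close>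

definition dgram :: "('a, 'm::finite) riem \<Rightarrow> ('a, 'm) chart \<Rightarrow> 'a \<Rightarrow> 'm \<Rightarrow> 'm \<Rightarrow> 'm \<Rightarrow> real" where
  "dgram M c p i j l =
     frechet_derivative (\<lambda>y. gram M c (cinv c y) $ j $ l) (at (cmap c p)) (axis i 1)"

text \<open>\<open>christoffel M c p k i j\<close> is \<open>\<Gamma>\<^sup>k\<^sub>i\<^sub>j\<close> of the Levi-Civita connection.\<close>

definition christoffel ::
    "('a, 'm::finite) riem \<Rightarrow> ('a, 'm) chart \<Rightarrow> 'a \<Rightarrow> 'm \<Rightarrow> 'm \<Rightarrow> 'm \<Rightarrow> real" where
  "christoffel M c p k i j = (1/2) * (\<Sum>l\<in>UNIV. matrix_inv (gram M c p) $ k $ l *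
     (dgram M c p i j l + dgram M c p j i l - dgram M c p l i j))"

text \<open>\<open>\<nabla>\<^sub>X Y\<close> at \<open>p\<close>, for \<open>X\<close> in the tangent space at \<open>p\<close> and a vector field \<open>Y\<close> defined near \<open>p\<close>.\<close>

definition cov_deriv ::
    "('a, 'm::finite) riem \<Rightarrow> 'a \<Rightarrow> ('a, 'm) tvec \<Rightarrow> ('a \<Rightarrow> ('a, 'm) tvec) \<Rightarrow> ('a, 'm) tvec" where
  "cov_deriv M p X Y = (\<lambda>c. if c \<in> charts_at M p
     then frechet_derivative (\<lambda>y. Y (cinv c y) c) (at (cmap c p)) (X c) +
       (\<chi> k. \<Sum>i\<in>UNIV. \<Sum>j\<in>UNIV. christoffel M c p k i j * X c $ i * Y p c $ j)
     else 0)"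

definition differential :: "('a, 'm::finite) riem \<Rightarrow> ('b, 'n::finite) riem \<Rightarrow> ('a \<Rightarrow> 'b) \<Rightarrow> 'a \<Rightarrow>
    ('a, 'm) tvec \<Rightarrow> ('b, 'n) tvec" where
  "differential M N u p X = (\<lambda>d. if d \<in> charts_at N (u p)
     then let c = some_chart M p in
       frechet_derivative (cmap d \<circ> u \<circ> cinv c) (at (cmap c p)) (X c)
     else 0)"

text \<open>\<open>\<nabla>\<^sub>X V\<close> at \<open>p\<close> for a section \<open>V\<close> of the pull-back bundle \<open>u\<^sup>-\<^sup>1 TN\<close> and the connection induced
  by the Levi-Civita connection of \<open>N\<close>. As functions of the point of \<open>M\<close>, the components of \<open>V\<close> in
  a chart of \<open>N\<close> are differentiated in a chart of \<open>M\<close>.\<close>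

definition pullback_cov_deriv :: "('a, 'm::finite) riem \<Rightarrow> ('b, 'n::finite) riem \<Rightarrow> ('a \<Rightarrow> 'b) \<Rightarrow>
    'a \<Rightarrow> ('a, 'm) tvec \<Rightarrow> ('a \<Rightarrow> ('b, 'n) tvec) \<Rightarrow> ('b, 'n) tvec" where
  "pullback_cov_deriv M N u p X V = (\<lambda>d. if d \<in> charts_at N (u p)
     then let c = some_chart M p in
       frechet_derivative (\<lambda>y. V (cinv c y) d) (at (cmap c p)) (X c) +
       (\<chi> k. \<Sum>i\<in>UNIV. \<Sum>j\<in>UNIV.
          christoffel N d (u p) k i j * differential M N u p X d $ i * V p d $ j)
     else 0)"

definition Ck_map :: "nat \<Rightarrow> ('a::topological_space, 'm::finite) riem \<Rightarrow>
    ('b::topological_space, 'n::finite) riem \<Rightarrow> ('a \<Rightarrow> 'b) \<Rightarrow> bool" where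
  "Ck_map k M N u \<longleftrightarrow> continuous_on UNIV u \<and>
     (\<forall>c\<in>atlas M. \<forall>d\<in>atlas N.
        Ck_on k (cmap c ` (cdom c \<inter> u -` cdom d)) (cmap d \<circ> u \<circ> cinv c))"

definition Ck_section :: "nat \<Rightarrow> ('a, 'm::finite) riem \<Rightarrow> ('b, 'n::finite) riem \<Rightarrow> ('a \<Rightarrow> 'b) \<Rightarrow>
    ('a \<Rightarrow> ('b, 'n) tvec) \<Rightarrow> bool" where
  "Ck_section k M N u V \<longleftrightarrow> (\<forall>p. V p \<in> tangent_space N (u p)) \<and>
     (\<forall>c\<in>atlas M. \<forall>d\<in>atlas N.
        Ck_on k (cmap c ` (cdom c \<inter> u -` cdom d)) (\<lambda>y. V (cinv c y) d))"

definition parallel_section :: "('a, 'm::finite) riem \<Rightarrow> ('b, 'n::finite) riem \<Rightarrow> ('a \<Rightarrow> 'b) \<Rightarrow>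
    ('a \<Rightarrow> ('b, 'n) tvec) \<Rightarrow> bool" where
  "parallel_section M N u V \<longleftrightarrow> Ck_section 1 M N u V \<and>
     (\<forall>p. \<forall>X\<in>tangent_space M p. pullback_cov_deriv M N u p X V = tzero)"

subsection \<open>Orthonormal frames\<close>

definition smooth_vector_field_on ::
    "('a, 'm::finite) riem \<Rightarrow> 'a set \<Rightarrow> ('a \<Rightarrow> ('a, 'm) tvec) \<Rightarrow> bool" where
  "smooth_vector_field_on M W Y \<longleftrightarrow> (\<forall>p\<in>W. Y p \<in> tangent_space M p) \<and>
     (\<forall>c\<in>atlas M. smooth_on (cmap c ` (cdom c \<inter> W)) (\<lambda>y. Y (cinv c y) c))"

definition orthonormal_frame_on ::
    "('a::topological_space, 'm::finite) riem \<Rightarrow> 'a set \<Rightarrow> ('m \<Rightarrow> 'a \<Rightarrow> ('a, 'm) tvec) \<Rightarrow> bool" where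
  "orthonormal_frame_on M W e \<longleftrightarrow> open W \<and> (\<forall>i. smooth_vector_field_on M W (e i)) \<and>
     (\<forall>p\<in>W. \<forall>i j. metric M p (e i p) (e j p) = (if i = j then 1 else 0))"

text \<open>A local orthonormal frame around \<open>p\<close>. The traces taken below over such a frame do not depend on
  its choice (for \<open>\<omega>\<close> linear on tangent spaces and differentiable).\<close>

definition frame_at ::
    "('a::topological_space, 'm::finite) riem \<Rightarrow> 'a \<Rightarrow> 'm \<Rightarrow> 'a \<Rightarrow> ('a, 'm) tvec" where
  "frame_at M p = (SOME e. \<exists>W. p \<in> W \<and> orthonormal_frame_on M W e)"

subsection \<open>The functional and its stress form\<close>

definition halfline_deriv :: "(real \<Rightarrow> real) \<Rightarrow> real \<Rightarrow> real" where
  "halfline_deriv F t = vector_derivative F (at t within {0..})"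

definition C2_halfline :: "(real \<Rightarrow> real) \<Rightarrow> bool" where
  "C2_halfline F \<longleftrightarrow> F differentiable_on {0..} \<and> halfline_deriv F differentiable_on {0..} \<and>
     continuous_on {0..} (halfline_deriv (halfline_deriv F))"

definition F_degree :: "(real \<Rightarrow> real) \<Rightarrow> ereal" where
  "F_degree F = (SUP t\<in>{0<..}. ereal (t * halfline_deriv F t / F t))"

text \<open>\<open>\<parallel>u\<^sup>* h\<parallel>\<^sup>2\<close> at \<open>p\<close>.\<close>

definition pullback_norm2 :: "('a::topological_space, 'm::finite) riem \<Rightarrow> ('b, 'n::finite) riem \<Rightarrow>
    ('a \<Rightarrow> 'b) \<Rightarrow> 'a \<Rightarrow> real" where
  "pullback_norm2 M N u p = (let e = (\<lambda>i. frame_at M p i p) in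
     \<Sum>i\<in>UNIV. \<Sum>j\<in>UNIV.
       (metric N (u p) (differential M N u p (e i)) (differential M N u p (e j)))\<^sup>2)"

definition Phi :: "(real \<Rightarrow> real) \<Rightarrow> ('a::topological_space, 'm::finite) riem \<Rightarrow>
    ('b, 'n::finite) riem \<Rightarrow> ('a \<Rightarrow> 'b) \<Rightarrow> ennreal" where
  "Phi F M N u = (\<integral>\<^sup>+p. ennreal (F (pullback_norm2 M N u p / 4)) \<partial>vol M)"

definition sigma :: "('a::topological_space, 'm::finite) riem \<Rightarrow> ('b, 'n::finite) riem \<Rightarrow>
    ('a \<Rightarrow> 'b) \<Rightarrow> 'a \<Rightarrow> ('a, 'm) tvec \<Rightarrow> ('b, 'n) tvec" where
  "sigma M N u p Y = (let e = (\<lambda>i. frame_at M p i p) in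
     (\<lambda>d. \<Sum>i\<in>UNIV. metric N (u p) (differential M N u p Y) (differential M N u p (e i)) *\<^sub>R
            differential M N u p (e i) d))"

definition sigma_F :: "(real \<Rightarrow> real) \<Rightarrow> ('a::topological_space, 'm::finite) riem \<Rightarrow>
    ('b, 'n::finite) riem \<Rightarrow> ('a \<Rightarrow> 'b) \<Rightarrow> 'a \<Rightarrow> ('a, 'm) tvec \<Rightarrow> ('b, 'n) tvec" where
  "sigma_F F M N u p Y =
     (\<lambda>d. halfline_deriv F (pullback_norm2 M N u p / 4) *\<^sub>R sigma M N u p Y d)"

text \<open>Hilbert--Schmidt norm and divergence of a \<open>u\<^sup>-\<^sup>1 TN\<close>-valued 1-form \<open>\<omega>\<close> on \<open>M\<close>.\<close>

definition hs_norm :: "('a::topological_space, 'm::finite) riem \<Rightarrow> ('b, 'n::finite) riem \<Rightarrow>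
    ('a \<Rightarrow> 'b) \<Rightarrow> ('a \<Rightarrow> ('a, 'm) tvec \<Rightarrow> ('b, 'n) tvec) \<Rightarrow> 'a \<Rightarrow> real" where
  "hs_norm M N u \<omega> p = (let e = (\<lambda>i. frame_at M p i p) in
     sqrt (\<Sum>i\<in>UNIV. metric N (u p) (\<omega> p (e i)) (\<omega> p (e i))))"

definition divergence :: "('a::topological_space, 'm::finite) riem \<Rightarrow> ('b, 'n::finite) riem \<Rightarrow>
    ('a \<Rightarrow> 'b) \<Rightarrow> ('a \<Rightarrow> ('a, 'm) tvec \<Rightarrow> ('b, 'n) tvec) \<Rightarrow> 'a \<Rightarrow> ('b, 'n) tvec" where
  "divergence M N u \<omega> p = (let e = frame_at M p in
     (\<lambda>d. \<Sum>i\<in>UNIV. pullback_cov_deriv M N u p (e i p) (\<lambda>q. \<omega> q (e i q)) d -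
            \<omega> p (cov_deriv M p (e i p) (e i)) d))"

text \<open>Stationary maps for \<^const>\<open>Phi\<close> are by definition the solutions of its Euler--Lagrange
  equation.\<close>

definition stationary :: "(real \<Rightarrow> real) \<Rightarrow> ('a::topological_space, 'm::finite) riem \<Rightarrow>
    ('b, 'n::finite) riem \<Rightarrow> ('a \<Rightarrow> 'b) \<Rightarrow> bool" where
  "stationary F M N u \<longleftrightarrow> (\<forall>p. divergence M N u (sigma_F F M N u) p = tzero)"

end

theory Submission
  imports Defs
begin

text \<open>
  Pair \<open>\<sigma>\<^sub>F\<close> with the parallel section \<open>s\<close> to obtain a vector field \<open>X\<close> on \<open>M\<close>. Since \<open>s\<close> is parallel,
  \<open>div X = \<bar>s\<bar>\<^sup>2\<close> is a constant \<open>c\<close>. Testing against a cutoff that is \<open>1\<close> on \<open>B(R)\<close>, vanishes outside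
  \<open>B(2R)\<close> and is \<open>1/R\<close>-Lipschitz gives \<open>c V(R) \<le> (K/R) \<integral>\<^bsub>B(4R)\<^esub> \<bar>X\<bar>\<close>. By the growth hypothesis
  and doubling the right-hand side is at most \<open>K' \<phi>(4R)/R V(R)\<close>, so \<open>c = 0\<close>.

  The Hopf--Rinow theorem is not needed: doubling and completeness already make bounded closed
  sets compact. The distance cutoff is only Lipschitz, but no smoothing is used: the integration by parts
  is done with difference quotients, in charts where the metric is nearly Euclidean at a point.
\<close>

subsection \<open>Calculus of \<open>C\<^sup>k\<close> functions\<close>

text \<open>Two obstacles shape the development. The definitions choose: \<open>frame_at\<close>
  picks a frame at each point separately, \<open>some_chart\<close> picks a chart,
  \<open>vol\<close> is described by its values in charts. Nothing can be differentiated or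
  integrated before the traces are shown independent of the frame, the differential independent of
  the chart, and the chart measures glued. Moreover the equation is written with covariant
  derivatives along frames, while integration by parts happens in charts. The bridge is the identity
  g(e_i, nabla_{e_j} e_j) = g(e_j, [e_i, e_j]): it contains no Christoffel symbols, and a bracket is
  visibly independent of the chart. Localization must not bring in the number of charts, which would
  grow with R. The estimate is therefore proved for the divergence of \<open>\<psi>\<close> X with
  weights \<open>\<psi>\<close> \<ge> 0. Its right side is linear in \<open>\<psi>\<close> and its
  left side subadditive, so the pieces recombine with one fixed factor 4 m, where m is the
  dimension: 2 for the length of a coordinate displacement, 2 for the comparison of norms, m for the
  directions.\<close>

lemma Ck_on_SucD:
  assumes "Ck_on (Suc k) S f" "y \<in> S"
  shows "(f has_derivative frechet_derivative f (at y)) (at y)"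
  using assms by (simp add: frechet_derivative_works)

lemma Ck_on_cong:
  assumes "open S" "\<And>y. y \<in> S \<Longrightarrow> f y = g y" "Ck_on k S f"
  shows "Ck_on k S g"
  using assms(2,3)
proof (induction k arbitrary: f g)
  case 0
  then show ?case by (metis Ck_on.simps(1) continuous_on_cong)
next
  case (Suc k)
  have d: "(g has_derivative frechet_derivative f (at y)) (at y)" if "y \<in> S" for y
    using Ck_on_SucD[OF Suc.prems(2) that] Suc.prems(1) that assms(1)
    by (meson has_derivative_transform_within_open)
  have e: "frechet_derivative g (at y) = frechet_derivative f (at y)" if "y \<in> S" for y
    using frechet_derivative_at[OF d[OF that]] by simp
  show ?case
  proof (simp, intro conjI ballI allI)
    fix v show "Ck_on k S (\<lambda>y. frechet_derivative g (at y) v)"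
      by (rule Suc.IH[of "\<lambda>y. frechet_derivative f (at y) v" "\<lambda>y. frechet_derivative g (at y) v"]) (use Suc.prems(2) in \<open>simp_all add: e\<close>)
  qed (use d in \<open>auto simp: differentiable_def\<close>)
qed

text \<open>Lets an explicitly known derivative stand in for \<open>frechet_derivative\<close>; the
  closure rules below then follow by induction from the corresponding derivative rules.\<close>

lemma Ck_on_SucI:
  assumes "open S" "\<And>y. y \<in> S \<Longrightarrow> (f has_derivative D y) (at y)" "\<And>v. Ck_on k S (\<lambda>y. D y v)"
  shows "Ck_on (Suc k) S f"
proof (simp, intro conjI ballI allI)
  fix v
  have "frechet_derivative f (at y) v = D y v" if "y \<in> S" for y
    using frechet_derivative_at[OF assms(2)[OF that]] by simp
  then show "Ck_on k S (\<lambda>y. frechet_derivative f (at y) v)"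
    by (intro Ck_on_cong[OF assms(1) _ assms(3)[of v]]) simp
qed (use assms(2) in \<open>auto simp: differentiable_def\<close>)

lemma Ck_on_subset: "Ck_on k S f \<Longrightarrow> T \<subseteq> S \<Longrightarrow> Ck_on k T f"
  by (induction k arbitrary: f) (auto intro: continuous_on_subset)

lemma Ck_on_continuous_on: "Ck_on k S f \<Longrightarrow> continuous_on S f"
  by (cases k) (auto intro!: continuous_at_imp_continuous_on differentiable_imp_continuous_within)

lemma Ck_on_lower: "Ck_on (Suc k) S f \<Longrightarrow> Ck_on k S f"
proof (induction k arbitrary: f)
  case 0
  then show ?case using Ck_on_continuous_on[OF 0] by simp
next
  case (Suc k)
  then show ?case by (metis Ck_on.simps(2))
qed

lemma Ck_on_mono: "Ck_on k S f \<Longrightarrow> j \<le> k \<Longrightarrow> Ck_on j S f"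
  by (induction k) (auto simp: le_Suc_eq dest: Ck_on_lower simp del: Ck_on.simps)

lemma Ck_on_const: "Ck_on k S (\<lambda>y. a)"
  by (induction k arbitrary: a) (auto simp: frechet_derivative_const)

lemma Ck_on_bounded_linear:
  assumes "bounded_linear L" "open S" "Ck_on k S f"
  shows "Ck_on k S (\<lambda>y. L (f y))"
  using assms(3)
proof (induction k arbitrary: f)
  case 0
  then show ?case using assms(1)
    by (auto intro: linear_continuous_on_compose bounded_linear.continuous_on)
next
  case (Suc k)
  show ?case
  proof (rule Ck_on_SucI[OF assms(2)])
    show "((\<lambda>y. L (f y)) has_derivative (\<lambda>v. L (frechet_derivative f (at y) v))) (at y)" if "y \<in> S" for y
      by (rule bounded_linear.has_derivative[OF assms(1) Ck_on_SucD[OF Suc.prems that]])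
    show "Ck_on k S (\<lambda>y. L (frechet_derivative f (at y) v))" for v
      using Suc by simp
  qed
qed

lemma Ck_on_id:
  assumes "open S" shows "Ck_on k S (\<lambda>y. y)"
proof (cases k)
  case (Suc j)
  show ?thesis unfolding Suc
    by (rule Ck_on_SucI[OF assms, where D="\<lambda>_ v. v"]) (auto intro: Ck_on_const)
qed simp

lemma Ck_on_add:
  assumes "open S" "Ck_on k S f" "Ck_on k S g"
  shows "Ck_on k S (\<lambda>y. f y + g y)"
  using assms(2,3)
proof (induction k arbitrary: f g)
  case (Suc k)
  show ?case
  proof (rule Ck_on_SucI[OF assms(1)])
    show "((\<lambda>y. f y + g y) has_derivative (\<lambda>v. frechet_derivative f (at y) v + frechet_derivative g (at y) v)) (at y)"
      if "y \<in> S" for y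
      by (intro has_derivative_add Ck_on_SucD[OF Suc.prems(1) that] Ck_on_SucD[OF Suc.prems(2) that])
    show "Ck_on k S (\<lambda>y. frechet_derivative f (at y) v + frechet_derivative g (at y) v)" for v
      using Suc by simp
  qed
qed (auto intro: continuous_intros)

lemma Ck_on_sum:
  assumes "open S" "\<And>i. i \<in> I \<Longrightarrow> Ck_on k S (f i)"
  shows "Ck_on k S (\<lambda>y. \<Sum>i\<in>I. f i y)"
  using assms(2) by (induction I rule: infinite_finite_induct) (auto intro: Ck_on_const Ck_on_add[OF assms(1)])

lemma Ck_on_bilinear:
  assumes B: "bounded_bilinear B" and "open S" "Ck_on k S f" "Ck_on k S g"
  shows "Ck_on k S (\<lambda>y. B (f y) (g y))"
  using assms(3,4)
proof (induction k arbitrary: f g)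
  case 0
  then show ?case by (auto intro: bounded_bilinear.continuous_on[OF B])
next
  case (Suc k)
  show ?case
  proof (rule Ck_on_SucI[OF assms(2)])
    show "((\<lambda>y. B (f y) (g y)) has_derivative (\<lambda>v. B (f y) (frechet_derivative g (at y) v) + B (frechet_derivative f (at y) v) (g y))) (at y)"
      if "y \<in> S" for y
      by (intro bounded_bilinear.FDERIV[OF B] Ck_on_SucD[OF Suc.prems(1) that] Ck_on_SucD[OF Suc.prems(2) that])
    show "Ck_on k S (\<lambda>y. B (f y) (frechet_derivative g (at y) v) + B (frechet_derivative f (at y) v) (g y))" for v
      using Suc.prems by (intro Ck_on_add[OF assms(2)] Suc.IH Ck_on_lower[of k S f] Ck_on_lower[of k S g]) auto
  qed
qed

lemmas Ck_on_scaleR = Ck_on_bilinear[OF bounded_bilinear_scaleR]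
lemmas Ck_on_inner = Ck_on_bilinear[OF bounded_bilinear_inner]
lemmas Ck_on_mult = Ck_on_bilinear[OF bounded_bilinear_mult]

lemma Ck_on_diff:
  assumes "open S" "Ck_on k S f" "Ck_on k S g"
  shows "Ck_on k S (\<lambda>y. f y - g y)"
  using Ck_on_add[OF assms(1,2) Ck_on_bounded_linear[OF bounded_linear_minus[OF bounded_linear_ident] assms(1,3)]]
  by simp

text \<open>\<open>Ck_on\<close> controls derivatives in fixed directions only, while the chain rule
  evaluates the outer derivative in a direction that moves with y. Expanding that direction over
  \<open>Basis\<close> leaves fixed directions with differentiable coefficients.\<close>

lemma Ck_on_compose:
  fixes f :: "'c::euclidean_space \<Rightarrow> 'd::euclidean_space" and g :: "'d \<Rightarrow> 'e::real_normed_vector"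
  assumes "open S" "open T" "f ` S \<subseteq> T" "Ck_on k S f" "Ck_on k T g"
  shows "Ck_on k S (\<lambda>y. g (f y))"
  using assms(4,5)
proof (induction k arbitrary: g)
  case 0
  then show ?case using assms(3) by (auto intro: continuous_on_compose2)
next
  case (Suc k)
  let ?D = "\<lambda>y v. frechet_derivative g (at (f y)) (frechet_derivative f (at y) v)"
  have d: "((\<lambda>y. g (f y)) has_derivative ?D y) (at y)" and 
    e: "?D y v = (\<Sum>b\<in>Basis. (frechet_derivative f (at y) v \<bullet> b) *\<^sub>R frechet_derivative g (at (f y)) b)"
    if "y \<in> S" for y v
  proof -
    have *: "(g has_derivative frechet_derivative g (at (f y))) (at (f y))"
      using Ck_on_SucD[OF Suc.prems(2), of "f y"] that assms(3) by auto
    show "((\<lambda>y. g (f y)) has_derivative ?D y) (at y)"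
      using has_derivative_compose[OF Ck_on_SucD[OF Suc.prems(1) that] *] .
    interpret bounded_linear "frechet_derivative g (at (f y))" using * by (rule has_derivative_bounded_linear)
    show "?D y v = (\<Sum>b\<in>Basis. (frechet_derivative f (at y) v \<bullet> b) *\<^sub>R frechet_derivative g (at (f y)) b)"
      by (subst euclidean_representation[symmetric, of "frechet_derivative f (at y) v"])
         (simp add: sum scaleR)
  qed
  show ?case
  proof (rule Ck_on_SucI[OF assms(1) d])
    fix v
    have "Ck_on k S (\<lambda>y. frechet_derivative g (at (f y)) b)" for b
      using Suc.prems Ck_on_lower[OF Suc.prems(1)] by (intro Suc.IH[of "\<lambda>z. frechet_derivative g (at z) b"]) simp_all
    then have "Ck_on k S (\<lambda>y. \<Sum>b\<in>Basis. (frechet_derivative f (at y) v \<bullet> b) *\<^sub>R frechet_derivative g (at (f y)) b)"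
      using Suc.prems by (intro Ck_on_sum Ck_on_scaleR Ck_on_inner Ck_on_const assms(1)) simp_all
    then show "Ck_on k S (\<lambda>y. ?D y v)" by (rule Ck_on_cong[OF assms(1), rotated]) (simp add: e)
  qed auto
qed

lemma Ck_on_vec_nth:
  fixes f :: "'c::euclidean_space \<Rightarrow> 'd::real_normed_vector ^ 'n"
  shows "open S \<Longrightarrow> Ck_on k S f \<Longrightarrow> Ck_on k S (\<lambda>y. f y $ i)"
  by (rule Ck_on_bounded_linear[OF bounded_linear_vec_nth])

lemma bounded_bilinear_matrix_vector_mult:
  "bounded_bilinear ((*v) :: real^'m^'n \<Rightarrow> real^'m \<Rightarrow> real^'n)"
proof
  show "\<exists>K. \<forall>(A::real^'m^'n) x. norm (A *v x) \<le> norm A * norm x * K"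
  proof (intro exI allI)
    fix A :: "real^'m^'n" and x :: "real^'m"
    have "norm (A *v x) \<le> (\<Sum>i\<in>UNIV. \<bar>(A *v x) $ i\<bar>)" by (rule norm_le_l1_cart)
    also have "\<dots> \<le> (\<Sum>i\<in>(UNIV::'n set). norm A * norm x)"
    proof (rule sum_mono)
      fix i
      have "\<bar>(A *v x) $ i\<bar> = \<bar>A $ i \<bullet> x\<bar>" by (simp add: matrix_vector_mul_component)
      also have "\<dots> \<le> norm (A $ i) * norm x" by (rule Cauchy_Schwarz_ineq2)
      also have "\<dots> \<le> norm A * norm x" by (intro mult_right_mono Finite_Cartesian_Product.norm_nth_le) auto
      finally show "\<bar>(A *v x) $ i\<bar> \<le> norm A * norm x" .
    qed
    also have "\<dots> = norm A * norm x * CARD('n)" by simp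
    finally show "norm (A *v x) \<le> norm A * norm x * CARD('n)" .
  qed
qed (simp_all add: matrix_vector_mult_add_rdistrib matrix_vector_right_distrib scaleR_matrix_vector_assoc
      matrix_vector_mult_scaleR)

lemmas Ck_on_matrix_vector = Ck_on_bilinear[OF bounded_bilinear_matrix_vector_mult]

text \<open>Serves twice: with exponent -1/2 for the normalization in the Gram-Schmidt process, and
  with exponent -1 for the quotient that defines a plateau function.\<close>

lemma Ck_on_powr: "Ck_on k {0<..} (\<lambda>t::real. t powr a)"
proof (induction k arbitrary: a)
  case 0
  then show ?case by (auto intro!: continuous_intros)
next
  case (Suc k)
  have "Ck_on k {0<..} (\<lambda>t::real. v * (a * t powr (a - 1)))" for v
    by (intro Ck_on_mult Ck_on_const Suc) auto
  moreover have "((\<lambda>t::real. t powr a) has_derivative (\<lambda>v. v * (a * y powr (a - 1)))) (at y)" if "y > 0" for y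
    using has_real_derivative_powr[OF that, of a] by (simp add: has_field_derivative_def mult_commute_abs)
  ultimately show ?case by (intro Ck_on_SucI) auto
qed

text \<open>The quotient is symmetric in v and w although the derivative on the right is not visibly
  so; this is the source of the symmetry of second derivatives. The mean value theorem is used in
  the direction v only, after which differentiability of the first derivative at the single point y
  is enough.\<close>

lemma second_difference_limit:
  fixes f :: "'c::real_normed_vector \<Rightarrow> real"
  assumes S: "open S" "y \<in> S" and f: "\<And>z. z \<in> S \<Longrightarrow> (f has_derivative f' z) (at z)"
    and g: "((\<lambda>z. f' z v) has_derivative g') (at y)"
  shows "((\<lambda>t. (f (y + t *\<^sub>R v + t *\<^sub>R w) - f (y + t *\<^sub>R v) - f (y + t *\<^sub>R w) + f y) / t\<^sup>2) \<longlongrightarrow> g' w) (at_right 0)"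
proof (rule tendstoI)
  fix e :: real assume "e > 0"
  interpret g: bounded_linear g' using g by (rule has_derivative_bounded_linear)
  \<comment> \<open>Both displacements a and b met below have norm at most t K, and their norms add
    up to less than 2 t K; this matches the tolerance e / (2 K).\<close>
  define K where "K = 2 * norm v + norm w + 1"
  have K: "K > 0" unfolding K_def by (smt (verit) norm_ge_zero)
  obtain d where d: "d > 0" "\<And>z. norm (z - y) < d \<Longrightarrow> norm (f' z v - f' y v - g' (z - y)) \<le> e / (2 * K) * norm (z - y)"
    using g K \<open>e > 0\<close> unfolding has_derivative_at_alt
    by (metis divide_pos_pos mult_pos_pos zero_less_numeral)
  obtain r where r: "r > 0" "ball y r \<subseteq> S" using S open_contains_ball by blast
  define d' where "d' = min d r / K"
  have "\<bar>(f (y + t *\<^sub>R v + t *\<^sub>R w) - f (y + t *\<^sub>R v) - f (y + t *\<^sub>R w) + f y) / t\<^sup>2 - g' w\<bar> < e"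
    if t: "0 < t" "t < d'" for t
  proof -
    have tK: "t * K < min d r" using t K by (simp add: d'_def pos_less_divide_eq)
    have nrm: "norm ((s * t) *\<^sub>R v + c *\<^sub>R w) \<le> t * K" if "0 \<le> s" "s \<le> 1" "0 \<le> c" "c \<le> t" for s c
    proof -
      have "norm ((s * t) *\<^sub>R v + c *\<^sub>R w) \<le> s * t * norm v + c * norm w"
        using norm_triangle_ineq[of "(s * t) *\<^sub>R v" "c *\<^sub>R w"] t that by (simp add: abs_mult)
      also have "\<dots> \<le> t * norm v + t * norm w"
        using that t by (intro add_mono mult_right_mono) (auto simp: mult_left_le_one_le)
      also have "\<dots> \<le> t * K" using t by (simp add: K_def algebra_simps)
      finally show ?thesis .
    qed
    have inS: "y + ((s * t) *\<^sub>R v + c *\<^sub>R w) \<in> S" if "0 \<le> s" "s \<le> 1" "0 \<le> c" "c \<le> t" for s c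
    proof -
      have "y + ((s * t) *\<^sub>R v + c *\<^sub>R w) \<in> ball y r"
        using nrm[OF that] tK unfolding mem_ball dist_commute[of y] by (simp add: dist_norm)
      then show ?thesis using r(2) by blast
    qed
    \<comment> \<open>Moves along t v with the shift t w switched on and off, so that h 1 - h 0 is
      the second difference.\<close>
    define h where "h s = f (y + ((s * t) *\<^sub>R v + t *\<^sub>R w)) - f (y + ((s * t) *\<^sub>R v + 0 *\<^sub>R w))" for s
    have dh: "(h has_derivative (\<lambda>u. u * (t * (f' (y + ((s * t) *\<^sub>R v + t *\<^sub>R w)) v - f' (y + ((s * t) *\<^sub>R v + 0 *\<^sub>R w)) v)))) (at s)"
      if s: "0 \<le> s" "s \<le> 1" for s
    proof -
      have "((\<lambda>s. f (y + ((s * t) *\<^sub>R v + c *\<^sub>R w))) has_derivative (\<lambda>u. f' (y + ((s * t) *\<^sub>R v + c *\<^sub>R w)) ((u * t) *\<^sub>R v))) (at s)"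
        if "0 \<le> c" "c \<le> t" for c
        by (rule has_derivative_compose[where f="\<lambda>s. y + ((s * t) *\<^sub>R v + c *\<^sub>R w)" and g=f and x=s and s=UNIV and f'="\<lambda>u. (u * t) *\<^sub>R v", OF _ f[OF inS[OF s that]]])
           (auto intro!: derivative_eq_intros)
      moreover have "f' (y + ((s * t) *\<^sub>R v + c *\<^sub>R w)) ((u * t) *\<^sub>R v) = u * (t * f' (y + ((s * t) *\<^sub>R v + c *\<^sub>R w)) v)"
        if "0 \<le> c" "c \<le> t" for c u
        using linear_scale[OF has_derivative_linear[OF f[OF inS[OF s that]]], of "u * t" v] by simp
      ultimately have *: "((\<lambda>s. f (y + ((s * t) *\<^sub>R v + c *\<^sub>R w))) has_derivative (\<lambda>u. u * (t * f' (y + ((s * t) *\<^sub>R v + c *\<^sub>R w)) v))) (at s)"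
        if "0 \<le> c" "c \<le> t" for c using that by simp
      show ?thesis unfolding h_def
        by (rule has_derivative_eq_rhs, rule has_derivative_diff[OF *[of t] *[of 0]]) (use t in \<open>auto simp: algebra_simps\<close>)
    qed
    obtain s where s: "0 < s" "s < 1" "h 1 - h 0 = (1 - 0) * (t * (f' (y + ((s * t) *\<^sub>R v + t *\<^sub>R w)) v - f' (y + ((s * t) *\<^sub>R v + 0 *\<^sub>R w)) v))"
      using mvt_simple[of 0 1 h, OF _ has_derivative_at_withinI[OF dh]] by auto
    define a b where "a = (s * t) *\<^sub>R v + t *\<^sub>R w" and "b = (s * t) *\<^sub>R v + 0 *\<^sub>R w"
    have na: "norm a \<le> t * K" "norm b \<le> t * K" using s t unfolding a_def b_def by (intro nrm; simp)+
    \<comment> \<open>First-order expansion of z \<mapsto> f' z v at y, applied to both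
      displacements; the linear parts differ by g' (a - b) = t g' w.\<close>
    have "\<bar>(f' (y + a) v - f' (y + b) v) - g' (a - b)\<bar> \<le> \<bar>f' (y + a) v - f' y v - g' a\<bar> + \<bar>f' (y + b) v - f' y v - g' b\<bar>"
      by (simp add: g.diff)
    also have "\<dots> \<le> e / (2 * K) * norm a + e / (2 * K) * norm b"
      using d(2)[of "y + a"] d(2)[of "y + b"] na tK by (intro add_mono) auto
    also have "norm a + norm b < t * (2 * K)"
    proof -
      have sv: "s * t * norm v \<le> t * norm v"
        using s t by (intro mult_right_mono) (auto simp: mult_left_le_one_le)
      have "norm a \<le> s * t * norm v + t * norm w"
        using norm_triangle_ineq[of "(s * t) *\<^sub>R v" "t *\<^sub>R w"] s t by (simp add: a_def abs_mult)
      also note sv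
      finally have "norm a \<le> t * norm v + t * norm w" by simp
      moreover have "norm b \<le> t * norm v" using s t sv by (simp add: b_def abs_mult)
      ultimately have "norm a + norm b \<le> t * (2 * norm v + norm w)" by (simp add: algebra_simps)
      also have "\<dots> < t * (2 * K)" using t norm_ge_zero[of v] norm_ge_zero[of w] 
        using K unfolding K_def by (intro mult_strict_left_mono) simp_all
      finally show ?thesis .
    qed
    then have "e / (2 * K) * norm a + e / (2 * K) * norm b < e / (2 * K) * (t * (2 * K))"
      using K \<open>e > 0\<close> unfolding distrib_left[symmetric] by (intro mult_strict_left_mono) auto
    also have "\<dots> = t * e" using K by simp
    finally have ab: "\<bar>(f' (y + a) v - f' (y + b) v) - t * g' w\<bar> < t * e" by (simp add: a_def b_def g.scaleR)
    have "f (y + t *\<^sub>R v + t *\<^sub>R w) - f (y + t *\<^sub>R v) - f (y + t *\<^sub>R w) + f y = h 1 - h 0"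
      by (simp add: h_def algebra_simps)
    also have "\<dots> = t * (f' (y + a) v - f' (y + b) v)" using s(3) by (simp add: a_def b_def)
    finally have "(f (y + t *\<^sub>R v + t *\<^sub>R w) - f (y + t *\<^sub>R v) - f (y + t *\<^sub>R w) + f y) / t\<^sup>2 - g' w
      = (f' (y + a) v - f' (y + b) v - t * g' w) / t"
      using t by (simp add: power2_eq_square diff_divide_distrib)
    moreover have "\<bar>(f' (y + a) v - f' (y + b) v - t * g' w) / t\<bar> < e"
      using ab t by (simp add: abs_divide pos_divide_less_eq mult.commute)
    ultimately show ?thesis by simp
  qed
  moreover have "d' > 0" using d r K by (simp add: d'_def)
  ultimately show "\<forall>\<^sub>F t in at_right 0. dist ((f (y + t *\<^sub>R v + t *\<^sub>R w) - f (y + t *\<^sub>R v) - f (y + t *\<^sub>R w) + f y) / t\<^sup>2) (g' w) < e"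
    unfolding eventually_at_right_field dist_real_def by blast
qed

text \<open>Exchanging v and w leaves the second difference unchanged, so its two limits agree. This
  is what makes Lie brackets independent of the chart later on.\<close>

lemma second_derivative_symmetric:
  fixes f :: "'c::euclidean_space \<Rightarrow> 'd::euclidean_space"
  assumes "open S" "y \<in> S" "Ck_on 2 S f"
  shows "frechet_derivative (\<lambda>z. frechet_derivative f (at z) v) (at y) w
       = frechet_derivative (\<lambda>z. frechet_derivative f (at z) w) (at y) v"
proof (rule euclidean_eqI)
  fix b :: 'd assume "b \<in> Basis"
  have f: "((\<lambda>z. f z \<bullet> b) has_derivative (\<lambda>v. frechet_derivative f (at z) v \<bullet> b)) (at z)" if "z \<in> S" for z
    using Ck_on_SucD[of 1 S f z] assms(3) that by (intro has_derivative_inner_left) (simp add: numeral_2_eq_2)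
  have g: "((\<lambda>z. frechet_derivative f (at z) v \<bullet> b) has_derivative (\<lambda>w. frechet_derivative (\<lambda>z. frechet_derivative f (at z) v) (at y) w \<bullet> b)) (at y)" for v
    using assms(2,3) Ck_on_SucD[of 0 S "\<lambda>z. frechet_derivative f (at z) v" y] by (intro has_derivative_inner_left) (simp add: numeral_2_eq_2)
  show "frechet_derivative (\<lambda>z. frechet_derivative f (at z) v) (at y) w \<bullet> b
       = frechet_derivative (\<lambda>z. frechet_derivative f (at z) w) (at y) v \<bullet> b"
    using second_difference_limit[OF assms(1,2) f g[of v], of w] second_difference_limit[OF assms(1,2) f g[of w], of v]
    by (intro tendsto_unique[of "at_right (0::real)"]) (auto simp: algebra_simps)
qed

text \<open>In the Leibniz expansion every permutation other than the identity contributes at least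
  two off-diagonal entries, which vanish at the identity matrix. Differentiating one factor still
  leaves another zero, so only the diagonal product contributes.\<close>

lemma has_derivative_det_at_identity:
  fixes A :: "'c::real_normed_vector \<Rightarrow> real^'m^'m"
  assumes "(A has_derivative A') (at x)" "A x = mat 1"
  shows "((\<lambda>y. det (A y)) has_derivative (\<lambda>h. \<Sum>i\<in>UNIV. A' h $ i $ i)) (at x)"
proof -
  have comp: "((\<lambda>y. A y $ i $ j) has_derivative (\<lambda>h. A' h $ i $ j)) (at x)" for i j
    by (intro bounded_linear.has_derivative[OF bounded_linear_vec_nth] assms(1))
  have *: "(\<Sum>i\<in>UNIV. A' h $ i $ p i * (\<Prod>j\<in>UNIV - {i}. A x $ j $ p j)) = (if p = id then \<Sum>i\<in>UNIV. A' h $ i $ i else 0)"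
    if "p permutes UNIV" for p :: "'m \<Rightarrow> 'm" and h
  proof (cases "p = id")
    case True
    then show ?thesis by (simp add: assms(2) mat_def)
  next
    case False
    have "(\<Prod>j\<in>UNIV - {i}. A x $ j $ p j) = 0" for i :: 'm
    proof -
      \<comment> \<open>A permutation that fixes everything except possibly i fixes i too, by
        injectivity; so a second index is moved.\<close>
      obtain k where k: "k \<noteq> i" "p k \<noteq> k"
      proof (rule ccontr)
        assume n: "\<not> thesis"
        have fx: "p k = k" if "k \<noteq> i" for k using n that \<open>\<And>k. k \<noteq> i \<Longrightarrow> p k \<noteq> k \<Longrightarrow> thesis\<close> by blast
        have "p i = i" using fx that permutes_inj[OF \<open>p permutes UNIV\<close>] by (metis injD)
        then show False using fx False by (metis eq_id_iff)
      qed
      then have "A x $ k $ p k = 0" by (simp add: assms(2) mat_def)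
      then show ?thesis using k by (intro prod_zero bexI[of _ k]) auto
    qed
    then have "(\<Sum>i\<in>UNIV. A' h $ i $ p i * (\<Prod>j\<in>UNIV - {i}. A x $ j $ p j)) = 0"
      by (intro sum.neutral ballI) (simp only: mult_zero_right)
    then show ?thesis using False by simp
  qed
  show ?thesis unfolding det_def
  proof (rule has_derivative_eq_rhs, rule has_derivative_sum)
    fix p assume "p \<in> {p. p permutes (UNIV :: 'm set)}"
    show "((\<lambda>y. of_int (sign p) * (\<Prod>i\<in>UNIV. A y $ i $ p i)) has_derivative
       (\<lambda>h. of_int (sign p) * (\<Sum>i\<in>UNIV. A' h $ i $ p i * (\<Prod>j\<in>UNIV - {i}. A x $ j $ p j)))) (at x)"
      by (intro has_derivative_mult_right has_derivative_prod comp)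
  next
    show "(\<lambda>h. \<Sum>p | p permutes (UNIV :: 'm set). of_int (sign p) * (\<Sum>i\<in>UNIV. A' h $ i $ p i * (\<Prod>j\<in>UNIV - {i}. A x $ j $ p j)))
      = (\<lambda>h. \<Sum>i\<in>UNIV. A' h $ i $ i)"
    proof
      fix h
      have "(\<Sum>p | p permutes (UNIV :: 'm set). of_int (sign p) * (\<Sum>i\<in>UNIV. A' h $ i $ p i * (\<Prod>j\<in>UNIV - {i}. A x $ j $ p j)))
        = (\<Sum>p | p permutes (UNIV :: 'm set). if p = id then (\<Sum>i\<in>UNIV. A' h $ i $ i) else 0)"
        by (rule sum.cong) (auto simp: *)
      also have "\<dots> = (\<Sum>i\<in>UNIV. A' h $ i $ i)" by (simp add: permutes_id finite_permutations)
      finally show "(\<Sum>p | p permutes (UNIV :: 'm set). of_int (sign p) * (\<Sum>i\<in>UNIV. A' h $ i $ p i * (\<Prod>j\<in>UNIV - {i}. A x $ j $ p j)))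
        = (\<Sum>i\<in>UNIV. A' h $ i $ i)" .
    qed
  qed
qed

subsection \<open>Charts and tangent vectors\<close>

abbreviation cim :: "('a, 'm::finite) chart \<Rightarrow> (real ^ 'm) set" where "cim c \<equiv> cmap c ` cdom c"

definition jac :: "('a, 'm::finite) chart \<Rightarrow> ('a, 'm) chart \<Rightarrow> 'a \<Rightarrow> real ^ 'm \<Rightarrow> real ^ 'm" where
  "jac c d p = frechet_derivative (cmap d \<circ> cinv c) (at (cmap c p))"

definition tvec_of :: "('a, 'm::finite) riem \<Rightarrow> ('a, 'm) chart \<Rightarrow> 'a \<Rightarrow> real ^ 'm \<Rightarrow> ('a, 'm) tvec" where
  "tvec_of M c p x = (\<lambda>d. if d \<in> charts_at M p then jac c d p x else 0)"

abbreviation ginner :: "('a, 'm::finite) riem \<Rightarrow> ('a, 'm) chart \<Rightarrow> 'a \<Rightarrow> real ^ 'm \<Rightarrow> real ^ 'm \<Rightarrow> real" where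
  "ginner M c p x y \<equiv> x \<bullet> (gram M c p *v y)"

lemma tangent_space_eq:
  "tangent_space M p = {v. (\<forall>c. c \<notin> charts_at M p \<longrightarrow> v c = 0) \<and>
     (\<forall>c\<in>charts_at M p. \<forall>d\<in>charts_at M p. v d = jac c d p (v c))}"
  by (simp add: tangent_space_def jac_def)

lemma coord_vec_tvec_of: "coord_vec M c i p = tvec_of M c p (axis i 1)"
  by (simp add: fun_eq_iff coord_vec_def tvec_of_def jac_def)

lemma vec_axis_sum: "x = (\<Sum>i\<in>UNIV. (x $ i) *\<^sub>R (axis i 1 :: real ^ 'n))"
  using basis_expansion[of x] by (simp add: scalar_mult_eq_scaleR)

locale riem_mfd =
  fixes M :: "('a::{t2_space, second_countable_topology}, 'm::finite) riem"
  assumes riem: "riemannian_manifold M"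
begin

lemma charts_at_iff: "c \<in> charts_at M p \<longleftrightarrow> c \<in> atlas M \<and> p \<in> cdom c"
  by (auto simp: charts_at_def)

lemma smooth_atlas: "smooth_atlas (atlas M)"
  and connected_UNIV: "connected (UNIV :: 'a set)"
  and inner_product: "inner_product_on_tangent M p"
  and gram_smooth: "c \<in> atlas M \<Longrightarrow> Ck_on k (cim c) (gram M c \<circ> cinv c)"
  using riem by (auto simp: riemannian_manifold_def smooth_on_def)

lemma is_chart: "c \<in> atlas M \<Longrightarrow> is_chart c"
  using smooth_atlas by (auto simp: smooth_atlas_def)

lemma open_cdom: "c \<in> atlas M \<Longrightarrow> open (cdom c)"
  and open_cim: "c \<in> atlas M \<Longrightarrow> open (cim c)"
  and chart_homeo: "c \<in> atlas M \<Longrightarrow> homeomorphism (cdom c) (cim c) (cmap c) (cinv c)"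
  using is_chart by (auto simp: is_chart_def)

lemma cinv_cmap [simp]: "c \<in> atlas M \<Longrightarrow> p \<in> cdom c \<Longrightarrow> cinv c (cmap c p) = p"
  and cmap_cinv [simp]: "c \<in> atlas M \<Longrightarrow> y \<in> cim c \<Longrightarrow> cmap c (cinv c y) = y"
  and cinv_in_cdom: "c \<in> atlas M \<Longrightarrow> y \<in> cim c \<Longrightarrow> cinv c y \<in> cdom c"
  and continuous_on_cmap: "c \<in> atlas M \<Longrightarrow> continuous_on (cdom c) (cmap c)"
  and continuous_on_cinv: "c \<in> atlas M \<Longrightarrow> continuous_on (cim c) (cinv c)"
  using chart_homeo[of c] by (auto simp: homeomorphism_def)

lemma cmap_image_Int:
  assumes "c \<in> atlas M" shows "cmap c ` (cdom c \<inter> U) = {y \<in> cim c. cinv c y \<in> U}"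
  using assms by (auto simp: image_iff)

lemma open_cmap_image:
  assumes "c \<in> atlas M" "open U" shows "open (cmap c ` (cdom c \<inter> U))"
  using continuous_open_preimage[OF continuous_on_cinv[OF assms(1)] open_cim[OF assms(1)] assms(2)]
  unfolding cmap_image_Int[OF assms(1)] by (simp add: vimage_def Int_def)

lemma open_cinv_image:
  assumes "c \<in> atlas M" "open V" "V \<subseteq> cim c" shows "open (cinv c ` V)"
proof -
  have "cinv c ` V = cdom c \<inter> cmap c -` V"
    using assms by (auto simp: cinv_in_cdom image_iff subset_iff) (metis (no_types, lifting) cinv_cmap assms(1))
  then show ?thesis
    using continuous_open_preimage[OF continuous_on_cmap[OF assms(1)] open_cdom[OF assms(1)] assms(2)] by simp
qed

lemma ex_chart: "\<exists>c. c \<in> charts_at M p"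
  using smooth_atlas by (force simp: smooth_atlas_def charts_at_def)

lemma some_chart: "some_chart M p \<in> charts_at M p"
  unfolding some_chart_def using ex_chart by (rule someI_ex)

lemma transition_smooth:
  "c \<in> atlas M \<Longrightarrow> d \<in> atlas M \<Longrightarrow> Ck_on k (cmap c ` (cdom c \<inter> cdom d)) (cmap d \<circ> cinv c)"
  using smooth_atlas by (auto simp: smooth_atlas_def smooth_on_def)

lemma open_overlap: "c \<in> atlas M \<Longrightarrow> d \<in> atlas M \<Longrightarrow> open (cmap c ` (cdom c \<inter> cdom d))"
  by (intro open_cmap_image open_cdom)

section \<open>Coordinate Jacobians and the tangent spaces they define\<close>

lemma jac_has_derivative:
  assumes "c \<in> charts_at M p" "d \<in> charts_at M p"
  shows "(cmap d \<circ> cinv c has_derivative jac c d p) (at (cmap c p))"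
  unfolding jac_def
  using assms Ck_on_SucD[OF transition_smooth[of c d "Suc 0"], of "cmap c p"] by (auto simp: charts_at_iff)

lemma jac_linear: "c \<in> charts_at M p \<Longrightarrow> d \<in> charts_at M p \<Longrightarrow> bounded_linear (jac c d p)"
  using jac_has_derivative by (rule has_derivative_bounded_linear)

text \<open>The codomain of f is arbitrary because the rule is applied to coordinate maps, to
  components of frames and to scalar functions alike.\<close>

lemma chart_change_has_derivative:
  assumes "c \<in> charts_at M p" "d \<in> charts_at M p" 
    "((\<lambda>y. f (cinv d y)) has_derivative D) (at (cmap d p))"
  shows "((\<lambda>y. f (cinv c y)) has_derivative (\<lambda>v. D (jac c d p v))) (at (cmap c p))"
proof -
  have "((\<lambda>y. f (cinv d ((cmap d \<circ> cinv c) y))) has_derivative (\<lambda>v. D (jac c d p v))) (at (cmap c p))"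
    using assms by (intro has_derivative_compose[OF jac_has_derivative[OF assms(1,2)]]) (simp add: charts_at_iff)
  then show ?thesis
  proof (rule has_derivative_transform_within_open[where s="cmap c ` (cdom c \<inter> cdom d)"])
    show "open (cmap c ` (cdom c \<inter> cdom d))" using assms by (intro open_overlap) (auto simp: charts_at_iff)
  qed (use assms in \<open>auto simp: charts_at_iff\<close>)
qed

lemma jac_comp:
  assumes "c \<in> charts_at M p" "d \<in> charts_at M p" "e \<in> charts_at M p"
  shows "jac d e p (jac c d p x) = jac c e p x"
proof -
  have "((\<lambda>y. cmap e (cinv c y)) has_derivative (\<lambda>v. jac d e p (jac c d p v))) (at (cmap c p))"
    using chart_change_has_derivative[OF assms(1,2), of "cmap e"] jac_has_derivative[OF assms(2,3)] by (simp add: o_def)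
  from has_derivative_unique[OF this jac_has_derivative[OF assms(1,3), unfolded o_def]]
  show ?thesis by (metis)
qed

lemma jac_same: "c \<in> charts_at M p \<Longrightarrow> jac c c p x = x"
proof -
  assume c: "c \<in> charts_at M p"
  have "((\<lambda>y. y) has_derivative jac c c p) (at (cmap c p))"
    using jac_has_derivative[OF c c]
    by (rule has_derivative_transform_within_open[where s="cim c"])
       (use c in \<open>auto simp: charts_at_iff open_cim\<close>)
  from has_derivative_unique[OF has_derivative_ident this] show ?thesis by metis
qed

lemma tvec_of_tangent: "c \<in> charts_at M p \<Longrightarrow> tvec_of M c p x \<in> tangent_space M p"
  by (simp add: tangent_space_eq tvec_of_def jac_comp)

lemma tvec_of_at: "c \<in> charts_at M p \<Longrightarrow> tvec_of M c p x c = x"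
  by (simp add: tvec_of_def jac_same)

lemma tangent_eq: "v \<in> tangent_space M p \<Longrightarrow> c \<in> charts_at M p \<Longrightarrow> v = tvec_of M c p (v c)"
proof
  fix d assume "v \<in> tangent_space M p" "c \<in> charts_at M p"
  then have "d \<notin> charts_at M p \<Longrightarrow> v d = 0" "d \<in> charts_at M p \<Longrightarrow> v d = jac c d p (v c)"
    unfolding tangent_space_eq by blast+
  then show "v d = tvec_of M c p (v c) d" unfolding tvec_of_def by presburger
qed

lemma tangent_jac: "v \<in> tangent_space M p \<Longrightarrow> c \<in> charts_at M p \<Longrightarrow> d \<in> charts_at M p \<Longrightarrow> v d = jac c d p (v c)"
  unfolding tangent_space_eq by blast

lemma tangent_out: "v \<in> tangent_space M p \<Longrightarrow> d \<notin> charts_at M p \<Longrightarrow> v d = 0"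
  unfolding tangent_space_eq by blast

lemma tangent_eqI: "v \<in> tangent_space M p \<Longrightarrow> w \<in> tangent_space M p \<Longrightarrow> c \<in> charts_at M p \<Longrightarrow> v c = w c \<Longrightarrow> v = w"
  by (metis tangent_eq)

lemma tangentI:
  assumes "c \<in> charts_at M p" "\<And>d. d \<in> charts_at M p \<Longrightarrow> v d = jac c d p (v c)" "\<And>d. d \<notin> charts_at M p \<Longrightarrow> v d = 0"
  shows "v \<in> tangent_space M p"
proof -
  have "v = tvec_of M c p (v c)" unfolding tvec_of_def using assms(2,3) by metis
  then show ?thesis using tvec_of_tangent[OF assms(1)] by metis
qed

lemma tangent_0: "(\<lambda>c. 0) \<in> tangent_space M p"
  by (auto simp: tangent_space_eq linear_0[OF bounded_linear.linear[OF jac_linear]])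

lemma tangent_scale_add:
  assumes "v \<in> tangent_space M p" "w \<in> tangent_space M p"
  shows "(\<lambda>c. a *\<^sub>R v c + b *\<^sub>R w c) \<in> tangent_space M p"
proof -
  obtain c where c: "c \<in> charts_at M p" using ex_chart by blast
  show ?thesis
  proof (rule tangentI[OF c])
    fix d assume d: "d \<in> charts_at M p"
    interpret bounded_linear "jac c d p" by (rule jac_linear[OF c d])
    show "a *\<^sub>R v d + b *\<^sub>R w d = jac c d p (a *\<^sub>R v c + b *\<^sub>R w c)"
      unfolding add scaleR tangent_jac[OF assms(1) c d, symmetric] tangent_jac[OF assms(2) c d, symmetric] ..
  qed (simp add: tangent_out[OF assms(1)] tangent_out[OF assms(2)])
qed

lemma tangent_sum:
  assumes "\<And>i. i \<in> I \<Longrightarrow> v i \<in> tangent_space M p"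
  shows "(\<lambda>c. \<Sum>i\<in>I. a i *\<^sub>R v i c) \<in> tangent_space M p"
  using assms
proof (induction I rule: infinite_finite_induct)
  case (insert i I)
  then show ?case using tangent_scale_add[of "v i" p "\<lambda>c. \<Sum>i\<in>I. a i *\<^sub>R v i c" "a i" 1] by simp
qed (simp_all add: tangent_0)

section \<open>The metric expressed by its Gram matrix in a chart\<close>

lemma metric_sym: "v \<in> tangent_space M p \<Longrightarrow> w \<in> tangent_space M p \<Longrightarrow> metric M p v w = metric M p w v"
  and metric_lin: "v \<in> tangent_space M p \<Longrightarrow> w \<in> tangent_space M p \<Longrightarrow> z \<in> tangent_space M p \<Longrightarrow>
     metric M p (\<lambda>c. a *\<^sub>R v c + b *\<^sub>R w c) z = a * metric M p v z + b * metric M p w z"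
  and metric_pos: "v \<in> tangent_space M p \<Longrightarrow> v \<noteq> tzero \<Longrightarrow> metric M p v v > 0"
  using inner_product[of p] by (auto simp: inner_product_on_tangent_def)

lemma metric_0: "z \<in> tangent_space M p \<Longrightarrow> metric M p (\<lambda>c. 0) z = 0"
  using metric_lin[OF tangent_0 tangent_0, of z p 0 0] by simp

lemma metric_sum:
  assumes "\<And>i. i \<in> I \<Longrightarrow> v i \<in> tangent_space M p" "z \<in> tangent_space M p"
  shows "metric M p (\<lambda>c. \<Sum>i\<in>I. a i *\<^sub>R v i c) z = (\<Sum>i\<in>I. a i * metric M p (v i) z)"
  using assms(1)
proof (induction I rule: infinite_finite_induct)
  case (insert i I)
  then show ?case 
    using metric_lin[of "v i" p "\<lambda>c. \<Sum>i\<in>I. a i *\<^sub>R v i c" z "a i" 1] tangent_sum[of I v p a] assms(2) by simp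
qed (simp_all add: metric_0[OF assms(2)])

lemma tangent_coord_sum:
  assumes "c \<in> charts_at M p" "v \<in> tangent_space M p"
  shows "v = (\<lambda>d. \<Sum>i\<in>UNIV. (v c $ i) *\<^sub>R coord_vec M c i p d)"
proof (rule tangent_eqI[OF assms(2) tangent_sum assms(1)])
  show "coord_vec M c i p \<in> tangent_space M p" for i
    by (simp add: coord_vec_tvec_of tvec_of_tangent assms)
  show "v c = (\<Sum>i\<in>UNIV. (v c $ i) *\<^sub>R coord_vec M c i p c)"
    unfolding coord_vec_tvec_of tvec_of_at[OF assms(1)] by (rule vec_axis_sum)
qed

lemma metric_gram:
  assumes "c \<in> charts_at M p" "v \<in> tangent_space M p" "w \<in> tangent_space M p"
  shows "metric M p v w = ginner M c p (v c) (w c)"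
proof -
  have t: "coord_vec M c i p \<in> tangent_space M p" for i
    by (simp add: coord_vec_tvec_of tvec_of_tangent assms)
  have "metric M p v w = (\<Sum>i\<in>UNIV. v c $ i * metric M p (coord_vec M c i p) w)"
    by (subst tangent_coord_sum[OF assms(1,2)], rule metric_sum) (use t assms in auto)
  also have "\<dots> = (\<Sum>i\<in>UNIV. v c $ i * (\<Sum>j\<in>UNIV. w c $ j * metric M p (coord_vec M c i p) (coord_vec M c j p)))"
  proof (intro sum.cong refl arg_cong[where f="(*) _"])
    fix i
    have "metric M p (coord_vec M c i p) w = metric M p w (coord_vec M c i p)" by (rule metric_sym[OF t assms(3)])
    also have "\<dots> = (\<Sum>j\<in>UNIV. w c $ j * metric M p (coord_vec M c j p) (coord_vec M c i p))"
      by (subst tangent_coord_sum[OF assms(1,3)], rule metric_sum) (use t assms in auto)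
    also have "\<dots> = (\<Sum>j\<in>UNIV. w c $ j * metric M p (coord_vec M c i p) (coord_vec M c j p))"
      by (intro sum.cong refl arg_cong[where f="(*) _"] metric_sym t)
    finally show "metric M p (coord_vec M c i p) w = (\<Sum>j\<in>UNIV. w c $ j * metric M p (coord_vec M c i p) (coord_vec M c j p))" .
  qed
  also have "\<dots> = ginner M c p (v c) (w c)"
    by (simp add: inner_vec_def matrix_vector_mult_def gram_def mult.commute)
  finally show ?thesis .
qed

lemma ginner_metric:
  "c \<in> charts_at M p \<Longrightarrow> ginner M c p x y = metric M p (tvec_of M c p x) (tvec_of M c p y)"
  by (simp add: metric_gram tvec_of_tangent tvec_of_at)

lemma ginner_sym: "c \<in> charts_at M p \<Longrightarrow> ginner M c p x y = ginner M c p y x"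
  by (simp add: ginner_metric metric_sym tvec_of_tangent)

lemma ginner_pos:
  assumes "c \<in> charts_at M p" "x \<noteq> 0" shows "ginner M c p x x > 0"
proof -
  have "tvec_of M c p x \<noteq> tzero" using tvec_of_at[OF assms(1), of x] assms(2) by (auto simp: tzero_def)
  then show ?thesis using assms by (simp add: ginner_metric metric_pos tvec_of_tangent)
qed

lemma ginner_nonneg: "c \<in> charts_at M p \<Longrightarrow> ginner M c p x x \<ge> 0"
  using ginner_pos[of c p x] by (cases "x = 0") auto

lemma metric_nonneg: "v \<in> tangent_space M p \<Longrightarrow> metric M p v v \<ge> 0"
  using ex_chart[of p] metric_gram ginner_nonneg by metis

lemma ginner_jac:
  assumes "c \<in> charts_at M p" "d \<in> charts_at M p"
  shows "ginner M d p (jac c d p x) (jac c d p y) = ginner M c p x y"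
  using ginner_metric[OF assms(1), of x y] metric_gram[OF assms(2) tvec_of_tangent[OF assms(1)] tvec_of_tangent[OF assms(1)]]
  by (simp add: tvec_of_def assms)

lemma gram_cont: "c \<in> atlas M \<Longrightarrow> continuous_on (cim c) (\<lambda>y. gram M c (cinv c y))"
  using gram_smooth[of c 0] by (simp add: o_def)

end

subsection \<open>Orthonormal frames\<close>

definition onb :: "real ^ 'm ^ 'm \<Rightarrow> ('m \<Rightarrow> real ^ 'm) \<Rightarrow> bool" where
  "onb G e \<longleftrightarrow> (\<forall>i j. e i \<bullet> (G *v e j) = (if i = j then 1 else 0))"

definition frame_matrix :: "('m \<Rightarrow> real ^ 'm) \<Rightarrow> real ^ 'm ^ 'm" where
  "frame_matrix e = (\<chi> a i. e i $ a)"

lemma gram_frame_matrix: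
  "transpose (frame_matrix e) ** A ** frame_matrix e = (\<chi> i j. e i \<bullet> (A *v (e j :: real ^ 'm)))"
proof -
  have "(transpose (frame_matrix e) ** A ** frame_matrix e) $ i $ j = e i \<bullet> (A *v e j)" for i j
  proof -
    have "(transpose (frame_matrix e) ** (A ** frame_matrix e)) $ i $ j = (\<Sum>a\<in>UNIV. e i $ a * (\<Sum>b\<in>UNIV. A $ a $ b * e j $ b))"
      by (simp add: matrix_matrix_mult_def transpose_def frame_matrix_def)
    then show ?thesis by (simp add: matrix_mul_assoc inner_vec_def matrix_vector_mult_def)
  qed
  then show ?thesis by (simp add: vec_eq_iff)
qed

lemma det_frame:
  "det (\<chi> i j. e i \<bullet> (A *v (e j :: real ^ 'm))) = (det (frame_matrix e))\<^sup>2 * det A"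
  by (simp add: gram_frame_matrix[symmetric] det_mul det_transpose power2_eq_square)

lemma onb_matrix: "onb G e \<Longrightarrow> (\<chi> i j. e i \<bullet> (G *v e j)) = mat 1"
  by (simp add: onb_def vec_eq_iff mat_def)

lemma onb_det: "onb G e \<Longrightarrow> (det (frame_matrix e))\<^sup>2 * det G = 1"
  using det_frame[of e G] by (simp add: onb_matrix)

lemma onb_det_pos: "onb G e \<Longrightarrow> det G > 0"
  using onb_det[of G e] by (metis mult_nonneg_nonpos not_le not_one_le_zero zero_le_power2)

text \<open>With E the matrix of the basis, orthonormality says that transpose E G is a left inverse
  of E. For square matrices it is then a right inverse as well, and x = E (transpose E (G x)) is the
  expansion.\<close>

lemma onb_expand:
  fixes x :: "real ^ 'm"
  assumes "onb G e"
  shows "x = (\<Sum>i\<in>UNIV. (e i \<bullet> (G *v x)) *\<^sub>R e i)"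
proof -
  let ?E = "frame_matrix e"
  have "(transpose ?E ** G) ** ?E = mat 1" using gram_frame_matrix[of e G] onb_matrix[OF assms] by simp
  then have "?E ** (transpose ?E ** G) = mat 1" using matrix_left_right_inverse by blast
  then have "x = ?E *v (transpose ?E *v (G *v x))"
    by (metis matrix_vector_mul_assoc matrix_vector_mul_lid)
  also have "transpose ?E *v (G *v x) = (\<chi> i. e i \<bullet> (G *v x))"
    by (simp add: vec_eq_iff matrix_vector_mult_def transpose_def frame_matrix_def inner_vec_def)
  also have "?E *v (\<chi> i. e i \<bullet> (G *v x)) = (\<Sum>i\<in>UNIV. (e i \<bullet> (G *v x)) *\<^sub>R e i)"
    by (simp add: vec_eq_iff matrix_vector_mult_def frame_matrix_def mult.commute)
  finally show ?thesis .
qed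

lemma onb_parseval:
  fixes x y :: "real ^ 'm"
  assumes "onb G e" "\<And>x y. x \<bullet> (G *v y) = y \<bullet> (G *v x)"
  shows "x \<bullet> (G *v y) = (\<Sum>i\<in>UNIV. (e i \<bullet> (G *v x)) * (e i \<bullet> (G *v y)))"
  by (subst onb_expand[OF assms(1), of x]) (simp add: inner_sum_left)

text \<open>The matrix between two orthonormal bases is orthogonal, by Parseval, so the double sum
  collapses. Every quantity that the definitions compute in the chosen \<open>frame_at\<close> is
  freed from that choice by this lemma.\<close>

lemma onb_trace:
  fixes e f :: "'m::finite \<Rightarrow> real ^ 'm" and B :: "real ^ 'm \<Rightarrow> real ^ 'm \<Rightarrow> 'v::real_vector"
  assumes "onb G e" "onb G f" and sym: "\<And>x y. x \<bullet> (G *v y) = y \<bullet> (G *v x)" and "bilinear B"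
  shows "(\<Sum>i\<in>UNIV. B (e i) (e i)) = (\<Sum>i\<in>UNIV. B (f i) (f i))"
proof -
  have "B (e i) (e i) = (\<Sum>j\<in>UNIV. \<Sum>k\<in>UNIV. ((f j \<bullet> (G *v e i)) * (f k \<bullet> (G *v e i))) *\<^sub>R B (f j) (f k))" for i
  proof -
    have "B (e i) (e i) = B (\<Sum>j\<in>UNIV. (f j \<bullet> (G *v e i)) *\<^sub>R f j) (\<Sum>k\<in>UNIV. (f k \<bullet> (G *v e i)) *\<^sub>R f k)"
      using onb_expand[OF assms(2), of "e i"] by simp
    also have "\<dots> = (\<Sum>(j,k)\<in>UNIV \<times> UNIV. B ((f j \<bullet> (G *v e i)) *\<^sub>R f j) ((f k \<bullet> (G *v e i)) *\<^sub>R f k))"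
      by (rule bilinear_sum[OF assms(4)])
    finally show ?thesis
      by (simp add: bilinear_lmul[OF assms(4)] bilinear_rmul[OF assms(4)] sum.cartesian_product mult.commute)
  qed
  then have "(\<Sum>i\<in>UNIV. B (e i) (e i)) = (\<Sum>i\<in>UNIV. \<Sum>j\<in>UNIV. \<Sum>k\<in>UNIV. ((f j \<bullet> (G *v e i)) * (f k \<bullet> (G *v e i))) *\<^sub>R B (f j) (f k))"
    by simp
  also have "\<dots> = (\<Sum>j\<in>UNIV. \<Sum>i\<in>UNIV. \<Sum>k\<in>UNIV. ((f j \<bullet> (G *v e i)) * (f k \<bullet> (G *v e i))) *\<^sub>R B (f j) (f k))"
    by (rule sum.swap)
  also have "\<dots> = (\<Sum>j\<in>UNIV. \<Sum>k\<in>UNIV. \<Sum>i\<in>UNIV. ((f j \<bullet> (G *v e i)) * (f k \<bullet> (G *v e i))) *\<^sub>R B (f j) (f k))"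
    by (intro sum.cong refl sum.swap)
  also have "\<dots> = (\<Sum>j\<in>UNIV. \<Sum>k\<in>UNIV. (\<Sum>i\<in>UNIV. (f j \<bullet> (G *v e i)) * (f k \<bullet> (G *v e i))) *\<^sub>R B (f j) (f k))"
    by (simp only: scaleR_left.sum)
  also have "\<dots> = (\<Sum>j\<in>UNIV. \<Sum>k\<in>UNIV. (if j = k then 1 else 0) *\<^sub>R B (f j) (f k))"
  proof (intro sum.cong refl arg_cong2[where f="(*\<^sub>R)"])
    fix j k
    show "(\<Sum>i\<in>UNIV. (f j \<bullet> (G *v e i)) * (f k \<bullet> (G *v e i))) = (if j = k then 1 else 0)"
      using onb_parseval[OF assms(1) sym, of "f j" "f k"] assms(2) sym by (simp add: onb_def)
  qed
  also have "\<dots> = (\<Sum>j\<in>UNIV. B (f j) (f j))"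
    by (intro sum.cong refl) (simp add: if_distrib[where f="\<lambda>a. a *\<^sub>R _"] cong: if_cong)
  finally show ?thesis .
qed

text \<open>Gram-Schmidt with parameters, by induction over a set I of coordinate indices. Besides
  orthonormality, the induction carries that the vectors constructed so far have no components
  outside I; this keeps the next coordinate vector independent of them at every y.\<close>

lemma gram_schmidt_field:
  fixes G :: "real ^ 'm \<Rightarrow> real ^ 'm ^ 'm"
  assumes S: "open S" and G: "\<And>k. Ck_on k S G"
    and sym: "\<And>y v w. y \<in> S \<Longrightarrow> v \<bullet> (G y *v w) = w \<bullet> (G y *v v)"
    and pos: "\<And>y v. y \<in> S \<Longrightarrow> v \<noteq> 0 \<Longrightarrow> v \<bullet> (G y *v v) > 0"
  obtains E :: "'m \<Rightarrow> real ^ 'm \<Rightarrow> real ^ 'm" where "\<And>i k. Ck_on k S (E i)" "\<And>y. y \<in> S \<Longrightarrow> onb (G y) (\<lambda>i. E i y)"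
proof -
  have "\<exists>E :: 'm \<Rightarrow> real ^ 'm \<Rightarrow> real ^ 'm. (\<forall>i\<in>I. \<forall>k. Ck_on k S (E i)) \<and>
      (\<forall>y\<in>S. \<forall>i\<in>I. \<forall>j\<in>I. E i y \<bullet> (G y *v E j y) = (if i = j then 1 else 0)) \<and>
      (\<forall>y\<in>S. \<forall>i\<in>I. \<forall>k. k \<notin> I \<longrightarrow> E i y $ k = 0)" for I :: "'m set"
    using finite[of I]
  proof (induction I rule: finite_induct)
    case (insert a I)
    then obtain E :: "'m \<Rightarrow> real ^ 'm \<Rightarrow> real ^ 'm" where E: "\<And>i k. i \<in> I \<Longrightarrow> Ck_on k S (E i)"
      "\<And>y i j. y \<in> S \<Longrightarrow> i \<in> I \<Longrightarrow> j \<in> I \<Longrightarrow> E i y \<bullet> (G y *v E j y) = (if i = j then 1 else 0)"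
      "\<And>y i k. y \<in> S \<Longrightarrow> i \<in> I \<Longrightarrow> k \<notin> I \<Longrightarrow> E i y $ k = 0"
      by blast
    define w where "w y = axis a 1 - (\<Sum>i\<in>I. (axis a 1 \<bullet> (G y *v E i y)) *\<^sub>R E i y)" for y
    define N where "N y = w y \<bullet> (G y *v w y)" for y
    \<comment> \<open>A power with exponent -1/2 replaces division by the length, so that smoothness
      follows by composition.\<close>
    define E' where "E' = E(a := \<lambda>y. (N y powr (-1/2)) *\<^sub>R w y)"
    have sw: "Ck_on k S w" for k
      unfolding w_def
      by (intro Ck_on_diff Ck_on_sum Ck_on_scaleR Ck_on_inner Ck_on_matrix_vector Ck_on_const S G E(1))
    have sN: "Ck_on k S N" for k unfolding N_def by (intro Ck_on_inner Ck_on_matrix_vector S G sw)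
    \<comment> \<open>The a-component of w is 1 because the subtracted vectors live on I; hence w
      never vanishes and N is positive.\<close>
    have wa: "w y $ k = (if k = a then 1 else 0)" if "y \<in> S" "k \<notin> I" for y k
      using that E(3)[OF that(1) _ that(2)] by (simp add: w_def axis_def)
    have Npos: "N y > 0" if "y \<in> S" for y
      unfolding N_def using wa[OF that insert.hyps(2)] by (intro pos that) auto
    have wE: "w y \<bullet> (G y *v E j y) = 0" if "y \<in> S" "j \<in> I" for y j
    proof -
      have "w y \<bullet> (G y *v E j y) = axis a 1 \<bullet> (G y *v E j y) - (\<Sum>i\<in>I. (axis a 1 \<bullet> (G y *v E i y)) * (if i = j then 1 else 0))"
        by (simp add: w_def inner_diff_left inner_sum_left E(2)[OF that(1) _ that(2)] cong: sum.cong)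
      then show ?thesis using that(2) insert.hyps(1) by (simp add: if_distrib[where f="\<lambda>u. _ * u"] cong: if_cong)
    qed
    have NN: "N y powr (-1/2) * (N y powr (-1/2) * N y) = 1" if "y \<in> S" for y
    proof -
      have "N y powr (-1/2) * N y powr (-1/2) = N y powr (- 1)" by (simp add: powr_add[symmetric])
      then show ?thesis using Npos[OF that] by (simp add: mult.assoc[symmetric] powr_minus)
    qed
    have "E' i y \<bullet> (G y *v E' j y) = (if i = j then 1 else 0)" if ij: "y \<in> S" "i \<in> insert a I" "j \<in> insert a I" for y i j
    proof -
      consider "i = a" "j = a" | "i = a" "j \<in> I" "j \<noteq> a" | "i \<in> I" "j = a" "i \<noteq> a" | "i \<in> I" "j \<in> I" "i \<noteq> a" "j \<noteq> a"
        using ij insert.hyps by auto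
      then show ?thesis
      proof cases
        case 1
        then show ?thesis using NN[OF ij(1)] by (simp add: E'_def matrix_vector_mult_scaleR N_def[symmetric])
      next
        case 2
        then show ?thesis using wE[OF ij(1)] by (simp add: E'_def)
      next
        case 3
        then show ?thesis using wE[OF ij(1)] sym[OF ij(1), of "E i y" "w y"] by (simp add: E'_def matrix_vector_mult_scaleR)
      next
        case 4
        then show ?thesis using E(2) ij by (simp add: E'_def)
      qed
    qed
    moreover have "Ck_on k S (E' i)" if "i \<in> insert a I" for i k
    proof (cases "i = a")
      case True
      have "Ck_on k S (\<lambda>y. N y powr (-1/2))"
        by (rule Ck_on_compose[OF S _ _ sN Ck_on_powr]) (use Npos in auto)
      then show ?thesis using True by (simp add: E'_def Ck_on_scaleR[OF S _ sw])
    next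
      case False
      then show ?thesis using E(1) that by (simp add: E'_def)
    qed
    moreover have "E' i y $ k = 0" if "y \<in> S" "i \<in> insert a I" "k \<notin> insert a I" for i y k
      using that wa[OF that(1), of k] E(3)[OF that(1), of i k] by (auto simp: E'_def)
    ultimately show ?case by (intro exI[of _ E']) blast
  qed auto
  from this[of UNIV] obtain E :: "'m \<Rightarrow> real ^ 'm \<Rightarrow> real ^ 'm" where "\<And>i k. Ck_on k S (E i)"
      "\<And>y i j. y \<in> S \<Longrightarrow> E i y \<bullet> (G y *v E j y) = (if i = j then 1 else 0)"
    by blast
  then show ?thesis by (intro that[of E]) (simp_all add: onb_def)
qed

text \<open>Jacobi's formula without the adjugate: in the orthonormal basis e the matrix G x becomes
  the identity, and \<open>onb_det\<close> converts the determinants back.\<close>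

lemma has_derivative_det_onb:
  fixes G :: "'c::real_normed_vector \<Rightarrow> real ^ 'm ^ 'm"
  assumes "(G has_derivative G') (at x)" "onb (G x) e"
  shows "((\<lambda>y. det (G y)) has_derivative (\<lambda>h. det (G x) * (\<Sum>i\<in>UNIV. e i \<bullet> (G' h *v e i)))) (at x)"
proof -
  let ?L = "\<lambda>A::real^'m^'m. (\<chi> i j. e i \<bullet> (A *v e j)) :: real^'m^'m"
  have "linear ?L"
    by (rule linearI) (simp_all add: vec_eq_iff matrix_vector_mult_add_rdistrib inner_add_right
        bounded_bilinear.scaleR_left[OF bounded_bilinear_matrix_vector_mult])
  then have "bounded_linear ?L" by (simp only: linear_conv_bounded_linear)
  then have "((\<lambda>y. ?L (G y)) has_derivative (\<lambda>h. ?L (G' h))) (at x)"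
    by (rule bounded_linear.has_derivative) (rule assms(1))
  then have "((\<lambda>y. det (?L (G y))) has_derivative (\<lambda>h. \<Sum>i\<in>UNIV. ?L (G' h) $ i $ i)) (at x)"
    by (rule has_derivative_det_at_identity) (rule onb_matrix[OF assms(2)])
  then have "((\<lambda>y. det (G x) * det (?L (G y))) has_derivative (\<lambda>h. det (G x) * (\<Sum>i\<in>UNIV. ?L (G' h) $ i $ i))) (at x)"
    by (rule has_derivative_mult_right)
  moreover have "det (G x) * det (?L A) = det A" for A
    using onb_det[OF assms(2)] unfolding det_frame by (metis mult.assoc mult.commute mult.right_neutral)
  ultimately show ?thesis by simp
qed

context riem_mfd
begin

section \<open>Smooth local orthonormal frames\<close>

lemma ex_frame_chart:
  assumes "c \<in> atlas M"
  obtains E where "\<And>i k. Ck_on k (cim c) (E i)" "\<And>y. y \<in> cim c \<Longrightarrow> onb (gram M c (cinv c y)) (\<lambda>i. E i y)"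
proof -
  have *: "c \<in> charts_at M (cinv c y)" if "y \<in> cim c" for y
    using that assms by (simp add: charts_at_iff cinv_in_cdom)
  show ?thesis
    using gram_schmidt_field[OF open_cim[OF assms] gram_smooth[OF assms, unfolded o_def] ginner_sym[OF *] ginner_pos[OF *]] that
    by blast
qed

lemma ex_onb: "c \<in> charts_at M p \<Longrightarrow> \<exists>e. onb (gram M c p) e"
  using ex_frame_chart[of c] by (metis charts_at_iff cinv_cmap imageI)

lemma gram_det_pos: "c \<in> charts_at M p \<Longrightarrow> det (gram M c p) > 0"
  using ex_onb onb_det_pos by blast

text \<open>In the chart d the components are a moving Jacobian applied to a moving vector.
  Expanding the vector over the coordinate axes separates the two dependences.\<close>

lemma tvec_of_Ck_on:
  assumes c: "c \<in> atlas M" and d: "d \<in> atlas M" and "open W" and Y: "Ck_on k (cmap c ` (cdom c \<inter> W)) Y"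
  shows "Ck_on k (cmap d ` (cdom d \<inter> (cdom c \<inter> W))) (\<lambda>y. tvec_of M c (cinv d y) (Y (cmap c (cinv d y))) d)"
proof -
  let ?S = "cmap d ` (cdom d \<inter> (cdom c \<inter> W))" and ?T = "\<lambda>y. cmap c (cinv d y)"
  have S: "open ?S" by (intro open_cmap_image d open_Int open_cdom c \<open>open W\<close>)
  have T: "Ck_on k ?S ?T" 
    by (rule Ck_on_subset[OF transition_smooth[OF d c, unfolded o_def]]) auto
  have YT: "Ck_on k ?S (\<lambda>y. Y (?T y))"
    by (rule Ck_on_compose[OF S _ _ T Y]) (use c d \<open>open W\<close> in \<open>auto intro!: open_cmap_image\<close>)
  have JT: "Ck_on k ?S (\<lambda>y. frechet_derivative (cmap d \<circ> cinv c) (at (?T y)) v)" for v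
  proof (rule Ck_on_compose[OF S _ _ T])
    show "Ck_on k (cmap c ` (cdom c \<inter> cdom d)) (\<lambda>z. frechet_derivative (cmap d \<circ> cinv c) (at z) v)"
      using transition_smooth[OF c d, of "Suc k"] by simp
  qed (use c d in \<open>auto intro!: open_cmap_image open_cdom\<close>)
  have "Ck_on k ?S (\<lambda>y. \<Sum>a\<in>UNIV. (Y (?T y) $ a) *\<^sub>R frechet_derivative (cmap d \<circ> cinv c) (at (?T y)) (axis a 1))"
    by (intro Ck_on_sum Ck_on_scaleR Ck_on_vec_nth S YT JT)
  then show ?thesis
  proof (rule Ck_on_cong[OF S, rotated])
    fix y assume y: "y \<in> ?S"
    then have ch: "c \<in> charts_at M (cinv d y)" "d \<in> charts_at M (cinv d y)" using c d by (auto simp: charts_at_iff)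
    interpret bounded_linear "jac c d (cinv d y)" by (rule jac_linear[OF ch])
    have "tvec_of M c (cinv d y) (Y (?T y)) d = jac c d (cinv d y) (\<Sum>a\<in>UNIV. (Y (?T y) $ a) *\<^sub>R axis a 1)"
      using ch(2) unfolding tvec_of_def vec_axis_sum[symmetric] by simp
    also have "\<dots> = (\<Sum>a\<in>UNIV. (Y (?T y) $ a) *\<^sub>R jac c d (cinv d y) (axis a 1))"
      by (simp add: sum scaleR)
    finally show "(\<Sum>a\<in>UNIV. (Y (?T y) $ a) *\<^sub>R frechet_derivative (cmap d \<circ> cinv c) (at (?T y)) (axis a 1))
      = tvec_of M c (cinv d y) (Y (?T y)) d"
      by (simp only: jac_def)
  qed
qed

text \<open>Gives the choice in \<open>frame_at\<close> a witness, and thereby its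
  properties.\<close>

lemma ex_frame: "\<exists>e W. p \<in> W \<and> orthonormal_frame_on M W e"
proof -
  obtain c where c: "c \<in> atlas M" "p \<in> cdom c" using ex_chart charts_at_iff by blast
  obtain E where E: "\<And>i k. Ck_on k (cim c) (E i)" "\<And>y. y \<in> cim c \<Longrightarrow> onb (gram M c (cinv c y)) (\<lambda>i. E i y)"
    using ex_frame_chart[OF c(1)] by blast
  define e where "e i q = tvec_of M c q (E i (cmap c q))" for i q
  have ch: "c \<in> charts_at M q" if "q \<in> cdom c" for q using c that by (simp add: charts_at_iff)
  have "orthonormal_frame_on M (cdom c) e"
    unfolding orthonormal_frame_on_def smooth_vector_field_on_def smooth_on_def
  proof (intro conjI allI ballI open_cdom[OF c(1)])
    show "e i q \<in> tangent_space M q" if "q \<in> cdom c" for i q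
      unfolding e_def by (rule tvec_of_tangent[OF ch[OF that]])
    show "metric M q (e i q) (e j q) = (if i = j then 1 else 0)" if "q \<in> cdom c" for i j q
      using E(2)[of "cmap c q"] that c ginner_metric[OF ch[OF that], of "E i (cmap c q)" "E j (cmap c q)"]
      by (simp add: e_def onb_def)
    show "Ck_on k (cmap d ` (cdom d \<inter> cdom c)) (\<lambda>y. e i (cinv d y) d)" if "d \<in> atlas M" for d i k
      using tvec_of_Ck_on[OF c(1) that open_UNIV, of k "E i"] E(1) by (simp add: e_def)
  qed
  then show ?thesis using c(2) by blast
qed

lemma frame_at_orthonormal: "\<exists>W. p \<in> W \<and> orthonormal_frame_on M W (frame_at M p)"
  unfolding frame_at_def by (rule someI_ex[OF ex_frame])

lemma frame_tangent: "orthonormal_frame_on M W e \<Longrightarrow> q \<in> W \<Longrightarrow> e i q \<in> tangent_space M q"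
  by (simp add: orthonormal_frame_on_def smooth_vector_field_on_def)

lemma frame_onb:
  assumes "orthonormal_frame_on M W e" "q \<in> W" "c \<in> charts_at M q"
  shows "onb (gram M c q) (\<lambda>i. e i q c)"
  using assms metric_gram[OF assms(3) frame_tangent[OF assms(1,2)] frame_tangent[OF assms(1,2)]]
  by (simp add: onb_def orthonormal_frame_on_def)

lemma frame_at_tangent: "frame_at M p i p \<in> tangent_space M p"
  using frame_at_orthonormal frame_tangent by blast

lemma frame_at_onb: "c \<in> charts_at M p \<Longrightarrow> onb (gram M c p) (\<lambda>i. frame_at M p i p c)"
  using frame_at_orthonormal[of p] frame_onb by blast

lemma frame_Ck_on:
  "orthonormal_frame_on M W e \<Longrightarrow> c \<in> atlas M \<Longrightarrow> Ck_on k (cmap c ` (cdom c \<inter> W)) (\<lambda>y. e i (cinv c y) c)"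
  by (simp add: orthonormal_frame_on_def smooth_vector_field_on_def smooth_on_def)

end

subsection \<open>Change of variables for an arbitrary finite index type\<close>

text \<open>The library theorem needs a well-ordered index type; \<open>wof\<close> equips a finite type with an order.\<close>

typedef 'a wof = "UNIV :: 'a set" morphisms unwof wof by auto

definition wof_index :: "'a::finite wof \<Rightarrow> nat" where
  "wof_index x = (SOME f :: 'a \<Rightarrow> nat. inj f) (unwof x)"

lemma inj_wof_index: "inj (wof_index :: 'a::finite wof \<Rightarrow> nat)"
proof -
  have "\<exists>f :: 'a \<Rightarrow> nat. inj f" using finite_imp_inj_to_nat_seg[OF finite, of "UNIV :: 'a set"] by blast
  then have *: "inj (SOME f :: 'a \<Rightarrow> nat. inj f)" by (rule someI_ex)
  show ?thesis unfolding wof_index_def by (rule injI) (simp only: inj_eq[OF *] unwof_inject)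
qed

instance wof :: (finite) finite
proof
  have "(UNIV :: 'a wof set) = range wof" by (metis surj_def unwof_inverse)
  then show "finite (UNIV :: 'a wof set)" by (metis finite finite_imageI)
qed

instantiation wof :: (finite) linorder
begin
definition "x \<le> y \<longleftrightarrow> wof_index x \<le> wof_index y"
definition "x < y \<longleftrightarrow> wof_index x < wof_index y"
instance by standard (auto simp: less_eq_wof_def less_wof_def intro: injD[OF inj_wof_index])
end

instance wof :: (finite) wellorder
proof
  fix P :: "'a wof \<Rightarrow> bool" and a
  assume step: "\<And>x. (\<And>y. y < x \<Longrightarrow> P y) \<Longrightarrow> P x"
  show "P a"
    by (induction a rule: measure_induct_rule[of wof_index]) (use step in \<open>auto simp: less_wof_def\<close>)
qed

section \<open>Transfer of vectors, determinants and Lebesgue measure to the ordered index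
  type\<close>

definition to_wof :: "real ^ 'm \<Rightarrow> real ^ 'm wof" where "to_wof x = (\<chi> i. x $ unwof i)"
definition of_wof :: "real ^ 'm wof \<Rightarrow> real ^ 'm" where "of_wof x = (\<chi> i. x $ wof i)"

lemma of_to_wof [simp]: "of_wof (to_wof x) = x" and to_of_wof [simp]: "to_wof (of_wof y) = y"
  by (simp_all add: of_wof_def to_wof_def vec_eq_iff wof_inverse unwof_inverse)

lemma linear_to_wof: "linear to_wof" and linear_of_wof: "linear of_wof"
  by (auto intro!: linearI simp: to_wof_def of_wof_def vec_eq_iff)

lemma bounded_linear_to_wof: "bounded_linear to_wof" and bounded_linear_of_wof: "bounded_linear of_wof"
  using linear_to_wof linear_of_wof by (simp_all add: linear_conv_bounded_linear)

lemma bij_wof: "bij (wof :: 'a \<Rightarrow> 'a wof)"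
  by (rule bijI') (simp_all add: wof_inject, metis unwof_inverse)

text \<open>Conjugation with \<open>wof\<close> is a sign-preserving bijection between the
  permutations of the two index types, so the two Leibniz sums agree term by term.\<close>

lemma det_reindex_wof:
  fixes A :: "real ^ 'm ^ 'm"
  shows "det (\<chi> i j. A $ unwof i $ unwof j) = det A"
proof -
  let ?h = "map_permutation (UNIV :: 'm set) wof"
  have im: "range (wof :: 'm \<Rightarrow> 'm wof) = UNIV" using bij_wof bij_is_surj by blast
  have inj: "inj (wof :: 'm \<Rightarrow> 'm wof)" using bij_wof bij_is_inj by blast
  have "bij_betw ?h {p. p permutes UNIV} {p. p permutes UNIV}"
  proof (rule bij_betwI[where g="map_permutation (UNIV :: 'm wof set) unwof"])
    show "?h \<in> {p. p permutes UNIV} \<rightarrow> {p. p permutes UNIV}"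
      using bij_wof by (auto intro!: map_permutation_permutes)
    show "map_permutation (UNIV :: 'm wof set) unwof \<in> {p. p permutes UNIV} \<rightarrow> {p. p permutes UNIV}"
      by (auto intro!: map_permutation_permutes bijI' simp: unwof_inject) (metis wof_inverse UNIV_I)
    show "map_permutation UNIV unwof (?h p) = p" if "p \<in> {p. p permutes UNIV}" for p
      using that im by (intro map_permutation_compose_inv[where A=UNIV]) (auto simp: wof_inverse bij_wof)
    show "?h (map_permutation UNIV unwof q) = q" if "q \<in> {p. p permutes UNIV}" for q
      using that by (intro map_permutation_compose_inv[where A=UNIV])
        (auto simp: unwof_inverse unwof_inject intro!: bijI', metis wof_inverse UNIV_I)
  qed
  then have "det (\<chi> i j. A $ unwof i $ unwof j)
    = (\<Sum>p | p permutes (UNIV::'m set). of_int (sign (?h p)) * (\<Prod>i\<in>UNIV. A $ unwof i $ unwof (?h p i)))"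
    unfolding det_def by (subst sum.reindex_bij_betw[symmetric]) (auto intro!: sum.cong)
  also have "\<dots> = (\<Sum>p | p permutes (UNIV::'m set). of_int (sign p) * (\<Prod>i\<in>UNIV. A $ i $ p i))"
  proof (intro sum.cong refl arg_cong2[where f="(*)"])
    fix p assume p: "p \<in> {p. p permutes (UNIV::'m set)}"
    then show "of_int (sign (?h p)) = (of_int (sign p) :: real)"
      using inj by (simp add: sign_map_permutation)
    have "(\<Prod>i\<in>UNIV. A $ unwof i $ unwof (?h p i)) = (\<Prod>i\<in>UNIV. A $ unwof (wof i) $ unwof (?h p (wof i)))"
      by (rule prod.reindex_bij_betw[symmetric]) (rule bij_wof)
    also have "\<dots> = (\<Prod>i\<in>UNIV. A $ i $ p i)"
      using inj by (simp add: wof_inverse map_permutation_apply)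
    finally show "(\<Prod>i\<in>UNIV. A $ unwof i $ unwof (?h p i)) = (\<Prod>i\<in>UNIV. A $ i $ p i)" .
  qed
  finally show ?thesis by (simp add: det_def)
qed

lemma prod_Basis_vec: "(\<Prod>b\<in>Basis. (x :: real ^ 'n) \<bullet> b) = (\<Prod>i\<in>UNIV. x $ i)"
proof -
  have B: "(Basis :: (real ^ 'n) set) = (\<lambda>i. axis i 1) ` UNIV" by (auto simp: Basis_vec_def)
  have "inj (\<lambda>i::'n. axis i (1::real))" by (auto simp: inj_def axis_eq_axis)
  then show ?thesis unfolding B by (simp add: prod.reindex inner_axis)
qed

text \<open>Lebesgue measure is determined by boxes, and the preimage of a box is a box with the
  same side lengths, only indexed differently.\<close>

lemma lborel_distr_to_wof: "distr lborel lborel (to_wof :: real ^ 'm \<Rightarrow> _) = lborel"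
proof (rule lborel_eqI[symmetric])
  have m: "(to_wof :: real ^ 'm \<Rightarrow> _) \<in> borel_measurable borel"
    by (intro borel_measurable_continuous_onI linear_continuous_on bounded_linear_to_wof)
  fix l u :: "real ^ 'm wof" assume le: "\<And>b. b \<in> Basis \<Longrightarrow> l \<bullet> b \<le> u \<bullet> b"
  have le': "l $ i \<le> u $ i" for i using le[of "axis i 1"] by (auto simp: Basis_vec_def inner_axis)
  have "(to_wof :: real ^ 'm \<Rightarrow> _) -` box l u = box (of_wof l) (of_wof u)"
    unfolding set_eq_iff vimage_def mem_Collect_eq mem_box_cart
    by (auto simp: to_wof_def of_wof_def) (metis wof_inverse UNIV_I unwof_inverse)+
  then have "emeasure (distr lborel lborel (to_wof :: real ^ 'm \<Rightarrow> _)) (box l u) = emeasure lborel (box (of_wof l) (of_wof u))"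
    using m by (subst emeasure_distr) simp_all
  also have "\<dots> = ennreal (\<Prod>b\<in>Basis. (of_wof u - of_wof l) \<bullet> b)"
    by (intro emeasure_lborel_box) (auto simp: Basis_vec_def inner_axis of_wof_def le')
  also have "(\<Prod>b\<in>Basis. (of_wof u - of_wof l) \<bullet> b) = (\<Prod>i\<in>UNIV. (u - l) $ wof i)"
    by (simp only: prod_Basis_vec) (simp add: of_wof_def)
  also have "\<dots> = (\<Prod>b\<in>Basis. (u - l) \<bullet> b)"
    unfolding prod_Basis_vec by (rule prod.reindex_bij_betw[OF bij_wof])
  finally show "emeasure (distr lborel lborel (to_wof :: real ^ 'm \<Rightarrow> _)) (box l u) = ennreal (\<Prod>b\<in>Basis. (u - l) \<bullet> b)" .
qed simp

text \<open>The theorem for absolutely integrable vector functions is applied to f with values in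
  \<open>real ^ 1\<close>. It also says that the two sides are integrable simultaneously; if they
  are not, nonnegativity makes both integrals infinite.\<close>

lemma nn_integral_change_of_variables_wellorder:
  fixes g :: "real^'m::{finite,wellorder} \<Rightarrow> real^'m::_" and f :: "_ \<Rightarrow> real"
  assumes S: "S \<in> sets borel" "g ` S \<in> sets borel"
    and der: "\<And>x. x \<in> S \<Longrightarrow> (g has_derivative g' x) (at x)" and inj: "inj_on g S"
    and mf: "(\<lambda>y. indicator (g ` S) y * f y) \<in> borel_measurable borel"
    and mg: "(\<lambda>x. indicator S x * (\<bar>det (matrix (g' x))\<bar> * f (g x))) \<in> borel_measurable borel"
    and pos: "\<And>y. f y \<ge> 0"
  shows "(\<integral>\<^sup>+y. ennreal (indicator (g ` S) y * f y) \<partial>lborel)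
       = (\<integral>\<^sup>+x. ennreal (indicator S x * (\<bar>det (matrix (g' x))\<bar> * f (g x))) \<partial>lborel)"
proof -
  let ?h = "\<lambda>x. indicator S x * (\<bar>det (matrix (g' x))\<bar> * f (g x))" and ?k = "\<lambda>y. indicator (g ` S) y * f y"
  let ?F = "\<lambda>y. vec (f y) :: real ^ 1"
  have vec: "vec a = a *\<^sub>R (vec 1 :: real ^ 1)" for a by (simp add: vec_eq_iff)
  have ai: "(\<lambda>x. vec (q x) :: real ^ 1) absolutely_integrable_on T \<longleftrightarrow> integrable lborel (\<lambda>x. indicator T x * q x)"
    if "(\<lambda>x. indicator T x * q x) \<in> borel_measurable borel" for q T
  proof -
    have "(\<lambda>x. vec (q x) :: real ^ 1) absolutely_integrable_on T \<longleftrightarrow> q absolutely_integrable_on T"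
      by (subst absolutely_integrable_componentwise_iff) (simp add: Basis_vec_def inner_axis)
    also have "\<dots> \<longleftrightarrow> integrable lebesgue (\<lambda>x. indicator T x * q x)" by (simp add: set_integrable_def)
    also have "\<dots> \<longleftrightarrow> integrable lborel (\<lambda>x. indicator T x * q x)"
      using that by (intro integrable_completion) simp
    finally show ?thesis .
  qed
  have ig: "integral T (\<lambda>x. vec (q x) :: real ^ 1) = vec (integral\<^sup>L lborel (\<lambda>x. indicator T x * q x))"
    if "(\<lambda>x. indicator T x * q x) \<in> borel_measurable borel" "integrable lborel (\<lambda>x. indicator T x * q x)" for q T
  proof -
    have si: "set_integrable lebesgue T q"
      using that by (simp add: set_integrable_def integrable_completion)
    have "integral T (\<lambda>x. vec (q x) :: real ^ 1) = vec (integral T q)"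
      unfolding vec[of "q _"] vec[of "integral T q"]
      using set_lebesgue_integral_eq_integral(1)[OF si] by (intro integral_unique has_integral_scaleR_left) auto
    also have "integral T q = integral\<^sup>L lborel (\<lambda>x. indicator T x * q x)"
      using set_lebesgue_integral_eq_integral(2)[OF si] integral_completion[of "\<lambda>x. indicator T x * q x" lborel] that
      by (simp add: set_lebesgue_integral_def)
    finally show ?thesis .
  qed
  have cov: "(\<lambda>x. \<bar>det (matrix (g' x))\<bar> *\<^sub>R ?F (g x)) absolutely_integrable_on S \<and> integral S (\<lambda>x. \<bar>det (matrix (g' x))\<bar> *\<^sub>R ?F (g x)) = b
     \<longleftrightarrow> ?F absolutely_integrable_on (g ` S) \<and> integral (g ` S) ?F = b" for b
    using S by (intro has_absolute_integral_change_of_variables inj has_derivative_at_withinI[OF der]) auto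
  have e: "\<bar>det (matrix (g' x))\<bar> *\<^sub>R ?F (g x) = vec (\<bar>det (matrix (g' x))\<bar> * f (g x))" for x
    by (simp add: vec_eq_iff)
  have iff: "integrable lborel ?h \<longleftrightarrow> integrable lborel ?k"
    using cov unfolding e ai[OF mf] ai[OF mg] by blast
  show ?thesis
  proof (cases "integrable lborel ?h")
    case True
    then have k: "integrable lborel ?k" using iff by simp
    have "(vec (integral\<^sup>L lborel ?h) :: real ^ 1) = vec (integral\<^sup>L lborel ?k)"
      using cov True k unfolding e ai[OF mf] ai[OF mg] ig[OF mf k] ig[OF mg True] by metis
    then have "integral\<^sup>L lborel ?h = integral\<^sup>L lborel ?k" by (simp add: vec_eq_iff)
    moreover have "(\<integral>\<^sup>+x. ennreal (?h x) \<partial>lborel) = ennreal (integral\<^sup>L lborel ?h)"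
      by (rule nn_integral_eq_integral[OF True]) (simp add: pos)
    moreover have "(\<integral>\<^sup>+x. ennreal (?k x) \<partial>lborel) = ennreal (integral\<^sup>L lborel ?k)"
      by (rule nn_integral_eq_integral[OF k]) (simp add: pos)
    ultimately show ?thesis by (simp only:)
  next
    case False
    have inf: "(\<integral>\<^sup>+x. ennreal (q x) \<partial>lborel) = \<infinity>" if "q \<in> borel_measurable borel" "\<And>x. q x \<ge> 0" "\<not> integrable lborel q" for q :: "real^'m::_ \<Rightarrow> real"
    proof (rule ccontr)
      assume "\<not> ?thesis"
      then have "(\<integral>\<^sup>+x. ennreal (q x) \<partial>lborel) < \<infinity>" by (simp add: less_top)
      then show False using integrableI_nonneg[of q lborel] that by simp
    qed
    have "\<not> integrable lborel ?k" using False iff by blast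
    from inf[OF mf _ this] inf[OF mg _ False] show ?thesis by (simp add: pos)
  qed
qed

text \<open>Conjugates g with the reindexing isometry; Lebesgue measure and the Jacobian determinant
  are both unchanged by it.\<close>

lemma nn_integral_change_of_variables:
  fixes g :: "real^'m \<Rightarrow> real^'m" and f :: "_ \<Rightarrow> real"
  assumes S: "S \<in> sets borel" "g ` S \<in> sets borel"
    and der: "\<And>x. x \<in> S \<Longrightarrow> (g has_derivative g' x) (at x)" and inj: "inj_on g S"
    and mf: "(\<lambda>y. indicator (g ` S) y * f y) \<in> borel_measurable borel"
    and mg: "(\<lambda>x. indicator S x * (\<bar>det (matrix (g' x))\<bar> * f (g x))) \<in> borel_measurable borel"
    and pos: "\<And>y. f y \<ge> 0"
  shows "(\<integral>\<^sup>+y. ennreal (indicator (g ` S) y * f y) \<partial>lborel)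
       = (\<integral>\<^sup>+x. ennreal (indicator S x * (\<bar>det (matrix (g' x))\<bar> * f (g x))) \<partial>lborel)"
proof -
  define G where "G = to_wof \<circ> g \<circ> of_wof"
  define G' where "G' x = to_wof \<circ> g' (of_wof x) \<circ> of_wof" for x
  have mt: "(to_wof :: real ^ 'm \<Rightarrow> _) \<in> borel_measurable borel" and mo: "(of_wof :: _ \<Rightarrow> real ^ 'm) \<in> borel_measurable borel"
    by (intro borel_measurable_continuous_onI linear_continuous_on bounded_linear_to_wof bounded_linear_of_wof)+
  have vim: "to_wof ` A = of_wof -` A" for A :: "(real ^ 'm) set"
    by (auto simp: image_iff) (metis to_of_wof)
  have mim: "to_wof ` A \<in> sets borel" if "A \<in> sets borel" for A :: "(real ^ 'm) set"
    unfolding vim using measurable_sets[OF mo that] by simp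
  have GS: "G ` (to_wof ` S) = to_wof ` (g ` S)" by (auto simp: G_def image_image)
  have trans: "(\<integral>\<^sup>+x. q x \<partial>lborel) = (\<integral>\<^sup>+x. q (of_wof x) \<partial>lborel)" if "q \<in> borel_measurable borel" for q :: "real ^ 'm \<Rightarrow> ennreal"
  proof -
    have "(\<integral>\<^sup>+x. q (of_wof x) \<partial>lborel) = (\<integral>\<^sup>+x. q (of_wof x) \<partial>distr lborel lborel to_wof)"
      by (simp only: lborel_distr_to_wof)
    also have "\<dots> = (\<integral>\<^sup>+x. q x \<partial>lborel)"
      using mt mo that by (subst nn_integral_distr) (auto intro: measurable_compose)
    finally show ?thesis by simp
  qed
  have ind: "indicator (to_wof ` A) x = (indicator A (of_wof x) :: real)" for A :: "(real ^ 'm) set" and x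
    unfolding vim by (simp add: indicator_def)
  have dt: "det (matrix (G' x)) = det (matrix (g' (of_wof x)))" for x
  proof -
    have ax: "of_wof (axis j 1) = axis (unwof j) 1" for j :: "'m wof"
      by (auto simp: of_wof_def axis_def vec_eq_iff wof_inverse unwof_inverse)
    have "matrix (G' x) = (\<chi> i j. matrix (g' (of_wof x)) $ unwof i $ unwof j)"
      by (simp add: matrix_def G'_def vec_eq_iff to_wof_def ax)
    then show ?thesis by (simp add: det_reindex_wof)
  qed
  have "(\<integral>\<^sup>+y. ennreal (indicator (g ` S) y * f y) \<partial>lborel) = (\<integral>\<^sup>+y. ennreal (indicator (G ` (to_wof ` S)) y * (f \<circ> of_wof) y) \<partial>lborel)"
    unfolding GS ind by (subst trans) (use mf in auto)
  also have "\<dots> = (\<integral>\<^sup>+x. ennreal (indicator (to_wof ` S) x * (\<bar>det (matrix (G' x))\<bar> * (f \<circ> of_wof) (G x))) \<partial>lborel)"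
  proof (rule nn_integral_change_of_variables_wellorder)
    show "to_wof ` S \<in> sets borel" "G ` (to_wof ` S) \<in> sets borel" unfolding GS using S mim by auto
    show "(G has_derivative G' x) (at x)" if "x \<in> to_wof ` S" for x
    proof -
      have x: "of_wof x \<in> S" using that by auto
      have "((\<lambda>x. g (of_wof x)) has_derivative (\<lambda>v. g' (of_wof x) (of_wof v))) (at x)"
        by (rule has_derivative_compose[OF bounded_linear_imp_has_derivative[OF bounded_linear_of_wof] der[OF x]])
      from bounded_linear.has_derivative[OF bounded_linear_to_wof this]
      show ?thesis by (simp add: G_def G'_def o_def)
    qed
    show "inj_on G (to_wof ` S)"
      using inj unfolding inj_on_def G_def by (auto simp: image_iff) (metis of_to_wof)
    show "(\<lambda>y. indicator (G ` to_wof ` S) y * (f \<circ> of_wof) y) \<in> borel_measurable borel"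
      unfolding GS ind o_def by (rule measurable_compose[OF mo mf])
    show "(\<lambda>x. indicator (to_wof ` S) x * (\<bar>det (matrix (G' x))\<bar> * (f \<circ> of_wof) (G x))) \<in> borel_measurable borel"
      unfolding ind dt using measurable_compose[OF mo mg] by (simp add: G_def)
  qed (use pos in auto)
  also have "\<dots> = (\<integral>\<^sup>+x. ennreal (indicator S (of_wof x) * (\<bar>det (matrix (g' (of_wof x)))\<bar> * f (g (of_wof x)))) \<partial>lborel)"
    unfolding ind dt by (simp add: G_def)
  also have "\<dots> = (\<integral>\<^sup>+x. ennreal (indicator S x * (\<bar>det (matrix (g' x))\<bar> * f (g x))) \<partial>lborel)"
    by (rule trans[symmetric]) (use mg in auto)
  finally show ?thesis .
qed

subsection \<open>The Riemannian volume measure\<close>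

context riem_mfd
begin

text \<open>The indicator extends the Riemannian density by zero to a Borel function on the whole
  space; the measure \<open>cmeas c\<close> then has no mass outside the domain of c.\<close>

definition dens :: "('a, 'm) chart \<Rightarrow> real ^ 'm \<Rightarrow> real" where
  "dens c y = indicator (cim c) y * sqrt (det (gram M c (cinv c y)))"

definition cmeas :: "('a, 'm) chart \<Rightarrow> 'a measure" where
  "cmeas c = distr (density lborel (\<lambda>y. ennreal (dens c y))) borel (cinv c)"

lemma chart_at_cinv: "c \<in> atlas M \<Longrightarrow> y \<in> cim c \<Longrightarrow> c \<in> charts_at M (cinv c y)"
  by (simp add: charts_at_iff cinv_in_cdom)

lemma dens_pos: "c \<in> atlas M \<Longrightarrow> y \<in> cim c \<Longrightarrow> dens c y > 0"
  using gram_det_pos[OF chart_at_cinv] by (simp add: dens_def)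

lemma dens_nonneg: "c \<in> atlas M \<Longrightarrow> dens c y \<ge> 0"
  using dens_pos[of c y] by (cases "y \<in> cim c") (auto simp: dens_def less_imp_le)

lemma continuous_on_dens: "c \<in> atlas M \<Longrightarrow> continuous_on (cim c) (dens c)"
proof -
  assume c: "c \<in> atlas M"
  have "continuous_on (cim c) (\<lambda>y. sqrt (det (gram M c (cinv c y))))"
    unfolding det_def
    by (intro continuous_intros bounded_linear.continuous_on[OF bounded_linear_vec_nth] gram_cont c)
  then show ?thesis by (rule continuous_on_eq) (simp add: dens_def)
qed

lemma dens_measurable [measurable]: "c \<in> atlas M \<Longrightarrow> dens c \<in> borel_measurable borel"
proof -
  assume c: "c \<in> atlas M"
  have "(\<lambda>y. indicator (cim c) y *\<^sub>R dens c y) \<in> borel_measurable borel"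
    by (intro borel_measurable_continuous_on_indicator continuous_on_dens c) (simp add: open_cim[OF c])
  also have "(\<lambda>y. indicator (cim c) y *\<^sub>R dens c y) = dens c" by (auto simp: dens_def fun_eq_iff indicator_def)
  finally show ?thesis .
qed

lemma cinv_measurable [measurable]: "c \<in> atlas M \<Longrightarrow> cinv c \<in> borel_measurable borel"
proof -
  assume c: "c \<in> atlas M"
  have "cinv c \<in> borel_measurable (restrict_space borel (cim c))"
    by (rule borel_measurable_continuous_on_restrict[OF continuous_on_cinv[OF c]])
  \<comment> \<open>Off the image of the chart, \<open>inv_into\<close> returns one and the same
    default value for every y, so \<open>cinv c\<close> is constant there and measurable on the
    whole space.\<close>
  then have "(\<lambda>y. if y \<in> cim c then cinv c y else (SOME x. False)) \<in> borel_measurable borel"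
    by (subst (asm) measurable_restrict_space_iff) (auto simp: open_cim[OF c])
  also have "(\<lambda>y. if y \<in> cim c then cinv c y else (SOME x. False)) = cinv c"
  proof
    fix y
    have "(\<lambda>x. x \<in> cdom c \<and> cmap c x = y) = (\<lambda>x. False)" if "y \<notin> cim c" using that by auto
    then show "(if y \<in> cim c then cinv c y else (SOME x. False)) = cinv c y"
      by (auto simp: cinv_def inv_into_def)
  qed
  finally show ?thesis .
qed

lemma cmap_image_borel: "c \<in> atlas M \<Longrightarrow> A \<in> sets borel \<Longrightarrow> A \<subseteq> cdom c \<Longrightarrow> cmap c ` A \<in> sets borel"
proof -
  assume c: "c \<in> atlas M" and A: "A \<in> sets borel" "A \<subseteq> cdom c"
  have "cmap c ` A = cim c \<inter> (cinv c -` A \<inter> space borel)"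
    using cmap_image_Int[OF c, of A] A(2) by (auto simp: Int_absorb1)
  also have "\<dots> \<in> sets borel"
    using measurable_sets[OF cinv_measurable[OF c] A(1)] open_cim[OF c] by auto
  finally show ?thesis .
qed

lemma sets_cmeas [simp]: "sets (cmeas c) = sets borel" and space_cmeas [simp]: "space (cmeas c) = UNIV"
  by (simp_all add: cmeas_def)

lemma emeasure_cmeas:
  assumes "c \<in> atlas M" "A \<in> sets borel"
  shows "emeasure (cmeas c) A = (\<integral>\<^sup>+y. ennreal (dens c y) * indicator A (cinv c y) \<partial>lborel)"
proof -
  have "emeasure (cmeas c) A = emeasure (density lborel (\<lambda>y. ennreal (dens c y))) (cinv c -` A)"
    unfolding cmeas_def using assms by (subst emeasure_distr) auto
  also have "\<dots> = (\<integral>\<^sup>+y. ennreal (dens c y) * indicator (cinv c -` A) y \<partial>lborel)"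
    using assms measurable_sets[OF cinv_measurable[OF assms(1)] assms(2)] by (subst emeasure_density) auto
  finally show ?thesis by (simp add: indicator_def)
qed

lemma emeasure_cmeas_image:
  assumes "c \<in> atlas M" "A \<in> sets borel" "A \<subseteq> cdom c"
  shows "emeasure (cmeas c) A = (\<integral>\<^sup>+y. ennreal (indicator (cmap c ` A) y * dens c y) \<partial>lborel)"
    and "emeasure (cmeas c) A = (\<integral>\<^sup>+y\<in>cmap c ` A. ennreal (sqrt (det (gram M c (cinv c y)))) \<partial>lborel)"
proof -
  have *: "y \<in> cim c \<Longrightarrow> cinv c y \<in> A \<longleftrightarrow> y \<in> cmap c ` A" "y \<notin> cim c \<Longrightarrow> y \<notin> cmap c ` A" for y
    using assms(3) cmap_image_Int[OF assms(1), of A] by (auto simp: Int_absorb1)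
  show "emeasure (cmeas c) A = (\<integral>\<^sup>+y. ennreal (indicator (cmap c ` A) y * dens c y) \<partial>lborel)"
    unfolding emeasure_cmeas[OF assms(1,2)]
    by (rule nn_integral_cong, rename_tac y, case_tac "y \<in> cim c") (auto simp: * indicator_def dens_def)
  also have "\<dots> = (\<integral>\<^sup>+y\<in>cmap c ` A. ennreal (sqrt (det (gram M c (cinv c y)))) \<partial>lborel)"
    by (rule nn_integral_cong, rename_tac y, case_tac "y \<in> cim c") (auto simp: * indicator_def dens_def)
  finally show "emeasure (cmeas c) A = (\<integral>\<^sup>+y\<in>cmap c ` A. ennreal (sqrt (det (gram M c (cinv c y)))) \<partial>lborel)" .
qed

lemma det_gram_change:
  assumes "c \<in> charts_at M p" "d \<in> charts_at M p"
  shows "det (gram M c p) = (det (matrix (jac c d p)))\<^sup>2 * det (gram M d p)"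
proof -
  have "gram M c p = (\<chi> i j. axis i 1 \<bullet> (gram M c p *v axis j 1))"
    by (simp add: vec_eq_iff inner_axis' matrix_vector_mul_component inner_axis)
  also have "\<dots> = (\<chi> i j. jac c d p (axis i 1) \<bullet> (gram M d p *v jac c d p (axis j 1)))"
    by (simp add: ginner_jac[OF assms])
  also have "det \<dots> = (det (frame_matrix (\<lambda>i. jac c d p (axis i 1))))\<^sup>2 * det (gram M d p)"
    by (rule det_frame)
  also have "frame_matrix (\<lambda>i. jac c d p (axis i 1)) = matrix (jac c d p)"
    by (simp add: frame_matrix_def matrix_def)
  finally show ?thesis .
qed

text \<open>The Jacobian factor from the change of variables is exactly the square root of the
  factor by which the Gram determinants differ.\<close>

lemma cmeas_compat:
  assumes c: "c \<in> atlas M" and d: "d \<in> atlas M" and A: "A \<in> sets borel" "A \<subseteq> cdom c \<inter> cdom d"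
  shows "emeasure (cmeas c) A = emeasure (cmeas d) A"
proof -
  let ?g = "cmap d \<circ> cinv c" and ?S = "cmap c ` A"
  have gS: "?g ` ?S = cmap d ` A" using c A by (auto simp: image_image subset_iff intro!: image_cong)
  have S: "?S \<in> sets borel" "cmap d ` A \<in> sets borel" using cmap_image_borel c d A by auto
  have ch: "c \<in> charts_at M (cinv c x)" "d \<in> charts_at M (cinv c x)" "x = cmap c (cinv c x)" "?g x \<in> cim d" "cinv d (?g x) = cinv c x"
    if "x \<in> ?S" for x
    using that c d A by (auto simp: charts_at_iff subset_iff)
  have e: "indicator ?S x * (\<bar>det (matrix (jac c d (cinv c x)))\<bar> * dens d (?g x)) = indicator ?S x * dens c x" for x
  proof (cases "x \<in> ?S")
    case True
    then have "x \<in> cim c" using A by auto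
    then show ?thesis using ch[OF True] det_gram_change[OF ch(1,2)[OF True]]
      by (simp add: dens_def real_sqrt_mult)
  qed simp
  have "emeasure (cmeas d) A = (\<integral>\<^sup>+y. ennreal (indicator (?g ` ?S) y * dens d y) \<partial>lborel)"
    unfolding gS using emeasure_cmeas_image[OF d A(1)] A(2) by auto
  also have "\<dots> = (\<integral>\<^sup>+x. ennreal (indicator ?S x * (\<bar>det (matrix (jac c d (cinv c x)))\<bar> * dens d (?g x))) \<partial>lborel)"
  proof (rule nn_integral_change_of_variables)
    show "?S \<in> sets borel" "?g ` ?S \<in> sets borel" using S gS by auto
    show "(?g has_derivative jac c d (cinv c x)) (at x)" if "x \<in> ?S" for x
      using jac_has_derivative[OF ch(1,2)[OF that]] ch(3)[OF that] by simp
    show "inj_on ?g ?S" by (rule inj_onI) (metis ch(3) ch(5))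
    show "(\<lambda>y. indicator (?g ` ?S) y * dens d y) \<in> borel_measurable borel"
      unfolding gS using S d by auto
    show "(\<lambda>x. indicator ?S x * (\<bar>det (matrix (jac c d (cinv c x)))\<bar> * dens d (?g x))) \<in> borel_measurable borel"
      unfolding e using S c by auto
  qed (use dens_nonneg[OF d] in auto)
  also have "\<dots> = emeasure (cmeas c) A"
    unfolding e using emeasure_cmeas_image[OF c A(1)] A(2) by auto
  finally show ?thesis by simp
qed

text \<open>Second countability enters here, through the Lindelof property. Countably many charts
  make the gluing below a countable sum.\<close>

lemma countable_atlas:
  "\<exists>C :: nat \<Rightarrow> ('a, 'm) chart. (\<forall>n. C n \<in> atlas M) \<and> (\<Union>n. cdom (C n)) = UNIV"
proof -
  have U: "\<Union> (cdom ` atlas M) = UNIV" using smooth_atlas by (auto simp: smooth_atlas_def)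
  have "openin (top_of_set UNIV) S" if "S \<in> cdom ` atlas M" for S
  proof -
    obtain c where "c \<in> atlas M" "S = cdom c" using \<open>S \<in> cdom ` atlas M\<close> by blast
    then show ?thesis using open_cdom[of c] by simp
  qed
  from Lindelof_openin[OF this] obtain F where F: "F \<subseteq> cdom ` atlas M" "countable F" "\<Union> F = \<Union> (cdom ` atlas M)"
    by blast
  have ne: "F \<noteq> {}" using F U by auto
  have "\<exists>c\<in>atlas M. from_nat_into F n = cdom c" for n
    using F(1) from_nat_into[OF ne, of n] by auto
  then obtain C where C: "\<And>n. C n \<in> atlas M" "\<And>n. from_nat_into F n = cdom (C n)" by metis
  have "(\<Union>n. cdom (C n)) = \<Union> (range (from_nat_into F))" by (simp add: C)
  also have "\<dots> = UNIV" using F U by (simp add: range_from_nat_into[OF ne F(2)])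
  finally show ?thesis using C(1) by (intro exI[of _ C]) simp
qed

text \<open>Existence and uniqueness behind the definite description \<open>vol\<close>. The
  manifold is cut into countably many disjoint Borel pieces, each inside one chart. Summing the
  chart measures over the pieces gives a measure, and \<open>cmeas_compat\<close> shows that it has
  the prescribed value in every chart, not only in the countably many used.\<close>

lemma ex1_vol:
  "\<exists>!\<mu>. sets \<mu> = sets borel \<and> (\<forall>c\<in>atlas M. \<forall>A\<in>sets borel. A \<subseteq> cdom c \<longrightarrow>
        emeasure \<mu> A = (\<integral>\<^sup>+y\<in>cmap c ` A. ennreal (sqrt (det (gram M c (cinv c y)))) \<partial>lborel))"
proof -
  define C where "C = (SOME C :: nat \<Rightarrow> ('a, 'm) chart. (\<forall>n. C n \<in> atlas M) \<and> (\<Union>n. cdom (C n)) = UNIV)"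
  have C: "C n \<in> atlas M" "(\<Union>n. cdom (C n)) = UNIV" for n
    using someI_ex[OF countable_atlas] unfolding C_def by blast+
  define D where "D = disjointed (\<lambda>n. cdom (C n))"
  have r: "range (\<lambda>n. cdom (C n)) \<subseteq> sets borel"
    by (intro image_subsetI borel_open open_cdom C(1))
  have D: "D n \<in> sets borel" "D n \<subseteq> cdom (C n)" for n
    using sets.range_disjointed_sets[OF r] disjointed_subset[of "\<lambda>n. cdom (C n)" n] unfolding D_def by blast+
  have dj: "disjoint_family D" unfolding D_def by (rule disjoint_family_disjointed)
  have UD: "(\<Union>n. D n) = UNIV" using C(2) by (simp add: D_def UN_disjointed_eq)
  \<comment> \<open>Written as an integral over the counting measure, so that countable additivity
    is an interchange of integral and series.\<close>
  define m where "m A = (\<integral>\<^sup>+n. emeasure (cmeas (C n)) (A \<inter> D n) \<partial>count_space UNIV)" for A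
  define \<mu> where "\<mu> = measure_of UNIV (sets borel) m"
  have \<mu>: "sets \<mu> = sets borel" by (simp add: \<mu>_def sets.sigma_sets_eq[of borel, simplified])
  have em: "emeasure \<mu> A = m A" if "A \<in> sets borel" for A
  proof (rule emeasure_measure_of[OF \<mu>_def])
    show "positive (sets \<mu>) m" by (simp add: positive_def m_def)
    show "countably_additive (sets \<mu>) m"
    proof (rule countably_additiveI)
      fix A :: "nat \<Rightarrow> 'a set" assume A: "range A \<subseteq> sets \<mu>" "disjoint_family A"
      have "(\<Sum>i. m (A i)) = (\<integral>\<^sup>+n. (\<Sum>i. emeasure (cmeas (C n)) (A i \<inter> D n)) \<partial>count_space UNIV)"
        unfolding m_def by (rule nn_integral_suminf[symmetric]) simp
      also have "\<dots> = m (\<Union>i. A i)"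
        unfolding m_def
      proof (rule nn_integral_cong)
        fix n
        have "(\<Sum>i. emeasure (cmeas (C n)) (A i \<inter> D n)) = emeasure (cmeas (C n)) (\<Union>i. A i \<inter> D n)"
          using A \<mu> D(1) by (intro suminf_emeasure) (auto simp: disjoint_family_on_def)
        then show "(\<Sum>i. emeasure (cmeas (C n)) (A i \<inter> D n)) = emeasure (cmeas (C n)) ((\<Union>i. A i) \<inter> D n)" by simp
      qed
      finally show "(\<Sum>i. m (A i)) = m (\<Union>i. A i)" .
    qed
  qed (use that \<mu> in auto)
  have split: "emeasure \<nu> A = (\<Sum>n. emeasure \<nu> (A \<inter> D n))" if "sets \<nu> = sets borel" "A \<in> sets borel" for \<nu> and A :: "'a set"
  proof -
    have "(\<Sum>n. emeasure \<nu> (A \<inter> D n)) = emeasure \<nu> (\<Union>n. A \<inter> D n)"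
    proof (rule suminf_emeasure)
      show "disjoint_family (\<lambda>n. A \<inter> D n)" using dj unfolding disjoint_family_on_def by blast
    qed (use that D(1) in auto)
    also have "(\<Union>n. A \<inter> D n) = A" using UD by auto
    finally show ?thesis by simp
  qed
  have chart: "emeasure \<mu> A = emeasure (cmeas c) A" if "c \<in> atlas M" "A \<in> sets borel" "A \<subseteq> cdom c" for c A
  proof -
    have "emeasure \<mu> A = (\<Sum>n. emeasure (cmeas (C n)) (A \<inter> D n))"
      using em that by (simp add: m_def nn_integral_count_space_nat)
    also have "\<dots> = (\<Sum>n. emeasure (cmeas c) (A \<inter> D n))"
      using that D C(1) by (intro suminf_cong cmeas_compat) auto
    also have "\<dots> = emeasure (cmeas c) A" using split[of "cmeas c"] that by simp
    finally show ?thesis .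
  qed
  show ?thesis
  proof (rule ex1I[of _ \<mu>])
    show "sets \<mu> = sets borel \<and> (\<forall>c\<in>atlas M. \<forall>A\<in>sets borel. A \<subseteq> cdom c \<longrightarrow>
        emeasure \<mu> A = (\<integral>\<^sup>+y\<in>cmap c ` A. ennreal (sqrt (det (gram M c (cinv c y)))) \<partial>lborel))"
      using \<mu> chart emeasure_cmeas_image(2) by auto
  next
    fix \<nu> assume \<nu>: "sets \<nu> = sets borel \<and> (\<forall>c\<in>atlas M. \<forall>A\<in>sets borel. A \<subseteq> cdom c \<longrightarrow>
        emeasure \<nu> A = (\<integral>\<^sup>+y\<in>cmap c ` A. ennreal (sqrt (det (gram M c (cinv c y)))) \<partial>lborel))"
    \<comment> \<open>Each piece lies in a single chart, where the value of \<open>\<nu>\<close> is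
      prescribed; countable additivity then determines \<open>\<nu>\<close>.\<close>
    have sm: "emeasure \<nu> (A \<inter> D n) = emeasure \<mu> (A \<inter> D n)" if "A \<in> sets borel" for A n
    proof -
      have "emeasure \<nu> (A \<inter> D n) = emeasure (cmeas (C n)) (A \<inter> D n)"
      proof -
        have Dn: "A \<inter> D n \<in> sets borel" "A \<inter> D n \<subseteq> cdom (C n)" using D[of n] that by auto
        show ?thesis unfolding emeasure_cmeas_image(2)[OF C(1) Dn] using \<nu> C(1)[of n] Dn by blast
      qed
      also have "\<dots> = emeasure \<mu> (A \<inter> D n)" using C(1)[of n] D[of n] that by (intro chart[symmetric]) auto
      finally show ?thesis .
    qed
    show "\<nu> = \<mu>"
      by (rule measure_eqI) (use \<nu> \<mu> split[of \<nu>] split[of \<mu>] sm in auto)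
  qed
qed

section \<open>Integration against the volume in a chart, positivity and local finiteness\<close>

lemma sets_vol [simp]: "sets (vol M) = sets borel"
  and emeasure_vol_chart: "c \<in> atlas M \<Longrightarrow> A \<in> sets borel \<Longrightarrow> A \<subseteq> cdom c \<Longrightarrow> emeasure (vol M) A = emeasure (cmeas c) A"
  using theI'[OF ex1_vol, folded vol_def] emeasure_cmeas_image(2) by auto

lemma space_vol [simp]: "space (vol M) = UNIV"
  using sets_eq_imp_space_eq[OF sets_vol] by simp

lemma borel_measurable_vol [simp]: "borel_measurable (vol M) = borel_measurable borel"
  by (rule measurable_cong_sets) simp_all

lemma density_vol_chart:
  assumes c: "c \<in> atlas M" shows "density (vol M) (indicator (cdom c)) = cmeas c"
proof (rule measure_eqI)
  fix A assume "A \<in> sets (density (vol M) (indicator (cdom c)))"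
  then have A: "A \<in> sets borel" by simp
  have cd: "cdom c \<in> sets borel" using open_cdom[OF c] by simp
  have "emeasure (density (vol M) (indicator (cdom c))) A = (\<integral>\<^sup>+x. indicator (A \<inter> cdom c) x \<partial>vol M)"
    using A cd by (subst emeasure_density) (auto intro!: nn_integral_cong simp del: nn_integral_indicator simp: indicator_def)
  also have "\<dots> = emeasure (vol M) (A \<inter> cdom c)" by (rule nn_integral_indicator) (use A cd in auto)
  also have "\<dots> = emeasure (cmeas c) (A \<inter> cdom c)" using A cd c by (intro emeasure_vol_chart) auto
  also have "\<dots> = emeasure (cmeas c) A"
    using A cd c unfolding emeasure_cmeas[OF c A]
    by (subst emeasure_cmeas) (auto intro!: nn_integral_cong simp: dens_def indicator_def cinv_in_cdom)
  finally show "emeasure (density (vol M) (indicator (cdom c))) A = emeasure (cmeas c) A" .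
qed simp

lemma integral_vol_chart:
  fixes f :: "'a \<Rightarrow> real"
  assumes c: "c \<in> atlas M" and f [measurable]: "f \<in> borel_measurable borel" and 0: "\<And>x. x \<notin> cdom c \<Longrightarrow> f x = 0"
  shows "integral\<^sup>L (vol M) f = (\<integral>y. dens c y * f (cinv c y) \<partial>lborel)"
proof -
  note [measurable] = cinv_measurable[OF c] dens_measurable[OF c]
  have cd [measurable]: "cdom c \<in> sets borel" using open_cdom[OF c] by simp
  have "integral\<^sup>L (vol M) f = integral\<^sup>L (vol M) (\<lambda>x. indicator (cdom c) x *\<^sub>R f x)"
    using 0 by (intro Bochner_Integration.integral_cong) (auto simp: indicator_def)
  also have "\<dots> = integral\<^sup>L (density (vol M) (\<lambda>x. ennreal (indicator (cdom c) x))) f"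
    by (subst integral_density) auto
  also have "\<dots> = integral\<^sup>L (cmeas c) f" unfolding ennreal_indicator density_vol_chart[OF c] ..
  also have "\<dots> = (\<integral>y. f (cinv c y) \<partial>density lborel (\<lambda>y. ennreal (dens c y)))"
    unfolding cmeas_def by (subst integral_distr) auto
  also have "\<dots> = (\<integral>y. dens c y * f (cinv c y) \<partial>lborel)"
    by (subst integral_density) (auto simp: dens_nonneg[OF c])
  finally show ?thesis .
qed

text \<open>The density is positive on the coordinate image, and a nonempty open set is not
  negligible for Lebesgue measure.\<close>

lemma vol_open_pos:
  assumes "open U" "U \<noteq> {}" shows "emeasure (vol M) U > 0"
proof -
  obtain p where p: "p \<in> U" using assms by auto
  obtain c where c: "c \<in> atlas M" "p \<in> cdom c" using ex_chart charts_at_iff by blast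
  let ?V = "cmap c ` (cdom c \<inter> U)"
  have oV: "open ?V" using open_cmap_image[OF c(1) assms(1)] .
  have V: "?V \<subseteq> cim c" "cmap c p \<in> ?V" using c p by auto
  have o: "cdom c \<inter> U \<in> sets borel" using open_Int[OF open_cdom[OF c(1)] assms(1)] by simp
  have "emeasure (vol M) (cdom c \<inter> U) = (\<integral>\<^sup>+y. ennreal (indicator ?V y * dens c y) \<partial>lborel)"
    using emeasure_vol_chart[OF c(1) o] emeasure_cmeas_image(1)[OF c(1) o] by auto
  moreover have "\<dots> \<noteq> 0"
  proof
    assume "(\<integral>\<^sup>+y. ennreal (indicator ?V y * dens c y) \<partial>lborel) = 0"
    then have "AE y in lborel. ennreal (indicator ?V y * dens c y) = 0"
      using oV c by (subst (asm) nn_integral_0_iff_AE) auto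
    then have "AE y in lborel. y \<notin> ?V"
      by (rule AE_mp) (use V dens_pos[OF c(1)] in \<open>auto intro!: AE_I2 simp: indicator_def ennreal_eq_0_iff not_le split: if_splits\<close>)
    then have "emeasure lborel ?V = 0" using oV by (subst (asm) AE_iff_measurable[of ?V]) auto
    then have "negligible ?V" using oV
      by (simp add: negligible_iff_null_sets null_sets_def)
    then show False using open_not_negligible[OF oV] V by auto
  qed
  moreover have "emeasure (vol M) (cdom c \<inter> U) \<le> emeasure (vol M) U"
    using assms by (intro emeasure_mono) auto
  ultimately show ?thesis by (metis le_zero_eq not_gr_zero)
qed

text \<open>The density is continuous, hence bounded on a compact coordinate ball.\<close>

lemma vol_locally_finite: "\<exists>U. open U \<and> p \<in> U \<and> emeasure (vol M) U < \<infinity>"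
proof -
  obtain c where c: "c \<in> atlas M" "p \<in> cdom c" using ex_chart charts_at_iff by blast
  obtain r where r: "r > 0" "cball (cmap c p) r \<subseteq> cim c"
    using open_cim[OF c(1)] c(2) by (meson imageI open_contains_cball)
  have "compact (dens c ` cball (cmap c p) r)"
    by (intro compact_continuous_image continuous_on_subset[OF continuous_on_dens[OF c(1)] r(2)]) simp
  then obtain B where B: "\<And>y. y \<in> cball (cmap c p) r \<Longrightarrow> dens c y \<le> B"
    by (meson bdd_above.E bounded_imp_bdd_above compact_imp_bounded imageI)
  let ?U = "cinv c ` ball (cmap c p) r"
  have br: "ball (cmap c p) r \<subseteq> cim c" using r by auto
  have oU: "open ?U" by (intro open_cinv_image c br) auto
  have Uc: "?U \<subseteq> cdom c" using br cinv_in_cdom[OF c(1)] by auto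
  have im: "cmap c ` ?U = ball (cmap c p) r" using br c(1) by (force simp: image_image)
  have "emeasure (vol M) ?U = (\<integral>\<^sup>+y. ennreal (indicator (ball (cmap c p) r) y * dens c y) \<partial>lborel)"
    using emeasure_vol_chart[OF c(1) _ Uc] emeasure_cmeas_image(1)[OF c(1) _ Uc] oU im by simp
  also have "\<dots> \<le> (\<integral>\<^sup>+y. ennreal B * indicator (ball (cmap c p) r) y \<partial>lborel)"
    by (rule nn_integral_mono) (use B in \<open>auto simp: indicator_def intro!: ennreal_leI\<close>)
  also have "\<dots> = ennreal B * emeasure lborel (ball (cmap c p) r)"
    by (subst nn_integral_cmult) (auto intro!: borel_measurable_indicator)
  also have "\<dots> < \<infinity>"
    using emeasure_bounded_finite[of "ball (cmap c p) r"] by (simp add: ennreal_mult_less_top)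
  finally show ?thesis using oU c r by (intro exI[of _ ?U]) (auto intro!: image_eqI[of _ _ "cmap c p"])
qed

lemma vol_compact_finite:
  assumes "compact K" shows "emeasure (vol M) K < \<infinity>"
proof -
  obtain U where U: "\<And>p. open (U p)" "\<And>p. p \<in> U p" "\<And>p. emeasure (vol M) (U p) < \<infinity>"
    using vol_locally_finite by metis
  obtain F where F: "finite F" "F \<subseteq> K" "K \<subseteq> (\<Union>p\<in>F. U p)"
    using compactE_image[OF assms, of K U] U by (metis UN_I subsetI)
  have "emeasure (vol M) K \<le> emeasure (vol M) (\<Union>p\<in>F. U p)"
    using F U(1) by (intro emeasure_mono) (auto intro!: borel_open)
  also have "\<dots> \<le> (\<Sum>p\<in>F. emeasure (vol M) (U p))"
    using F U(1) by (intro emeasure_subadditive_finite) auto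
  also have "\<dots> < \<infinity>" using U(3) F(1) by simp
  finally show ?thesis .
qed

text \<open>The weight \<open>\<phi>\<close> is controlled on positive arguments only, and the
  distance from the base point vanishes at the base point. As a null set, this point can be left out
  in the weighted estimate.\<close>

lemma vol_singleton: "emeasure (vol M) {p} = 0"
proof -
  obtain c where c: "c \<in> atlas M" "p \<in> cdom c" using ex_chart charts_at_iff by blast
  have "emeasure (vol M) {p} = (\<integral>\<^sup>+y. ennreal (indicator {cmap c p} y * dens c y) \<partial>lborel)"
    using emeasure_vol_chart[OF c(1)] emeasure_cmeas_image(1)[OF c(1), of "{p}"] c by simp
  also have "\<dots> = (\<integral>\<^sup>+y. 0 \<partial>(lborel :: (real ^ 'm) measure))"
  proof (rule nn_integral_cong_AE)
    have "AE y in lborel. y \<noteq> cmap c p" using AE_lborel_singleton[of "cmap c p"] .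
    then show "AE y in lborel. ennreal (indicator {cmap c p} y * dens c y) = 0"
      by eventually_elim simp
  qed
  finally show ?thesis by simp
qed

end

subsection \<open>Curves and their length\<close>

text \<open>A property of intervals that holds between break points and survives concatenation holds
  on every interval: cut at one break point after the other.\<close>

lemma breakpoint_induct:
  fixes l u :: real
  assumes "finite T"
    and base: "\<And>a b. l \<le> a \<Longrightarrow> a < b \<Longrightarrow> b \<le> u \<Longrightarrow> {a<..<b} \<inter> T = {} \<Longrightarrow> Q a b"
    and comb: "\<And>a b c. l \<le> a \<Longrightarrow> a < b \<Longrightarrow> b < c \<Longrightarrow> c \<le> u \<Longrightarrow> Q a b \<Longrightarrow> Q b c \<Longrightarrow> Q a c"
    and "l \<le> a" "a < b" "b \<le> u"
  shows "Q a b"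
proof -
  \<comment> \<open>The base case is required only for subintervals of the interval at hand. This
    lets the induction hypothesis for T apply to the two halves after a cut at x.\<close>
  have "\<forall>a b. l \<le> a \<and> a < b \<and> b \<le> u \<and>
     (\<forall>a' b'. a \<le> a' \<and> a' < b' \<and> b' \<le> b \<and> {a'<..<b'} \<inter> T = {} \<longrightarrow> Q a' b') \<longrightarrow> Q a b"
    using \<open>finite T\<close>
  proof (induction T rule: finite_induct)
    case (insert x T)
    show ?case
    proof (intro allI impI, elim conjE)
      fix a b assume ab: "l \<le> a" "a < b" "b \<le> u"
        and Q: "\<forall>a' b'. a \<le> a' \<and> a' < b' \<and> b' \<le> b \<and> {a'<..<b'} \<inter> insert x T = {} \<longrightarrow> Q a' b'"
      show "Q a b"
      proof (cases "x \<in> {a<..<b}")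
        case True
        have "Q a x"
        proof (rule insert.IH[rule_format], intro conjI allI impI)
          fix a' b' assume "a \<le> a' \<and> a' < b' \<and> b' \<le> x \<and> {a'<..<b'} \<inter> T = {}"
          then show "Q a' b'" using True by (intro Q[rule_format]) auto
        qed (use ab True in auto)
        moreover have "Q x b"
        proof (rule insert.IH[rule_format], intro conjI allI impI)
          fix a' b' assume "x \<le> a' \<and> a' < b' \<and> b' \<le> b \<and> {a'<..<b'} \<inter> T = {}"
          then show "Q a' b'" using True by (intro Q[rule_format]) auto
        qed (use ab True in auto)
        ultimately show ?thesis using True ab by (intro comb[of a x b]) auto
      next
        case False
        show ?thesis
        proof (rule insert.IH[rule_format], intro conjI allI impI)
          fix a' b' assume "a \<le> a' \<and> a' < b' \<and> b' \<le> b \<and> {a'<..<b'} \<inter> T = {}"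
          then show "Q a' b'" using False by (intro Q[rule_format]) auto
        qed (use ab in auto)
      qed
    qed
  qed auto
  then show ?thesis using assms by (meson order_trans)
qed

context riem_mfd
begin

definition speed :: "(real \<Rightarrow> 'a) \<Rightarrow> real \<Rightarrow> real" where
  "speed \<gamma> t = sqrt (metric M (\<gamma> t) (velocity M \<gamma> t) (velocity M \<gamma> t))"

lemma curve_length_speed: "curve_length M \<gamma> = integral {0..1} (speed \<gamma>)"
  by (simp add: curve_length_def speed_def[abs_def])

lemma curve_chart_change:
  assumes "t \<in> I" "continuous (at t within I) \<gamma>" "c \<in> charts_at M (\<gamma> t)" "d \<in> charts_at M (\<gamma> t)"
    "(cmap c \<circ> \<gamma> has_vector_derivative v) (at t within I)"
  shows "(cmap d \<circ> \<gamma> has_vector_derivative jac c d (\<gamma> t) v) (at t within I)"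
proof -
  have J: "(cmap d \<circ> cinv c has_derivative jac c d (\<gamma> t)) (at ((cmap c \<circ> \<gamma>) t))"
    using jac_has_derivative[OF assms(3,4)] by simp
  have "((\<lambda>s. (cmap d \<circ> cinv c) ((cmap c \<circ> \<gamma>) s)) has_derivative (\<lambda>h. jac c d (\<gamma> t) (h *\<^sub>R v))) (at t within I)"
    using has_derivative_compose[OF assms(5)[unfolded has_vector_derivative_def] J] .
  then have "(cmap d \<circ> \<gamma> has_derivative (\<lambda>h. jac c d (\<gamma> t) (h *\<^sub>R v))) (at t within I)"
  proof (rule has_derivative_transform_eventually)
    have "\<forall>\<^sub>F s in at t within I. \<gamma> s \<in> cdom c"
      using assms(2,3) open_cdom unfolding continuous_within charts_at_iff by (blast dest: topological_tendstoD)
    then show "\<forall>\<^sub>F s in at t within I. (cmap d \<circ> cinv c) ((cmap c \<circ> \<gamma>) s) = (cmap d \<circ> \<gamma>) s"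
      by eventually_elim (use assms(3) in \<open>simp add: charts_at_iff\<close>)
  qed (use assms in \<open>auto simp: charts_at_iff\<close>)
  then show ?thesis
    using linear_scale[OF bounded_linear.linear[OF jac_linear[OF assms(3,4)]]]
    by (simp add: has_vector_derivative_def)
qed

text \<open>\<open>velocity\<close> is a two-sided derivative and carries no information at the ends
  of a piece. The function s is built from derivatives within the closed interval instead: it agrees
  with the speed inside and is continuous up to the ends, which yields integrability.\<close>

lemma C1_curve_speed:
  assumes C1: "C1_curve_on M {a..b} \<gamma>" and cont: "continuous_on {a..b} \<gamma>" and "a < b"
  obtains s where "continuous_on {a..b} s" "\<And>t. t \<in> {a<..<b} \<Longrightarrow> speed \<gamma> t = s t"
    "\<And>t c. t \<in> {a<..<b} \<Longrightarrow> c \<in> charts_at M (\<gamma> t) \<Longrightarrow> (cmap c \<circ> \<gamma> has_vector_derivative velocity M \<gamma> t c) (at t)"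
    "\<And>t. t \<in> {a<..<b} \<Longrightarrow> velocity M \<gamma> t \<in> tangent_space M (\<gamma> t)"
proof -
  define wv :: "('a, 'm) chart \<Rightarrow> real \<Rightarrow> real ^ 'm" where "wv c t = vector_derivative (cmap c \<circ> \<gamma>) (at t within {a..b})" for c t
  obtain D where D0: "\<forall>c\<in>atlas M. continuous_on {t \<in> {a..b}. \<gamma> t \<in> cdom c} (D c) \<and>
     (\<forall>t\<in>{a..b}. \<gamma> t \<in> cdom c \<longrightarrow> (cmap c \<circ> \<gamma> has_vector_derivative D c t) (at t within {a..b}))"
    using bchoice[OF C1[unfolded C1_curve_on_def]] by blast
  have D: "c \<in> atlas M \<Longrightarrow> continuous_on {t \<in> {a..b}. \<gamma> t \<in> cdom c} (D c)"
    "c \<in> atlas M \<Longrightarrow> t \<in> {a..b} \<Longrightarrow> \<gamma> t \<in> cdom c \<Longrightarrow> (cmap c \<circ> \<gamma> has_vector_derivative D c t) (at t within {a..b})" for c t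
    using D0 by blast+
  have wvD: "wv c t = D c t" if "c \<in> atlas M" "t \<in> {a..b}" "\<gamma> t \<in> cdom c" for c t
    unfolding wv_def using vector_derivative_within_cbox[of a b t "cmap c \<circ> \<gamma>" "D c t"] D(2)[OF that] that assms(3)
    by (simp add: cbox_interval)
  have cw: "continuous (at t within {a..b}) \<gamma>" if "t \<in> {a..b}" for t
    using cont that by (simp add: continuous_on_eq_continuous_within)
  have wvJ: "wv d t = jac c d (\<gamma> t) (wv c t)" if "t \<in> {a..b}" "c \<in> charts_at M (\<gamma> t)" "d \<in> charts_at M (\<gamma> t)" for c d t
  proof -
    have "(cmap d \<circ> \<gamma> has_vector_derivative jac c d (\<gamma> t) (D c t)) (at t within {a..b})"
      using that D(2) by (intro curve_chart_change cw) (auto simp: charts_at_iff)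
    then have "wv d t = jac c d (\<gamma> t) (D c t)"
      unfolding wv_def using vector_derivative_within_cbox[of a b t] that assms(3) by (simp add: cbox_interval)
    then show ?thesis using wvD[of c t] that by (auto simp: charts_at_iff)
  qed
  define s where "s t = (let c = some_chart M (\<gamma> t) in sqrt (ginner M c (\<gamma> t) (wv c t) (wv c t)))" for t
  have s: "s t = sqrt (ginner M c (\<gamma> t) (wv c t) (wv c t))" if "t \<in> {a..b}" "c \<in> charts_at M (\<gamma> t)" for t c
    using ginner_jac[OF some_chart that(2)] wvJ[OF that(1) some_chart that(2)] by (simp add: s_def Let_def)
  have "continuous_on {a..b} s"
  proof (rule continuous_on_eq_continuous_within[THEN iffD2], intro ballI)
    fix t assume t: "t \<in> {a..b}"
    obtain c where c: "c \<in> charts_at M (\<gamma> t)" using ex_chart by blast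
    have ca: "c \<in> atlas M" using c by (simp add: charts_at_iff)
    let ?I = "{t \<in> {a..b}. \<gamma> t \<in> cdom c}"
    have "continuous_on ?I (\<lambda>t. sqrt (D c t \<bullet> (gram M c (cinv c (cmap c (\<gamma> t))) *v D c t)))"
    proof (intro continuous_intros bounded_bilinear.continuous_on[OF bounded_bilinear_matrix_vector_mult] D(1)[OF ca])
      show "continuous_on ?I (\<lambda>x. gram M c (cinv c (cmap c (\<gamma> x))))"
      proof (rule continuous_on_compose2[OF gram_cont[OF ca]])
        show "continuous_on ?I (\<lambda>x. cmap c (\<gamma> x))"
          by (rule continuous_on_compose2[OF continuous_on_cmap[OF ca] continuous_on_subset[OF cont]]) auto
      qed auto
    qed
    then have cI: "continuous_on ?I s"
    proof (rule continuous_on_eq)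
      fix x assume "x \<in> ?I"
      then show "sqrt (D c x \<bullet> (gram M c (cinv c (cmap c (\<gamma> x))) *v D c x)) = s x"
        using ca s[of x c] wvD[of c x] by (simp add: charts_at_iff)
    qed
    then have "continuous (at t within ?I) s"
      using t c by (auto simp: continuous_on_eq_continuous_within charts_at_iff)
    moreover obtain U where U: "open U" "U \<inter> {a..b} = \<gamma> -` cdom c \<inter> {a..b}"
      using continuous_on_open_invariant[THEN iffD1, OF cont, rule_format, OF open_cdom[OF ca]] by blast
    \<comment> \<open>Continuity of s at t is known only among the times spent in one chart; near t
      these are all times of the interval.\<close>
    have "at t within ?I = at t within {a..b}"
    proof (rule at_within_nhd[OF _ U(1)])
      have UU: "x \<in> U \<longleftrightarrow> \<gamma> x \<in> cdom c" if "x \<in> {a..b}" for x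
      proof -
        have "x \<in> U \<inter> {a..b} \<longleftrightarrow> x \<in> \<gamma> -` cdom c \<inter> {a..b}" by (simp only: U(2))
        then show ?thesis using that by simp
      qed
      show "t \<in> U" using UU[OF t] c by (simp add: charts_at_iff)
      show "?I \<inter> U - {t} = {a..b} \<inter> U - {t}"
      proof (rule set_eqI)
        fix x show "x \<in> ?I \<inter> U - {t} \<longleftrightarrow> x \<in> {a..b} \<inter> U - {t}" using UU[of x] by simp blast
      qed
    qed
    ultimately show "continuous (at t within {a..b}) s" by simp
  qed
  moreover have vel: "(cmap c \<circ> \<gamma> has_vector_derivative velocity M \<gamma> t c) (at t)" "velocity M \<gamma> t c = wv c t"
    if t: "t \<in> {a<..<b}" and c: "c \<in> charts_at M (\<gamma> t)" for t c
  proof -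
    have at: "at t within {a..b} = at t" using t by (intro at_within_interior) (simp add: interior_cbox[of a b, simplified])
    have *: "(cmap c \<circ> \<gamma> has_vector_derivative D c t) (at t)"
      using D(2)[of c t] t c unfolding at by (auto simp: charts_at_iff)
    then have "velocity M \<gamma> t c = D c t" using c by (simp add: velocity_def vector_derivative_at)
    then show "(cmap c \<circ> \<gamma> has_vector_derivative velocity M \<gamma> t c) (at t)" "velocity M \<gamma> t c = wv c t"
      using * wvD[of c t] t c by (auto simp: charts_at_iff)
  qed
  moreover have tan: "velocity M \<gamma> t \<in> tangent_space M (\<gamma> t)" if t: "t \<in> {a<..<b}" for t
  proof -
    obtain c where c: "c \<in> charts_at M (\<gamma> t)" using ex_chart by blast
    show ?thesis
    proof (rule tangentI[OF c])
      fix d assume d: "d \<in> charts_at M (\<gamma> t)"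
      show "velocity M \<gamma> t d = jac c d (\<gamma> t) (velocity M \<gamma> t c)"
        unfolding vel(2)[OF t c] vel(2)[OF t d] by (rule wvJ[OF _ c d]) (use t in auto)
    qed (simp add: velocity_def)
  qed
  moreover have "speed \<gamma> t = s t" if t: "t \<in> {a<..<b}" for t
  proof -
    obtain c where c: "c \<in> charts_at M (\<gamma> t)" using ex_chart by blast
    show ?thesis unfolding speed_def metric_gram[OF c tan[OF t] tan[OF t]]
      using s[OF _ c] t vel(2)[OF t c] by simp
  qed
  ultimately show ?thesis using that by blast
qed

definition breaks :: "(real \<Rightarrow> 'a) \<Rightarrow> real set \<Rightarrow> bool" where
  "breaks \<gamma> T \<longleftrightarrow> finite T \<and> continuous_on {0..1} \<gamma> \<and>
     (\<forall>a b. 0 \<le> a \<and> a < b \<and> b \<le> 1 \<and> {a<..<b} \<inter> T = {} \<longrightarrow> C1_curve_on M {a..b} \<gamma>)"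

lemma piecewise_breaks: "piecewise_C1_curve M \<gamma> \<longleftrightarrow> (\<exists>T. breaks \<gamma> T)"
  by (auto simp: piecewise_C1_curve_def breaks_def)

lemma breaks_velocity:
  assumes "breaks \<gamma> T" "t \<in> {0<..<1} - T"
  shows "c \<in> charts_at M (\<gamma> t) \<Longrightarrow> (cmap c \<circ> \<gamma> has_vector_derivative velocity M \<gamma> t c) (at t)"
    and "velocity M \<gamma> t \<in> tangent_space M (\<gamma> t)"
proof -
  have "open ({0<..<1} - T)" using assms(1) by (intro open_Diff finite_imp_closed) (auto simp: breaks_def)
  then obtain e where e: "e > 0" "cball t e \<subseteq> {0<..<1} - T" using assms(2) open_contains_cball by blast
  have sub: "{t-e..t+e} \<subseteq> {0<..<1} - T" using e(2) by (simp add: cball_eq_atLeastAtMost)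
  have "t - e \<in> {t-e..t+e}" "t + e \<in> {t-e..t+e}" using e by auto
  then have b: "0 \<le> t - e" "t + e \<le> 1" using sub by fastforce+
  have "{t-e<..<t+e} \<subseteq> {t-e..t+e}" by auto
  then have "{t-e<..<t+e} \<inter> T = {}" using sub by blast
  then have "0 \<le> t-e \<and> t-e < t+e \<and> t+e \<le> 1 \<and> {t-e<..<t+e} \<inter> T = {}" using b e by simp
  then have "C1_curve_on M {t-e..t+e} \<gamma>" using assms(1) unfolding breaks_def by blast
  moreover have "continuous_on {t-e..t+e} \<gamma>"
    using assms(1) b unfolding breaks_def by (auto intro: continuous_on_subset)
  ultimately obtain s where "\<And>u c. u \<in> {t-e<..<t+e} \<Longrightarrow> c \<in> charts_at M (\<gamma> u) \<Longrightarrow> (cmap c \<circ> \<gamma> has_vector_derivative velocity M \<gamma> u c) (at u)"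
    "\<And>u. u \<in> {t-e<..<t+e} \<Longrightarrow> velocity M \<gamma> u \<in> tangent_space M (\<gamma> u)"
    by (rule C1_curve_speed) (use e in auto)
  then show "c \<in> charts_at M (\<gamma> t) \<Longrightarrow> (cmap c \<circ> \<gamma> has_vector_derivative velocity M \<gamma> t c) (at t)"
    "velocity M \<gamma> t \<in> tangent_space M (\<gamma> t)" using e(1) by auto
qed

lemma breaks_integrable:
  assumes "breaks \<gamma> T" shows "speed \<gamma> integrable_on {0..1}"
proof (rule breakpoint_induct[where T=T and l=0 and u=1 and Q="\<lambda>a b. speed \<gamma> integrable_on {a..b}"])
  fix a b :: real assume ab: "0 \<le> a" "a < b" "b \<le> 1" "{a<..<b} \<inter> T = {}"
  have "C1_curve_on M {a..b} \<gamma>" "continuous_on {a..b} \<gamma>"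
    using assms ab unfolding breaks_def by (auto intro: continuous_on_subset)
  then obtain s where s: "continuous_on {a..b} s" "\<And>t. t \<in> {a<..<b} \<Longrightarrow> speed \<gamma> t = s t"
    by (rule C1_curve_speed) (use ab in auto)
  show "speed \<gamma> integrable_on {a..b}"
    by (rule integrable_spike_finite[of "{a,b}" _ _ s])
       (use s in \<open>auto intro: integrable_continuous_interval\<close>)
next
  fix a b c :: real assume "a < b" "b < c" "speed \<gamma> integrable_on {a..b}" "speed \<gamma> integrable_on {b..c}"
  then show "speed \<gamma> integrable_on {a..c}" by (intro Henstock_Kurzweil_Integration.integrable_combine[where a=a and b=c and c=b]) auto
qed (use assms in \<open>auto simp: breaks_def\<close>)

lemma speed_nonneg:
  assumes "breaks \<gamma> T" "t \<in> {0<..<1} - T" shows "speed \<gamma> t \<ge> 0"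
  using metric_nonneg[OF breaks_velocity(2)[OF assms]] by (simp add: speed_def)

lemma curve_length_nonneg:
  assumes "piecewise_C1_curve M \<gamma>" shows "curve_length M \<gamma> \<ge> 0"
proof -
  obtain T where T: "breaks \<gamma> T" using assms piecewise_breaks by blast
  \<comment> \<open>At break points and end points the velocity need not be tangent, so the sign of
    the speed is unknown there; it is replaced by 0 on this finite set.\<close>
  define s where "s t = (if t \<in> {0<..<1} - T then speed \<gamma> t else 0)" for t
  have "integral {0..1} (speed \<gamma>) = integral {0..1} s"
    by (rule integral_spike[of "insert 0 (insert 1 T)"]) (use T in \<open>auto simp: s_def breaks_def\<close>)
  moreover have "s integrable_on {0..1}"
    by (rule integrable_spike_finite[of "insert 0 (insert 1 T)" _ _ "speed \<gamma>"])
       (use T breaks_integrable[OF T] in \<open>auto simp: s_def breaks_def\<close>)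
  then have "integral {0..1} s \<ge> 0"
    by (rule Henstock_Kurzweil_Integration.integral_nonneg) (use speed_nonneg[OF T] in \<open>auto simp: s_def\<close>)
  ultimately show ?thesis by (simp add: curve_length_speed)
qed

section \<open>Affine reparametrization, reversal and concatenation of curves\<close>

lemma C1_curve_affine:
  assumes "C1_curve_on M J \<gamma>" "\<And>t. t \<in> I \<Longrightarrow> k * t + l \<in> J" "\<And>t. t \<in> I \<Longrightarrow> \<delta> t = \<gamma> (k * t + l)"
  shows "C1_curve_on M I \<delta>"
  unfolding C1_curve_on_def
proof
  fix c assume "c \<in> atlas M"
  then obtain D where D: "continuous_on {t \<in> J. \<gamma> t \<in> cdom c} D"
    "\<And>t. t \<in> J \<Longrightarrow> \<gamma> t \<in> cdom c \<Longrightarrow> (cmap c \<circ> \<gamma> has_vector_derivative D t) (at t within J)"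
    using assms(1) unfolding C1_curve_on_def by blast
  show "\<exists>D. continuous_on {t \<in> I. \<delta> t \<in> cdom c} D \<and>
     (\<forall>t\<in>I. \<delta> t \<in> cdom c \<longrightarrow> (cmap c \<circ> \<delta> has_vector_derivative D t) (at t within I))"
  proof (intro exI[of _ "\<lambda>t. k *\<^sub>R D (k * t + l)"] conjI ballI impI)
    show "continuous_on {t \<in> I. \<delta> t \<in> cdom c} (\<lambda>t. k *\<^sub>R D (k * t + l))"
      by (intro continuous_intros continuous_on_compose2[OF D(1)]) (use assms(2,3) in auto)
    fix t assume t: "t \<in> I" "\<delta> t \<in> cdom c"
    have "((\<lambda>t. k * t + l) has_vector_derivative k) (at t within I)"
      by (auto intro!: derivative_eq_intros simp: has_real_derivative_iff_has_vector_derivative[symmetric])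
    moreover have "(cmap c \<circ> \<gamma> has_vector_derivative D (k * t + l)) (at (k * t + l) within (\<lambda>t. k * t + l) ` I)"
      by (rule has_vector_derivative_within_subset[OF D(2)]) (use t assms(2,3) in auto)
    ultimately have "((cmap c \<circ> \<gamma>) \<circ> (\<lambda>t. k * t + l) has_vector_derivative k *\<^sub>R D (k * t + l)) (at t within I)"
      by (rule vector_diff_chain_within)
    then show "(cmap c \<circ> \<delta> has_vector_derivative k *\<^sub>R D (k * t + l)) (at t within I)"
      by (rule has_vector_derivative_transform[rotated 2]) (use t assms(3) in auto)
  qed
qed

lemma metric_scale:
  assumes "v \<in> tangent_space M p" shows "metric M p (\<lambda>c. k *\<^sub>R v c) (\<lambda>c. k *\<^sub>R v c) = k\<^sup>2 * metric M p v v"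
proof -
  obtain c where c: "c \<in> charts_at M p" using ex_chart by blast
  have "(\<lambda>c. k *\<^sub>R v c) \<in> tangent_space M p" using tangent_scale_add[OF assms assms, of k 0] by simp
  then show ?thesis using c assms
    by (simp add: metric_gram matrix_vector_mult_scaleR power2_eq_square)
qed

lemma speed_affine:
  assumes \<gamma>: "breaks \<gamma> T" "k * t + l \<in> {0<..<1} - T" and U: "open U" "t \<in> U" "\<And>t. t \<in> U \<Longrightarrow> \<delta> t = \<gamma> (k * t + l)"
  shows "speed \<delta> t = \<bar>k\<bar> * speed \<gamma> (k * t + l)"
proof -
  have "velocity M \<delta> t = (\<lambda>c. k *\<^sub>R velocity M \<gamma> (k * t + l) c)"
  proof
    fix c
    show "velocity M \<delta> t c = k *\<^sub>R velocity M \<gamma> (k * t + l) c"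
    proof (cases "c \<in> charts_at M (\<delta> t)")
      case True
      then have "(cmap c \<circ> \<gamma> has_vector_derivative velocity M \<gamma> (k * t + l) c) (at (k * t + l))"
        using breaks_velocity(1)[OF \<gamma>] U by simp
      moreover have "((\<lambda>t. k * t + l) has_vector_derivative k) (at t)"
        by (auto intro!: derivative_eq_intros simp: has_real_derivative_iff_has_vector_derivative[symmetric])
      ultimately have "((cmap c \<circ> \<gamma>) \<circ> (\<lambda>t. k * t + l) has_vector_derivative k *\<^sub>R velocity M \<gamma> (k * t + l) c) (at t)"
        by (intro vector_diff_chain_at)
      then have "(cmap c \<circ> \<delta> has_vector_derivative k *\<^sub>R velocity M \<gamma> (k * t + l) c) (at t)"
        by (rule has_vector_derivative_transform_within_open[OF _ U(1,2)]) (use U(3) in auto)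
      then show ?thesis using True by (simp add: velocity_def vector_derivative_at)
    next
      case False
      then show ?thesis using U by (simp add: velocity_def)
    qed
  qed
  then show ?thesis
    using U(2,3) metric_scale[OF breaks_velocity(2)[OF \<gamma>]] by (simp add: speed_def real_sqrt_mult)
qed

lemma speed_affine_integral:
  assumes \<gamma>: "breaks \<gamma> T" and k: "k \<noteq> 0" and im: "(\<lambda>t. k * t + l) ` {a..b} = {0..1}" and "a < b"
    and U: "\<And>t. t \<in> {a<..<b} \<Longrightarrow> \<delta> t = \<gamma> (k * t + l)"
  shows "(speed \<delta> has_integral curve_length M \<gamma>) {a..b}"
proof -
  \<comment> \<open>Excluded times: the ends of the new interval, and those that the substitution
    sends to a break point or an end of the old curve.\<close>
  let ?T = "{a, b} \<union> (\<lambda>t. (t - l) / k) ` (insert 0 (insert 1 T))"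
  have inv: "(\<lambda>x. (1 / k) *\<^sub>R x + - ((1 / k) *\<^sub>R l)) ` cbox 0 1 = {a..b}"
  proof -
    have "(\<lambda>x. (1 / k) *\<^sub>R x + - ((1 / k) *\<^sub>R l)) ` ((\<lambda>t. k * t + l) ` {a..b}) = {a..b}"
      using k by (simp add: image_image add_divide_distrib)
    then show ?thesis unfolding im by (simp add: cbox_interval)
  qed
  have "(speed \<gamma> has_integral curve_length M \<gamma>) (cbox 0 1)"
    unfolding curve_length_speed using breaks_integrable[OF \<gamma>] by (simp add: cbox_interval integrable_integral)
  from has_integral_affinity[OF this k, of l]
  have "((\<lambda>x. speed \<gamma> (k * x + l)) has_integral (1 / \<bar>k\<bar>) * curve_length M \<gamma>) {a..b}"
    unfolding inv by simp
  then have "((\<lambda>x. \<bar>k\<bar> * speed \<gamma> (k * x + l)) has_integral \<bar>k\<bar> * ((1 / \<bar>k\<bar>) * curve_length M \<gamma>)) {a..b}"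
    by (rule has_integral_mult_right)
  then have "((\<lambda>x. \<bar>k\<bar> * speed \<gamma> (k * x + l)) has_integral curve_length M \<gamma>) {a..b}" using k by simp
  then show ?thesis
  proof (rule has_integral_spike_finite[rotated 2])
    show "finite ?T" using \<gamma> by (simp add: breaks_def)
    fix t assume t: "t \<in> {a..b} - ?T"
    have n: "k * t + l \<notin> insert 0 (insert 1 T)"
    proof
      assume "k * t + l \<in> insert 0 (insert 1 T)"
      then have "(\<lambda>t. (t - l) / k) (k * t + l) \<in> (\<lambda>t. (t - l) / k) ` (insert 0 (insert 1 T))" by (rule imageI)
      then show False using t k by simp
    qed
    have "k * t + l \<in> {0..1}" using im t by blast
    with n have "k * t + l \<in> {0<..<1} - T" by auto
    then show "speed \<delta> t = \<bar>k\<bar> * speed \<gamma> (k * t + l)"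
      using t U by (intro speed_affine[OF \<gamma>, where U="{a<..<b}"]) auto
  qed
qed

lemma curve_reverse:
  assumes "piecewise_C1_curve M \<gamma>"
  shows "piecewise_C1_curve M (\<lambda>t. \<gamma> (1 - t))" "curve_length M (\<lambda>t. \<gamma> (1 - t)) = curve_length M \<gamma>"
proof -
  obtain T where T: "breaks \<gamma> T" using assms piecewise_breaks by blast
  have "breaks (\<lambda>t. \<gamma> (1 - t)) ((\<lambda>t. 1 - t) ` T)"
    unfolding breaks_def
  proof (intro conjI allI impI)
    show "finite ((\<lambda>t. 1 - t) ` T)" using T by (simp add: breaks_def)
    show "continuous_on {0..1} (\<lambda>t. \<gamma> (1 - t))"
      by (rule continuous_on_compose2[of "{0..1}" \<gamma>]) (use T in \<open>auto simp: breaks_def intro!: continuous_intros\<close>)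
    fix a b :: real assume ab: "0 \<le> a \<and> a < b \<and> b \<le> 1 \<and> {a<..<b} \<inter> (\<lambda>t. 1 - t) ` T = {}"
    have "{1-b<..<1-a} \<inter> T = {}"
    proof (rule ccontr)
      assume "\<not> ?thesis"
      then obtain t where "t \<in> T" "1 - b < t" "t < 1 - a" by auto
      then have "1 - t \<in> {a<..<b} \<inter> (\<lambda>t. 1 - t) ` T" by auto
      then show False using ab by blast
    qed
    then have "C1_curve_on M {1-b..1-a} \<gamma>" using T ab unfolding breaks_def by auto
    then show "C1_curve_on M {a..b} (\<lambda>t. \<gamma> (1 - t))" by (rule C1_curve_affine[where k="-1" and l=1]) auto
  qed
  then show "piecewise_C1_curve M (\<lambda>t. \<gamma> (1 - t))" using piecewise_breaks by blast
  have "(\<lambda>t::real. -1 * t + 1) ` {0..1} = {0..1}"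
    by (simp add: image_affinity_atLeastAtMost del: mult_minus1)
  from speed_affine_integral[OF T _ this, of "\<lambda>t. \<gamma> (1 - t)"]
  show "curve_length M (\<lambda>t. \<gamma> (1 - t)) = curve_length M \<gamma>"
    by (simp add: curve_length_speed integral_unique)
qed

lemma curve_join:
  assumes "piecewise_C1_curve M \<gamma>" "piecewise_C1_curve M \<delta>" "\<gamma> 1 = \<delta> 0"
  shows "piecewise_C1_curve M (\<gamma> +++ \<delta>)" "curve_length M (\<gamma> +++ \<delta>) = curve_length M \<gamma> + curve_length M \<delta>"
proof -
  obtain S T where S: "breaks \<gamma> S" and T: "breaks \<delta> T" using assms piecewise_breaks by blast
  let ?S = "(\<lambda>t. t / 2) ` S" and ?T = "(\<lambda>t. (t + 1) / 2) ` T"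
  have "breaks (\<gamma> +++ \<delta>) (insert (1/2) (?S \<union> ?T))"
    unfolding breaks_def
  proof (intro conjI allI impI)
    show "finite (insert (1/2) (?S \<union> ?T))" using S T by (simp add: breaks_def)
    show "continuous_on {0..1} (\<gamma> +++ \<delta>)"
      using path_join_imp[of \<gamma> \<delta>] S T assms(3) by (simp add: breaks_def path_def pathfinish_def pathstart_def)
    fix a b :: real assume ab: "0 \<le> a \<and> a < b \<and> b \<le> 1 \<and> {a<..<b} \<inter> insert (1/2) (?S \<union> ?T) = {}"
    then have disj: "{a<..<b} \<inter> ?S = {}" "{a<..<b} \<inter> ?T = {}" "1/2 \<notin> {a<..<b}" by auto
    show "C1_curve_on M {a..b} (\<gamma> +++ \<delta>)"
    proof (cases "b \<le> 1/2")
      case True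
      have "{2*a<..<2*b} \<inter> S = {}"
      proof (rule ccontr)
        assume "\<not> ?thesis"
        then obtain t where "t \<in> S" "2 * a < t" "t < 2 * b" by auto
        then have "t / 2 \<in> {a<..<b} \<inter> ?S" by auto
        then show False using disj by blast
      qed
      then have "C1_curve_on M {2*a..2*b} \<gamma>" using S ab True unfolding breaks_def by auto
      then show ?thesis by (rule C1_curve_affine[where k=2 and l=0]) (use True in \<open>auto simp: joinpaths_def\<close>)
    next
      case False
      then have a: "a \<ge> 1/2" using disj(3) ab by auto
      have "{2*a-1<..<2*b-1} \<inter> T = {}"
      proof (rule ccontr)
        assume "\<not> ?thesis"
        then obtain t where "t \<in> T" "2 * a - 1 < t" "t < 2 * b - 1" by auto
        then have "(t + 1) / 2 \<in> {a<..<b} \<inter> ?T" by auto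
        then show False using disj by blast
      qed
      then have "C1_curve_on M {2*a-1..2*b-1} \<delta>" using T ab a unfolding breaks_def by auto
      then show ?thesis
      proof (rule C1_curve_affine[where k=2 and l="-1"])
        fix t assume "t \<in> {a..b}"
        \<comment> \<open>\<open>joinpaths\<close> takes its value at the midpoint from the first
          curve, so t = 1/2 is where the matching condition is used.\<close>
        then show "(\<gamma> +++ \<delta>) t = \<delta> (2 * t + -1)"
          using a assms(3) by (cases "t = 1/2") (simp_all add: joinpaths_def del: eq_divide_eq_numeral1)
      qed auto
    qed
  qed
  then show "piecewise_C1_curve M (\<gamma> +++ \<delta>)" using piecewise_breaks by blast
  have im: "(\<lambda>t::real. 2 * t + 0) ` {0..1/2} = {0..1}" "(\<lambda>t::real. 2 * t + -1) ` {1/2..1} = {0..1}"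
    by (simp_all only: image_affinity_atLeastAtMost) auto
  have "(speed (\<gamma> +++ \<delta>) has_integral curve_length M \<gamma>) {0..1/2}"
    by (rule speed_affine_integral[OF S _ im(1)]) (auto simp: joinpaths_def)
  moreover have "(speed (\<gamma> +++ \<delta>) has_integral curve_length M \<delta>) {1/2..1}"
    by (rule speed_affine_integral[OF T _ im(2)]) (auto simp: joinpaths_def)
  ultimately have "(speed (\<gamma> +++ \<delta>) has_integral (curve_length M \<gamma> + curve_length M \<delta>)) {0..1}"
    by (intro has_integral_combine[where c="1/2"]) auto
  then show "curve_length M (\<gamma> +++ \<delta>) = curve_length M \<gamma> + curve_length M \<delta>"
    by (simp add: curve_length_speed integral_unique)
qed

text \<open>Source of all upper bounds for the distance. The metric is bounded only along the
  segment and only on the one vector z - y. So the lemma serves both with a crude local constant and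
  with the sharper comparison that the integration by parts relies on.\<close>

lemma curve_segment:
  assumes c: "c \<in> atlas M" and seg: "closed_segment y z \<subseteq> cim c"
    and K: "\<And>w. w \<in> closed_segment y z \<Longrightarrow> ginner M c (cinv c w) (z - y) (z - y) \<le> K\<^sup>2" "K \<ge> 0"
  obtains \<gamma> where "piecewise_C1_curve M \<gamma>" "\<gamma> 0 = cinv c y" "\<gamma> 1 = cinv c z" "curve_length M \<gamma> \<le> K"
proof -
  define \<gamma> where "\<gamma> t = cinv c (y + t *\<^sub>R (z - y))" for t
  have ins: "y + t *\<^sub>R (z - y) \<in> closed_segment y z" if "t \<in> {0..1}" for t
    using that by (auto simp: closed_segment_def algebra_simps intro!: exI[of _ t])
  have dom: "\<gamma> t \<in> cdom c" "cmap c (\<gamma> t) = y + t *\<^sub>R (z - y)" if "t \<in> {0..1}" for t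
    using ins[OF that] seg c by (auto simp: \<gamma>_def cinv_in_cdom)
  have cont: "continuous_on {0..1} \<gamma>"
    unfolding \<gamma>_def by (rule continuous_on_compose2[OF continuous_on_cinv[OF c]]) (use ins seg in \<open>auto intro!: continuous_intros\<close>)
  have dc: "(cmap c \<circ> \<gamma> has_vector_derivative z - y) (at t within I)" if "I \<subseteq> {0..1}" "t \<in> I" for t I
  proof -
    have "((\<lambda>t. y + t *\<^sub>R (z - y)) has_vector_derivative z - y) (at t within I)"
      by (auto intro!: derivative_eq_intros simp: has_vector_derivative_def)
    then show ?thesis by (rule has_vector_derivative_transform[rotated 2]) (use that dom in auto)
  qed
  have "C1_curve_on M I \<gamma>" if I: "I \<subseteq> {0..1}" for I
    unfolding C1_curve_on_def
  proof (intro ballI exI conjI impI)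
    fix d t assume d: "d \<in> atlas M" "t \<in> I" "\<gamma> t \<in> cdom d"
    show "(cmap d \<circ> \<gamma> has_vector_derivative jac c d (\<gamma> t) (z - y)) (at t within I)"
      using d I c dom continuous_on_subset[OF cont I] dc[OF I]
      by (intro curve_chart_change) (auto simp: charts_at_iff continuous_on_eq_continuous_within)
  next
    fix d assume d: "d \<in> atlas M"
    have "Ck_on 0 (cmap c ` (cdom c \<inter> cdom d)) (\<lambda>w. frechet_derivative (cmap d \<circ> cinv c) (at w) (z - y))"
      using transition_smooth[OF c d, of "Suc 0"] by simp
    then have "continuous_on (cmap c ` (cdom c \<inter> cdom d)) (\<lambda>w. frechet_derivative (cmap d \<circ> cinv c) (at w) (z - y))" by simp
    then have "continuous_on {t \<in> I. \<gamma> t \<in> cdom d} (\<lambda>t. frechet_derivative (cmap d \<circ> cinv c) (at (y + t *\<^sub>R (z - y))) (z - y))"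
    proof (rule continuous_on_compose2)
      show "(\<lambda>t. y + t *\<^sub>R (z - y)) ` {t \<in> I. \<gamma> t \<in> cdom d} \<subseteq> cmap c ` (cdom c \<inter> cdom d)"
        using dom I by (force simp: subset_iff image_iff)
    qed (auto intro!: continuous_intros)
    then show "continuous_on {t \<in> I. \<gamma> t \<in> cdom d} (\<lambda>t. jac c d (\<gamma> t) (z - y))"
      by (rule continuous_on_eq) (use dom I in \<open>auto simp: jac_def subset_iff\<close>)
  qed
  then have br: "breaks \<gamma> {}" using cont by (auto simp: breaks_def)
  have sp: "speed \<gamma> t \<le> K" if t: "t \<in> {0<..<1}" for t
  proof -
    have ch: "c \<in> charts_at M (\<gamma> t)" using dom t c by (auto simp: charts_at_iff)
    have "at t within {0..1} = at t" using t by (intro at_within_interior) (simp add: interior_cbox[of 0 1, simplified])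
    then have "(cmap c \<circ> \<gamma> has_vector_derivative z - y) (at t)" using dc[of "{0..1}" t] t by auto
    then have "velocity M \<gamma> t c = z - y" using ch by (simp add: velocity_def vector_derivative_at)
    then have "speed \<gamma> t = sqrt (ginner M c (\<gamma> t) (z - y) (z - y))"
      using metric_gram[OF ch] breaks_velocity(2)[OF br, of t] t by (simp add: speed_def)
    also have "\<dots> \<le> K"
      using K(1)[OF ins, of t] K(2) t by (simp add: \<gamma>_def real_le_lsqrt real_sqrt_le_iff' real_sqrt_le_mono[of _ "K\<^sup>2", simplified])
    finally show ?thesis .
  qed
  have "(speed \<gamma> has_integral curve_length M \<gamma>) {0..1}"
    unfolding curve_length_speed using breaks_integrable[OF br] by (rule integrable_integral)
  then have "((\<lambda>t. if t \<in> {0<..<1} then speed \<gamma> t else K) has_integral curve_length M \<gamma>) {0..1}"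
    by (rule has_integral_spike_finite[of "{0,1}", rotated 2]) auto
  moreover have "((\<lambda>t. K) has_integral K) {0..1::real}" using has_integral_const_real[of K 0 1] by simp
  ultimately have "curve_length M \<gamma> \<le> K" by (rule has_integral_le) (use sp in auto)
  then show ?thesis using br by (intro that[of \<gamma>]) (auto simp: piecewise_breaks \<gamma>_def)
qed

end

subsection \<open>The Riemannian distance\<close>

context riem_mfd
begin

text \<open>The squares of k and K are the minimum and the maximum of the quadratic form over a
  closed coordinate ball times the unit sphere; homogeneity extends the bounds to all
  vectors.\<close>

lemma local_gram_bounds:
  assumes c: "c \<in> atlas M" and p: "p \<in> cdom c"
  shows "\<exists>r k K. r > 0 \<and> k > 0 \<and> K > 0 \<and> cball (cmap c p) r \<subseteq> cim c \<and>
    (\<forall>w\<in>cball (cmap c p) r. \<forall>v. k\<^sup>2 * (norm v)\<^sup>2 \<le> ginner M c (cinv c w) v v \<and>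
       ginner M c (cinv c w) v v \<le> K\<^sup>2 * (norm v)\<^sup>2)"
proof -
  obtain r where r: "r > 0" "cball (cmap c p) r \<subseteq> cim c"
    using open_cim[OF c] p by (meson imageI open_contains_cball)
  let ?S = "cball (cmap c p) r \<times> sphere (0 :: real ^ 'm) 1"
  let ?f = "\<lambda>x. snd x \<bullet> (gram M c (cinv c (fst x)) *v snd x)"
  have cS: "compact ?S" by (intro compact_Times) auto
  obtain a :: "real ^ 'm" where "norm a = 1" using vector_choose_size[of 1] by auto
  then have ne: "?S \<noteq> {}" using r(1) by auto
  have cf: "continuous_on ?S ?f"
    by (intro continuous_intros bounded_bilinear.continuous_on[OF bounded_bilinear_matrix_vector_mult]
        continuous_on_compose2[OF gram_cont[OF c]]) (use r in auto)
  obtain x where x: "x \<in> ?S" "\<forall>y\<in>?S. ?f x \<le> ?f y" using continuous_attains_inf[OF cS ne cf] by blast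
  obtain z where z: "z \<in> ?S" "\<forall>y\<in>?S. ?f y \<le> ?f z" using continuous_attains_sup[OF cS ne cf] by blast
  have pos: "?f y > 0" if "y \<in> ?S" for y
  proof -
    have "fst y \<in> cim c" "snd y \<noteq> 0" using that r by auto
    then show ?thesis using ginner_pos[OF chart_at_cinv[OF c]] by auto
  qed
  have sc: "?f x * (norm v)\<^sup>2 \<le> ginner M c (cinv c w) v v" "ginner M c (cinv c w) v v \<le> ?f z * (norm v)\<^sup>2"
    if "w \<in> cball (cmap c p) r" for w v
  proof -
    have "?f x * (norm v)\<^sup>2 \<le> ginner M c (cinv c w) v v \<and> ginner M c (cinv c w) v v \<le> ?f z * (norm v)\<^sup>2"
    proof (cases "v = 0")
      case False
      define v' where "v' = v /\<^sub>R norm v"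
      have v: "v = norm v *\<^sub>R v'" "norm v' = 1" using False by (auto simp: v'_def)
      then have "(w, v') \<in> ?S" using that by auto
      then have "?f x \<le> ginner M c (cinv c w) v' v'" "ginner M c (cinv c w) v' v' \<le> ?f z" using x(2) z(2) by force+
      moreover have "ginner M c (cinv c w) v v = (norm v)\<^sup>2 * ginner M c (cinv c w) v' v'"
        by (subst (1 2) v(1)) (simp only: matrix_vector_mult_scaleR inner_scaleR_left inner_scaleR_right power2_eq_square mult.assoc)
      ultimately show ?thesis by (simp add: mult.commute mult_left_mono)
    qed simp
    then show "?f x * (norm v)\<^sup>2 \<le> ginner M c (cinv c w) v v" "ginner M c (cinv c w) v v \<le> ?f z * (norm v)\<^sup>2" by blast+
  qed
  show ?thesis
    by (rule exI[of _ r], rule exI[of _ "sqrt (?f x)"], rule exI[of _ "sqrt (?f z)"])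
       (use r sc pos[OF x(1)] pos[OF z(1)] in auto)
qed

lemma segment_curve:
  assumes c: "c \<in> atlas M" and b: "cball y0 r \<subseteq> cim c"
    and K: "\<And>w v. w \<in> cball y0 r \<Longrightarrow> ginner M c (cinv c w) v v \<le> K\<^sup>2 * (norm v)\<^sup>2" "K > 0"
    and yz: "y \<in> cball y0 r" "z \<in> cball y0 r"
  shows "\<exists>\<gamma>. piecewise_C1_curve M \<gamma> \<and> \<gamma> 0 = cinv c y \<and> \<gamma> 1 = cinv c z \<and> curve_length M \<gamma> \<le> K * norm (z - y)"
proof -
  have seg: "closed_segment y z \<subseteq> cball y0 r" using yz by (intro closed_segment_subset) auto
  show ?thesis
  proof (rule curve_segment[OF c, of y z "K * norm (z - y)"])
    show "closed_segment y z \<subseteq> cim c" using seg b by blast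
    show "ginner M c (cinv c w) (z - y) (z - y) \<le> (K * norm (z - y))\<^sup>2" if "w \<in> closed_segment y z" for w
      using K(1)[of w "z - y"] seg that by (auto simp: power_mult_distrib)
  qed (use K(2) in auto)
qed

text \<open>The set R of points reachable from x is open, and so is its complement, because
  coordinate segments join any two points of a small coordinate ball. By connectedness the infimum
  in \<open>gdist\<close> is never over the empty set.\<close>

lemma curve_exists: "\<exists>\<gamma>. piecewise_C1_curve M \<gamma> \<and> \<gamma> 0 = x \<and> \<gamma> 1 = y"
proof -
  define R where "R = {y. \<exists>\<gamma>. piecewise_C1_curve M \<gamma> \<and> \<gamma> 0 = x \<and> \<gamma> 1 = y}"
  have loc: "\<exists>V. open V \<and> p \<in> V \<and> (\<forall>y\<in>V. \<forall>z\<in>V. \<exists>\<gamma>. piecewise_C1_curve M \<gamma> \<and> \<gamma> 0 = y \<and> \<gamma> 1 = z)" for p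
  proof -
    obtain c where c: "c \<in> atlas M" "p \<in> cdom c" using ex_chart charts_at_iff by blast
    obtain r k K where r0: "r > 0" "k > 0" "K > 0" "cball (cmap c p) r \<subseteq> cim c"
      "\<forall>w\<in>cball (cmap c p) r. \<forall>v. k\<^sup>2 * (norm v)\<^sup>2 \<le> ginner M c (cinv c w) v v \<and>
       ginner M c (cinv c w) v v \<le> K\<^sup>2 * (norm v)\<^sup>2"
      using local_gram_bounds[OF c] by blast
    have r: "r > 0" "K > 0" "cball (cmap c p) r \<subseteq> cim c"
      "\<And>w v. w \<in> cball (cmap c p) r \<Longrightarrow> ginner M c (cinv c w) v v \<le> K\<^sup>2 * (norm v)\<^sup>2"
      using r0 by blast+
    have "ball (cmap c p) r \<subseteq> cim c" using r(3) by auto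
    then have "open (cinv c ` ball (cmap c p) r)" by (intro open_cinv_image c) auto
    moreover have "p \<in> cinv c ` ball (cmap c p) r" using c r(1) by (auto intro!: image_eqI[of _ _ "cmap c p"])
    moreover have "\<exists>\<gamma>. piecewise_C1_curve M \<gamma> \<and> \<gamma> 0 = cinv c y \<and> \<gamma> 1 = cinv c z"
      if "y \<in> ball (cmap c p) r" "z \<in> ball (cmap c p) r" for y z
      using segment_curve[OF c(1) r(3,4,2), of y z] that by auto
    ultimately show ?thesis by (intro exI[of _ "cinv c ` ball (cmap c p) r"]) auto
  qed
  have join: "z \<in> R" if j: "y \<in> R" "piecewise_C1_curve M \<delta>" "\<delta> 0 = y" "\<delta> 1 = z" for y z \<delta>
  proof -
    obtain \<gamma> where \<gamma>: "piecewise_C1_curve M \<gamma>" "\<gamma> 0 = x" "\<gamma> 1 = y" using j(1) by (auto simp: R_def)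
    then have "piecewise_C1_curve M (\<gamma> +++ \<delta>)" using j by (intro curve_join) auto
    then show ?thesis unfolding R_def using \<gamma> j by (auto simp: joinpaths_def intro!: exI[of _ "\<gamma> +++ \<delta>"])
  qed
  have "open R"
  proof (rule topological_space_class.openI)
    fix p assume p: "p \<in> R"
    obtain V where V: "open V" "p \<in> V" "\<forall>y\<in>V. \<forall>z\<in>V. \<exists>\<gamma>. piecewise_C1_curve M \<gamma> \<and> \<gamma> 0 = y \<and> \<gamma> 1 = z" using loc by blast
    have "V \<subseteq> R" using V join[OF p] by blast
    then show "\<exists>T. open T \<and> p \<in> T \<and> T \<subseteq> R" using V by blast
  qed
  moreover have "open (- R)"
  proof (rule topological_space_class.openI)
    fix p assume p: "p \<in> - R"
    obtain V where V: "open V" "p \<in> V" "\<forall>y\<in>V. \<forall>z\<in>V. \<exists>\<gamma>. piecewise_C1_curve M \<gamma> \<and> \<gamma> 0 = y \<and> \<gamma> 1 = z" using loc by blast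
    have "V \<subseteq> - R" using V join p by blast
    then show "\<exists>T. open T \<and> p \<in> T \<and> T \<subseteq> - R" using V by blast
  qed
  moreover have "x \<in> R"
  proof -
    obtain V where V: "open V" "x \<in> V" "\<forall>y\<in>V. \<forall>z\<in>V. \<exists>\<gamma>. piecewise_C1_curve M \<gamma> \<and> \<gamma> 0 = y \<and> \<gamma> 1 = z" using loc by blast
    then show ?thesis unfolding R_def by blast
  qed
  ultimately have "R = UNIV"
    using connectedD[OF connected_UNIV, of R "- R"] by auto
  then show ?thesis unfolding R_def by blast
qed

lemma gdist_le: "piecewise_C1_curve M \<gamma> \<Longrightarrow> \<gamma> 0 = x \<Longrightarrow> \<gamma> 1 = y \<Longrightarrow> gdist M x y \<le> curve_length M \<gamma>"
  unfolding gdist_def by (rule cInf_lower) (auto intro!: bdd_belowI[of _ 0] curve_length_nonneg)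

lemma gdist_ge:
  assumes "\<And>\<gamma>. piecewise_C1_curve M \<gamma> \<Longrightarrow> \<gamma> 0 = x \<Longrightarrow> \<gamma> 1 = y \<Longrightarrow> B \<le> curve_length M \<gamma>"
  shows "B \<le> gdist M x y"
  unfolding gdist_def using curve_exists[of x y] assms by (intro cInf_greatest) auto

lemma gdist_nonneg: "gdist M x y \<ge> 0"
  by (rule gdist_ge) (rule curve_length_nonneg)

lemma gdist_less:
  assumes "gdist M x y < B"
  obtains \<gamma> where "piecewise_C1_curve M \<gamma>" "\<gamma> 0 = x" "\<gamma> 1 = y" "curve_length M \<gamma> < B"
  using assms gdist_ge[of x y B] by (meson not_le)

lemma gdist_commute: "gdist M x y = gdist M y x"
proof -
  have "gdist M x y \<le> gdist M y x" for x y
  proof (rule gdist_ge)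
    fix \<gamma> assume \<gamma>: "piecewise_C1_curve M \<gamma>" "\<gamma> 0 = y" "\<gamma> 1 = x"
    show "gdist M x y \<le> curve_length M \<gamma>"
      using gdist_le[OF curve_reverse(1)[OF \<gamma>(1)], of x y] curve_reverse(2)[OF \<gamma>(1)] \<gamma> by simp
  qed
  then show ?thesis by (meson antisym)
qed

lemma gdist_triangle: "gdist M x z \<le> gdist M x y + gdist M y z"
proof (rule field_le_epsilon)
  fix e :: real assume e: "e > 0"
  obtain \<gamma> where \<gamma>: "piecewise_C1_curve M \<gamma>" "\<gamma> 0 = x" "\<gamma> 1 = y" "curve_length M \<gamma> < gdist M x y + e/2"
    using gdist_less[of x y "gdist M x y + e/2"] e by auto
  obtain \<delta> where \<delta>: "piecewise_C1_curve M \<delta>" "\<delta> 0 = y" "\<delta> 1 = z" "curve_length M \<delta> < gdist M y z + e/2"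
    using gdist_less[of y z "gdist M y z + e/2"] e by auto
  have j: "\<gamma> 1 = \<delta> 0" using \<gamma> \<delta> by simp
  have "gdist M x z \<le> curve_length M (\<gamma> +++ \<delta>)"
    using \<gamma> \<delta> by (intro gdist_le curve_join(1) j) (auto simp: joinpaths_def)
  then show "gdist M x z \<le> gdist M x y + gdist M y z + e"
    using curve_join(2)[OF \<gamma>(1) \<delta>(1) j] \<gamma>(4) \<delta>(4) by simp
qed

lemma gdist_chart_le:
  assumes "c \<in> atlas M" "cball y0 r \<subseteq> cim c"
    "\<And>w v. w \<in> cball y0 r \<Longrightarrow> ginner M c (cinv c w) v v \<le> K\<^sup>2 * (norm v)\<^sup>2" "K > 0"
    "y \<in> cball y0 r" "z \<in> cball y0 r"
  shows "gdist M (cinv c y) (cinv c z) \<le> K * norm (z - y)"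
proof -
  have "\<exists>\<gamma>. piecewise_C1_curve M \<gamma> \<and> \<gamma> 0 = cinv c y \<and> \<gamma> 1 = cinv c z \<and> curve_length M \<gamma> \<le> K * norm (z - y)"
    by (rule segment_curve[OF assms(1,2) _ assms(4,5,6)]) (rule assms(3))
  then obtain \<gamma> where "piecewise_C1_curve M \<gamma>" "\<gamma> 0 = cinv c y" "\<gamma> 1 = cinv c z" "curve_length M \<gamma> \<le> K * norm (z - y)"
    by blast
  then show ?thesis using gdist_le[of \<gamma> "cinv c y" "cinv c z"] by linarith
qed

lemma gdist_refl [simp]: "gdist M x x = 0"
proof -
  obtain c where c: "c \<in> atlas M" "x \<in> cdom c" using ex_chart charts_at_iff by blast
  obtain r k K where r0: "r > 0" "k > 0" "K > 0" "cball (cmap c x) r \<subseteq> cim c"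
      "\<forall>w\<in>cball (cmap c x) r. \<forall>v. k\<^sup>2 * (norm v)\<^sup>2 \<le> ginner M c (cinv c w) v v \<and>
       ginner M c (cinv c w) v v \<le> K\<^sup>2 * (norm v)\<^sup>2"
      using local_gram_bounds[OF c] by blast
    have r: "r > 0" "K > 0" "cball (cmap c x) r \<subseteq> cim c"
      "\<And>w v. w \<in> cball (cmap c x) r \<Longrightarrow> ginner M c (cinv c w) v v \<le> K\<^sup>2 * (norm v)\<^sup>2"
      using r0 by blast+
  then have "gdist M (cinv c (cmap c x)) (cinv c (cmap c x)) \<le> K * norm (cmap c x - cmap c x)"
    by (intro gdist_chart_le c(1)) auto
  then show ?thesis using c gdist_nonneg[of x x] by simp
qed

text \<open>Source of all lower bounds for the distance. Up to its first exit the curve stays in the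
  coordinate ball, where the speed is at least k times the Euclidean speed, and by then its
  coordinates have moved by at least r.\<close>

lemma curve_exit_length:
  assumes c: "c \<in> atlas M" and p: "p \<in> cdom c" and r: "r > 0" "k > 0" "cball (cmap c p) r \<subseteq> cim c"
    and k: "\<And>w v. w \<in> cball (cmap c p) r \<Longrightarrow> k\<^sup>2 * (norm v)\<^sup>2 \<le> ginner M c (cinv c w) v v"
    and \<gamma>: "piecewise_C1_curve M \<gamma>" "\<gamma> 0 = p" "\<gamma> 1 \<notin> cinv c ` ball (cmap c p) r"
  shows "k * r \<le> curve_length M \<gamma>"
proof -
  obtain T where T: "breaks \<gamma> T" using \<gamma>(1) piecewise_breaks by blast
  let ?V = "cinv c ` ball (cmap c p) r"
  have cont: "continuous_on {0..1} \<gamma>" using T by (simp add: breaks_def)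
  have bs: "ball (cmap c p) r \<subseteq> cim c" using r by auto
  have oV: "open ?V" by (intro open_cinv_image c bs) auto
  define S where "S = {0..1} \<inter> \<gamma> -` (- ?V)"
  have cS: "closed S" unfolding S_def
    using continuous_closed_preimage[OF cont closed_atLeastAtMost, of "- ?V"] oV by (auto simp: closed_def)
  have S1: "1 \<in> S" using \<gamma>(3) by (simp add: S_def)
  have bS: "bdd_below S" by (rule bdd_belowI[of _ 0]) (auto simp: S_def)
  \<comment> \<open>The first time outside the open coordinate ball; the infimum is attained because
    S is closed.\<close>
  define t0 where "t0 = Inf S"
  have t0S: "t0 \<in> S" unfolding t0_def using closed_contains_Inf[OF _ bS cS] S1 by blast
  have inV: "\<gamma> t \<in> ?V" if "0 \<le> t" "t < t0" for t
  proof (rule ccontr)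
    assume "\<gamma> t \<notin> ?V"
    then have "t \<in> S" using that t0S by (auto simp: S_def)
    then have "t0 \<le> t" unfolding t0_def by (rule cInf_lower[OF _ bS])
    then show False using that by simp
  qed
  have pV: "p \<in> ?V" using c p r by (auto intro!: image_eqI[of _ _ "cmap c p"])
  have t01: "0 < t0" "t0 \<le> 1"
  proof -
    have "t0 \<noteq> 0" using t0S pV \<gamma>(2) by (auto simp: S_def)
    then show "0 < t0" "t0 \<le> 1" using t0S by (auto simp: S_def)
  qed
  let ?C = "cinv c ` cball (cmap c p) r"
  have cC: "closed ?C"
    by (intro compact_imp_closed compact_continuous_image continuous_on_subset[OF continuous_on_cinv[OF c] r(3)]) auto
  \<comment> \<open>At t0 the curve has left the open ball but, by continuity, is still in the
    closed one, so the metric bounds hold up to and including t0.\<close>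
  have inC: "\<gamma> t \<in> ?C" if "t \<in> {0..t0}" for t
  proof -
    have "closed ({0..t0} \<inter> \<gamma> -` ?C)"
      by (rule continuous_closed_preimage[OF continuous_on_subset[OF cont] _ cC]) (use t01 in auto)
    moreover have "{0<..<t0} \<subseteq> {0..t0} \<inter> \<gamma> -` ?C"
    proof
      fix s assume "s \<in> {0<..<t0}"
      then show "s \<in> {0..t0} \<inter> \<gamma> -` ?C" using inV[of s] by auto
    qed
    ultimately have "closure {0<..<t0} \<subseteq> {0..t0} \<inter> \<gamma> -` ?C" by (rule closure_minimal[rotated])
    then show ?thesis using that t01 by auto
  qed
  have Cd: "?C \<subseteq> cdom c" using r(3) cinv_in_cdom[OF c] by auto
  have cb: "cmap c (\<gamma> t) \<in> cball (cmap c p) r" if "t \<in> {0..t0}" for t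
    using inC[OF that] r(3) c by (auto simp: subset_iff)
  define f where "f = cmap c \<circ> \<gamma>"
  have r0: "norm (f t0 - f 0) \<ge> r"
  proof (rule ccontr)
    assume "\<not> ?thesis"
    then have "cmap c (\<gamma> t0) \<in> ball (cmap c p) r" by (simp add: f_def \<gamma>(2) dist_norm norm_minus_commute)
    then have "cinv c (cmap c (\<gamma> t0)) \<in> ?V" by (rule imageI)
    moreover have "\<gamma> t0 \<in> cdom c" using inC[of t0] t01 Cd by auto
    ultimately have "\<gamma> t0 \<in> ?V" using c by simp
    then show False using t0S by (auto simp: S_def)
  qed
  let ?T = "insert 0 (insert t0 T)"
  \<comment> \<open>Derivative and speed are set to 0 at the finitely many exceptional times, so
    that the pointwise comparison holds on all of [0, t0] without changing the integrals.\<close>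
  define f' where "f' t = (if t \<in> {0..t0} - ?T then velocity M \<gamma> t c else 0)" for t
  define g where "g t = (if t \<in> {0..t0} - ?T then speed \<gamma> t else 0)" for t
  have ft: "finite ?T" using T by (simp add: breaks_def)
  have chT: "c \<in> charts_at M (\<gamma> t)" if "t \<in> {0..t0}" for t using inC[OF that] Cd c by (auto simp: charts_at_iff)
  have "(f' has_integral (f t0 - f 0)) {0..t0}"
  proof (rule fundamental_theorem_of_calculus_interior_strong[OF ft])
    show "(f has_vector_derivative f' t) (at t)" if "t \<in> {0<..<t0} - ?T" for t
      using breaks_velocity(1)[OF T, of t c] chT[of t] that t01 by (simp add: f_def f'_def)
    show "continuous_on {0..t0} f" unfolding f_def
      by (intro continuous_on_compose continuous_on_subset[OF cont] continuous_on_subset[OF continuous_on_cmap[OF c]])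
         (use t01 inC Cd in auto)
  qed (use t01 in simp)
  moreover have sp: "speed \<gamma> integrable_on {0..t0}"
    by (rule integrable_on_subinterval[OF breaks_integrable[OF T]]) (use t01 in auto)
  then have g: "g integrable_on {0..t0}"
    by (rule integrable_spike_finite[OF ft, rotated]) (simp add: g_def)
  then have "(\<lambda>t. g t / k) integrable_on {0..t0}" by (rule integrable_on_divide)
  moreover have "norm (f' t) \<le> g t / k" if "t \<in> {0..t0}" for t
  proof (cases "t \<in> ?T")
    case False
    then have tt: "t \<in> {0<..<1} - T" using that t01 by auto
    have "speed \<gamma> t = sqrt (ginner M c (\<gamma> t) (velocity M \<gamma> t c) (velocity M \<gamma> t c))"
      using metric_gram[OF chT[OF that]] breaks_velocity(2)[OF T tt] by (simp add: speed_def)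
    also have "\<dots> \<ge> sqrt (k\<^sup>2 * (norm (velocity M \<gamma> t c))\<^sup>2)"
      using k[OF cb[OF that], of "velocity M \<gamma> t c"] chT[OF that] by (simp add: charts_at_iff)
    finally have "k * norm (velocity M \<gamma> t c) \<le> speed \<gamma> t" using r(2) by (simp add: real_sqrt_mult)
    then show ?thesis using r(2) False that by (simp add: f'_def g_def field_simps)
  qed (simp add: f'_def g_def)
  ultimately have "norm (f t0 - f 0) \<le> integral {0..t0} (\<lambda>t. g t / k)"
    using Henstock_Kurzweil_Integration.integral_norm_bound_integral[of f' "{0..t0}" "\<lambda>t. g t / k"]
    by (auto simp: has_integral_integrable_integral)
  also have "\<dots> = integral {0..t0} g / k" by simp
  also have "integral {0..t0} g = integral {0..t0} (speed \<gamma>)"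
    by (rule integral_spike[of ?T]) (use ft in \<open>auto simp: g_def\<close>)
  also have "\<dots> \<le> curve_length M \<gamma>"
  proof -
    define h where "h t = (if t \<in> {0<..<1} - T then speed \<gamma> t else 0)" for t
    have ft1: "finite (insert 0 (insert 1 T))" using ft by simp
    have hi: "h integrable_on {0..1}"
      by (rule integrable_spike_finite[OF ft1 _ breaks_integrable[OF T]]) (auto simp: h_def)
    have "integral {0..t0} (speed \<gamma>) = integral {0..t0} h"
      by (rule integral_spike[of "insert 0 (insert 1 T)"]) (use ft1 t01 in \<open>auto simp: h_def\<close>)
    also have "\<dots> \<le> integral {0..1} h"
      by (rule integral_subset_le) (use hi t01 speed_nonneg[OF T] in \<open>auto simp: h_def intro: integrable_on_subinterval[OF hi]\<close>)
    also have "\<dots> = integral {0..1} (speed \<gamma>)"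
      by (rule integral_spike[of "insert 0 (insert 1 T)"]) (use ft1 in \<open>auto simp: h_def\<close>)
    finally show ?thesis by (simp add: curve_length_speed)
  qed
  finally have "norm (f t0 - f 0) \<le> curve_length M \<gamma> / k" using r(2) by (simp add: divide_right_mono)
  then show ?thesis using r0 r(2) by (simp add: field_simps) (metis mult.commute mult_left_mono order_trans less_imp_le)
qed

text \<open>A curve shorter than k s cannot leave the coordinate ball of radius s.\<close>

lemma gball_subset_open:
  assumes "open U" "p \<in> U" obtains e where "e > 0" "gball M p e \<subseteq> U"
proof -
  obtain c where c: "c \<in> atlas M" "p \<in> cdom c" using ex_chart charts_at_iff by blast
  obtain r k K where r0: "r > 0" "k > 0" "K > 0" "cball (cmap c p) r \<subseteq> cim c"
      "\<forall>w\<in>cball (cmap c p) r. \<forall>v. k\<^sup>2 * (norm v)\<^sup>2 \<le> ginner M c (cinv c w) v v \<and>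
       ginner M c (cinv c w) v v \<le> K\<^sup>2 * (norm v)\<^sup>2"
      using local_gram_bounds[OF c] by blast
    have r: "r > 0" "k > 0" "cball (cmap c p) r \<subseteq> cim c"
      "\<And>w v. w \<in> cball (cmap c p) r \<Longrightarrow> k\<^sup>2 * (norm v)\<^sup>2 \<le> ginner M c (cinv c w) v v"
      using r0 by blast+
  have "cmap c p \<in> cmap c ` (cdom c \<inter> U)" using c assms by auto
  then obtain r' where r': "r' > 0" "cball (cmap c p) r' \<subseteq> cmap c ` (cdom c \<inter> U)"
    using open_cmap_image[OF c(1) assms(1)] open_contains_cball by blast
  define s where "s = min r r'"
  have s: "s > 0" "cball (cmap c p) s \<subseteq> cim c" "cball (cmap c p) s \<subseteq> cball (cmap c p) r" "cball (cmap c p) s \<subseteq> cball (cmap c p) r'"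
    using r r' by (auto simp: s_def)
  have VU: "cinv c ` ball (cmap c p) s \<subseteq> U"
  proof
    fix q assume "q \<in> cinv c ` ball (cmap c p) s"
    then obtain w where "w \<in> ball (cmap c p) s" "q = cinv c w" by blast
    then have "w \<in> cball (cmap c p) s" "q = cinv c w" by auto
    then have "w \<in> cmap c ` (cdom c \<inter> U)" "q = cinv c w" using s(4) r'(2) by blast+
    then show "q \<in> U" using c by auto
  qed
  have "gball M p (k * s) \<subseteq> U"
  proof
    fix q assume "q \<in> gball M p (k * s)"
    then have "gdist M p q < k * s" by (simp add: gball_def)
    then obtain \<gamma> where \<gamma>: "piecewise_C1_curve M \<gamma>" "\<gamma> 0 = p" "\<gamma> 1 = q" "curve_length M \<gamma> < k * s" by (rule gdist_less)
    have "q \<in> cinv c ` ball (cmap c p) s"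
      using curve_exit_length[OF c s(1) r(2) s(2) _ \<gamma>(1,2)] r(4) s(3) \<gamma> by fastforce
    then show "q \<in> U" using VU by blast
  qed
  then show ?thesis using that r s by (metis mult_pos_pos)
qed

lemma open_gball: "open (gball M p R)"
proof (rule topological_space_class.openI)
  fix q assume "q \<in> gball M p R"
  then have e: "R - gdist M p q > 0" by (simp add: gball_def)
  obtain c where c: "c \<in> atlas M" "q \<in> cdom c" using ex_chart charts_at_iff by blast
  obtain r k K where r0: "r > 0" "k > 0" "K > 0" "cball (cmap c q) r \<subseteq> cim c"
      "\<forall>w\<in>cball (cmap c q) r. \<forall>v. k\<^sup>2 * (norm v)\<^sup>2 \<le> ginner M c (cinv c w) v v \<and>
       ginner M c (cinv c w) v v \<le> K\<^sup>2 * (norm v)\<^sup>2"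
      using local_gram_bounds[OF c] by blast
    have r: "r > 0" "K > 0" "cball (cmap c q) r \<subseteq> cim c"
      "\<And>w v. w \<in> cball (cmap c q) r \<Longrightarrow> ginner M c (cinv c w) v v \<le> K\<^sup>2 * (norm v)\<^sup>2"
      using r0 by blast+
  \<comment> \<open>Distances are at most K times coordinate distances, so this radius uses up no
    more than the slack \<open>R - gdist M p q\<close>.\<close>
  define s where "s = min r ((R - gdist M p q) / K)"
  have s: "s > 0" "ball (cmap c q) s \<subseteq> cball (cmap c q) r" using r e by (auto simp: s_def)
  let ?V = "cinv c ` ball (cmap c q) s"
  have "open ?V" using s r(3) by (intro open_cinv_image c) auto
  moreover have "q \<in> ?V" using c s by (auto intro!: image_eqI[of _ _ "cmap c q"])
  moreover have "?V \<subseteq> gball M p R"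
  proof
    fix z assume "z \<in> ?V"
    then obtain w where w: "w \<in> ball (cmap c q) s" "z = cinv c w" by blast
    have "gdist M (cinv c (cmap c q)) (cinv c w) \<le> K * norm (w - cmap c q)"
      using w s r by (intro gdist_chart_le[OF c(1) r(3,4,2)]) auto
    also have "norm (w - cmap c q) < (R - gdist M p q) / K" using w by (simp add: s_def dist_norm norm_minus_commute)
    then have "K * norm (w - cmap c q) < R - gdist M p q" using r(2) by (simp add: field_simps)
    finally have "gdist M q z < R - gdist M p q" using c w by simp
    then show "z \<in> gball M p R" using gdist_triangle[of p z q] by (simp add: gball_def)
  qed
  ultimately show "\<exists>T. open T \<and> q \<in> T \<and> T \<subseteq> gball M p R" by blast
qed

section \<open>The Riemannian distance is a metric inducing the manifold topology\<close>

lemma metric_space_gdist: "Metric_space UNIV (gdist M)"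
proof
  show "gdist M x y = 0 \<longleftrightarrow> x = y" for x y
  proof
    assume 0: "gdist M x y = 0"
    show "x = y"
    proof (rule ccontr)
      assume "x \<noteq> y"
      obtain e where "e > 0" "gball M x e \<subseteq> - {y}"
        by (rule gball_subset_open[of "- {y}" x]) (use \<open>x \<noteq> y\<close> in auto)
      then show False using 0 by (auto simp: gball_def)
    qed
  qed simp
qed (auto simp: gdist_nonneg gdist_triangle intro: gdist_commute)

lemma mtopology_gdist: "Metric_space.mtopology UNIV (gdist M) = euclidean"
proof -
  interpret G: Metric_space UNIV "gdist M" by (rule metric_space_gdist)
  have mb: "G.mball x r = gball M x r" for x r by (auto simp: gball_def)
  have "openin G.mtopology U \<longleftrightarrow> open U" for U
  proof
    assume "openin G.mtopology U"
    then have *: "\<exists>r>0. gball M x r \<subseteq> U" if "x \<in> U" for x using that by (auto simp: G.openin_mtopology mb)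
    show "open U"
    proof (rule topological_space_class.openI)
      fix x assume "x \<in> U"
      then obtain r where r: "r > 0" "gball M x r \<subseteq> U" using * by blast
      have "x \<in> gball M x r" using r by (simp add: gball_def)
      then show "\<exists>T. open T \<and> x \<in> T \<and> T \<subseteq> U" using open_gball r by blast
    qed
  next
    assume U: "open U"
    show "openin G.mtopology U" unfolding G.openin_mtopology mb
    proof (intro conjI allI impI subset_UNIV)
      fix x assume "x \<in> U"
      then obtain e where "e > 0" "gball M x e \<subseteq> U" using gball_subset_open[OF U] by blast
      then show "\<exists>r>0. gball M x r \<subseteq> U" by blast
    qed
  qed
  then show ?thesis by (simp add: topology_eq)
qed

lemma gdist_lipschitz: "\<bar>gdist M x y - gdist M x z\<bar> \<le> gdist M y z"
  using gdist_triangle[of x y z] gdist_triangle[of x z y] gdist_commute[of y z] by linarith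

lemma continuous_on_gdist: "continuous_on UNIV (gdist M x)"
proof (rule continuous_at_imp_continuous_on, rule ballI)
  fix y
  show "isCont (gdist M x) y"
    unfolding isCont_def
  proof (rule tendstoI)
    fix e :: real assume "e > 0"
    then have "y \<in> gball M y e" by (simp add: gball_def)
    then have "\<forall>\<^sub>F z in at y. z \<in> gball M y e"
      using open_gball eventually_at_topological by blast
    then show "\<forall>\<^sub>F z in at y. dist (gdist M x z) (gdist M x y) < e"
    proof eventually_elim
      fix z assume "z \<in> gball M y e"
      then have "gdist M y z < e" by (simp add: gball_def)
      then show "dist (gdist M x z) (gdist M x y) < e"
        using gdist_lipschitz[of x z y] gdist_commute[of y z] by (simp add: dist_real_def)
    qed
  qed
qed

subsection \<open>Doubling and completeness make bounded closed sets compact\<close>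

lemma gball_borel [simp]: "gball M x R \<in> sets borel"
  using open_gball by simp

lemma vol_gball_pos: "R > 0 \<Longrightarrow> emeasure (vol M) (gball M x R) > 0"
  by (rule vol_open_pos[OF open_gball]) (auto simp: gball_def intro!: exI[of _ x])

lemma gball_mono: "R \<le> S \<Longrightarrow> gball M x R \<subseteq> gball M x S"
  by (auto simp: gball_def)

lemma gball_empty: "R \<le> 0 \<Longrightarrow> gball M x R = {}"
proof (rule equals0I)
  fix y assume "R \<le> 0" "y \<in> gball M x R"
  then show False using gdist_nonneg[of x y] by (simp add: gball_def)
qed

lemma doubling_iterate:
  assumes D: "\<And>R x. R > 0 \<Longrightarrow> emeasure (vol M) (gball M x (2 * R)) \<le> ennreal D * emeasure (vol M) (gball M x R)"
    and "R > 0"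
  shows "emeasure (vol M) (gball M x (2 ^ n * R)) \<le> ennreal D ^ n * emeasure (vol M) (gball M x R)"
proof (induction n)
  case (Suc n)
  have "emeasure (vol M) (gball M x (2 ^ Suc n * R)) \<le> ennreal D * emeasure (vol M) (gball M x (2 ^ n * R))"
    using D[of "2 ^ n * R" x] \<open>R > 0\<close> by (simp add: mult.assoc)
  also have "\<dots> \<le> ennreal D * (ennreal D ^ n * emeasure (vol M) (gball M x R))"
    by (rule mult_left_mono[OF Suc]) simp
  finally show ?case by (simp add: mult.assoc)
qed simp

lemma doubling_cover:
  assumes "R > 0" "S > 0" obtains n :: nat where "S \<le> 2 ^ n * (R :: real)"
proof -
  obtain n where "S / R < 2 ^ n" using real_arch_pow[of 2 "S / R"] by auto
  then have "S \<le> 2 ^ n * R" using assms by (simp add: field_simps)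
  then show ?thesis using that by blast
qed

text \<open>Some small ball lies in a neighbourhood of finite volume; finitely many doublings carry
  finiteness to every radius.\<close>

lemma vol_gball_finite:
  assumes "doubling M" shows "emeasure (vol M) (gball M x R) < \<infinity>"
proof (cases "R > 0")
  case False
  then have "gball M x R = {}" by (intro gball_empty) simp
  then show ?thesis by simp
next
  case True
  obtain D where D: "\<And>R x. R > 0 \<Longrightarrow> emeasure (vol M) (gball M x (2 * R)) \<le> ennreal D * emeasure (vol M) (gball M x R)"
    using assms unfolding doubling_def by blast
  obtain U where U: "open U" "x \<in> U" "emeasure (vol M) U < \<infinity>" using vol_locally_finite by blast
  obtain e where e: "e > 0" "gball M x e \<subseteq> U" using gball_subset_open[OF U(1,2)] by blast
  obtain n where n: "R \<le> 2 ^ n * e" using doubling_cover[OF e(1) True] by blast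
  have "emeasure (vol M) (gball M x R) \<le> emeasure (vol M) (gball M x (2 ^ n * e))"
    by (rule emeasure_mono[OF gball_mono[OF n]]) simp
  also have "\<dots> \<le> ennreal D ^ n * emeasure (vol M) (gball M x e)" by (rule doubling_iterate[OF D e(1)])
  also have "\<dots> \<le> ennreal D ^ n * emeasure (vol M) U"
    using e(2) U(1) by (intro mult_left_mono emeasure_mono) auto
  also have "\<dots> < \<infinity>" using U(3) by (simp add: ennreal_mult_less_top power_less_top_ennreal)
  finally show ?thesis .
qed

text \<open>A packing argument. The e/2-balls around an e-separated subset are disjoint, and by
  doubling each has at least a fixed fraction of the volume of one ball containing them all. This
  bounds the cardinality, and a separated set of maximal cardinality is an e-net.\<close>

lemma gball_mtotally_bounded:
  assumes "doubling M" shows "Metric_space.mtotally_bounded UNIV (gdist M) (gball M x R)"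
proof -
  interpret G: Metric_space UNIV "gdist M" by (rule metric_space_gdist)
  obtain D where D: "\<And>R x. R > 0 \<Longrightarrow> emeasure (vol M) (gball M x (2 * R)) \<le> ennreal D * emeasure (vol M) (gball M x R)"
    using assms unfolding doubling_def by blast
  show ?thesis
  proof (cases "R > 0")
    case False
    then have "gball M x R = {}" by (intro gball_empty) simp
    then show ?thesis by simp
  next
    case True
    show ?thesis unfolding G.mtotally_bounded_def
    proof (intro allI impI)
      fix e :: real assume e: "e > 0"
      let ?B = "gball M x (R + e)"
      \<comment> \<open>For y in the ball of radius R, the big ball around x lies within 2 (R + e)
        of y; n doublings of the radius e/2 reach that far, with n independent of y.\<close>
      obtain n where n: "2 * (R + e) \<le> 2 ^ n * (e/2)" using doubling_cover[of "e/2" "2 * (R + e)"] e True by auto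
      define sep where "sep F \<longleftrightarrow> finite F \<and> F \<subseteq> gball M x R \<and> (\<forall>y\<in>F. \<forall>z\<in>F. y \<noteq> z \<longrightarrow> gdist M y z \<ge> e)" for F
      have big: "emeasure (vol M) ?B \<le> ennreal D ^ n * emeasure (vol M) (gball M y (e/2))" if "y \<in> gball M x R" for y
      proof -
        have "?B \<subseteq> gball M y (2 ^ n * (e/2))"
        proof
          fix z assume "z \<in> ?B"
          then have "gdist M y z < 2 * (R + e)"
            using that gdist_triangle[of y z x] gdist_commute[of x y] e True by (simp add: gball_def)
          then show "z \<in> gball M y (2 ^ n * (e/2))" using n by (simp add: gball_def)
        qed
        then have "emeasure (vol M) ?B \<le> emeasure (vol M) (gball M y (2 ^ n * (e/2)))" by (intro emeasure_mono) simp_all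
        also have "\<dots> \<le> ennreal D ^ n * emeasure (vol M) (gball M y (e/2))" using e by (intro doubling_iterate D) auto
        finally show ?thesis .
      qed
      have card: "of_nat (card F) \<le> ennreal D ^ n" if F: "sep F" for F
      proof -
        have "emeasure (vol M) ?B * of_nat (card F) = (\<Sum>y\<in>F. emeasure (vol M) ?B)" by (simp add: mult.commute)
        also have "\<dots> \<le> (\<Sum>y\<in>F. ennreal D ^ n * emeasure (vol M) (gball M y (e/2)))"
          using F by (intro sum_mono big) (auto simp: sep_def)
        also have "\<dots> = ennreal D ^ n * (\<Sum>y\<in>F. emeasure (vol M) (gball M y (e/2)))" by (simp add: sum_distrib_left)
        also have "(\<Sum>y\<in>F. emeasure (vol M) (gball M y (e/2))) = emeasure (vol M) (\<Union>y\<in>F. gball M y (e/2))"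
        proof (rule sum_emeasure)
          show "disjoint_family_on (\<lambda>y. gball M y (e/2)) F"
            unfolding disjoint_family_on_def
          proof (intro ballI impI)
            fix y z assume yz: "y \<in> F" "z \<in> F" "y \<noteq> z"
            show "gball M y (e/2) \<inter> gball M z (e/2) = {}"
            proof (rule ccontr)
              assume "gball M y (e/2) \<inter> gball M z (e/2) \<noteq> {}"
              then obtain a where "gdist M y a < e/2" "gdist M z a < e/2" by (auto simp: gball_def)
              then have "gdist M y z < e" using gdist_triangle[of y z a] gdist_commute[of z a] by simp
              then show False using F yz by (force simp: sep_def)
            qed
          qed
        qed (use F in \<open>auto simp: sep_def\<close>)
        also have "ennreal D ^ n * emeasure (vol M) (\<Union>y\<in>F. gball M y (e/2)) \<le> ennreal D ^ n * emeasure (vol M) ?B"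
        proof (intro mult_left_mono emeasure_mono)
          show "(\<Union>y\<in>F. gball M y (e/2)) \<subseteq> ?B"
          proof
            fix z assume "z \<in> (\<Union>y\<in>F. gball M y (e/2))"
            then obtain y where "y \<in> F" "gdist M y z < e/2" by (auto simp: gball_def)
            moreover from this have "gdist M x y < R" using F by (auto simp: sep_def gball_def)
            ultimately show "z \<in> ?B" using gdist_triangle[of x z y] e by (simp add: gball_def)
          qed
        qed simp_all
        finally have "emeasure (vol M) ?B * of_nat (card F) \<le> emeasure (vol M) ?B * ennreal D ^ n" by (simp add: mult.commute)
        \<comment> \<open>Cancelling the volume of the big ball requires it to be positive and
          finite.\<close>
        then show ?thesis
          using vol_gball_pos[of "R + e" x] vol_gball_finite[OF assms, of x "R + e"] e True
          by (subst (asm) ennreal_mult_le_mult_iff) (auto simp: less_top)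
      qed
      have bnd: "card F \<le> nat \<lceil>enn2real (ennreal D ^ n)\<rceil>" if "sep F" for F
      proof -
        have "ennreal D ^ n < top" by (simp add: power_less_top_ennreal)
        then have "real (card F) \<le> enn2real (ennreal D ^ n)"
          using card[OF that] by (simp add: ennreal_of_nat_eq_real_of_nat le_ennreal_iff[symmetric] ennreal_enn2real ennreal_le_iff[symmetric])
        then show ?thesis by linarith
      qed
      have ex: "\<exists>F. sep F \<and> (\<forall>F'. sep F' \<longrightarrow> card F' \<le> card F)"
      proof -
        have "sep {}" by (simp add: sep_def)
        then show ?thesis using ex_has_greatest_nat[of sep "{}" card "Suc (nat \<lceil>enn2real (ennreal D ^ n)\<rceil>)"] bnd
          by (metis le_imp_less_Suc less_imp_le_nat)
      qed
      then obtain F where F: "sep F" "\<And>F'. sep F' \<Longrightarrow> card F' \<le> card F" by blast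
      have "gball M x R \<subseteq> (\<Union>y\<in>F. G.mball y e)"
      proof
        fix z assume z: "z \<in> gball M x R"
        show "z \<in> (\<Union>y\<in>F. G.mball y e)"
        \<comment> \<open>A point at distance at least e from all of F could be added to F, against
          maximality.\<close>
        proof (rule ccontr)
          assume "z \<notin> (\<Union>y\<in>F. G.mball y e)"
          then have far: "gdist M y z \<ge> e" if "y \<in> F" for y using that by force
          then have "z \<notin> F" using e by force
          moreover have "sep (insert z F)"
            using F(1) z far gdist_commute[of z] unfolding sep_def by auto
          ultimately show False using F(2)[of "insert z F"] F(1) by (simp add: sep_def)
        qed
      qed
      then show "\<exists>K. finite K \<and> K \<subseteq> gball M x R \<and> gball M x R \<subseteq> (\<Union>y\<in>K. G.mball y e)"
        using F(1) by (intro exI[of _ F]) (simp add: sep_def)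
    qed
  qed
qed

lemma gcball_compact:
  assumes "doubling M" "complete_riem M" shows "compact {y. gdist M x y \<le> R}"
proof -
  interpret G: Metric_space UNIV "gdist M" by (rule metric_space_gdist)
  have "G.mcomplete" using assms(2) by (simp add: complete_riem_def)
  \<comment> \<open>Total boundedness is available for open balls; radius R + 1 provides one that
    contains the closed ball.\<close>
  then have "compact (closure (gball M x (R + 1)))"
    using G.mtotally_bounded_eq_compact_closure_of[of "gball M x (R + 1)"] gball_mtotally_bounded[OF assms(1)]
    by (simp add: mtopology_gdist)
  moreover have "closed {y. gdist M x y \<le> R}"
    using continuous_closed_preimage[OF continuous_on_gdist closed_UNIV, of "{..R}" x] by (simp add: vimage_def)
  moreover have "{y. gdist M x y \<le> R} \<subseteq> closure (gball M x (R + 1))"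
    by (rule order_trans[OF _ closure_subset]) (auto simp: gball_def)
  ultimately show ?thesis using compact_Int_closed by (metis inf.absorb2)
qed

end

subsection \<open>The Levi-Civita connection along orthonormal frames\<close>

text \<open>The coordinate trace of an endomorphism, and hence a coordinate divergence, rewritten in
  a basis adapted to G.\<close>

lemma onb_trace_linear:
  fixes L :: "real ^ 'm \<Rightarrow> real ^ 'm"
  assumes "onb G e" "linear L"
  shows "(\<Sum>a\<in>UNIV. L (axis a 1) $ a) = (\<Sum>j\<in>UNIV. e j \<bullet> (G *v L (e j)))"
proof -
  interpret linear L by fact
  have "L (axis a 1) $ a = (\<Sum>j\<in>UNIV. (e j \<bullet> (G *v axis a 1)) * L (e j) $ a)" for a
    by (subst onb_expand[OF assms(1), of "axis a 1"]) (simp add: sum scale)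
  then have "(\<Sum>a\<in>UNIV. L (axis a 1) $ a) = (\<Sum>a\<in>UNIV. \<Sum>j\<in>UNIV. (e j \<bullet> (G *v axis a 1)) * L (e j) $ a)"
    by simp
  also have "\<dots> = (\<Sum>j\<in>UNIV. \<Sum>a\<in>UNIV. (e j \<bullet> (G *v axis a 1)) * L (e j) $ a)" by (rule sum.swap)
  also have "\<dots> = (\<Sum>j\<in>UNIV. e j \<bullet> (G *v L (e j)))"
  proof (intro sum.cong refl)
    fix j
    have "e j \<bullet> (G *v L (e j)) = e j \<bullet> (G *v (\<Sum>a\<in>UNIV. (L (e j) $ a) *\<^sub>R axis a 1))"
      using vec_axis_sum[of "L (e j)"] by simp
    also have "\<dots> = (\<Sum>a\<in>UNIV. (e j \<bullet> (G *v axis a 1)) * L (e j) $ a)"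
      by (simp add: vec.sum matrix_vector_mult_scaleR inner_sum_right mult.commute
           linear_sum[OF matrix_vector_mul_linear])
    finally show "(\<Sum>a\<in>UNIV. (e j \<bullet> (G *v axis a 1)) * L (e j) $ a) = e j \<bullet> (G *v L (e j))" by simp
  qed
  finally show ?thesis .
qed

context riem_mfd
begin

definition gram_deriv :: "('a, 'm) chart \<Rightarrow> 'a \<Rightarrow> real ^ 'm \<Rightarrow> real ^ 'm ^ 'm" where
  "gram_deriv c p = frechet_derivative (\<lambda>y. gram M c (cinv c y)) (at (cmap c p))"

definition christoffel_vec :: "('a, 'm) chart \<Rightarrow> 'a \<Rightarrow> real ^ 'm \<Rightarrow> real ^ 'm \<Rightarrow> real ^ 'm" where
  "christoffel_vec c p x y = (\<chi> k. \<Sum>i\<in>UNIV. \<Sum>j\<in>UNIV. christoffel M c p k i j * x $ i * y $ j)"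

lemma gram_has_derivative:
  assumes "c \<in> charts_at M p"
  shows "((\<lambda>y. gram M c (cinv c y)) has_derivative gram_deriv c p) (at (cmap c p))"
  unfolding gram_deriv_def using assms Ck_on_SucD[OF gram_smooth[of c "Suc 0"], of "cmap c p"]
  by (auto simp: charts_at_iff o_def)

lemma gram_deriv_linear: "c \<in> charts_at M p \<Longrightarrow> linear (gram_deriv c p)"
  by (rule has_derivative_linear[OF gram_has_derivative])

lemma gram_deriv_sym:
  assumes c: "c \<in> charts_at M p"
  shows "x \<bullet> (gram_deriv c p h *v y) = y \<bullet> (gram_deriv c p h *v x)"
proof -
  have d: "((\<lambda>w. a \<bullet> (gram M c (cinv c w) *v b)) has_derivative (\<lambda>h. a \<bullet> (gram_deriv c p h *v b))) (at (cmap c p))" for a b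
    using bounded_bilinear.FDERIV[OF bounded_bilinear_matrix_vector_mult gram_has_derivative[OF c] has_derivative_const[of b]]
    by (intro has_derivative_inner_right) (simp add: matrix_vector_mult_0_right)
  have ca: "c \<in> atlas M" "p \<in> cdom c" using c by (auto simp: charts_at_iff)
  have "((\<lambda>w. y \<bullet> (gram M c (cinv c w) *v x)) has_derivative (\<lambda>h. x \<bullet> (gram_deriv c p h *v y))) (at (cmap c p))"
    by (rule has_derivative_transform_within_open[OF d open_cim[OF ca(1)]])
       (use ca ginner_sym[OF chart_at_cinv[OF ca(1)]] in auto)
  from has_derivative_unique[OF this d[of y x]] show ?thesis by metis
qed

lemma dgram_eq:
  assumes c: "c \<in> charts_at M p"
  shows "dgram M c p i j l = gram_deriv c p (axis i 1) $ j $ l"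
proof -
  have "((\<lambda>y. gram M c (cinv c y) $ j $ l) has_derivative (\<lambda>h. gram_deriv c p h $ j $ l)) (at (cmap c p))"
    by (intro bounded_linear.has_derivative[OF bounded_linear_vec_nth] gram_has_derivative c)
  from frechet_derivative_at[OF this] show ?thesis unfolding dgram_def by metis
qed

lemma gram_deriv_expand:
  assumes c: "c \<in> charts_at M p"
  shows "y \<bullet> (gram_deriv c p x *v z) = (\<Sum>i\<in>UNIV. \<Sum>j\<in>UNIV. \<Sum>l\<in>UNIV. x $ i * y $ j * z $ l * dgram M c p i j l)"
proof -
  have "gram_deriv c p x = (\<Sum>i\<in>UNIV. (x $ i) *\<^sub>R gram_deriv c p (axis i 1))"
    by (subst vec_axis_sum[of x]) (simp only: linear_sum[OF gram_deriv_linear[OF c]] linear_scale[OF gram_deriv_linear[OF c]])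
  then have "gram_deriv c p x $ j $ l = (\<Sum>i\<in>UNIV. x $ i * dgram M c p i j l)" for j l
    by (simp add: dgram_eq[OF c])
  then have "y \<bullet> (gram_deriv c p x *v z) = (\<Sum>j\<in>UNIV. \<Sum>l\<in>UNIV. \<Sum>i\<in>UNIV. x $ i * y $ j * z $ l * dgram M c p i j l)"
    by (simp add: inner_vec_def matrix_vector_mult_def sum_distrib_left sum_distrib_right mult_ac)
  also have "\<dots> = (\<Sum>j\<in>UNIV. \<Sum>i\<in>UNIV. \<Sum>l\<in>UNIV. x $ i * y $ j * z $ l * dgram M c p i j l)"
    by (intro sum.cong refl sum.swap)
  also have "\<dots> = (\<Sum>i\<in>UNIV. \<Sum>j\<in>UNIV. \<Sum>l\<in>UNIV. x $ i * y $ j * z $ l * dgram M c p i j l)"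
    by (rule sum.swap)
  finally show ?thesis .
qed

lemma gram_inv:
  assumes "c \<in> charts_at M p" shows "gram M c p *v (matrix_inv (gram M c p) *v a) = a"
proof -
  have "invertible (gram M c p)" using gram_det_pos[OF assms] by (simp add: invertible_det_nz)
  then have "gram M c p ** matrix_inv (gram M c p) = mat 1" unfolding invertible_def matrix_inv_def by (metis (mono_tags, lifting) someI_ex)
  then show ?thesis by (simp add: matrix_vector_mul_assoc)
qed

text \<open>Lowering the index cancels the inverse Gram matrix and leaves the Koszul formula for
  constant coordinate fields. Only this form of the connection is used in computations.\<close>

lemma christoffel_lower:
  assumes c: "c \<in> charts_at M p"
  shows "ginner M c p z (christoffel_vec c p x y) =
    (1/2) * (y \<bullet> (gram_deriv c p x *v z) + x \<bullet> (gram_deriv c p y *v z) - x \<bullet> (gram_deriv c p z *v y))"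
proof -
  let ?d = "dgram M c p"
  define a where "a = (\<chi> l. \<Sum>i\<in>UNIV. \<Sum>j\<in>UNIV. (1/2) * (?d i j l + ?d j i l - ?d l i j) * x $ i * y $ j)"
  have "christoffel_vec c p x y = matrix_inv (gram M c p) *v a"
  proof -
    have "christoffel_vec c p x y $ k = (matrix_inv (gram M c p) *v a) $ k" for k
    proof -
      have "christoffel_vec c p x y $ k = (\<Sum>i\<in>UNIV. \<Sum>j\<in>UNIV. \<Sum>l\<in>UNIV. matrix_inv (gram M c p) $ k $ l * ((1/2) * (?d i j l + ?d j i l - ?d l i j) * x $ i * y $ j))"
        by (simp add: christoffel_vec_def christoffel_def sum_distrib_left sum_distrib_right mult_ac)
      also have "\<dots> = (\<Sum>i\<in>UNIV. \<Sum>l\<in>UNIV. \<Sum>j\<in>UNIV. matrix_inv (gram M c p) $ k $ l * ((1/2) * (?d i j l + ?d j i l - ?d l i j) * x $ i * y $ j))"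
        by (intro sum.cong refl sum.swap)
      also have "\<dots> = (\<Sum>l\<in>UNIV. \<Sum>i\<in>UNIV. \<Sum>j\<in>UNIV. matrix_inv (gram M c p) $ k $ l * ((1/2) * (?d i j l + ?d j i l - ?d l i j) * x $ i * y $ j))"
        by (rule sum.swap)
      also have "\<dots> = (matrix_inv (gram M c p) *v a) $ k"
        by (simp add: a_def matrix_vector_mult_def sum_distrib_left)
      finally show ?thesis .
    qed
    then show ?thesis by (simp add: vec_eq_iff)
  qed
  then have "ginner M c p z (christoffel_vec c p x y) = z \<bullet> a" by (simp only: gram_inv[OF c])
  also have "z \<bullet> a = (\<Sum>l\<in>UNIV. \<Sum>i\<in>UNIV. \<Sum>j\<in>UNIV. (1/2) * (x $ i * y $ j * z $ l * ?d i j l)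
      + (1/2) * (x $ i * y $ j * z $ l * ?d j i l) - (1/2) * (x $ i * y $ j * z $ l * ?d l i j))"
    by (simp add: inner_vec_def a_def sum_distrib_left algebra_simps)
  also have "\<dots> = (1/2) * (\<Sum>l\<in>UNIV. \<Sum>i\<in>UNIV. \<Sum>j\<in>UNIV. x $ i * y $ j * z $ l * ?d i j l)
      + (1/2) * (\<Sum>l\<in>UNIV. \<Sum>i\<in>UNIV. \<Sum>j\<in>UNIV. x $ i * y $ j * z $ l * ?d j i l)
      - (1/2) * (\<Sum>l\<in>UNIV. \<Sum>i\<in>UNIV. \<Sum>j\<in>UNIV. x $ i * y $ j * z $ l * ?d l i j)"
    by (simp only: sum.distrib sum_subtractf sum_distrib_left)
  also have "(\<Sum>l\<in>UNIV. \<Sum>i\<in>UNIV. \<Sum>j\<in>UNIV. x $ i * y $ j * z $ l * ?d i j l) = y \<bullet> (gram_deriv c p x *v z)"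
  proof -
    have "(\<Sum>l\<in>UNIV. \<Sum>i\<in>UNIV. \<Sum>j\<in>UNIV. x $ i * y $ j * z $ l * ?d i j l) = (\<Sum>i\<in>UNIV. \<Sum>l\<in>UNIV. \<Sum>j\<in>UNIV. x $ i * y $ j * z $ l * ?d i j l)"
      by (rule sum.swap)
    also have "\<dots> = (\<Sum>i\<in>UNIV. \<Sum>j\<in>UNIV. \<Sum>l\<in>UNIV. x $ i * y $ j * z $ l * ?d i j l)"
      by (intro sum.cong refl sum.swap)
    finally show ?thesis by (simp only: gram_deriv_expand[OF c])
  qed
  also have "(\<Sum>l\<in>UNIV. \<Sum>i\<in>UNIV. \<Sum>j\<in>UNIV. x $ i * y $ j * z $ l * ?d j i l) = x \<bullet> (gram_deriv c p y *v z)"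
  proof -
    have "(\<Sum>l\<in>UNIV. \<Sum>i\<in>UNIV. \<Sum>j\<in>UNIV. x $ i * y $ j * z $ l * ?d j i l) = (\<Sum>l\<in>UNIV. \<Sum>j\<in>UNIV. \<Sum>i\<in>UNIV. x $ i * y $ j * z $ l * ?d j i l)"
      by (intro sum.cong refl sum.swap)
    also have "\<dots> = (\<Sum>j\<in>UNIV. \<Sum>l\<in>UNIV. \<Sum>i\<in>UNIV. x $ i * y $ j * z $ l * ?d j i l)"
      by (rule sum.swap)
    also have "\<dots> = (\<Sum>j\<in>UNIV. \<Sum>i\<in>UNIV. \<Sum>l\<in>UNIV. x $ i * y $ j * z $ l * ?d j i l)"
      by (intro sum.cong refl sum.swap)
    finally show ?thesis by (simp only: gram_deriv_expand[OF c] mult.commute[of "x $ _"])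
  qed
  also have "(\<Sum>l\<in>UNIV. \<Sum>i\<in>UNIV. \<Sum>j\<in>UNIV. x $ i * y $ j * z $ l * ?d l i j) = x \<bullet> (gram_deriv c p z *v y)"
    by (simp add: gram_deriv_expand[OF c] mult_ac)
  finally show ?thesis by (simp add: algebra_simps)
qed

lemma cov_deriv_chart:
  "c \<in> charts_at M p \<Longrightarrow> cov_deriv M p X Y c =
     frechet_derivative (\<lambda>y. Y (cinv c y) c) (at (cmap c p)) (X c) + christoffel_vec c p (X c) (Y p c)"
  by (simp add: cov_deriv_def christoffel_vec_def)

lemma frame_has_derivative:
  assumes "orthonormal_frame_on M W e" "p \<in> W" "c \<in> charts_at M p"
  shows "((\<lambda>y. e i (cinv c y) c) has_derivative frechet_derivative (\<lambda>y. e i (cinv c y) c) (at (cmap c p))) (at (cmap c p))"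
  using Ck_on_SucD[OF frame_Ck_on[OF assms(1), of c "Suc 0"], of "cmap c p"] assms(2,3) by (auto simp: charts_at_iff)

text \<open>The derivative of the constant function g(e_i, e_j).\<close>

lemma frame_orthonormal_deriv:
  fixes c
  assumes e: "orthonormal_frame_on M W e" "p \<in> W" "c \<in> charts_at M p"
  defines "E \<equiv> \<lambda>i. e i p c" and "DE \<equiv> \<lambda>i. frechet_derivative (\<lambda>y. e i (cinv c y) c) (at (cmap c p))"
  shows "ginner M c p (DE i h) (E j) + E i \<bullet> (gram_deriv c p h *v E j) + ginner M c p (E i) (DE j h) = 0"
proof -
  have ca: "c \<in> atlas M" "p \<in> cdom c" using e(3) by (auto simp: charts_at_iff)
  let ?f = "\<lambda>y. e i (cinv c y) c \<bullet> (gram M c (cinv c y) *v e j (cinv c y) c)"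
  have oW: "open W" using e(1) by (simp add: orthonormal_frame_on_def)
  have d: "(?f has_derivative (\<lambda>h. E i \<bullet> (gram M c p *v DE j h + gram_deriv c p h *v E j) + DE i h \<bullet> (gram M c p *v E j))) (at (cmap c p))"
    using has_derivative_inner[OF frame_has_derivative[OF e, of i]
       bounded_bilinear.FDERIV[OF bounded_bilinear_matrix_vector_mult gram_has_derivative[OF e(3)] frame_has_derivative[OF e, of j]]] ca
    by (simp add: E_def DE_def)
  have "((\<lambda>y. if i = j then 1 else 0) has_derivative (\<lambda>h. E i \<bullet> (gram M c p *v DE j h + gram_deriv c p h *v E j) + DE i h \<bullet> (gram M c p *v E j))) (at (cmap c p))"
  proof (rule has_derivative_transform_within_open[OF d open_cmap_image[OF ca(1) oW]])
    show "cmap c p \<in> cmap c ` (cdom c \<inter> W)" using ca e(2) by auto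
    fix y assume "y \<in> cmap c ` (cdom c \<inter> W)"
    then have "cinv c y \<in> W" "c \<in> charts_at M (cinv c y)" using ca by (auto simp: charts_at_iff)
    then show "?f y = (if i = j then 1 else 0)" using frame_onb[OF e(1)] by (simp add: onb_def)
  qed
  from has_derivative_unique[OF this has_derivative_const]
  have "E i \<bullet> (gram M c p *v DE j h + gram_deriv c p h *v E j) + DE i h \<bullet> (gram M c p *v E j) = 0" by metis
  then show ?thesis by (simp add: inner_add_right)
qed

text \<open>The right side is g(e_j, [e_i, e_j]): metric compatibility moves the derivative to e_i,
  and since the torsion vanishes, exchanging the two fields costs a bracket; the remaining term
  g(nabla_{e_i} e_j, e_j) is half the derivative of a constant. No Christoffel symbol
  survives.\<close>

lemma cov_frame_lower:
  assumes e: "orthonormal_frame_on M W e" "p \<in> W" "c \<in> charts_at M p"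
  defines "E \<equiv> \<lambda>i. e i p c" and "DE \<equiv> \<lambda>i. frechet_derivative (\<lambda>y. e i (cinv c y) c) (at (cmap c p))"
  shows "ginner M c p (E i) (cov_deriv M p (e j p) (e j) c) = ginner M c p (E j) (DE j (E i) - DE i (E j))"
proof -
  have "ginner M c p (E i) (cov_deriv M p (e j p) (e j) c) = ginner M c p (E i) (DE j (E j)) + ginner M c p (E i) (christoffel_vec c p (E j) (E j))"
    by (simp add: cov_deriv_chart[OF e(3)] E_def DE_def matrix_vector_right_distrib inner_add_right)
  also have "ginner M c p (E i) (christoffel_vec c p (E j) (E j)) = E j \<bullet> (gram_deriv c p (E j) *v E i) - (1/2) * (E j \<bullet> (gram_deriv c p (E i) *v E j))"
    by (simp add: christoffel_lower[OF e(3)])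
  also have "ginner M c p (E i) (DE j (E j)) = ginner M c p (DE j (E j)) (E i)" by (rule ginner_sym[OF e(3)])
  finally have 1: "ginner M c p (E i) (cov_deriv M p (e j p) (e j) c) = ginner M c p (DE j (E j)) (E i)
      + (E j \<bullet> (gram_deriv c p (E j) *v E i) - (1/2) * (E j \<bullet> (gram_deriv c p (E i) *v E j)))" .
  have 2: "ginner M c p (DE j (E j)) (E i) + E j \<bullet> (gram_deriv c p (E j) *v E i) + ginner M c p (E j) (DE i (E j)) = 0"
    unfolding E_def DE_def by (rule frame_orthonormal_deriv[OF e])
  have "ginner M c p (DE j (E i)) (E j) + E j \<bullet> (gram_deriv c p (E i) *v E j) + ginner M c p (E j) (DE j (E i)) = 0"
    unfolding E_def DE_def by (rule frame_orthonormal_deriv[OF e])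
  then have 3: "2 * ginner M c p (E j) (DE j (E i)) + E j \<bullet> (gram_deriv c p (E i) *v E j) = 0"
    using ginner_sym[OF e(3), of "DE j (E i)" "E j"] by simp
  have "ginner M c p (E j) (DE j (E i) - DE i (E j)) = ginner M c p (E j) (DE j (E i)) - ginner M c p (E j) (DE i (E j))"
    by (simp add: matrix_vector_mult_diff_distrib inner_diff_right)
  with 1 2 3 show ?thesis by simp
qed

text \<open>Chart independence of the Lie bracket. Each derivative alone picks up a second
  derivative of the coordinate change; in the difference these cancel by symmetry.\<close>

lemma frame_bracket_change:
  assumes e: "orthonormal_frame_on M W e" "p \<in> W" "c \<in> charts_at M p" and d: "d \<in> charts_at M p"
  defines "E \<equiv> \<lambda>c i. e i p c" and "DE \<equiv> \<lambda>c i. frechet_derivative (\<lambda>y. e i (cinv c y) c) (at (cmap c p))"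
  shows "DE d j (E d i) - DE d i (E d j) = jac c d p (DE c j (E c i) - DE c i (E c j))"
proof -
  let ?T = "cmap d \<circ> cinv c"
  let ?y = "cmap c p"
  have ca: "c \<in> atlas M" "p \<in> cdom c" "d \<in> atlas M" "p \<in> cdom d" using e(3) d by (auto simp: charts_at_iff)
  let ?O = "cmap c ` (cdom c \<inter> cdom d)"
  have oO: "open ?O" and yO: "?y \<in> ?O" using ca by (auto intro: open_overlap)
  define D2 where "D2 x = frechet_derivative (\<lambda>z. frechet_derivative ?T (at z) x) (at ?y)" for x
  have T2: "Ck_on 2 ?O ?T" by (rule transition_smooth[OF ca(1,3)])
  have D2: "((\<lambda>z. frechet_derivative ?T (at z) x) has_derivative D2 x) (at ?y)" for x
    using T2 Ck_on_SucD[of 0 ?O "\<lambda>z. frechet_derivative ?T (at z) x" ?y] yO by (simp add: D2_def numeral_2_eq_2)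
  have sym: "D2 x h = D2 h x" for x h
    unfolding D2_def by (rule second_derivative_symmetric[OF oO yO T2])
  have lin: "frechet_derivative ?T (at z) x = (\<Sum>a\<in>UNIV. (x $ a) *\<^sub>R frechet_derivative ?T (at z) (axis a 1))" if "z \<in> ?O" for z x
  proof -
    have l: "linear (frechet_derivative ?T (at z))"
      using Ck_on_SucD[of 1 ?O ?T z] T2 that by (intro has_derivative_linear) (simp add: numeral_2_eq_2)
    show ?thesis by (subst vec_axis_sum[of x]) (simp only: linear_sum[OF l] linear_scale[OF l])
  qed
  have D2lin: "D2 x h = (\<Sum>a\<in>UNIV. (x $ a) *\<^sub>R D2 (axis a 1) h)" for x h
  proof -
    have "((\<lambda>z. \<Sum>a\<in>UNIV. (x $ a) *\<^sub>R frechet_derivative ?T (at z) (axis a 1)) has_derivative (\<lambda>h. \<Sum>a\<in>UNIV. (x $ a) *\<^sub>R D2 (axis a 1) h)) (at ?y)"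
      by (intro has_derivative_sum has_derivative_scaleR_right D2)
    then have "((\<lambda>z. frechet_derivative ?T (at z) x) has_derivative (\<lambda>h. \<Sum>a\<in>UNIV. (x $ a) *\<^sub>R D2 (axis a 1) h)) (at ?y)"
      by (rule has_derivative_transform_within_open[OF _ oO yO]) (rule lin[symmetric])
    from has_derivative_unique[OF D2 this] show ?thesis by metis
  qed
  \<comment> \<open>In the chart d the components of e_k are the derivative of the coordinate change
    applied to those in c; the product rule yields the non-tensorial term \<open>D2\<close>.\<close>
  have key: "DE d k (jac c d p h) = D2 (E c k) h + jac c d p (DE c k h)" for k h
  proof -
    have E: "((\<lambda>y. e k (cinv c y) c) has_derivative DE c k) (at ?y)" unfolding DE_def by (rule frame_has_derivative[OF e])
    have Ed: "((\<lambda>y. e k (cinv d y) d) has_derivative DE d k) (at (cmap d p))" unfolding DE_def by (rule frame_has_derivative[OF e(1,2) d])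
    have l: "((\<lambda>y. e k (cinv c y) d) has_derivative (\<lambda>h. DE d k (jac c d p h))) (at ?y)"
      by (rule chart_change_has_derivative[OF e(3) d Ed])
    have "((\<lambda>y. \<Sum>a\<in>UNIV. (e k (cinv c y) c $ a) *\<^sub>R frechet_derivative ?T (at y) (axis a 1)) has_derivative
       (\<lambda>h. \<Sum>a\<in>UNIV. (e k (cinv c ?y) c $ a) *\<^sub>R D2 (axis a 1) h + (DE c k h $ a) *\<^sub>R frechet_derivative ?T (at ?y) (axis a 1))) (at ?y)"
      by (intro has_derivative_sum has_derivative_scaleR D2 bounded_linear.has_derivative[OF bounded_linear_vec_nth] E)
    then have "((\<lambda>y. e k (cinv c y) d) has_derivative
       (\<lambda>h. \<Sum>a\<in>UNIV. (e k (cinv c ?y) c $ a) *\<^sub>R D2 (axis a 1) h + (DE c k h $ a) *\<^sub>R frechet_derivative ?T (at ?y) (axis a 1))) (at ?y)"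
    proof (rule has_derivative_transform_within_open)
      have oW: "open W" using e(1) by (simp add: orthonormal_frame_on_def)
      show "open (cmap c ` (cdom c \<inter> (cdom d \<inter> W)))" by (intro open_cmap_image open_Int open_cdom oW ca)
      show "?y \<in> cmap c ` (cdom c \<inter> (cdom d \<inter> W))" using ca e(2) by auto
      fix y assume "y \<in> cmap c ` (cdom c \<inter> (cdom d \<inter> W))"
      then obtain q where q: "y = cmap c q" "q \<in> cdom c" "q \<in> cdom d" "q \<in> W" by blast
      then have ch: "c \<in> charts_at M q" "d \<in> charts_at M q" using ca by (auto simp: charts_at_iff)
      have "y \<in> ?O" using q by auto
      have "e k q d = jac c d q (e k q c)" by (rule tangent_jac[OF frame_tangent[OF e(1) q(4)] ch])
      also have "\<dots> = frechet_derivative ?T (at y) (e k q c)" using q by (simp add: jac_def)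
      finally show "(\<Sum>a\<in>UNIV. (e k (cinv c y) c $ a) *\<^sub>R frechet_derivative ?T (at y) (axis a 1)) = e k (cinv c y) d"
        using q ca lin[OF \<open>y \<in> ?O\<close>, of "e k q c"] by simp
    qed
    from has_derivative_unique[OF l this]
    have "DE d k (jac c d p h) = (\<Sum>a\<in>UNIV. (e k (cinv c ?y) c $ a) *\<^sub>R D2 (axis a 1) h + (DE c k h $ a) *\<^sub>R frechet_derivative ?T (at ?y) (axis a 1))"
      by metis
    also have "\<dots> = D2 (E c k) h + frechet_derivative ?T (at ?y) (DE c k h)"
      using ca by (simp only: sum.distrib D2lin[symmetric] lin[OF yO, symmetric] E_def cinv_cmap)
    finally show ?thesis by (simp add: jac_def)
  qed
  have Ed: "E d k = jac c d p (E c k)" for k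
    unfolding E_def by (rule tangent_jac[OF frame_tangent[OF e(1,2)] e(3) d])
  interpret J: bounded_linear "jac c d p" by (rule jac_linear[OF e(3) d])
  show ?thesis unfolding Ed key J.diff sym[of "E c j"] by simp
qed

text \<open>The products of the covariant derivative with the frame are brackets, so they agree in
  all charts and determine the vector. This bypasses the transformation law of the Christoffel
  symbols.\<close>

lemma cov_frame_tangent:
  assumes e: "orthonormal_frame_on M W e" "p \<in> W"
  shows "cov_deriv M p (e j p) (e j) \<in> tangent_space M p"
proof -
  obtain c where c: "c \<in> charts_at M p" using ex_chart by blast
  let ?C = "cov_deriv M p (e j p) (e j)"
  show ?thesis
  proof (rule tangentI[OF c])
    fix d assume d: "d \<in> charts_at M p"
    let ?E = "\<lambda>c i. e i p c"
    interpret J: bounded_linear "jac c d p" by (rule jac_linear[OF c d])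
    have Ed: "?E d k = jac c d p (?E c k)" for k
      by (rule tangent_jac[OF frame_tangent[OF e] c d])
    have "ginner M d p (?E d i) (?C d) = ginner M c p (?E c i) (?C c)" for i
      unfolding cov_frame_lower[OF e d] cov_frame_lower[OF e c] frame_bracket_change[OF e c d]
      unfolding Ed ginner_jac[OF c d] ..
    then have "?C d = (\<Sum>i\<in>UNIV. (ginner M c p (?E c i) (?C c)) *\<^sub>R ?E d i)"
      using onb_expand[OF frame_onb[OF e d], of "?C d"] by simp
    also have "\<dots> = jac c d p (\<Sum>i\<in>UNIV. (ginner M c p (?E c i) (?C c)) *\<^sub>R ?E c i)"
      unfolding Ed by (simp only: J.sum J.scaleR)
    also have "\<dots> = jac c d p (?C c)" using onb_expand[OF frame_onb[OF e c], of "?C c"] by simp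
    finally show "?C d = jac c d p (?C c)" .
  qed (simp add: cov_deriv_def)
qed

text \<open>Jacobi's formula followed by the square root, which accounts for the factor 1/2.\<close>

lemma dens_has_derivative:
  assumes e: "onb (gram M c p) E" and c: "c \<in> charts_at M p"
  shows "(dens c has_derivative (\<lambda>h. dens c (cmap c p) * ((1/2) * (\<Sum>j\<in>UNIV. E j \<bullet> (gram_deriv c p h *v E j))))) (at (cmap c p))"
proof -
  have ca: "c \<in> atlas M" "p \<in> cdom c" using c by (auto simp: charts_at_iff)
  have "((\<lambda>y. det (gram M c (cinv c y))) has_derivative (\<lambda>h. det (gram M c p) * (\<Sum>i\<in>UNIV. E i \<bullet> (gram_deriv c p h *v E i)))) (at (cmap c p))"
    using has_derivative_det_onb[OF gram_has_derivative[OF c], of E] e ca by simp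
  then have "((\<lambda>y. sqrt (det (gram M c (cinv c y)))) has_derivative
     (\<lambda>h. det (gram M c p) * (\<Sum>i\<in>UNIV. E i \<bullet> (gram_deriv c p h *v E i)) * (inverse (sqrt (det (gram M c p))) / 2))) (at (cmap c p))"
    using ca gram_det_pos[OF c] by (auto intro!: derivative_eq_intros)
  moreover have "det (gram M c p) * x * (inverse (sqrt (det (gram M c p))) / 2) = dens c (cmap c p) * ((1/2) * x)" for x
  proof -
    have "det (gram M c p) = sqrt (det (gram M c p)) * sqrt (det (gram M c p))" using gram_det_pos[OF c] by simp
    then have "det (gram M c p) * inverse (sqrt (det (gram M c p))) = sqrt (det (gram M c p))"
      using gram_det_pos[OF c] by (metis (no_types, lifting) less_irrefl mult.assoc mult.right_neutral real_sqrt_eq_0_iff right_inverse)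
    then show ?thesis using ca by (simp add: dens_def mult_ac)
  qed
  ultimately have "((\<lambda>y. sqrt (det (gram M c (cinv c y)))) has_derivative
     (\<lambda>h. dens c (cmap c p) * ((1/2) * (\<Sum>j\<in>UNIV. E j \<bullet> (gram_deriv c p h *v E j))))) (at (cmap c p))" by (simp only:)
  then show ?thesis
    by (rule has_derivative_transform_within_open[OF _ open_cim[OF ca(1)]]) (use ca in \<open>auto simp: dens_def\<close>)
qed

text \<open>Connects the two forms of the divergence: the left side is the coordinate expression
  that integrates by parts, the right side the frame expression that the definition of
  \<open>divergence\<close> produces. By the product rule it reduces to the divergence of a single
  frame field.\<close>

lemma coordinate_divergence_frame:
  assumes e: "orthonormal_frame_on M W e" "p \<in> W" "c \<in> charts_at M p"
    and f: "\<And>k. ((\<lambda>y. f k (cinv c y)) has_derivative Df k) (at (cmap c p))"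
    and X: "\<And>q. q \<in> W \<Longrightarrow> X q c = (\<Sum>k\<in>UNIV. f k q *\<^sub>R e k q c)"
    and D: "((\<lambda>y. dens c y *\<^sub>R X (cinv c y) c) has_derivative D) (at (cmap c p))"
  shows "(\<Sum>a\<in>UNIV. D (axis a 1) $ a) = dens c (cmap c p) *
    ((\<Sum>k\<in>UNIV. Df k (e k p c)) - (\<Sum>k\<in>UNIV. f k p * (\<Sum>j\<in>UNIV. metric M p (e k p) (cov_deriv M p (e j p) (e j)))))"
proof -
  define E where "E i = e i p c" for i
  define DE where "DE i = frechet_derivative (\<lambda>y. e i (cinv c y) c) (at (cmap c p))" for i
  have ca: "c \<in> atlas M" "p \<in> cdom c" using e(3) by (auto simp: charts_at_iff)
  have oE: "onb (gram M c p) E" using frame_onb[OF e] by (simp add: E_def[abs_def])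
  let ?w = "dens c (cmap c p)"
  let ?tr = "\<lambda>h. \<Sum>j\<in>UNIV. E j \<bullet> (gram_deriv c p h *v E j)"
  define t where "t h = ?tr h" for h
  have DE: "((\<lambda>y. e k (cinv c y) c) has_derivative DE k) (at (cmap c p))" for k
    unfolding DE_def by (rule frame_has_derivative[OF e])
  have "((\<lambda>y. dens c y *\<^sub>R (\<Sum>k\<in>UNIV. f k (cinv c y) *\<^sub>R e k (cinv c y) c)) has_derivative
     (\<lambda>h. ?w *\<^sub>R (\<Sum>k\<in>UNIV. f k (cinv c (cmap c p)) *\<^sub>R DE k h + Df k h *\<^sub>R e k (cinv c (cmap c p)) c)
        + (?w * ((1/2) * ?tr h)) *\<^sub>R (\<Sum>k\<in>UNIV. f k (cinv c (cmap c p)) *\<^sub>R e k (cinv c (cmap c p)) c))) (at (cmap c p))"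
    by (intro has_derivative_scaleR has_derivative_sum dens_has_derivative[OF oE e(3)] f DE)
  then have "((\<lambda>y. dens c y *\<^sub>R X (cinv c y) c) has_derivative
     (\<lambda>h. ?w *\<^sub>R (\<Sum>k\<in>UNIV. f k (cinv c (cmap c p)) *\<^sub>R DE k h + Df k h *\<^sub>R e k (cinv c (cmap c p)) c)
        + (?w * ((1/2) * ?tr h)) *\<^sub>R (\<Sum>k\<in>UNIV. f k (cinv c (cmap c p)) *\<^sub>R e k (cinv c (cmap c p)) c))) (at (cmap c p))"
  proof (rule has_derivative_transform_within_open)
    have oW: "open W" using e(1) by (simp add: orthonormal_frame_on_def)
    show "open (cmap c ` (cdom c \<inter> W))" by (intro open_cmap_image oW ca)
    show "cmap c p \<in> cmap c ` (cdom c \<inter> W)" using ca e(2) by auto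
    show "dens c y *\<^sub>R (\<Sum>k\<in>UNIV. f k (cinv c y) *\<^sub>R e k (cinv c y) c) = dens c y *\<^sub>R X (cinv c y) c" if "y \<in> cmap c ` (cdom c \<inter> W)" for y
      using X[of "cinv c y"] that ca by auto
  qed
  from has_derivative_unique[OF D this] ca
  have Dh: "D h = ?w *\<^sub>R ((\<Sum>k\<in>UNIV. f k p *\<^sub>R DE k h + Df k h *\<^sub>R E k) + ((1/2) * t h) *\<^sub>R (\<Sum>k\<in>UNIV. f k p *\<^sub>R E k))" for h
    by (simp add: E_def t_def scaleR_add_right)
  have lD: "linear (DE k)" for k by (rule has_derivative_linear[OF DE])
  have lf: "linear (Df k)" for k by (rule has_derivative_linear[OF f])
  have 1: "(\<Sum>a\<in>UNIV. D (axis a 1) $ a) = ?w * (\<Sum>k\<in>UNIV. f k p * (\<Sum>a\<in>UNIV. DE k (axis a 1) $ a)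
      + (\<Sum>a\<in>UNIV. Df k (axis a 1) * E k $ a) + f k p * (\<Sum>a\<in>UNIV. (1/2) * t (axis a 1) * E k $ a))"
  proof -
    have "D (axis a 1) $ a = (\<Sum>k\<in>UNIV. ?w * (f k p * DE k (axis a 1) $ a + Df k (axis a 1) * E k $ a + f k p * ((1/2) * t (axis a 1) * E k $ a)))" for a
      unfolding Dh by (simp add: sum_distrib_left sum.distrib algebra_simps)
    then have "(\<Sum>a\<in>UNIV. D (axis a 1) $ a) = (\<Sum>a\<in>UNIV. \<Sum>k\<in>UNIV. ?w * (f k p * DE k (axis a 1) $ a + Df k (axis a 1) * E k $ a + f k p * ((1/2) * t (axis a 1) * E k $ a)))"
      by simp
    also have "\<dots> = (\<Sum>k\<in>UNIV. \<Sum>a\<in>UNIV. ?w * (f k p * DE k (axis a 1) $ a + Df k (axis a 1) * E k $ a + f k p * ((1/2) * t (axis a 1) * E k $ a)))"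
      by (rule sum.swap)
    finally show ?thesis by (simp only: sum_distrib_left sum.distrib distrib_left)
  qed
  have 2: "(\<Sum>a\<in>UNIV. Df k (axis a 1) * E k $ a) = Df k (E k)" for k
    by (subst (2) vec_axis_sum[of "E k"]) (simp add: linear_sum[OF lf] linear_scale[OF lf] mult.commute)
  have ltr: "linear t" unfolding t_def
    by (rule linearI) (simp_all add: linear_add[OF gram_deriv_linear[OF e(3)]] linear_scale[OF gram_deriv_linear[OF e(3)]]
        matrix_vector_mult_add_rdistrib inner_add_right sum.distrib sum_distrib_left
        bounded_bilinear.scaleR_left[OF bounded_bilinear_matrix_vector_mult])
  have 3: "(\<Sum>a\<in>UNIV. (1/2) * t (axis a 1) * E k $ a) = (1/2) * t (E k)" for k
  proof -
    have "t (E k) = (\<Sum>a\<in>UNIV. (E k $ a) *\<^sub>R t (axis a 1))"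
      by (subst (1) vec_axis_sum[of "E k"]) (simp only: linear_sum[OF ltr] linear_scale[OF ltr])
    then show ?thesis by (simp add: sum_distrib_left mult_ac)
  qed
  \<comment> \<open>The left side is the divergence of e_k: the trace of its coordinate derivative
    plus the logarithmic derivative of the density along it.\<close>
  have 4: "(\<Sum>a\<in>UNIV. DE k (axis a 1) $ a) + (1/2) * t (E k) = - (\<Sum>j\<in>UNIV. metric M p (e k p) (cov_deriv M p (e j p) (e j)))" for k
  proof -
    have "metric M p (e k p) (cov_deriv M p (e j p) (e j)) = - (E j \<bullet> (gram M c p *v DE k (E j))) - (1/2) * (E j \<bullet> (gram_deriv c p (E k) *v E j))" for j
    proof -
      have "metric M p (e k p) (cov_deriv M p (e j p) (e j)) = ginner M c p (E j) (DE j (E k) - DE k (E j))"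
        using metric_gram[OF e(3) frame_tangent[OF e(1,2)] cov_frame_tangent[OF e(1,2)]] cov_frame_lower[OF e]
        by (simp add: E_def DE_def)
      also have "\<dots> = ginner M c p (E j) (DE j (E k)) - ginner M c p (E j) (DE k (E j))"
        by (simp add: matrix_vector_mult_diff_distrib inner_diff_right)
      also have "ginner M c p (E j) (DE j (E k)) = - (1/2) * (E j \<bullet> (gram_deriv c p (E k) *v E j))"
      proof -
        have "ginner M c p (DE j (E k)) (E j) + E j \<bullet> (gram_deriv c p (E k) *v E j) + ginner M c p (E j) (DE j (E k)) = 0"
          unfolding E_def DE_def by (rule frame_orthonormal_deriv[OF e])
        then show ?thesis using ginner_sym[OF e(3), of "DE j (E k)" "E j"] by simp
      qed
      finally show ?thesis by simp
    qed
    then show ?thesis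
      unfolding onb_trace_linear[OF oE lD] by (simp add: t_def sum_negf sum_subtractf sum_distrib_left)
  qed
  have "(\<Sum>a\<in>UNIV. D (axis a 1) $ a) = ?w * (\<Sum>k\<in>UNIV. Df k (E k) + f k p * ((\<Sum>a\<in>UNIV. DE k (axis a 1) $ a) + (1/2) * t (E k)))"
    unfolding 1 2 3 by (intro arg_cong[where f="(*) ?w"] sum.cong refl) (simp only: distrib_left add_ac)
  also have "\<dots> = ?w * ((\<Sum>k\<in>UNIV. Df k (e k p c)) - (\<Sum>k\<in>UNIV. f k p * (\<Sum>j\<in>UNIV. metric M p (e k p) (cov_deriv M p (e j p) (e j)))))"
    unfolding 4 by (simp add: sum.distrib sum_negf sum_subtractf E_def)
  finally show ?thesis .
qed

end

subsection \<open>The stress form paired with a parallel section\<close>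

lemma Ck_on_local:
  assumes "open S" "\<And>y. y \<in> S \<Longrightarrow> \<exists>T. open T \<and> y \<in> T \<and> Ck_on k T f"
  shows "Ck_on k S f"
  using assms(2)
proof (induction k arbitrary: f)
  case 0
  show ?case
    unfolding Ck_on.simps
  proof (rule continuous_at_imp_continuous_on, rule ballI)
    fix y assume "y \<in> S"
    then obtain T where "open T" "y \<in> T" "continuous_on T f" using 0 by auto
    then show "isCont f y" by (simp add: continuous_on_eq_continuous_at)
  qed
next
  case (Suc k)
  show ?case unfolding Ck_on.simps
  proof (intro conjI ballI allI)
    fix y assume "y \<in> S"
    then obtain T where "open T" "y \<in> T" "Ck_on (Suc k) T f" using Suc.prems by blast
    then show "f differentiable (at y)" by simp
  next
    fix v
    show "Ck_on k S (\<lambda>y. frechet_derivative f (at y) v)"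
    proof (rule Suc.IH)
      fix y assume "y \<in> S"
      then obtain T where "open T" "y \<in> T" "Ck_on (Suc k) T f" using Suc.prems by blast
      then show "\<exists>T. open T \<and> y \<in> T \<and> Ck_on k T (\<lambda>y. frechet_derivative f (at y) v)" by (intro exI[of _ T]) simp
    qed
  qed
qed

text \<open>At 0 only the derivative of \<open>halfline_deriv F\<close> from the right is available.
  Since n never becomes negative, the chain rule within the range of n applies even where n
  vanishes.\<close>

lemma C1_halfline_compose:
  assumes "C2_halfline F" "open S" and n: "Ck_on 1 S n" "\<And>y. n y \<ge> 0"
  shows "Ck_on 1 S (\<lambda>y. halfline_deriv F (n y))"
proof -
  let ?g = "halfline_deriv F" and ?g' = "halfline_deriv (halfline_deriv F)"
  have g: "(?g has_vector_derivative ?g' t) (at t within {0..})" if "t \<ge> 0" for t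
  proof -
    have "?g differentiable (at t within {0..})" using assms(1) that by (auto simp: C2_halfline_def differentiable_on_def)
    then show ?thesis unfolding halfline_deriv_def[of ?g] by (simp add: vector_derivative_works[symmetric])
  qed
  have "Ck_on (Suc 0) S (\<lambda>y. ?g (n y))"
  proof (rule Ck_on_SucI[OF assms(2)])
    fix y assume y: "y \<in> S"
    have "(n has_derivative frechet_derivative n (at y)) (at y)" using Ck_on_SucD[of 0 S n y] n(1) y by simp
    moreover have "(?g has_derivative (\<lambda>h. h *\<^sub>R ?g' (n y))) (at (n y) within range n)"
      using g[OF n(2)] n(2) unfolding has_vector_derivative_def by (auto intro: has_derivative_subset)
    ultimately show "((\<lambda>y. ?g (n y)) has_derivative (\<lambda>v. frechet_derivative n (at y) v *\<^sub>R ?g' (n y))) (at y)"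
      by (rule has_derivative_in_compose)
  next
    fix v
    have "continuous_on S n" using n(1) Ck_on_continuous_on by blast
    moreover have "continuous_on {0..} ?g'" using assms(1) by (simp add: C2_halfline_def)
    ultimately have "continuous_on S (\<lambda>y. ?g' (n y))" using n(2) by (auto intro: continuous_on_compose2)
    moreover have "continuous_on S (\<lambda>y. frechet_derivative n (at y) v)" using n(1) by simp
    ultimately show "Ck_on 0 S (\<lambda>y. frechet_derivative n (at y) v *\<^sub>R ?g' (n y))" by (auto intro: continuous_intros)
  qed
  then show ?thesis by simp
qed

context riem_mfd
begin

lemma ginner_Cauchy_Schwarz:
  assumes "c \<in> charts_at M p" shows "(ginner M c p x y)\<^sup>2 \<le> ginner M c p x x * ginner M c p y y"
proof -
  obtain e where e: "onb (gram M c p) e" using ex_onb[OF assms] by blast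
  note P = onb_parseval[OF e ginner_sym[OF assms]]
  have "ginner M c p a a = (\<Sum>i\<in>UNIV. (e i \<bullet> (gram M c p *v a))\<^sup>2)" for a
    unfolding P[of a a] by (simp add: power2_eq_square)
  then show ?thesis unfolding P[of x y] by (simp only: Cauchy_Schwarz_ineq_sum)
qed

lemma metric_Cauchy_Schwarz:
  assumes "v \<in> tangent_space M p" "w \<in> tangent_space M p"
  shows "(metric M p v w)\<^sup>2 \<le> metric M p v v * metric M p w w"
proof -
  obtain c where c: "c \<in> charts_at M p" using ex_chart by blast
  show ?thesis
    unfolding metric_gram[OF c assms] metric_gram[OF c assms(1,1)] metric_gram[OF c assms(2,2)]
    by (rule ginner_Cauchy_Schwarz[OF c])
qed

lemma tangent_scale: "v \<in> tangent_space M p \<Longrightarrow> (\<lambda>c. a *\<^sub>R v c) \<in> tangent_space M p"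
  using tangent_scale_add[of v p v a 0] by simp

end

locale stress = M: riem_mfd M + N: riem_mfd N
  for M :: "('a::{t2_space, second_countable_topology}, 'm::finite) riem"
    and N :: "('b::{t2_space, second_countable_topology}, 'n::finite) riem" +
  fixes F :: "real \<Rightarrow> real" and u :: "'a \<Rightarrow> 'b" and s :: "'a \<Rightarrow> ('b, 'n) tvec"
  assumes F2: "C2_halfline F" and u2: "Ck_map 2 M N u" and par: "parallel_section M N u s"
    and divs: "\<And>p. divergence M N u (sigma_F F M N u) p = s p"
begin

section \<open>The differential of \<open>u\<close> in charts\<close>

abbreviation "du \<equiv> differential M N u"

definition ujac :: "('a, 'm) chart \<Rightarrow> ('b, 'n) chart \<Rightarrow> 'a \<Rightarrow> real ^ 'm \<Rightarrow> real ^ 'n" where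
  "ujac c d p = frechet_derivative (cmap d \<circ> u \<circ> cinv c) (at (cmap c p))"

lemma continuous_u: "continuous_on UNIV u" using u2 by (simp add: Ck_map_def)

lemma open_u_vimage: "open V \<Longrightarrow> open (u -` V)"
  using continuous_open_preimage[OF continuous_u open_UNIV] by simp

lemma u_chart_Ck: "c \<in> atlas M \<Longrightarrow> d \<in> atlas N \<Longrightarrow> Ck_on 2 (cmap c ` (cdom c \<inter> u -` cdom d)) (cmap d \<circ> u \<circ> cinv c)"
  using u2 by (simp add: Ck_map_def)

lemma ujac_has_derivative:
  assumes "c \<in> charts_at M p" "d \<in> charts_at N (u p)"
  shows "((\<lambda>y. cmap d (u (cinv c y))) has_derivative ujac c d p) (at (cmap c p))"
  using Ck_on_SucD[of 1 "cmap c ` (cdom c \<inter> u -` cdom d)" "cmap d \<circ> u \<circ> cinv c" "cmap c p"] u_chart_Ck[of c d] assms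
  by (auto simp: M.charts_at_iff N.charts_at_iff ujac_def o_def numeral_2_eq_2)

lemma ujac_linear: "c \<in> charts_at M p \<Longrightarrow> d \<in> charts_at N (u p) \<Longrightarrow> linear (ujac c d p)"
  by (rule has_derivative_linear[OF ujac_has_derivative])

lemma ujac_change_source:
  assumes "c \<in> charts_at M p" "c' \<in> charts_at M p" "d \<in> charts_at N (u p)"
  shows "ujac c' d p (jac c c' p x) = ujac c d p x"
proof -
  from M.chart_change_has_derivative[OF assms(1,2), of "\<lambda>q. cmap d (u q)", OF ujac_has_derivative[OF assms(2,3)]]
  show ?thesis using has_derivative_unique[OF ujac_has_derivative[OF assms(1,3)]] by metis
qed

lemma ujac_change_target:
  assumes c: "c \<in> charts_at M p" and d: "d \<in> charts_at N (u p)" and d': "d' \<in> charts_at N (u p)"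
  shows "jac d d' (u p) (ujac c d p x) = ujac c d' p x"
proof -
  have ca: "c \<in> atlas M" "p \<in> cdom c" "d \<in> atlas N" "u p \<in> cdom d" using c d by (auto simp: M.charts_at_iff N.charts_at_iff)
  have "((\<lambda>y. (cmap d' \<circ> cinv d) (cmap d (u (cinv c y)))) has_derivative (\<lambda>x. jac d d' (u p) (ujac c d p x))) (at (cmap c p))"
    by (rule has_derivative_compose[OF ujac_has_derivative[OF c d]]) (use N.jac_has_derivative[OF d d'] ca in \<open>simp add: o_def\<close>)
  then have "((\<lambda>y. cmap d' (u (cinv c y))) has_derivative (\<lambda>x. jac d d' (u p) (ujac c d p x))) (at (cmap c p))"
  proof (rule has_derivative_transform_within_open)
    show "open (cmap c ` (cdom c \<inter> u -` cdom d))" using ca by (intro M.open_cmap_image open_u_vimage N.open_cdom)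
  qed (use ca in auto)
  from has_derivative_unique[OF this ujac_has_derivative[OF c d']] show ?thesis by metis
qed

text \<open>Removes \<open>some_chart\<close> from the differential: any chart around p computes
  it.\<close>

lemma du_chart:
  assumes "X \<in> tangent_space M p" "c \<in> charts_at M p" "d \<in> charts_at N (u p)"
  shows "du p X d = ujac c d p (X c)"
proof -
  have "du p X d = ujac (some_chart M p) d p (X (some_chart M p))"
    using assms(3) by (simp add: differential_def Let_def ujac_def)
  also have "\<dots> = ujac c d p (jac (some_chart M p) c p (X (some_chart M p)))"
    by (rule ujac_change_source[OF M.some_chart assms(2,3), symmetric])
  also have "jac (some_chart M p) c p (X (some_chart M p)) = X c"
    by (rule M.tangent_jac[OF assms(1) M.some_chart assms(2), symmetric])
  finally show ?thesis .
qed

lemma du_tangent: "du p X \<in> tangent_space N (u p)"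
proof -
  obtain d where d: "d \<in> charts_at N (u p)" using N.ex_chart by blast
  show ?thesis
  proof (rule N.tangentI[OF d])
    fix d' assume d': "d' \<in> charts_at N (u p)"
    show "du p X d' = jac d d' (u p) (du p X d)"
      using ujac_change_target[OF M.some_chart d d'] d d' by (simp add: differential_def Let_def ujac_def)
  qed (simp add: differential_def)
qed

lemma metric_du:
  assumes "X \<in> tangent_space M p" "Y \<in> tangent_space M p" "c \<in> charts_at M p" "d \<in> charts_at N (u p)"
  shows "metric N (u p) (du p X) (du p Y) = ginner N d (u p) (ujac c d p (X c)) (ujac c d p (Y c))"
  using N.metric_gram[OF assms(4) du_tangent du_tangent] du_chart[OF assms(1,3,4)] du_chart[OF assms(2,3,4)] by simp

text \<open>Orthonormality is demanded in all charts at once, so that each trace can be evaluated in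
  whichever chart is convenient.\<close>

definition tonb :: "'a \<Rightarrow> ('m \<Rightarrow> ('a, 'm) tvec) \<Rightarrow> bool" where
  "tonb p e \<longleftrightarrow> (\<forall>i. e i \<in> tangent_space M p) \<and> (\<forall>c\<in>charts_at M p. onb (gram M c p) (\<lambda>i. e i c))"

lemma tonb_frame: "orthonormal_frame_on M W e \<Longrightarrow> q \<in> W \<Longrightarrow> tonb q (\<lambda>i. e i q)"
  by (simp add: tonb_def M.frame_tangent M.frame_onb)

lemma tonb_frame_at: "tonb p (\<lambda>i. frame_at M p i p)"
  by (simp add: tonb_def M.frame_at_tangent M.frame_at_onb)

lemma ginner_lin: "ginner N d q (x + x') y = ginner N d q x y + ginner N d q x' y" "ginner N d q (a *\<^sub>R x) y = a * ginner N d q x y"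
  "ginner N d q x (y + y') = ginner N d q x y + ginner N d q x y'" "ginner N d q x (a *\<^sub>R y) = a * ginner N d q x y"
  by (simp_all add: inner_add_left inner_add_right matrix_vector_right_distrib matrix_vector_mult_scaleR)

text \<open>\<open>frame_at M p\<close> varies with p without any regularity. To differentiate the
  stress form near a point it must be computed with one local frame at all nearby points, which
  independence of the frame permits.\<close>

lemma sigma_tonb:
  assumes e: "tonb p e" and Y: "Y \<in> tangent_space M p"
  shows "sigma M N u p Y = (\<lambda>d. \<Sum>i\<in>UNIV. metric N (u p) (du p Y) (du p (e i)) *\<^sub>R du p (e i) d)"
proof
  fix d
  show "sigma M N u p Y d = (\<Sum>i\<in>UNIV. metric N (u p) (du p Y) (du p (e i)) *\<^sub>R du p (e i) d)"
  proof (cases "d \<in> charts_at N (u p)")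
    case True
    obtain c where c: "c \<in> charts_at M p" using M.ex_chart by blast
    let ?B = "\<lambda>x x'. ginner N d (u p) (ujac c d p (Y c)) (ujac c d p x) *\<^sub>R ujac c d p x'"
    have l: "ujac c d p (x + y) = ujac c d p x + ujac c d p y" "ujac c d p (a *\<^sub>R x) = a *\<^sub>R ujac c d p x" for x y a
      using linear_add[OF ujac_linear[OF c True]] linear_scale[OF ujac_linear[OF c True]] by auto
    have B: "bilinear ?B"
      unfolding bilinear_def by (auto intro!: linearI simp: l ginner_lin scaleR_add_left scaleR_add_right)
    have f: "(\<Sum>i\<in>UNIV. metric N (u p) (du p Y) (du p (f i)) *\<^sub>R du p (f i) d) = (\<Sum>i\<in>UNIV. ?B (f i c) (f i c))" if "tonb p f" for f
      using that metric_du[OF Y _ c True] du_chart[OF _ c True] by (simp add: tonb_def)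
    have "(\<Sum>i\<in>UNIV. ?B (frame_at M p i p c) (frame_at M p i p c)) = (\<Sum>i\<in>UNIV. ?B (e i c) (e i c))"
      using e tonb_frame_at[of p] c by (intro onb_trace[OF _ _ M.ginner_sym[OF c] B]) (auto simp: tonb_def)
    then show ?thesis using f[OF e] f[OF tonb_frame_at] by (simp add: sigma_def Let_def)
  next
    case False
    then show ?thesis by (simp add: sigma_def Let_def differential_def)
  qed
qed

lemma pullback_norm2_tonb:
  assumes e: "tonb p e"
  shows "pullback_norm2 M N u p = (\<Sum>i\<in>UNIV. \<Sum>j\<in>UNIV. (metric N (u p) (du p (e i)) (du p (e j)))\<^sup>2)"
proof -
  obtain c where c: "c \<in> charts_at M p" using M.ex_chart by blast
  obtain d where d: "d \<in> charts_at N (u p)" using N.ex_chart by blast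
  let ?b = "\<lambda>x y. ginner N d (u p) (ujac c d p x) (ujac c d p y)"
  have l: "ujac c d p (x + y) = ujac c d p x + ujac c d p y" "ujac c d p (a *\<^sub>R x) = a *\<^sub>R ujac c d p x" for x y a
    using linear_add[OF ujac_linear[OF c d]] linear_scale[OF ujac_linear[OF c d]] by auto
  have f: "(\<Sum>i\<in>UNIV. \<Sum>j\<in>UNIV. (metric N (u p) (du p (f i)) (du p (f j)))\<^sup>2) = (\<Sum>i\<in>UNIV. \<Sum>j\<in>UNIV. ?b (f i c) (f j c) * ?b (f i c) (f j c))" if "tonb p f" for f
    using that metric_du[OF _ _ c d] by (simp add: tonb_def power2_eq_square)
  have tr: "(\<Sum>i\<in>UNIV. B (frame_at M p i p c) (frame_at M p i p c)) = (\<Sum>i\<in>UNIV. B (e i c) (e i c))" if "bilinear B" for B :: "_ \<Rightarrow> _ \<Rightarrow> real"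
    using e tonb_frame_at[of p] c by (intro onb_trace[OF _ _ M.ginner_sym[OF c] that]) (auto simp: tonb_def)
  \<comment> \<open>The trace is replaced one index at a time, here the inner one with i fixed and
    then the outer one.\<close>
  have "(\<Sum>i\<in>UNIV. \<Sum>j\<in>UNIV. ?b (frame_at M p i p c) (frame_at M p j p c) * ?b (frame_at M p i p c) (frame_at M p j p c))
    = (\<Sum>i\<in>UNIV. \<Sum>j\<in>UNIV. ?b (frame_at M p i p c) (e j c) * ?b (frame_at M p i p c) (e j c))"
  proof (rule sum.cong[OF refl])
    fix i
    show "(\<Sum>j\<in>UNIV. ?b (frame_at M p i p c) (frame_at M p j p c) * ?b (frame_at M p i p c) (frame_at M p j p c)) = (\<Sum>j\<in>UNIV. ?b (frame_at M p i p c) (e j c) * ?b (frame_at M p i p c) (e j c))"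
      by (rule tr[of "\<lambda>x y. ?b (frame_at M p i p c) x * ?b (frame_at M p i p c) y"])
         (auto simp: bilinear_def l ginner_lin algebra_simps intro!: linearI)
  qed
  also have "\<dots> = (\<Sum>i\<in>UNIV. \<Sum>j\<in>UNIV. ?b (e i c) (e j c) * ?b (e i c) (e j c))"
    by (rule tr[of "\<lambda>x y. \<Sum>j\<in>UNIV. ?b x (e j c) * ?b y (e j c)"])
       (auto simp: bilinear_def l ginner_lin algebra_simps sum.distrib sum_distrib_left intro!: linearI)
  finally show ?thesis using f[OF e] f[OF tonb_frame_at] by (simp add: pullback_norm2_def Let_def)
qed

lemma s_tangent: "s p \<in> tangent_space N (u p)"
  using par by (simp add: parallel_section_def Ck_section_def)

lemma s_chart_Ck: "c \<in> atlas M \<Longrightarrow> d \<in> atlas N \<Longrightarrow> Ck_on 1 (cmap c ` (cdom c \<inter> u -` cdom d)) (\<lambda>y. s (cinv c y) d)"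
  using par by (simp add: parallel_section_def Ck_section_def)

lemma sigma_tangent: "sigma M N u p Y \<in> tangent_space N (u p)"
  unfolding sigma_def Let_def by (rule N.tangent_sum) (rule du_tangent)

lemma sigma_F_tangent: "sigma_F F M N u p Y \<in> tangent_space N (u p)"
  unfolding sigma_F_def by (rule N.tangent_scale[OF sigma_tangent])

definition omega :: "'a \<Rightarrow> ('a, 'm) tvec \<Rightarrow> real" where
  "omega p Y = metric N (u p) (s p) (sigma_F F M N u p Y)"

lemma omega_linear:
  assumes c: "c \<in> charts_at M p" shows "linear (\<lambda>x. omega p (tvec_of M c p x))"
proof -
  obtain d where d: "d \<in> charts_at N (u p)" using N.ex_chart by blast
  have l: "ujac c d p (x + y) = ujac c d p x + ujac c d p y" "ujac c d p (a *\<^sub>R x) = a *\<^sub>R ujac c d p x" for x y a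
    using linear_add[OF ujac_linear[OF c d]] linear_scale[OF ujac_linear[OF c d]] by auto
  have "omega p (tvec_of M c p x) = ginner N d (u p) (s p d)
     (halfline_deriv F (pullback_norm2 M N u p / 4) *\<^sub>R (\<Sum>i\<in>UNIV. ginner N d (u p) (ujac c d p x) (ujac c d p (frame_at M p i p c)) *\<^sub>R ujac c d p (frame_at M p i p c)))" for x
    unfolding omega_def N.metric_gram[OF d s_tangent sigma_F_tangent]
    unfolding sigma_F_def sigma_def Let_def
    by (simp add: metric_du[OF M.tvec_of_tangent[OF c] M.frame_at_tangent c d] du_chart[OF M.frame_at_tangent c d] M.tvec_of_at[OF c])
  then show ?thesis
    by (auto intro!: linearI simp: l ginner_lin scaleR_add_left sum.distrib scaleR_sum_right algebra_simps inner_sum_right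
        linear_sum[OF matrix_vector_mul_linear] scaleR_right_distrib matrix_vector_mult_scaleR sum_distrib_left)
qed

lemma omega_expand:
  assumes e: "tonb p e" and Y: "Y \<in> tangent_space M p"
  shows "omega p Y = (\<Sum>k\<in>UNIV. metric M p (e k) Y * omega p (e k))"
proof -
  obtain c where c: "c \<in> charts_at M p" using M.ex_chart by blast
  have et: "e k \<in> tangent_space M p" for k using e by (simp add: tonb_def)
  have o: "onb (gram M c p) (\<lambda>i. e i c)" using e c by (simp add: tonb_def)
  note L = omega_linear[OF c]
  have "omega p Y = omega p (tvec_of M c p (\<Sum>k\<in>UNIV. ginner M c p (e k c) (Y c) *\<^sub>R e k c))"
    using M.tangent_eq[OF Y c] onb_expand[OF o, of "Y c"] by simp
  also have "\<dots> = (\<Sum>k\<in>UNIV. ginner M c p (e k c) (Y c) * omega p (tvec_of M c p (e k c)))"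
    unfolding linear_sum[OF L] linear_scale[OF L] by simp
  finally show ?thesis using M.tangent_eq[OF et c] M.metric_gram[OF c et Y] by simp
qed

text \<open>The vector field metrically dual to the 1-form \<open>omega\<close>, that is, the field
  X of the overview; no potential function is involved.\<close>

definition grad :: "'a \<Rightarrow> ('a, 'm) tvec" where
  "grad p = (\<lambda>c. \<Sum>k\<in>UNIV. omega p (frame_at M p k p) *\<^sub>R frame_at M p k p c)"

lemma grad_tonb:
  assumes e: "tonb p e" and c: "c \<in> charts_at M p"
  shows "grad p c = (\<Sum>k\<in>UNIV. omega p (e k) *\<^sub>R e k c)"
proof -
  let ?B = "\<lambda>x x'. omega p (tvec_of M c p x) *\<^sub>R x'"
  have B: "bilinear ?B"
    unfolding bilinear_def using linear_add[OF omega_linear[OF c]] linear_scale[OF omega_linear[OF c]]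
    by (auto intro!: linearI simp: scaleR_add_left scaleR_add_right)
  have f: "(\<Sum>k\<in>UNIV. omega p (f k) *\<^sub>R f k c) = (\<Sum>k\<in>UNIV. ?B (f k c) (f k c))" if "tonb p f" for f
    using M.tangent_eq[OF _ c] that by (simp add: tonb_def)
  have "(\<Sum>i\<in>UNIV. ?B (frame_at M p i p c) (frame_at M p i p c)) = (\<Sum>i\<in>UNIV. ?B (e i c) (e i c))"
    using e tonb_frame_at[of p] c by (intro onb_trace[OF _ _ M.ginner_sym[OF c] B]) (auto simp: tonb_def)
  then show ?thesis using f[OF e] f[OF tonb_frame_at] by (simp add: grad_def)
qed

lemma grad_tangent: "grad p \<in> tangent_space M p"
  unfolding grad_def by (rule M.tangent_sum) (rule M.frame_at_tangent)

text \<open>By duality the squared length of the field is the sum of the squares of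
  \<open>omega\<close> on a frame; Cauchy-Schwarz is applied to each summand.\<close>

lemma grad_norm: "metric M p (grad p) (grad p) \<le> metric N (u p) (s p) (s p) * (hs_norm M N u (sigma_F F M N u) p)\<^sup>2"
proof -
  let ?e = "\<lambda>i. frame_at M p i p"
  have eg: "metric M p (?e k) (grad p) = omega p (?e k)" for k
  proof -
    obtain c where c: "c \<in> charts_at M p" using M.ex_chart by blast
    have o: "onb (gram M c p) (\<lambda>i. ?e i c)" by (rule M.frame_at_onb[OF c])
    have "metric M p (?e k) (grad p) = ginner M c p (?e k c) (\<Sum>j\<in>UNIV. omega p (?e j) *\<^sub>R ?e j c)"
      unfolding M.metric_gram[OF c M.frame_at_tangent grad_tangent] by (simp add: grad_def)
    also have "\<dots> = (\<Sum>j\<in>UNIV. omega p (?e j) * ginner M c p (?e k c) (?e j c))"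
      by (simp add: linear_sum[OF matrix_vector_mul_linear] matrix_vector_mult_scaleR inner_sum_right)
    also have "\<dots> = omega p (?e k)" using o by (simp add: onb_def if_distrib[where f="\<lambda>x. _ * x"] cong: if_cong)
    finally show ?thesis .
  qed
  have "metric M p (grad p) (grad p) = (\<Sum>k\<in>UNIV. (omega p (?e k))\<^sup>2)"
    using M.metric_sum[of UNIV ?e p "grad p" "\<lambda>k. omega p (?e k)", OF M.frame_at_tangent grad_tangent] eg
    by (simp add: grad_def[symmetric] power2_eq_square)
  also have "\<dots> \<le> (\<Sum>k\<in>UNIV. metric N (u p) (s p) (s p) * metric N (u p) (sigma_F F M N u p (?e k)) (sigma_F F M N u p (?e k)))"
    unfolding omega_def by (intro sum_mono N.metric_Cauchy_Schwarz s_tangent sigma_F_tangent)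
  also have "\<dots> = metric N (u p) (s p) (s p) * (hs_norm M N u (sigma_F F M N u) p)\<^sup>2"
    by (simp add: hs_norm_def Let_def sum_distrib_left sum_nonneg N.metric_nonneg sigma_F_tangent)
  finally show ?thesis .
qed

text \<open>In one local frame and a pair of charts, the stress form is a composition of the
  metrics, the frame and first derivatives of u. One derivative of the C^2 map u is spent, and C^1
  remains.\<close>

lemma local_coordinates:
  assumes e: "orthonormal_frame_on M W e" and c: "c \<in> atlas M" and d: "d \<in> atlas N"
  defines "S \<equiv> cmap c ` (cdom c \<inter> (W \<inter> u -` cdom d))"
  shows "Ck_on 1 S (\<lambda>y. sigma_F F M N u (cinv c y) (e i (cinv c y)) d)" "Ck_on 1 S (\<lambda>y. omega (cinv c y) (e i (cinv c y)))"
proof -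
  have oW: "open W" using e by (simp add: orthonormal_frame_on_def)
  have S: "open S" unfolding S_def by (intro M.open_cmap_image c open_Int oW open_u_vimage N.open_cdom d)
  let ?U = "cmap d \<circ> u \<circ> cinv c"
  \<comment> \<open>Coordinate names: w i is du(e_i), H the metric of N along u, b i j the inner
    products of these vectors, and n the argument of F'.\<close>
  define w where "w i y = (\<Sum>a\<in>UNIV. (e i (cinv c y) c $ a) *\<^sub>R frechet_derivative ?U (at y) (axis a 1))" for i y
  define H where "H y = gram N d (cinv d (?U y))" for y
  define b where "b i j y = w i y \<bullet> (H y *v w j y)" for i j y
  define n where "n y = (\<Sum>i\<in>UNIV. \<Sum>j\<in>UNIV. b i j y * b i j y) * (1/4)" for y
  have sub: "S \<subseteq> cmap c ` (cdom c \<inter> u -` cdom d)" "S \<subseteq> cmap c ` (cdom c \<inter> W)" unfolding S_def by auto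
  have U2: "Ck_on (Suc 1) S ?U" using Ck_on_subset[OF u_chart_Ck[OF c d] sub(1)] by (simp add: numeral_2_eq_2)
  have U1: "Ck_on 1 S ?U" by (rule Ck_on_lower[OF U2])
  have U': "Ck_on 1 S (\<lambda>y. frechet_derivative ?U (at y) v)" for v using U2 by simp
  have E: "Ck_on 1 S (\<lambda>y. e i (cinv c y) c)" for i by (rule Ck_on_subset[OF M.frame_Ck_on[OF e c] sub(2)])
  have w: "Ck_on 1 S (w i)" for i unfolding w_def by (intro Ck_on_sum Ck_on_scaleR Ck_on_vec_nth S E U')
  have "Ck_on 1 (cim d) (\<lambda>z. gram N d (cinv d z))" using N.gram_smooth[OF d, of 1] by (simp add: o_def)
  then have H: "Ck_on 1 S H" unfolding H_def
    by (intro Ck_on_compose[OF S N.open_cim[OF d] _ U1]) (use c in \<open>auto simp: S_def\<close>)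
  have b: "Ck_on 1 S (b i j)" for i j unfolding b_def by (intro Ck_on_inner Ck_on_matrix_vector S w H)
  have n: "Ck_on 1 S n" unfolding n_def by (intro Ck_on_mult Ck_on_sum Ck_on_const S b)
  have n0: "n y \<ge> 0" for y unfolding n_def by (simp add: sum_nonneg)
  note F1 = C1_halfline_compose[OF F2 S n n0]
  have V: "Ck_on 1 S (\<lambda>y. halfline_deriv F (n y) *\<^sub>R (\<Sum>j\<in>UNIV. b i j y *\<^sub>R w j y))"
    by (intro Ck_on_scaleR Ck_on_sum S F1 b w)
  have eq: "sigma_F F M N u (cinv c y) (e i (cinv c y)) d = halfline_deriv F (n y) *\<^sub>R (\<Sum>j\<in>UNIV. b i j y *\<^sub>R w j y)"
    and H_eq: "H y = gram N d (u (cinv c y))" and dN: "d \<in> charts_at N (u (cinv c y))" if yS: "y \<in> S" for y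
  proof -
    obtain q where q: "y = cmap c q" "q \<in> cdom c" "q \<in> W" "u q \<in> cdom d" using yS unfolding S_def by blast
    have ch: "c \<in> charts_at M q" "d \<in> charts_at N (u q)" using q c d by (auto simp: M.charts_at_iff N.charts_at_iff)
    have cq: "cinv c y = q" using q c by simp
    have et: "e j q \<in> tangent_space M q" for j using M.frame_tangent[OF e q(3)] .
    have wq: "w j y = ujac c d q (e j q c)" for j
      unfolding w_def cq by (subst (2) vec_axis_sum[of "e j q c"])
        (simp add: linear_sum[OF ujac_linear[OF ch]] linear_scale[OF ujac_linear[OF ch]] ujac_def[symmetric] q(1))
    have Hq: "H y = gram N d (u q)" using cq q d by (simp add: H_def)
    have bq: "metric N (u q) (du q (e i q)) (du q (e j q)) = b i j y" for i j
      using metric_du[OF et et ch] by (simp add: b_def wq Hq)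
    have nq: "pullback_norm2 M N u q / 4 = n y"
      using pullback_norm2_tonb[OF tonb_frame[OF e q(3)]] by (simp add: bq n_def power2_eq_square)
    show "sigma_F F M N u (cinv c y) (e i (cinv c y)) d = halfline_deriv F (n y) *\<^sub>R (\<Sum>j\<in>UNIV. b i j y *\<^sub>R w j y)"
      unfolding cq sigma_F_def nq sigma_tonb[OF tonb_frame[OF e q(3)] et]
      by (simp add: bq du_chart[OF et ch] wq)
    show "H y = gram N d (u (cinv c y))" "d \<in> charts_at N (u (cinv c y))" using Hq ch cq by auto
  qed
  show V': "Ck_on 1 S (\<lambda>y. sigma_F F M N u (cinv c y) (e i (cinv c y)) d)"
    by (rule Ck_on_cong[OF S _ V]) (simp add: eq)
  have "Ck_on 1 S (\<lambda>y. s (cinv c y) d \<bullet> (H y *v sigma_F F M N u (cinv c y) (e i (cinv c y)) d))"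
    by (intro Ck_on_inner Ck_on_matrix_vector S Ck_on_subset[OF s_chart_Ck[OF c d] sub(1)] H V')
  then show "Ck_on 1 S (\<lambda>y. omega (cinv c y) (e i (cinv c y)))"
  proof (rule Ck_on_cong[OF S, rotated])
    fix y assume y: "y \<in> S"
    show "s (cinv c y) d \<bullet> (H y *v sigma_F F M N u (cinv c y) (e i (cinv c y)) d) = omega (cinv c y) (e i (cinv c y))"
      unfolding omega_def N.metric_gram[OF dN[OF y] s_tangent sigma_F_tangent] H_eq[OF y] ..
  qed
qed

lemma grad_Ck:
  assumes c: "c \<in> atlas M" shows "Ck_on 1 (cim c) (\<lambda>y. grad (cinv c y) c)"
proof (rule Ck_on_local[OF M.open_cim[OF c]])
  fix y assume y: "y \<in> cim c"
  define p where "p = cinv c y"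
  have p: "p \<in> cdom c" "y = cmap c p" using y c by (auto simp: p_def)
  obtain d where d: "d \<in> atlas N" "u p \<in> cdom d" using N.ex_chart[of "u p"] by (auto simp: N.charts_at_iff)
  obtain W where W: "p \<in> W" "orthonormal_frame_on M W (frame_at M p)" using M.frame_at_orthonormal by blast
  let ?e = "frame_at M p" and ?S = "cmap c ` (cdom c \<inter> (W \<inter> u -` cdom d))"
  have oW: "open W" using W by (simp add: orthonormal_frame_on_def)
  have S: "open ?S" by (intro M.open_cmap_image c open_Int oW open_u_vimage N.open_cdom d)
  have "Ck_on 1 ?S (\<lambda>y. \<Sum>k\<in>UNIV. omega (cinv c y) (?e k (cinv c y)) *\<^sub>R ?e k (cinv c y) c)"
    by (intro Ck_on_sum Ck_on_scaleR S local_coordinates(2)[OF W(2) c d(1)] Ck_on_subset[OF M.frame_Ck_on[OF W(2) c]]) auto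
  then have "Ck_on 1 ?S (\<lambda>y. grad (cinv c y) c)"
  proof (rule Ck_on_cong[OF S, rotated])
    fix z assume "z \<in> ?S"
    then obtain q where q: "z = cmap c q" "q \<in> cdom c" "q \<in> W" by blast
    then have "c \<in> charts_at M q" "cinv c z = q" using c by (auto simp: M.charts_at_iff)
    then show "(\<Sum>k\<in>UNIV. omega (cinv c z) (?e k (cinv c z)) *\<^sub>R ?e k (cinv c z) c) = grad (cinv c z) c"
      using grad_tonb[OF tonb_frame[OF W(2) q(3)]] by simp
  qed
  moreover have "y \<in> ?S" using p W d by auto
  ultimately show "\<exists>T. open T \<and> y \<in> T \<and> Ck_on 1 T (\<lambda>y. grad (cinv c y) c)" using S by blast
qed

text \<open>Metric compatibility of the induced connection in one direction h, when S is parallel in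
  that direction. Stating it for bare coordinate functions S and V lets it serve with V = S for the
  length of s and with V the stress form on a frame field.\<close>

lemma pull_compat:
  assumes c: "c \<in> charts_at M p" and d: "d \<in> charts_at N (u p)"
    and S: "(S has_derivative DS) (at (cmap c p))" and V: "(V has_derivative DV) (at (cmap c p))"
    and D: "((\<lambda>y. S y \<bullet> (gram N d (u (cinv c y)) *v V y)) has_derivative D) (at (cmap c p))"
    and par: "DS h + N.christoffel_vec d (u p) (ujac c d p h) (S (cmap c p)) = 0"
  shows "D h = ginner N d (u p) (S (cmap c p)) (DV h + N.christoffel_vec d (u p) (ujac c d p h) (V (cmap c p)))"
proof -
  have ca: "c \<in> atlas M" "p \<in> cdom c" "d \<in> atlas N" "u p \<in> cdom d" using c d by (auto simp: M.charts_at_iff N.charts_at_iff)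
  define Y where "Y = ujac c d p h"
  define s0 where "s0 = S (cmap c p)"
  define v0 where "v0 = V (cmap c p)"
  have G: "((\<lambda>y. gram N d (u (cinv c y))) has_derivative (\<lambda>h. N.gram_deriv d (u p) (ujac c d p h))) (at (cmap c p))"
  proof -
    have "((\<lambda>y. gram N d (cinv d (cmap d (u (cinv c y))))) has_derivative (\<lambda>h. N.gram_deriv d (u p) (ujac c d p h))) (at (cmap c p))"
      by (rule has_derivative_compose[OF ujac_has_derivative[OF c d]]) (use N.gram_has_derivative[OF d] ca in simp)
    then show ?thesis
    proof (rule has_derivative_transform_within_open)
      show "open (cmap c ` (cdom c \<inter> u -` cdom d))" using ca by (intro M.open_cmap_image open_u_vimage N.open_cdom)
    qed (use ca in auto)
  qed
  have "((\<lambda>y. S y \<bullet> (gram N d (u (cinv c y)) *v V y)) has_derivative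
    (\<lambda>h. S (cmap c p) \<bullet> (gram N d (u (cinv c (cmap c p))) *v DV h + N.gram_deriv d (u p) (ujac c d p h) *v V (cmap c p))
       + DS h \<bullet> (gram N d (u (cinv c (cmap c p))) *v V (cmap c p)))) (at (cmap c p))"
    by (intro has_derivative_inner S bounded_bilinear.FDERIV[OF bounded_bilinear_matrix_vector_mult G V])
  from has_derivative_unique[OF D this]
  have "D h = s0 \<bullet> (gram N d (u p) *v DV h + N.gram_deriv d (u p) Y *v v0) + DS h \<bullet> (gram N d (u p) *v v0)"
    using ca unfolding Y_def s0_def v0_def by simp
  then have 1: "D h = ginner N d (u p) s0 (DV h) + s0 \<bullet> (N.gram_deriv d (u p) Y *v v0) + ginner N d (u p) (DS h) v0"
    by (simp add: inner_add_right)
  have "DS h = - N.christoffel_vec d (u p) Y s0" using par by (simp add: Y_def s0_def eq_neg_iff_add_eq_0)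
  then have "ginner N d (u p) (DS h) v0 = - ginner N d (u p) v0 (N.christoffel_vec d (u p) Y s0)"
    using N.ginner_sym[OF d, of v0 "N.christoffel_vec d (u p) Y s0"] by simp
  moreover have "ginner N d (u p) s0 (DV h + N.christoffel_vec d (u p) Y v0) = ginner N d (u p) s0 (DV h) + ginner N d (u p) s0 (N.christoffel_vec d (u p) Y v0)"
    by (rule ginner_lin)
  moreover have "v0 \<bullet> (N.gram_deriv d (u p) Y *v s0) = s0 \<bullet> (N.gram_deriv d (u p) Y *v v0)"
    by (rule N.gram_deriv_sym[OF d])
  moreover note N.christoffel_lower[OF d, of v0 Y s0] N.christoffel_lower[OF d, of s0 Y v0]
  \<comment> \<open>The remaining real arithmetic: half of the derivative b of the metric goes into
    each Christoffel term, and the two other Koszul terms k and l enter with opposite signs.\<close>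
  moreover have "x = t"
    if "x = a + b + g" "g = - g1" "t = a + g2" "b' = b" "g1 = 1/2 * (b + k - l)" "g2 = 1/2 * (b' + l - k)"
    for x t a b b' g g1 g2 k l :: real
    using that by (simp add: field_simps)
  ultimately have "D h = ginner N d (u p) s0 (DV h + N.christoffel_vec d (u p) Y v0)"
    using 1 by blast
  then show ?thesis by (simp add: Y_def s0_def v0_def)
qed

lemma s_has_derivative:
  assumes c: "c \<in> charts_at M p" and d: "d \<in> charts_at N (u p)"
  shows "((\<lambda>y. s (cinv c y) d) has_derivative frechet_derivative (\<lambda>y. s (cinv c y) d) (at (cmap c p))) (at (cmap c p))"
  using Ck_on_SucD[of 0 "cmap c ` (cdom c \<inter> u -` cdom d)" "\<lambda>y. s (cinv c y) d" "cmap c p"] s_chart_Ck[of c d] c d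
  by (auto simp: M.charts_at_iff N.charts_at_iff)

lemma s_parallel_chart:
  assumes d: "d \<in> charts_at N (u p)"
  defines "c \<equiv> some_chart M p"
  shows "frechet_derivative (\<lambda>y. s (cinv c y) d) (at (cmap c p)) h + N.christoffel_vec d (u p) (ujac c d p h) (s p d) = 0"
proof -
  have c: "c \<in> charts_at M p" unfolding c_def by (rule M.some_chart)
  have X: "tvec_of M c p h \<in> tangent_space M p" by (rule M.tvec_of_tangent[OF c])
  have "pullback_cov_deriv M N u p (tvec_of M c p h) s = tzero"
    using par X by (simp add: parallel_section_def)
  then have "pullback_cov_deriv M N u p (tvec_of M c p h) s d = 0" by (simp add: tzero_def)
  then show ?thesis
    using d M.tvec_of_at[OF c, of h] du_chart[OF X c d]
    by (simp add: pullback_cov_deriv_def Let_def c_def N.christoffel_vec_def)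
qed

definition snorm :: "'a \<Rightarrow> real" where "snorm p = metric N (u p) (s p) (s p)"

text \<open>Metric compatibility with both arguments equal to s: the covariant derivative on the
  right vanishes as well.\<close>

lemma snorm_derivative_zero:
  assumes c: "c \<in> charts_at M p" shows "((\<lambda>y. snorm (cinv c y)) has_derivative (\<lambda>h. 0)) (at (cmap c p))"
proof -
  define c' where "c' = some_chart M p"
  have c': "c' \<in> charts_at M p" unfolding c'_def by (rule M.some_chart)
  obtain d where d: "d \<in> charts_at N (u p)" using N.ex_chart by blast
  have ca: "c' \<in> atlas M" "p \<in> cdom c'" "d \<in> atlas N" "u p \<in> cdom d" using c' d by (auto simp: M.charts_at_iff N.charts_at_iff)
  let ?S = "cmap c' ` (cdom c' \<inter> u -` cdom d)"
  let ?y = "cmap c' p"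
  have S: "open ?S" using ca by (intro M.open_cmap_image open_u_vimage N.open_cdom)
  have yS: "?y \<in> ?S" using ca by auto
  let ?g = "\<lambda>y. s (cinv c' y) d \<bullet> (gram N d (u (cinv c' y)) *v s (cinv c' y) d)"
  have ds: "((\<lambda>y. s (cinv c' y) d) has_derivative frechet_derivative (\<lambda>y. s (cinv c' y) d) (at ?y)) (at ?y)"
    by (rule s_has_derivative[OF c' d])
  have "Ck_on 1 (cim d) (\<lambda>z. gram N d (cinv d z))" using N.gram_smooth[OF ca(3), of 1] by (simp add: o_def)
  then have "Ck_on 1 ?S (\<lambda>y. gram N d (cinv d ((cmap d \<circ> u \<circ> cinv c') y)))"
    by (intro Ck_on_compose[OF S N.open_cim[OF ca(3)] _ Ck_on_mono[OF u_chart_Ck[OF ca(1,3)]]]) (use ca in auto)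
  then have "Ck_on 1 ?S (\<lambda>y. gram N d (u (cinv c' y)))"
    by (rule Ck_on_cong[OF S, rotated]) (use ca in auto)
  then have "Ck_on (Suc 0) ?S ?g"
    unfolding One_nat_def[symmetric] by (intro Ck_on_inner Ck_on_matrix_vector S s_chart_Ck ca)
  from Ck_on_SucD[OF this yS] have dg: "(?g has_derivative frechet_derivative ?g (at ?y)) (at ?y)" .
  have "frechet_derivative ?g (at ?y) h = 0" for h
  proof -
    have z: "frechet_derivative (\<lambda>y. s (cinv c' y) d) (at ?y) h + N.christoffel_vec d (u p) (ujac c' d p h) (s (cinv c' ?y) d) = 0"
      using s_parallel_chart[OF d, of h] ca unfolding c'_def[symmetric] by simp
    show ?thesis using pull_compat[OF c' d ds ds dg z] unfolding z by simp
  qed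
  then have "(?g has_derivative (\<lambda>h. 0)) (at ?y)" using dg by (metis (no_types, lifting) ext)
  then have "((\<lambda>y. snorm (cinv c' y)) has_derivative (\<lambda>h. 0)) (at ?y)"
  proof (rule has_derivative_transform_within_open[OF _ S yS])
    fix y assume "y \<in> ?S"
    then have "d \<in> charts_at N (u (cinv c' y))" using ca by (auto simp: N.charts_at_iff)
    then show "?g y = snorm (cinv c' y)" by (simp add: snorm_def N.metric_gram s_tangent)
  qed
  from M.chart_change_has_derivative[OF c c' this] show ?thesis .
qed

lemma snorm_constant: "snorm p = snorm q"
proof -
  have loc: "\<exists>V. open V \<and> x \<in> V \<and> (\<forall>y\<in>V. snorm y = snorm x)" for x
  proof -
    obtain c where c: "c \<in> atlas M" "x \<in> cdom c" using M.ex_chart M.charts_at_iff by blast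
    obtain r where r: "r > 0" "ball (cmap c x) r \<subseteq> cim c"
      using M.open_cim[OF c(1)] c(2) by (meson imageI open_contains_ball)
    let ?B = "ball (cmap c x) r"
    have "\<exists>k. \<forall>y\<in>?B. snorm (cinv c y) = k"
    proof (rule has_derivative_zero_constant[OF convex_ball])
      fix y assume "y \<in> ?B"
      then have y: "y \<in> cim c" using r by blast
      have "((\<lambda>y. snorm (cinv c y)) has_derivative (\<lambda>h. 0)) (at (cmap c (cinv c y)))"
        by (rule snorm_derivative_zero[OF M.chart_at_cinv[OF c(1) y]])
      then show "((\<lambda>y. snorm (cinv c y)) has_derivative (\<lambda>h. 0)) (at y within ?B)"
        using y c by (simp add: has_derivative_at_withinI)
    qed
    then obtain k where k: "\<forall>y\<in>?B. snorm (cinv c y) = k" by blast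
    have cx: "cmap c x \<in> ?B" using r by simp
    have "snorm (cinv c (cmap c x)) = k" using k cx by blast
    then have "snorm x = k" using c by simp
    then show ?thesis using k cx r c
      by (intro exI[of _ "cinv c ` ?B"] conjI M.open_cinv_image) (auto intro!: image_eqI[of _ _ "cmap c x"])
  qed
  let ?A = "{x. snorm x = snorm q}"
  have "open ?A"
  proof (rule topological_space_class.openI)
    fix x assume x: "x \<in> ?A"
    obtain V where V: "open V" "x \<in> V" "\<forall>y\<in>V. snorm y = snorm x" using loc by blast
    have "y \<in> ?A" if "y \<in> V" for y
    proof -
      have e: "snorm y = snorm x" using V(3) that by blast
      show ?thesis using x unfolding mem_Collect_eq Compl_iff e .
    qed
    then show "\<exists>T. open T \<and> x \<in> T \<and> T \<subseteq> ?A" using V by (intro exI[of _ V] conjI subsetI)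
  qed
  moreover have "open (- ?A)"
  proof (rule topological_space_class.openI)
    fix x assume x: "x \<in> - ?A"
    obtain V where V: "open V" "x \<in> V" "\<forall>y\<in>V. snorm y = snorm x" using loc by blast
    have "y \<in> - ?A" if "y \<in> V" for y
    proof -
      have e: "snorm y = snorm x" using V(3) that by blast
      show ?thesis using x unfolding mem_Collect_eq Compl_iff e .
    qed
    then show "\<exists>T. open T \<and> x \<in> T \<and> T \<subseteq> - ?A" using V by (intro exI[of _ V] conjI subsetI)
  qed
  moreover have "q \<in> ?A" by simp
  ultimately have "?A = UNIV" using connectedD[OF M.connected_UNIV, of ?A "- ?A"] by auto
  then show ?thesis by blast
qed

text \<open>Pairs the equation div(sigma_F) = s with s itself. The left side becomes the squared
  length of s, the right side the frame form of the divergence of the dual field.\<close>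

lemma snorm_frame:
  assumes c: "c \<in> charts_at M p"
    and W: "p \<in> W" "orthonormal_frame_on M W (frame_at M p)"
    and f: "\<And>k. ((\<lambda>y. omega (cinv c y) (frame_at M p k (cinv c y))) has_derivative Df k) (at (cmap c p))"
  shows "snorm p = (\<Sum>k\<in>UNIV. Df k (frame_at M p k p c))
    - (\<Sum>k\<in>UNIV. omega p (frame_at M p k p) * (\<Sum>j\<in>UNIV. metric M p (frame_at M p k p) (cov_deriv M p (frame_at M p j p) (frame_at M p j))))"
proof -
  \<comment> \<open>\<open>pullback_cov_deriv\<close> differentiates in this chart; the computation
    is done there and the result carried to c by the Jacobian.\<close>
  define c' where "c' = some_chart M p"
  let ?e = "frame_at M p"
  have c': "c' \<in> charts_at M p" unfolding c'_def by (rule M.some_chart)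
  obtain d where d: "d \<in> charts_at N (u p)" using N.ex_chart by blast
  have ca: "c' \<in> atlas M" "p \<in> cdom c'" "d \<in> atlas N" "u p \<in> cdom d" using c' d by (auto simp: M.charts_at_iff N.charts_at_iff)
  let ?y = "cmap c' p"
  let ?S = "cmap c' ` (cdom c' \<inter> (W \<inter> u -` cdom d))"
  have oW: "open W" using W by (simp add: orthonormal_frame_on_def)
  have S: "open ?S" by (intro M.open_cmap_image open_Int oW open_u_vimage N.open_cdom ca)
  have yS: "?y \<in> ?S" using ca W by auto
  let ?V = "\<lambda>k y. sigma_F F M N u (cinv c' y) (?e k (cinv c' y)) d"
  have V: "((?V k) has_derivative frechet_derivative (?V k) (at ?y)) (at ?y)" for k
    using Ck_on_SucD[of 0 ?S "?V k" ?y] local_coordinates(1)[OF W(2) ca(1,3)] yS by simp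
  have Df': "((\<lambda>y. omega (cinv c' y) (?e k (cinv c' y))) has_derivative (\<lambda>h. Df k (jac c' c p h))) (at ?y)" for k
    using M.chart_change_has_derivative[OF c' c, of "\<lambda>q. omega q (?e k q)", OF f] .
  have ed: "?e k p c = jac c' c p (?e k p c')" for k by (rule M.tangent_jac[OF M.frame_at_tangent c' c])
  \<comment> \<open>Since s is parallel, pairing with it commutes with differentiation: the
    covariant derivative turns into the derivative of \<open>omega\<close> on the frame
    field.\<close>
  have term1: "ginner N d (u p) (s p d) (pullback_cov_deriv M N u p (?e k p) (\<lambda>q. sigma_F F M N u q (?e k q)) d) = Df k (?e k p c)" for k
  proof -
    have D: "((\<lambda>y. s (cinv c' y) d \<bullet> (gram N d (u (cinv c' y)) *v ?V k y)) has_derivative (\<lambda>h. Df k (jac c' c p h))) (at ?y)"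
    proof (rule has_derivative_transform_within_open[OF Df' S yS])
      fix y assume "y \<in> ?S"
      then have "d \<in> charts_at N (u (cinv c' y))" using ca by (auto simp: N.charts_at_iff)
      then show "omega (cinv c' y) (?e k (cinv c' y)) = s (cinv c' y) d \<bullet> (gram N d (u (cinv c' y)) *v ?V k y)"
        by (simp add: omega_def N.metric_gram s_tangent sigma_F_tangent)
    qed
    have z: "frechet_derivative (\<lambda>y. s (cinv c' y) d) (at ?y) h + N.christoffel_vec d (u p) (ujac c' d p h) (s (cinv c' ?y) d) = 0" for h
      using s_parallel_chart[OF d, of h] ca unfolding c'_def[symmetric] by simp
    have "Df k (jac c' c p (?e k p c')) = ginner N d (u p) (s (cinv c' ?y) d)
        (frechet_derivative (?V k) (at ?y) (?e k p c') + N.christoffel_vec d (u p) (ujac c' d p (?e k p c')) (?V k ?y))"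
      by (rule pull_compat[OF c' d s_has_derivative[OF c' d] V D z])
    moreover have "pullback_cov_deriv M N u p (?e k p) (\<lambda>q. sigma_F F M N u q (?e k q)) d
       = frechet_derivative (?V k) (at ?y) (?e k p c') + N.christoffel_vec d (u p) (ujac c' d p (?e k p c')) (?V k ?y)"
      using d ca du_chart[OF M.frame_at_tangent c' d, of k]
      by (simp add: pullback_cov_deriv_def Let_def c'_def[symmetric] N.christoffel_vec_def)
    ultimately show ?thesis using ca by (simp add: ed)
  qed
  have term2: "ginner N d (u p) (s p d) (sigma_F F M N u p Y d) = omega p Y" for Y
    by (simp add: omega_def N.metric_gram[OF d s_tangent sigma_F_tangent])
  have sp: "s p d = (\<Sum>k\<in>UNIV. pullback_cov_deriv M N u p (?e k p) (\<lambda>q. sigma_F F M N u q (?e k q)) d - sigma_F F M N u p (cov_deriv M p (?e k p) (?e k)) d)"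
    unfolding divs[of p, symmetric] divergence_def Let_def ..
  have gsum: "ginner N d (u p) x (\<Sum>k\<in>UNIV. A k - B k) = (\<Sum>k\<in>UNIV. ginner N d (u p) x (A k)) - (\<Sum>k\<in>UNIV. ginner N d (u p) x (B k))" for x and A B :: "'m \<Rightarrow> _"
    by (simp add: linear_sum[OF matrix_vector_mul_linear] inner_sum_right matrix_vector_mult_diff_distrib inner_diff_right sum_subtractf)
  have "snorm p = ginner N d (u p) (s p d) (s p d)" by (simp add: snorm_def N.metric_gram[OF d s_tangent s_tangent])
  also have "\<dots> = ginner N d (u p) (s p d) (\<Sum>k\<in>UNIV. pullback_cov_deriv M N u p (?e k p) (\<lambda>q. sigma_F F M N u q (?e k q)) d - sigma_F F M N u p (cov_deriv M p (?e k p) (?e k)) d)"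
    using sp by simp
  also have "\<dots> = (\<Sum>k\<in>UNIV. Df k (?e k p c)) - (\<Sum>k\<in>UNIV. omega p (cov_deriv M p (?e k p) (?e k)))"
    unfolding gsum term1 term2 ..
  \<comment> \<open>Expanding nabla_{e_k} e_k in the frame brings the term to the shape found in
    \<open>coordinate_divergence_frame\<close>.\<close>
  also have "(\<Sum>k\<in>UNIV. omega p (cov_deriv M p (?e k p) (?e k))) = (\<Sum>j\<in>UNIV. \<Sum>k\<in>UNIV. metric M p (?e k p) (cov_deriv M p (?e j p) (?e j)) * omega p (?e k p))"
    by (intro sum.cong refl omega_expand[OF tonb_frame_at] M.cov_frame_tangent[OF W(2,1)])
  also have "\<dots> = (\<Sum>k\<in>UNIV. \<Sum>j\<in>UNIV. metric M p (?e k p) (cov_deriv M p (?e j p) (?e j)) * omega p (?e k p))"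
    by (rule sum.swap)
  also have "\<dots> = (\<Sum>k\<in>UNIV. omega p (?e k p) * (\<Sum>j\<in>UNIV. metric M p (?e k p) (cov_deriv M p (?e j p) (?e j))))"
    by (simp add: sum_distrib_left mult.commute)
  finally show ?thesis .
qed

text \<open>The coordinate divergence of the dual field and the equation paired with s have the same
  frame expression.\<close>

lemma grad_divergence:
  assumes c: "c \<in> charts_at M p"
    and D: "((\<lambda>y. M.dens c y *\<^sub>R grad (cinv c y) c) has_derivative D) (at (cmap c p))"
  shows "(\<Sum>a\<in>UNIV. D (axis a 1) $ a) = M.dens c (cmap c p) * snorm p"
proof -
  let ?e = "frame_at M p"
  obtain W where W: "p \<in> W" "orthonormal_frame_on M W ?e" using M.frame_at_orthonormal by blast
  obtain d where d: "d \<in> atlas N" "u p \<in> cdom d" using N.ex_chart[of "u p"] by (auto simp: N.charts_at_iff)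
  have ca: "c \<in> atlas M" "p \<in> cdom c" using c by (auto simp: M.charts_at_iff)
  let ?S = "cmap c ` (cdom c \<inter> (W \<inter> u -` cdom d))"
  have yS: "cmap c p \<in> ?S" using ca W d by auto
  have f: "((\<lambda>y. omega (cinv c y) (?e k (cinv c y))) has_derivative frechet_derivative (\<lambda>y. omega (cinv c y) (?e k (cinv c y))) (at (cmap c p))) (at (cmap c p))" for k
    using Ck_on_SucD[of 0 ?S "\<lambda>y. omega (cinv c y) (?e k (cinv c y))" "cmap c p"] local_coordinates(2)[OF W(2) ca(1) d(1)] yS by simp
  \<comment> \<open>Needed on all of W, also where q lies outside the chart c; there every tangent
    vector has component 0 by convention.\<close>
  have X: "grad q c = (\<Sum>k\<in>UNIV. omega q (?e k q) *\<^sub>R ?e k q c)" if "q \<in> W" for q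
  proof (cases "c \<in> charts_at M q")
    case True
    then show ?thesis using grad_tonb[OF tonb_frame[OF W(2) that]] by blast
  next
    case False
    then show ?thesis using M.tangent_out[OF grad_tangent] M.tangent_out[OF M.frame_tangent[OF W(2) that]] by simp
  qed
  have "(\<Sum>a\<in>UNIV. D (axis a 1) $ a) = M.dens c (cmap c p) *
    ((\<Sum>k\<in>UNIV. frechet_derivative (\<lambda>y. omega (cinv c y) (?e k (cinv c y))) (at (cmap c p)) (?e k p c))
    - (\<Sum>k\<in>UNIV. omega p (?e k p) * (\<Sum>j\<in>UNIV. metric M p (?e k p) (cov_deriv M p (?e j p) (?e j)))))"
    by (rule M.coordinate_divergence_frame[OF W(2,1) c, where f="\<lambda>k q. omega q (?e k q)" and X=grad]) (rule f X D; assumption?)+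
  then show ?thesis by (simp only: snorm_frame[OF c W f])
qed

end

subsection \<open>Integration by parts against a Lipschitz function\<close>

lemma integral_lborel_translate:
  fixes f :: "'c::euclidean_space \<Rightarrow> real"
  assumes "f \<in> borel_measurable borel"
  shows "(\<integral>y. f (a + y) \<partial>lborel) = (\<integral>y. f y \<partial>lborel)"
proof -
  have "(\<integral>y. f y \<partial>lborel) = (\<integral>y. f y \<partial>distr lborel borel ((+) a))" by (simp only: lborel_distr_plus)
  also have "\<dots> = (\<integral>y. f (a + y) \<partial>lborel)" using assms by (subst integral_distr) auto
  finally show ?thesis by simp
qed

text \<open>h is never differentiated. The derivative of z is replaced by a difference quotient,
  translation invariance moves the difference onto h, where the Lipschitz bound applies, and
  dominated convergence removes the step size. The set B records where h may vary.\<close>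

lemma directional_ibp:
  fixes z h :: "'c::euclidean_space \<Rightarrow> real"
  assumes z: "Ck_on 1 UNIV z" and K: "compact K" "\<And>y. y \<notin> K \<Longrightarrow> z y = 0"
    and h: "h \<in> borel_measurable borel" "\<And>y. \<bar>h y\<bar> \<le> 1" and B: "B \<in> sets borel"
    and t0: "t0 > 0" "\<And>t y. 0 < t \<Longrightarrow> t < t0 \<Longrightarrow> y \<in> K \<Longrightarrow> \<bar>h (y - t *\<^sub>R v) - h y\<bar> \<le> t * C * indicator B y"
  shows "\<bar>\<integral>y. h y * frechet_derivative z (at y) v \<partial>lborel\<bar> \<le> C * (\<integral>y. indicator B y * \<bar>z y\<bar> \<partial>lborel)"
    and "integrable lborel (\<lambda>y. h y * frechet_derivative z (at y) v)"
proof -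
  define D where "D y = frechet_derivative z (at y) v" for y
  have zd: "(z has_derivative frechet_derivative z (at y)) (at y)" for y
    using Ck_on_SucD[of 0 UNIV z y] z by simp
  have cD: "continuous_on UNIV D" using z by (simp add: D_def[abs_def])
  have cz: "continuous_on UNIV z" using z Ck_on_continuous_on by blast
  note [measurable] = borel_measurable_continuous_onI[OF cD] borel_measurable_continuous_onI[OF cz] h(1) B
  have clK: "closed K" using K(1) compact_imp_closed by blast
  have D0: "D y = 0" if "y \<notin> K" for y
  proof -
    have "(z has_derivative (\<lambda>h. 0)) (at y)"
      by (rule has_derivative_transform_within_open[OF has_derivative_const[of 0] open_Compl[OF clK]]) (use that K(2) in auto)
    then show ?thesis using frechet_derivative_at[of z "\<lambda>h. 0"] unfolding D_def by metis
  qed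
  obtain A where A: "\<And>y. \<bar>D y\<bar> \<le> A" "A \<ge> 0"
  proof -
    have "bounded (D ` K)" by (intro compact_imp_bounded compact_continuous_image continuous_on_subset[OF cD] K) auto
    then obtain a where a: "\<forall>x\<in>D ` K. \<bar>x\<bar> \<le> a" by (auto simp: bounded_iff)
    have "\<bar>D y\<bar> \<le> max a 0" for y using a D0[of y] by (cases "y \<in> K") auto
    then show ?thesis using that[of "max a 0"] by auto
  qed
  have iK: "integrable lborel f" if "continuous_on UNIV f" "\<And>y. y \<notin> K \<Longrightarrow> f y = 0" for f :: "'c \<Rightarrow> real"
  proof -
    have "integrable lborel (\<lambda>y. indicator K y *\<^sub>R f y)"
      by (rule borel_integrable_compact[OF K(1)]) (rule continuous_on_subset[OF that(1)], simp)
    also have "(\<lambda>y. indicator K y *\<^sub>R f y) = f" using that(2) by (auto simp: indicator_def fun_eq_iff)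
    finally show ?thesis .
  qed
  have iz: "integrable lborel z" by (rule iK[OF cz K(2)])
  have bnd: "integrable lborel (\<lambda>y. k y * f y)" if "integrable lborel f" "k \<in> borel_measurable borel" "\<And>y. \<bar>k y\<bar> \<le> 1" for k f :: "'c \<Rightarrow> real"
  proof (rule Bochner_Integration.integrable_bound[OF that(1)])
    show "(\<lambda>y. k y * f y) \<in> borel_measurable lborel" using that by auto
    show "AE y in lborel. norm (k y * f y) \<le> norm (f y)"
      using that(3) by (auto simp: abs_mult intro!: mult_left_le_one_le)
  qed
  show hD: "integrable lborel (\<lambda>y. h y * frechet_derivative z (at y) v)"
    using bnd[OF iK[OF cD D0] h] by (simp add: D_def)
  \<comment> \<open>A null sequence of admissible step sizes; the factor 1/2 keeps its first term
    strictly below t0.\<close>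
  define t where "t n = t0 / 2 * inverse (real (Suc n))" for n
  have t: "0 < t n" "t n < t0" for n
  proof -
    show "0 < t n" using t0(1) by (simp add: t_def)
    have "t0 / 2 * inverse (real (Suc n)) \<le> t0 / 2 * 1"
      using t0(1) by (intro mult_left_mono) (auto simp: inverse_le_1_iff)
    then show "t n < t0" using t0(1) unfolding t_def by linarith
  qed
  have tl: "t \<longlonglongrightarrow> 0" unfolding t_def by (rule tendsto_mult_right_zero[OF LIMSEQ_inverse_real_of_nat])
  define q where "q n y = (z (y + t n *\<^sub>R v) - z y) / t n" for n y
  have qm [measurable]: "q n \<in> borel_measurable borel" for n
    unfolding q_def[abs_def] by (intro borel_measurable_continuous_onI continuous_intros continuous_on_compose2[OF cz]) (use t[of n] in auto)
  have line: "((\<lambda>s. z (y + s *\<^sub>R v)) has_real_derivative D (y + s *\<^sub>R v)) (at s)" for y s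
  proof -
    have "((\<lambda>s. z (y + s *\<^sub>R v)) has_derivative (\<lambda>u. frechet_derivative z (at (y + s *\<^sub>R v)) (u *\<^sub>R v))) (at s)"
      by (rule has_derivative_compose[where f="\<lambda>s. y + s *\<^sub>R v" and g=z and x=s and s=UNIV and f'="\<lambda>u. u *\<^sub>R v", OF _ zd])
         (auto intro!: derivative_eq_intros)
    moreover have "frechet_derivative z (at (y + s *\<^sub>R v)) (u *\<^sub>R v) = D (y + s *\<^sub>R v) * u" for u
      using linear_scale[OF has_derivative_linear[OF zd]] by (simp add: D_def mult.commute)
    ultimately show ?thesis by (simp add: has_field_derivative_def)
  qed
  have ql: "(\<lambda>n. q n y) \<longlonglongrightarrow> D y" for y
  proof -
    have "((\<lambda>s. (z (y + (0 + s) *\<^sub>R v) - z (y + 0 *\<^sub>R v)) / s) \<longlongrightarrow> D (y + 0 *\<^sub>R v)) (at 0)"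
      using line[of y 0] by (simp only: has_field_derivative_iff add_0_left diff_zero add.right_neutral)
    moreover have "filterlim t (at 0) sequentially"
      unfolding filterlim_at using tl t(1) by (auto intro!: always_eventually simp: less_imp_neq[symmetric])
    ultimately have "((\<lambda>n. (z (y + (0 + t n) *\<^sub>R v) - z (y + 0 *\<^sub>R v)) / t n) \<longlongrightarrow> D (y + 0 *\<^sub>R v)) sequentially"
      by (rule filterlim_compose)
    then show ?thesis by (simp add: q_def)
  qed
  \<comment> \<open>K swept backwards along v. It is compact and contains the supports of all
    difference quotients, so a multiple of its indicator dominates them.\<close>
  let ?K' = "(\<lambda>(y, s). y - s *\<^sub>R v) ` (K \<times> {0..t0})"
  have K': "compact ?K'"
    by (intro compact_continuous_image compact_Times K) (auto simp: case_prod_unfold intro!: continuous_intros)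
  have qb: "\<bar>q n y\<bar> \<le> A * indicator ?K' y" for n y
  proof (cases "y \<in> ?K'")
    case True
    obtain s where "z (y + t n *\<^sub>R v) - z (y + 0 *\<^sub>R v) = (t n - 0) * D (y + s *\<^sub>R v)"
      using MVT2[of 0 "t n" "\<lambda>s. z (y + s *\<^sub>R v)" "\<lambda>s. D (y + s *\<^sub>R v)"] t(1) line by blast
    then have "q n y = D (y + s *\<^sub>R v)" using t(1)[of n] by (simp add: q_def)
    then show ?thesis using A True by simp
  next
    case False
    have "y \<notin> K"
    proof
      assume "y \<in> K"
      then have "(\<lambda>(y, s). y - s *\<^sub>R v) (y, 0) \<in> ?K'" using t0 by (intro imageI) auto
      then show False using False by simp
    qed
    moreover have "y + t n *\<^sub>R v \<notin> K"
    proof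
      assume "y + t n *\<^sub>R v \<in> K"
      then have "(\<lambda>(y, s). y - s *\<^sub>R v) (y + t n *\<^sub>R v, t n) \<in> ?K'" using t[of n] by (intro imageI) auto
      then show False using False by simp
    qed
    ultimately show ?thesis using K(2) False by (simp add: q_def)
  qed
  have lim: "(\<lambda>n. \<integral>y. h y * q n y \<partial>lborel) \<longlonglongrightarrow> (\<integral>y. h y * D y \<partial>lborel)"
  proof (rule integral_dominated_convergence[where w="\<lambda>y. A * indicator ?K' y"])
    have "emeasure lborel ?K' < \<infinity>" using emeasure_bounded_finite[OF compact_imp_bounded[OF K']] by simp
    then show "integrable lborel (\<lambda>y. A * indicator ?K' y)"
      using compact_imp_closed[OF K'] by (intro integrable_mult_right integrable_real_indicator) auto
    show "AE y in lborel. (\<lambda>n. h y * q n y) \<longlonglongrightarrow> h y * D y" by (intro AE_I2 tendsto_mult ql tendsto_const)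
    show "AE y in lborel. norm (h y * q n y) \<le> A * indicator ?K' y" for n
    proof (rule AE_I2)
      fix y
      have "\<bar>h y\<bar> * \<bar>q n y\<bar> \<le> 1 * (A * indicator ?K' y)" using h(2) qb by (intro mult_mono) auto
      then show "norm (h y * q n y) \<le> A * indicator ?K' y" by (simp add: abs_mult)
    qed
  qed auto
  have est: "\<bar>\<integral>y. h y * q n y \<partial>lborel\<bar> \<le> C * (\<integral>y. indicator B y * \<bar>z y\<bar> \<partial>lborel)" for n
  proof -
    let ?g = "\<lambda>y. h (- (t n *\<^sub>R v) + y) * z y"
    have hm: "(\<lambda>y. h (- (t n *\<^sub>R v) + y)) \<in> borel_measurable borel" by measurable
    have ig: "integrable lborel ?g" by (rule bnd[OF iz hm]) (rule h(2))
    have ihz: "integrable lborel (\<lambda>y. h y * z y)" by (rule bnd[OF iz h])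
    \<comment> \<open>Discrete integration by parts: the shift of z becomes the opposite shift of
      h.\<close>
    have tr: "(\<integral>y. ?g y \<partial>lborel) = (\<integral>y. h y * z (y + t n *\<^sub>R v) \<partial>lborel)"
    proof -
      have "(\<integral>y. ?g (t n *\<^sub>R v + y) \<partial>lborel) = (\<integral>y. ?g y \<partial>lborel)"
        by (rule integral_lborel_translate) measurable
      then show ?thesis by (simp add: add.commute)
    qed
    have i2: "integrable lborel (\<lambda>y. h y * z (y + t n *\<^sub>R v))"
    proof -
      have "integrable (distr lborel borel ((+) (t n *\<^sub>R v))) z" using iz by (simp add: lborel_distr_plus)
      then have "integrable lborel (\<lambda>y. z (t n *\<^sub>R v + y))" by (subst (asm) integrable_distr_eq) auto
      then have "integrable lborel (\<lambda>y. z (y + t n *\<^sub>R v))" by (simp add: add.commute)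
      then show ?thesis by (rule bnd[OF _ h])
    qed
    have "(\<integral>y. h y * q n y \<partial>lborel) = (\<integral>y. (h y * z (y + t n *\<^sub>R v) - h y * z y) / t n \<partial>lborel)"
      by (simp add: q_def right_diff_distrib)
    also have "\<dots> = (\<integral>y. (?g y - h y * z y) / t n \<partial>lborel)"
      using i2 ihz ig tr by simp
    finally have e: "(\<integral>y. h y * q n y \<partial>lborel) = (\<integral>y. (?g y - h y * z y) / t n \<partial>lborel)" .
    have "\<bar>\<integral>y. (?g y - h y * z y) / t n \<partial>lborel\<bar> \<le> (\<integral>y. \<bar>(?g y - h y * z y) / t n\<bar> \<partial>lborel)"
      by (rule integral_abs_bound)
    also have "\<dots> \<le> (\<integral>y. C * (indicator B y * \<bar>z y\<bar>) \<partial>lborel)"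
    proof (rule integral_mono)
      show "integrable lborel (\<lambda>y. \<bar>(?g y - h y * z y) / t n\<bar>)" using ig ihz by (intro integrable_abs) auto
      show "integrable lborel (\<lambda>y. C * (indicator B y * \<bar>z y\<bar>))"
        using bnd[of "\<lambda>y. \<bar>z y\<bar>" "indicator B"] iz by (auto simp: indicator_def)
      fix y
      show "\<bar>(?g y - h y * z y) / t n\<bar> \<le> C * (indicator B y * \<bar>z y\<bar>)"
      proof (cases "y \<in> K")
        case True
        have "\<bar>h (y - t n *\<^sub>R v) - h y\<bar> * \<bar>z y\<bar> \<le> (t n * C * indicator B y) * \<bar>z y\<bar>"
          using t0(2)[OF t(1) t(2) True] by (intro mult_right_mono) auto
        moreover have "?g y - h y * z y = (h (y - t n *\<^sub>R v) - h y) * z y" by (simp add: algebra_simps)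
        ultimately have "\<bar>?g y - h y * z y\<bar> \<le> C * (indicator B y * \<bar>z y\<bar>) * t n" by (simp add: abs_mult mult_ac)
        then show ?thesis using t(1)[of n] by (simp add: abs_divide pos_divide_le_eq)
      qed (simp add: K(2))
    qed
    also have "\<dots> = C * (\<integral>y. indicator B y * \<bar>z y\<bar> \<partial>lborel)" by simp
    finally show ?thesis using e by simp
  qed
  show "\<bar>\<integral>y. h y * frechet_derivative z (at y) v \<partial>lborel\<bar> \<le> C * (\<integral>y. indicator B y * \<bar>z y\<bar> \<partial>lborel)"
    using LIMSEQ_le_const2[OF tendsto_rabs[OF lim]] est by (simp add: D_def)
qed

context riem_mfd
begin

text \<open>Near p the Gram matrices differ so little that the change of the quadratic form is at
  most \<open>k\<^sup>2\<close> times the squared Euclidean norm, which both forms dominate. The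
  factor 4 makes the two lengths comparable up to a factor 2.\<close>

lemma local_comparison:
  assumes c: "c \<in> atlas M" and p: "p \<in> cdom c"
  shows "\<exists>r>0. cball (cmap c p) r \<subseteq> cim c \<and> (\<forall>w\<in>cball (cmap c p) r. \<forall>v.
     ginner M c (cinv c w) v v \<le> 4 * ginner M c p v v \<and> ginner M c p v v \<le> 4 * ginner M c (cinv c w) v v)"
proof -
  obtain r k K where r: "r > 0" "k > 0" "K > 0" "cball (cmap c p) r \<subseteq> cim c"
      "\<forall>w\<in>cball (cmap c p) r. \<forall>v. k\<^sup>2 * (norm v)\<^sup>2 \<le> ginner M c (cinv c w) v v \<and>
       ginner M c (cinv c w) v v \<le> K\<^sup>2 * (norm v)\<^sup>2"
    using local_gram_bounds[OF c p] by blast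
  obtain B where B: "B > 0" "\<And>(A::real^'m^'m) v. norm (A *v v) \<le> norm A * norm v * B"
    using bounded_bilinear.pos_bounded[OF bounded_bilinear_matrix_vector_mult] by blast
  let ?G = "\<lambda>w. gram M c (cinv c w)"
  have "isCont ?G (cmap c p)"
    using gram_cont[OF c] open_cim[OF c] p by (simp add: continuous_on_eq_continuous_at)
  moreover have "k\<^sup>2 / B > 0" using r B by simp
  ultimately obtain s where s: "s > 0" "\<And>w. dist w (cmap c p) < s \<Longrightarrow> dist (?G w) (?G (cmap c p)) < k\<^sup>2 / B"
    unfolding continuous_at_eps_delta by blast
  define r' where "r' = min r (s/2)"
  have r': "r' > 0" "cball (cmap c p) r' \<subseteq> cball (cmap c p) r" using r s by (auto simp: r'_def)
  have "ginner M c (cinv c w) v v \<le> 4 * ginner M c p v v \<and> ginner M c p v v \<le> 4 * ginner M c (cinv c w) v v"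
    if w: "w \<in> cball (cmap c p) r'" for w v
  proof -
    have "dist w (cmap c p) < s" using w s by (auto simp: r'_def dist_commute)
    then have "norm (?G w - gram M c p) \<le> k\<^sup>2 / B" using s(2) p c by (simp add: dist_norm less_imp_le)
    have "\<bar>v \<bullet> ((?G w - gram M c p) *v v)\<bar> \<le> norm v * norm ((?G w - gram M c p) *v v)" by (rule Cauchy_Schwarz_ineq2)
    also have "\<dots> \<le> norm v * (norm (?G w - gram M c p) * norm v * B)" by (intro mult_left_mono B) auto
    also have "\<dots> \<le> norm v * (k\<^sup>2 / B * norm v * B)"
      using \<open>norm (?G w - gram M c p) \<le> k\<^sup>2 / B\<close> B by (intro mult_left_mono mult_right_mono) auto
    also have "\<dots> = k\<^sup>2 * (norm v)\<^sup>2" using B by (simp add: power2_eq_square)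
    finally have "\<bar>ginner M c (cinv c w) v v - ginner M c p v v\<bar> \<le> k\<^sup>2 * (norm v)\<^sup>2"
      by (simp add: matrix_vector_mult_diff_rdistrib inner_diff_right)
    moreover have "k\<^sup>2 * (norm v)\<^sup>2 \<le> ginner M c (cinv c w) v v" using r(5) w r'(2) by blast
    moreover have "k\<^sup>2 * (norm v)\<^sup>2 \<le> ginner M c p v v"
      using r(5)[rule_format, of "cmap c p" v] r(1) c p by simp
    moreover have "0 \<le> k\<^sup>2 * (norm v)\<^sup>2" by simp
    ultimately show ?thesis by linarith
  qed
  then show ?thesis using r' r(4) by blast
qed

text \<open>The coordinate divergence is split along a basis that is orthonormal for the metric at
  p, and each direction is treated by \<open>directional_ibp\<close>. A coordinate step t in such a
  direction moves a point by a distance of at most 2 t, and each component of Z is at most twice its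
  Riemannian length. With m directions this gives the factor 4 m.\<close>

lemma local_estimate:
  fixes L :: real
  assumes c: "c \<in> atlas M" and p: "p \<in> cdom c" and r: "cball (cmap c p) r \<subseteq> cim c" "\<rho> < r"
    and cmp: "\<And>w v. w \<in> cball (cmap c p) r \<Longrightarrow> ginner M c (cinv c w) v v \<le> 4 * ginner M c p v v"
      "\<And>w v. w \<in> cball (cmap c p) r \<Longrightarrow> ginner M c p v v \<le> 4 * ginner M c (cinv c w) v v"
    and Z: "Ck_on 1 UNIV Z" "\<And>y. y \<notin> cball (cmap c p) \<rho> \<Longrightarrow> Z y = 0"
    and \<eta>: "\<eta> \<in> borel_measurable borel" "\<And>x. 0 \<le> \<eta> x" "\<And>x. \<eta> x \<le> 1" "\<And>x y. \<bar>\<eta> x - \<eta> y\<bar> \<le> L * gdist M x y" "L \<ge> 0"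
    and B: "B \<in> sets borel" "\<epsilon> > 0" "\<And>x y. gdist M x y < \<epsilon> \<Longrightarrow> \<eta> x \<noteq> 0 \<or> \<eta> y \<noteq> 0 \<Longrightarrow> x \<in> B"
  shows "\<bar>\<integral>y. \<eta> (cinv c y) * (\<Sum>a\<in>UNIV. frechet_derivative Z (at y) (axis a 1) $ a) \<partial>lborel\<bar>
     \<le> 4 * CARD('m) * L * (\<integral>y. indicator B (cinv c y) * sqrt (ginner M c (cinv c y) (Z y) (Z y)) \<partial>lborel)"
proof -
  let ?y0 = "cmap c p" and ?K = "cball (cmap c p) \<rho>"
  let ?G0 = "gram M c p"
  have ch: "c \<in> charts_at M p" using c p by (simp add: charts_at_iff)
  obtain e where e: "onb ?G0 e" using ex_onb[OF ch] by blast
  define z where "z j y = e j \<bullet> (?G0 *v Z y)" for j y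
  have zC: "Ck_on 1 UNIV (z j)" for j
    unfolding z_def by (intro Ck_on_inner Ck_on_const Ck_on_matrix_vector open_UNIV Z(1))
  have z0: "z j y = 0" if "y \<notin> ?K" for j y using Z(2)[OF that] by (simp add: z_def)
  have Zd: "(Z has_derivative frechet_derivative Z (at y)) (at y)" for y
    using Ck_on_SucD[of 0 UNIV Z y] Z(1) by simp
  have zd: "frechet_derivative (z j) (at y) v = e j \<bullet> (?G0 *v frechet_derivative Z (at y) v)" for j y v
  proof -
    have "(z j has_derivative (\<lambda>v. e j \<bullet> (?G0 *v frechet_derivative Z (at y) v))) (at y)"
      unfolding z_def by (intro has_derivative_inner_right bounded_linear.has_derivative[OF matrix_vector_mul_bounded_linear] Zd)
    from frechet_derivative_at[OF this] show ?thesis by metis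
  qed
  have dv: "(\<Sum>a\<in>UNIV. frechet_derivative Z (at y) (axis a 1) $ a) = (\<Sum>j\<in>UNIV. frechet_derivative (z j) (at y) (e j))" for y
    unfolding zd by (rule onb_trace_linear[OF e has_derivative_linear[OF Zd]])
  note [measurable] = cinv_measurable[OF c] \<eta>(1) B(1)
  let ?h = "\<lambda>y. \<eta> (cinv c y)" and ?B = "cinv c -` B"
  have hm: "?h \<in> borel_measurable borel" by measurable
  have Bm: "?B \<in> sets borel" using measurable_sets[OF cinv_measurable[OF c] B(1)] by simp
  have main: "\<bar>\<integral>y. ?h y * frechet_derivative (z j) (at y) (e j) \<partial>lborel\<bar> \<le> (2 * L) * (\<integral>y. indicator ?B y * \<bar>z j y\<bar> \<partial>lborel)"
      "integrable lborel (\<lambda>y. ?h y * frechet_derivative (z j) (at y) (e j))" for j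
  proof -
    \<comment> \<open>The first bound keeps the moved point at distance less than
      \<open>\<epsilon>\<close>, since its distance is at most 2 t; the second keeps the segment
      inside the larger coordinate ball.\<close>
    define t0 where "t0 = min (\<epsilon> / 2) ((r - \<rho>) / (norm (e j) + 1))"
    have ne: "norm (e j) + 1 > 0" by (rule add_nonneg_pos) auto
    have t0: "t0 > 0" using B(2) r(2) ne by (simp add: t0_def)
    have step: "\<bar>?h (y - t *\<^sub>R e j) - ?h y\<bar> \<le> t * (2 * L) * indicator ?B y" if t: "0 < t" "t < t0" and y: "y \<in> ?K" for t y
    proof -
      have tn: "t * norm (e j) \<le> r - \<rho>"
      proof -
        have "t * norm (e j) \<le> t * (norm (e j) + 1)" using t by simp
        also have "t * (norm (e j) + 1) \<le> r - \<rho>" using t ne by (simp add: t0_def pos_less_divide_eq less_imp_le)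
        finally show ?thesis .
      qed
      have yr: "y \<in> cball ?y0 r" using y r(2) by auto
      have yr': "y - t *\<^sub>R e j \<in> cball ?y0 r"
      proof -
        have "dist ?y0 (y - t *\<^sub>R e j) \<le> dist ?y0 y + dist y (y - t *\<^sub>R e j)" by (rule dist_triangle)
        then show ?thesis using y tn t by (simp add: dist_norm)
      qed
      have seg: "closed_segment y (y - t *\<^sub>R e j) \<subseteq> cball ?y0 r" using yr yr' by (intro closed_segment_subset) auto
      obtain \<gamma> where \<gamma>: "piecewise_C1_curve M \<gamma>" "\<gamma> 0 = cinv c y" "\<gamma> 1 = cinv c (y - t *\<^sub>R e j)" "curve_length M \<gamma> \<le> 2 * t"
      proof (rule curve_segment[OF c, of y "y - t *\<^sub>R e j" "2 * t"])
        show "closed_segment y (y - t *\<^sub>R e j) \<subseteq> cim c" using seg r(1) by blast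
        fix w assume "w \<in> closed_segment y (y - t *\<^sub>R e j)"
        then have "ginner M c (cinv c w) (t *\<^sub>R e j) (t *\<^sub>R e j) \<le> 4 * ginner M c p (t *\<^sub>R e j) (t *\<^sub>R e j)"
          using seg by (intro cmp(1)) blast
        also have "ginner M c p (t *\<^sub>R e j) (t *\<^sub>R e j) = t\<^sup>2"
          using e by (simp add: onb_def matrix_vector_mult_scaleR power2_eq_square)
        finally show "ginner M c (cinv c w) (y - t *\<^sub>R e j - y) (y - t *\<^sub>R e j - y) \<le> (2 * t)\<^sup>2"
          by (simp add: power_mult_distrib linear_neg[OF matrix_vector_mul_linear])
      qed (use t in auto)
      have gd: "gdist M (cinv c y) (cinv c (y - t *\<^sub>R e j)) \<le> 2 * t"
        using gdist_le[OF \<gamma>(1-3)] \<gamma>(4) by simp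
      show ?thesis
      \<comment> \<open>Outside B the function \<open>\<eta>\<close> vanishes at both ends of the
        step, so only points of B contribute.\<close>
      proof (cases "cinv c y \<in> B")
        case True
        have "\<bar>?h (y - t *\<^sub>R e j) - ?h y\<bar> \<le> L * gdist M (cinv c (y - t *\<^sub>R e j)) (cinv c y)" by (rule \<eta>(4))
        also have "\<dots> \<le> L * (2 * t)" using gd \<eta>(5) by (intro mult_left_mono) (simp_all add: gdist_commute)
        finally show ?thesis using True by (simp add: mult_ac)
      next
        case False
        have "gdist M (cinv c y) (cinv c (y - t *\<^sub>R e j)) < \<epsilon>" using gd t by (simp add: t0_def)
        then have "?h y = 0" "?h (y - t *\<^sub>R e j) = 0" using B(3) False by blast+
        then show ?thesis using False by simp
      qed
    qed
    have h1: "\<bar>?h y\<bar> \<le> 1" for y using \<eta>(2,3) by simp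
    show "\<bar>\<integral>y. ?h y * frechet_derivative (z j) (at y) (e j) \<partial>lborel\<bar> \<le> (2 * L) * (\<integral>y. indicator ?B y * \<bar>z j y\<bar> \<partial>lborel)"
      "integrable lborel (\<lambda>y. ?h y * frechet_derivative (z j) (at y) (e j))"
      by (rule directional_ibp[OF zC compact_cball z0 hm h1 Bm t0 step]; assumption)+
  qed
  let ?n = "\<lambda>y. sqrt (ginner M c (cinv c y) (Z y) (Z y))"
  have Kc: "?K \<subseteq> cim c" using r by auto
  have nint: "integrable lborel (\<lambda>y. indicator ?B y * ?n y)"
  proof -
    have "continuous_on UNIV Z" using Z(1) Ck_on_continuous_on by blast
    then have "continuous_on ?K ?n"
      by (intro continuous_intros bounded_bilinear.continuous_on[OF bounded_bilinear_matrix_vector_mult]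
          continuous_on_subset[OF gram_cont[OF c] Kc]) (auto intro: continuous_on_subset)
    then have "integrable lborel (\<lambda>y. indicator ?K y *\<^sub>R ?n y)" by (intro borel_integrable_compact) auto
    then have "integrable lborel (\<lambda>y. (indicator ?K y *\<^sub>R ?n y) * indicator ?B y)"
      using Bm
      by (intro integrable_real_mult_indicator) auto
    also have "(\<lambda>y. (indicator ?K y *\<^sub>R ?n y) * indicator ?B y) = (\<lambda>y. indicator ?B y * ?n y)"
      using Z(2) by (auto simp: indicator_def fun_eq_iff)
    finally show ?thesis .
  qed
  have zn: "\<bar>z j y\<bar> \<le> 2 * ?n y" for j y
  proof (cases "y \<in> ?K")
    case True
    then have yr: "y \<in> cball ?y0 r" using r(2) by auto
    have "(z j y)\<^sup>2 \<le> (\<Sum>i\<in>UNIV. (z i y)\<^sup>2)" by (rule member_le_sum) auto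
    also have "\<dots> = ginner M c p (Z y) (Z y)"
      using onb_parseval[OF e ginner_sym[OF ch], of "Z y" "Z y"] by (simp add: z_def power2_eq_square)
    also have "\<dots> \<le> 4 * ginner M c (cinv c y) (Z y) (Z y)" by (rule cmp(2)[OF yr])
    finally have "sqrt ((z j y)\<^sup>2) \<le> sqrt (4 * ginner M c (cinv c y) (Z y) (Z y))" by (rule real_sqrt_le_mono)
    then show ?thesis by (simp add: real_sqrt_mult)
  qed (simp add: z0 Z(2))
  have n0: "0 \<le> ginner M c (cinv c y) (Z y) (Z y)" for y
  proof (cases "y \<in> ?K")
    case True
    then show ?thesis using ginner_nonneg[OF chart_at_cinv[OF c]] Kc by blast
  qed (simp add: Z(2))
  have "\<bar>\<integral>y. ?h y * (\<Sum>a\<in>UNIV. frechet_derivative Z (at y) (axis a 1) $ a) \<partial>lborel\<bar>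
      = \<bar>\<Sum>j\<in>UNIV. \<integral>y. ?h y * frechet_derivative (z j) (at y) (e j) \<partial>lborel\<bar>"
    unfolding dv by (simp add: sum_distrib_left main(2))
  also have "\<dots> \<le> (\<Sum>j\<in>UNIV. \<bar>\<integral>y. ?h y * frechet_derivative (z j) (at y) (e j) \<partial>lborel\<bar>)" by (rule sum_abs)
  also have "\<dots> \<le> (\<Sum>j\<in>(UNIV::'m set). (2 * L) * (\<integral>y. 2 * (indicator ?B y * ?n y) \<partial>lborel))"
  proof (rule sum_mono)
    fix j
    have "(\<integral>y. indicator ?B y * \<bar>z j y\<bar> \<partial>lborel) \<le> (\<integral>y. 2 * (indicator ?B y * ?n y) \<partial>lborel)"
    proof (rule integral_mono_AE')
      show "integrable lborel (\<lambda>y. 2 * (indicator ?B y * ?n y))" using nint by simp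
    qed (use zn[of j] n0 in \<open>auto simp: indicator_def\<close>)
    then have "(2 * L) * (\<integral>y. indicator ?B y * \<bar>z j y\<bar> \<partial>lborel) \<le> (2 * L) * (\<integral>y. 2 * (indicator ?B y * ?n y) \<partial>lborel)"
      using \<eta>(5) by (intro mult_left_mono) auto
    then show "\<bar>\<integral>y. ?h y * frechet_derivative (z j) (at y) (e j) \<partial>lborel\<bar> \<le> (2 * L) * (\<integral>y. 2 * (indicator ?B y * ?n y) \<partial>lborel)"
      using main(1)[of j] by linarith
  qed
  also have "\<dots> = 4 * CARD('m) * L * (\<integral>y. indicator ?B y * ?n y \<partial>lborel)" by simp
  also have "(\<integral>y. indicator ?B y * ?n y \<partial>lborel) = (\<integral>y. indicator B (cinv c y) * ?n y \<partial>lborel)"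
    by (simp add: indicator_def)
  finally show ?thesis .
qed

end

subsection \<open>Localization of the divergence inequality\<close>

text \<open>An elementary C^1 building block for cutoffs: the square flattens the corner of the
  positive part.\<close>

lemma Ck_on_square_positive_part: "Ck_on 1 UNIV (\<lambda>t::real. (max 0 t)\<^sup>2)"
proof -
  have d: "((\<lambda>t::real. (max 0 t)\<^sup>2) has_real_derivative 2 * max 0 t) (at t)" for t
  proof -
    consider "t > 0" | "t < 0" | "t = 0" by linarith
    then show ?thesis
    proof cases
      case 1
      have "((\<lambda>t::real. t\<^sup>2) has_real_derivative 2 * max 0 t) (at t)" using 1 by (auto intro!: derivative_eq_intros)
      then show ?thesis by (rule has_field_derivative_transform_within_open[of _ _ _ "{0<..}"]) (use 1 in auto)
    next
      case 2
      have "((\<lambda>t::real. 0) has_real_derivative 2 * max 0 t) (at t)" using 2 by auto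
      then show ?thesis by (rule has_field_derivative_transform_within_open[of _ _ _ "{..<0}"]) (use 2 in auto)
    next
      case 3
      have "((\<lambda>h::real. max 0 h) \<longlongrightarrow> max 0 0) (at 0)" by (intro tendsto_intros)
      then have "((\<lambda>h::real. ((max 0 (0 + h))\<^sup>2 - (max 0 0)\<^sup>2) / h) \<longlongrightarrow> max 0 0) (at 0)"
        by (rule Lim_transform_eventually) (auto simp: eventually_at_filter power2_eq_square max_def intro!: always_eventually)
      then show ?thesis using 3 by (simp add: has_field_derivative_iff)
    qed
  qed
  have "Ck_on (Suc 0) UNIV (\<lambda>t::real. (max 0 t)\<^sup>2)"
  proof (rule Ck_on_SucI[OF open_UNIV])
    show "((\<lambda>t::real. (max 0 t)\<^sup>2) has_derivative (\<lambda>v. (2 * max 0 t) * v)) (at t)" for t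
      using d[of t] by (simp add: has_field_derivative_def)
  qed (auto intro!: continuous_intros)
  then show ?thesis by simp
qed

text \<open>The quotient a / (a + b), where a is positive exactly inside radius
  \<open>\<rho>\<close> and b exactly outside radius \<open>\<rho> / 2\<close>; the two regions
  overlap, so the denominator never vanishes.\<close>

lemma ex_plateau:
  fixes y0 :: "'c::euclidean_space"
  assumes "\<rho> > 0"
  obtains \<theta> :: "'c \<Rightarrow> real" where "Ck_on 1 UNIV \<theta>" "\<And>y. 0 \<le> \<theta> y" "\<And>y. \<theta> y \<le> 1"
    "\<And>y. y \<in> ball y0 (\<rho> / 2) \<Longrightarrow> \<theta> y = 1" "\<And>y. y \<notin> cball y0 \<rho> \<Longrightarrow> \<theta> y = 0"
proof -
  let ?q = "\<lambda>t::real. (max 0 t)\<^sup>2"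
  define m where "m y = (y - y0) \<bullet> (y - y0)" for y
  define a where "a y = ?q (\<rho>\<^sup>2 - m y)" for y
  define b where "b y = ?q (m y - (\<rho> / 2)\<^sup>2)" for y
  define \<theta> where "\<theta> y = a y * (a y + b y) powr (-1)" for y
  have mC: "Ck_on 1 UNIV m" unfolding m_def by (intro Ck_on_inner Ck_on_diff Ck_on_id Ck_on_const open_UNIV)
  have aC: "Ck_on 1 UNIV a" unfolding a_def
    by (rule Ck_on_compose[OF open_UNIV open_UNIV _ _ Ck_on_square_positive_part]) (auto intro!: Ck_on_diff Ck_on_const mC simp del: Ck_on.simps One_nat_def)
  have bC: "Ck_on 1 UNIV b" unfolding b_def
    by (rule Ck_on_compose[OF open_UNIV open_UNIV _ _ Ck_on_square_positive_part]) (auto intro!: Ck_on_diff Ck_on_const mC simp del: Ck_on.simps One_nat_def)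
  have m: "m y = (norm (y - y0))\<^sup>2" for y by (simp add: m_def power2_norm_eq_inner)
  have pos: "a y + b y > 0" for y
  proof (cases "m y < \<rho>\<^sup>2")
    case True
    then have "a y > 0" by (simp add: a_def)
    then show ?thesis by (simp add: b_def add_pos_nonneg)
  next
    case False
    have "(\<rho> / 2)\<^sup>2 < \<rho>\<^sup>2" using assms by (intro power_strict_mono) auto
    then have "m y - (\<rho> / 2)\<^sup>2 > 0" using False by linarith
    then have "b y > 0" by (simp add: b_def)
    then show ?thesis by (simp add: a_def add_nonneg_pos)
  qed
  have th: "\<theta> y = a y / (a y + b y)" for y using pos[of y] by (simp add: \<theta>_def powr_minus divide_inverse)
  have ab: "a y \<ge> 0" "b y \<ge> 0" for y by (simp_all add: a_def b_def)
  have abC: "Ck_on 1 UNIV (\<lambda>y. a y + b y)" by (intro Ck_on_add open_UNIV aC bC)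
  have "Ck_on 1 UNIV (\<lambda>y. (a y + b y) powr (-1))"
    by (rule Ck_on_compose[OF open_UNIV open_greaterThan _ abC Ck_on_powr]) (use pos in auto)
  then have "Ck_on 1 UNIV \<theta>" unfolding \<theta>_def by (intro Ck_on_mult open_UNIV aC)
  moreover have "0 \<le> \<theta> y" "\<theta> y \<le> 1" for y using ab[of y] pos[of y] by (auto simp: th)
  moreover have "\<theta> y = 1" if "y \<in> ball y0 (\<rho> / 2)" for y
  proof -
    have "(norm (y - y0))\<^sup>2 \<le> (\<rho> / 2)\<^sup>2" using that by (intro power_mono) (auto simp: dist_norm norm_minus_commute)
    then have "b y = 0" by (simp add: b_def m)
    then show ?thesis using pos[of y] by (simp add: th)
  qed
  moreover have "\<theta> y = 0" if "y \<notin> cball y0 \<rho>" for y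
  proof -
    have "\<rho>\<^sup>2 \<le> (norm (y - y0))\<^sup>2" using that assms by (intro power_mono) (auto simp: dist_norm norm_minus_commute)
    then have "a y = 0" by (simp add: a_def m)
    then show ?thesis by (simp add: th)
  qed
  ultimately show ?thesis by (rule that)
qed

context riem_mfd
begin

lemma continuous_on_charts:
  fixes f :: "'a \<Rightarrow> 'z::topological_space"
  assumes "\<And>c. c \<in> atlas M \<Longrightarrow> continuous_on (cim c) (\<lambda>y. f (cinv c y))"
  shows "continuous_on UNIV f"
proof (rule continuous_at_imp_continuous_on, rule ballI)
  fix p
  obtain c where c: "c \<in> atlas M" "p \<in> cdom c" using ex_chart charts_at_iff by blast
  have "continuous_on (cdom c) (\<lambda>x. f (cinv c (cmap c x)))"
    by (rule continuous_on_compose2[OF assms[OF c(1)] continuous_on_cmap[OF c(1)]]) auto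
  then have "continuous_on (cdom c) f" by (rule continuous_on_eq) (use c in simp)
  then show "isCont f p" using open_cdom[OF c(1)] c(2) by (simp add: continuous_on_eq_continuous_at)
qed

lemma integrable_vol_compact_support:
  fixes f :: "'a \<Rightarrow> real"
  assumes K: "compact K" and f: "continuous_on UNIV f" and B: "B \<in> sets borel" "B \<subseteq> K"
  shows "integrable (vol M) (\<lambda>x. indicator B x * f x)"
proof -
  have "bounded (f ` K)" by (intro compact_imp_bounded compact_continuous_image continuous_on_subset[OF f] K) auto
  then obtain A where A: "\<And>x. x \<in> K \<Longrightarrow> \<bar>f x\<bar> \<le> A" by (auto simp: bounded_iff)
  have Kb: "K \<in> sets borel" using compact_imp_closed[OF K] by simp
  have [measurable]: "f \<in> borel_measurable borel" using f by (rule borel_measurable_continuous_onI)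
  show ?thesis
  proof (rule Bochner_Integration.integrable_bound)
    show "integrable (vol M) (\<lambda>x. A * indicator K x)"
      using Kb vol_compact_finite[OF K] by (intro integrable_mult_right integrable_real_indicator) auto
    show "(\<lambda>x. indicator B x * f x) \<in> borel_measurable (vol M)" using B by simp
    show "AE x in vol M. norm (indicator B x * f x) \<le> norm (A * indicator K x)"
      using A B(2) by (intro AE_I2) (force simp: indicator_def)
  qed
qed

text \<open>A smooth frame writes the derivative of the density as a continuous expression.\<close>

lemma dens_Ck: assumes c: "c \<in> atlas M" shows "Ck_on 1 (cim c) (dens c)"
proof -
  obtain E where E: "\<And>i k. Ck_on k (cim c) (E i)" "\<And>y. y \<in> cim c \<Longrightarrow> onb (gram M c (cinv c y)) (\<lambda>i. E i y)"
    using ex_frame_chart[OF c] by blast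
  let ?D = "\<lambda>y h. frechet_derivative (\<lambda>y. gram M c (cinv c y)) (at y) h"
  have "Ck_on (Suc 0) (cim c) (dens c)"
  proof (rule Ck_on_SucI[OF open_cim[OF c]])
    fix y assume y: "y \<in> cim c"
    show "(dens c has_derivative (\<lambda>h. dens c y * ((1/2) * (\<Sum>j\<in>UNIV. E j y \<bullet> (?D y h *v E j y))))) (at y)"
      using dens_has_derivative[OF E(2)[OF y] chart_at_cinv[OF c y]] c y by (simp add: gram_deriv_def)
  next
    fix v
    have "Ck_on 0 (cim c) (\<lambda>y. ?D y v)" using gram_smooth[OF c, of "Suc 0"] by (simp add: o_def)
    moreover have "Ck_on 0 (cim c) (dens c)" using continuous_on_dens[OF c] by simp
    ultimately show "Ck_on 0 (cim c) (\<lambda>y. dens c y * ((1/2) * (\<Sum>j\<in>UNIV. E j y \<bullet> (?D y v *v E j y))))"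
      by (intro Ck_on_mult Ck_on_const Ck_on_sum Ck_on_inner Ck_on_matrix_vector open_cim[OF c] E(1))
  qed
  then show ?thesis by simp
qed

definition C1fun :: "('a \<Rightarrow> real) \<Rightarrow> bool" where
  "C1fun g \<longleftrightarrow> (\<forall>c\<in>atlas M. Ck_on 1 (cim c) (\<lambda>y. g (cinv c y)))"

lemma C1funD: "C1fun g \<Longrightarrow> c \<in> atlas M \<Longrightarrow> Ck_on 1 (cim c) (\<lambda>y. g (cinv c y))"
  unfolding C1fun_def by (rule bspec)

lemma C1fun_intros:
  "C1fun (\<lambda>x. k)" "C1fun g \<Longrightarrow> C1fun h \<Longrightarrow> C1fun (\<lambda>x. g x * h x)"
  "C1fun g \<Longrightarrow> C1fun h \<Longrightarrow> C1fun (\<lambda>x. g x - h x)" "C1fun g \<Longrightarrow> C1fun h \<Longrightarrow> C1fun (\<lambda>x. g x + h x)"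
  unfolding C1fun_def by (auto intro!: Ck_on_const Ck_on_mult Ck_on_diff Ck_on_add open_cim simp del: Ck_on.simps One_nat_def)

lemma C1fun_prod: "(\<And>i. i \<in> I \<Longrightarrow> C1fun (g i)) \<Longrightarrow> C1fun (\<lambda>x. \<Prod>i\<in>I. g i x)"
  by (induction I rule: infinite_finite_induct) (auto intro!: C1fun_intros)

lemma C1fun_derivative:
  assumes "C1fun g" "c \<in> charts_at M p"
  shows "((\<lambda>y. g (cinv c y)) has_derivative frechet_derivative (\<lambda>y. g (cinv c y)) (at (cmap c p))) (at (cmap c p))"
proof -
  have "c \<in> atlas M" "cmap c p \<in> cim c" using assms(2) by (auto simp: charts_at_iff)
  then show ?thesis using Ck_on_SucD[of 0 "cim c" "\<lambda>y. g (cinv c y)" "cmap c p"] C1funD[OF assms(1)] by simp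
qed

text \<open>Extension by zero stays C^1 because the image of the closed coordinate ball is compact,
  hence closed in the Hausdorff space M. So M is covered by two open sets: the chart domain, where
  the function is a plateau in coordinates, and the complement of the compact image, where it is
  0.\<close>

lemma ex_bump:
  assumes c: "c \<in> atlas M" and p: "p \<in> cdom c" and \<rho>: "\<rho> > 0" "cball (cmap c p) \<rho> \<subseteq> cim c"
  shows "\<exists>\<beta> V. open V \<and> p \<in> V \<and> C1fun \<beta> \<and> (\<forall>x. 0 \<le> \<beta> x \<and> \<beta> x \<le> 1) \<and> (\<forall>x\<in>V. \<beta> x = 1)
     \<and> (\<forall>x. x \<notin> cinv c ` cball (cmap c p) \<rho> \<longrightarrow> \<beta> x = 0)"
proof -
  let ?y0 = "cmap c p"
  obtain \<theta> :: "real ^ 'm \<Rightarrow> real" where \<theta>: "Ck_on 1 UNIV \<theta>" "\<And>y. 0 \<le> \<theta> y" "\<And>y. \<theta> y \<le> 1"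
    "\<And>y. y \<in> ball ?y0 (\<rho> / 2) \<Longrightarrow> \<theta> y = 1" "\<And>y. y \<notin> cball ?y0 \<rho> \<Longrightarrow> \<theta> y = 0"
    using ex_plateau[OF \<rho>(1), of ?y0] by blast
  define \<beta> where "\<beta> x = (if x \<in> cdom c then \<theta> (cmap c x) else 0)" for x
  let ?C = "cinv c ` cball ?y0 \<rho>" and ?V = "cinv c ` ball ?y0 (\<rho> / 2)"
  have sub: "ball ?y0 (\<rho> / 2) \<subseteq> cim c"
    by (rule subset_trans[OF _ \<rho>(2)]) (use \<rho>(1) in auto)
  have oV: "open ?V" by (rule open_cinv_image[OF c open_ball sub])
  have clC: "closed ?C"
    by (intro compact_imp_closed compact_continuous_image continuous_on_subset[OF continuous_on_cinv[OF c] \<rho>(2)]) auto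
  have zero: "\<beta> x = 0" if "x \<notin> ?C" for x
  proof (cases "x \<in> cdom c")
    case True
    have "cmap c x \<notin> cball ?y0 \<rho>"
    proof
      assume "cmap c x \<in> cball ?y0 \<rho>"
      then have "cinv c (cmap c x) \<in> ?C" by (rule imageI)
      then show False using that True c by simp
    qed
    then show ?thesis using \<theta>(5) by (simp add: \<beta>_def)
  qed (simp add: \<beta>_def)
  have one: "\<beta> x = 1" if "x \<in> ?V" for x
  proof -
    obtain w where w: "w \<in> ball ?y0 (\<rho> / 2)" "x = cinv c w" using \<open>x \<in> ?V\<close> by blast
    then have "w \<in> cim c" using sub by blast
    then show ?thesis using w \<theta>(4)[OF w(1)] c by (simp add: \<beta>_def cinv_in_cdom)
  qed
  have "C1fun \<beta>" unfolding C1fun_def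
  proof
    fix d assume d: "d \<in> atlas M"
    show "Ck_on 1 (cim d) (\<lambda>y. \<beta> (cinv d y))"
    proof (rule Ck_on_local[OF open_cim[OF d]])
      fix y assume y: "y \<in> cim d"
      show "\<exists>T. open T \<and> y \<in> T \<and> Ck_on 1 T (\<lambda>y. \<beta> (cinv d y))"
      proof (cases "cinv d y \<in> cdom c")
        case True
        let ?T = "cmap d ` (cdom d \<inter> cdom c)"
        have oT: "open ?T" by (rule open_overlap[OF d c])
        have "Ck_on 1 ?T (\<lambda>y. \<theta> ((cmap c \<circ> cinv d) y))"
          by (rule Ck_on_compose[OF oT open_UNIV _ transition_smooth[OF d c] \<theta>(1)]) simp
        then have "Ck_on 1 ?T (\<lambda>y. \<beta> (cinv d y))"
          by (rule Ck_on_cong[OF oT, rotated]) (use d in \<open>auto simp: \<beta>_def\<close>)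
        moreover have "y \<in> ?T" using True y d by (auto simp: cmap_image_Int)
        ultimately show ?thesis using oT by blast
      next
        case False
        then have "\<beta> (cinv d y) = 0" by (simp add: \<beta>_def)
        let ?T = "cmap d ` (cdom d \<inter> - ?C)"
        have oT: "open ?T" by (rule open_cmap_image[OF d]) (use clC in auto)
        have "?C \<subseteq> cdom c" using \<rho>(2) cinv_in_cdom[OF c] by auto
        then have "cinv d y \<notin> ?C" using False by blast
        then have "y \<in> ?T" using y d by (auto simp: cmap_image_Int)
        moreover have "Ck_on 1 ?T (\<lambda>y. \<beta> (cinv d y))"
        proof (rule Ck_on_cong[OF oT _ Ck_on_const[of _ _ 0]])
          fix w assume "w \<in> ?T"
          then have "cinv d w \<notin> ?C" unfolding cmap_image_Int[OF d] by simp
          then show "0 = \<beta> (cinv d w)" using zero by simp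
        qed
        ultimately show ?thesis using oT by blast
      qed
    qed
  qed
  moreover have "p \<in> ?V" using c p \<rho>(1) by (intro image_eqI[of _ _ "cmap c p"]) auto
  ultimately show ?thesis
    using oV zero one \<theta>(2,3) by (intro exI[of _ \<beta>] exI[of _ ?V]) (auto simp: \<beta>_def)
qed

end

text \<open>Separates the analysis from the stress form: from here on only a C^1 tangent field with
  constant divergence \<open>c0\<close> matters. The divergence is prescribed in coordinate form,
  the form that the integration by parts consumes.\<close>

locale vfield = riem_mfd M for M :: "('a::{t2_space, second_countable_topology}, 'm::finite) riem" +
  fixes X :: "'a \<Rightarrow> ('a, 'm) tvec" and c0 :: real
  assumes Xt: "\<And>p. X p \<in> tangent_space M p"
    and XC: "\<And>c. c \<in> atlas M \<Longrightarrow> Ck_on 1 (cim c) (\<lambda>y. X (cinv c y) c)"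
    and Xdiv: "\<And>c p D. c \<in> charts_at M p \<Longrightarrow>
      ((\<lambda>y. dens c y *\<^sub>R X (cinv c y) c) has_derivative D) (at (cmap c p)) \<Longrightarrow>
      (\<Sum>a\<in>UNIV. D (axis a 1) $ a) = dens c (cmap c p) * c0"
begin

definition Xd :: "('a \<Rightarrow> real) \<Rightarrow> 'a \<Rightarrow> real" where
  "Xd g p = (let c = some_chart M p in frechet_derivative (\<lambda>y. g (cinv c y)) (at (cmap c p)) (X p c))"

text \<open>Since \<open>div X = c0\<close>, this is \<open>div (g X)\<close>.\<close>

definition dv :: "('a \<Rightarrow> real) \<Rightarrow> 'a \<Rightarrow> real" where "dv g p = g p * c0 + Xd g p"

definition xn :: "'a \<Rightarrow> real" where "xn p = sqrt (metric M p (X p) (X p))"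

lemma Xd_eq:
  assumes c: "c \<in> charts_at M p" and g: "((\<lambda>y. g (cinv c y)) has_derivative D) (at (cmap c p))"
  shows "Xd g p = D (X p c)"
proof -
  let ?c = "some_chart M p"
  have "((\<lambda>y. g (cinv ?c y)) has_derivative (\<lambda>v. D (jac ?c c p v))) (at (cmap ?c p))"
    by (rule chart_change_has_derivative[OF some_chart c g])
  from frechet_derivative_at[OF this] have "Xd g p = D (jac ?c c p (X p ?c))" unfolding Xd_def Let_def by metis
  then show ?thesis using tangent_jac[OF Xt some_chart c] by simp
qed

lemma Xd_chart: "C1fun g \<Longrightarrow> c \<in> charts_at M p \<Longrightarrow> Xd g p = frechet_derivative (\<lambda>y. g (cinv c y)) (at (cmap c p)) (X p c)"
  by (rule Xd_eq[OF _ C1fun_derivative])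

lemma dv_add:
  assumes "C1fun g" "C1fun h" shows "dv (\<lambda>x. g x + h x) p = dv g p + dv h p"
proof -
  obtain c where c: "c \<in> charts_at M p" using ex_chart by blast
  have "Xd (\<lambda>x. g x + h x) p = Xd g p + Xd h p"
    using Xd_eq[OF c has_derivative_add[OF C1fun_derivative[OF assms(1) c] C1fun_derivative[OF assms(2) c]]]
      Xd_chart[OF assms(1) c] Xd_chart[OF assms(2) c] by simp
  then show ?thesis by (simp add: dv_def distrib_right)
qed

lemma Xd_local_const:
  assumes "open U" "p \<in> U" "\<And>x. x \<in> U \<Longrightarrow> g x = k" shows "Xd g p = 0"
proof -
  obtain c where c: "c \<in> charts_at M p" using ex_chart by blast
  then have ca: "c \<in> atlas M" "p \<in> cdom c" by (auto simp: charts_at_iff)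
  have "((\<lambda>y. g (cinv c y)) has_derivative (\<lambda>h. 0)) (at (cmap c p))"
    by (rule has_derivative_transform_within_open[OF has_derivative_const[of k] open_cmap_image[OF ca(1) assms(1)]])
       (use ca assms in auto)
  from Xd_eq[OF c this] show ?thesis .
qed

lemma continuous_dv:
  assumes g: "C1fun g" shows "continuous_on UNIV (dv g)"
proof (rule continuous_on_charts)
  fix c assume c: "c \<in> atlas M"
  have cg: "continuous_on (cim c) (\<lambda>y. g (cinv c y))" using C1funD[OF g c] Ck_on_continuous_on by blast
  have cX: "continuous_on (cim c) (\<lambda>y. X (cinv c y) c)" using XC[OF c] Ck_on_continuous_on by blast
  have cD: "continuous_on (cim c) (\<lambda>y. frechet_derivative (\<lambda>y. g (cinv c y)) (at y) v)" for v
    using C1funD[OF g c] by simp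
  have "continuous_on (cim c) (\<lambda>y. g (cinv c y) * c0 + (\<Sum>a\<in>UNIV. X (cinv c y) c $ a * frechet_derivative (\<lambda>y. g (cinv c y)) (at y) (axis a 1)))"
    by (intro continuous_intros cg cD bounded_linear.continuous_on[OF bounded_linear_vec_nth] cX)
  then show "continuous_on (cim c) (\<lambda>y. dv g (cinv c y))"
  proof (rule continuous_on_eq)
    fix y assume y: "y \<in> cim c"
    have ch: "c \<in> charts_at M (cinv c y)" by (rule chart_at_cinv[OF c y])
    have l: "linear (frechet_derivative (\<lambda>y. g (cinv c y)) (at y))"
      using has_derivative_linear[OF C1fun_derivative[OF g ch]] c y by simp
    have "Xd g (cinv c y) = frechet_derivative (\<lambda>y. g (cinv c y)) (at y) (X (cinv c y) c)"
      using Xd_chart[OF g ch] c y by simp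
    also have "\<dots> = frechet_derivative (\<lambda>y. g (cinv c y)) (at y) (\<Sum>a\<in>UNIV. (X (cinv c y) c $ a) *\<^sub>R axis a 1)"
      using vec_axis_sum[of "X (cinv c y) c"] by simp
    also have "\<dots> = (\<Sum>a\<in>UNIV. X (cinv c y) c $ a * frechet_derivative (\<lambda>y. g (cinv c y)) (at y) (axis a 1))"
      by (simp only: linear_sum[OF l] linear_scale[OF l] real_scaleR_def)
    finally show "g (cinv c y) * c0 + (\<Sum>a\<in>UNIV. X (cinv c y) c $ a * frechet_derivative (\<lambda>y. g (cinv c y)) (at y) (axis a 1)) = dv g (cinv c y)"
      by (simp add: dv_def)
  qed
qed

lemma xn_chart: "c \<in> charts_at M p \<Longrightarrow> xn p = sqrt (ginner M c p (X p c) (X p c))"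
  by (simp add: xn_def metric_gram Xt)

lemma xn_nonneg: "xn p \<ge> 0" by (simp add: xn_def metric_nonneg Xt)

lemma continuous_xn: "continuous_on UNIV xn"
proof (rule continuous_on_charts)
  fix c assume c: "c \<in> atlas M"
  have cX: "continuous_on (cim c) (\<lambda>y. X (cinv c y) c)" using XC[OF c] Ck_on_continuous_on by blast
  have "continuous_on (cim c) (\<lambda>y. sqrt (ginner M c (cinv c y) (X (cinv c y) c) (X (cinv c y) c)))"
    by (intro continuous_intros cX bounded_bilinear.continuous_on[OF bounded_bilinear_matrix_vector_mult] gram_cont c)
  then show "continuous_on (cim c) (\<lambda>y. xn (cinv c y))"
    by (rule continuous_on_eq) (use xn_chart[OF chart_at_cinv[OF c]] in auto)
qed

text \<open>Transports \<open>local_estimate\<close> to the manifold. For Z equal to density times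
  \<open>\<psi>\<close> times X, the density turns the coordinate divergence into
  \<open>dv \<psi>\<close> and the Riemannian length into \<open>\<psi>\<close> times that of X,
  both integrated against the volume.\<close>

lemma chart_estimate:
  fixes L :: real
  assumes c: "c \<in> atlas M" and p: "p \<in> cdom c" and r: "cball (cmap c p) r \<subseteq> cim c" "\<rho> < r"
    and cmp: "\<And>w v. w \<in> cball (cmap c p) r \<Longrightarrow> ginner M c (cinv c w) v v \<le> 4 * ginner M c p v v"
      "\<And>w v. w \<in> cball (cmap c p) r \<Longrightarrow> ginner M c p v v \<le> 4 * ginner M c (cinv c w) v v"
    and \<psi>: "C1fun \<psi>" "\<And>x. x \<notin> cinv c ` cball (cmap c p) \<rho> \<Longrightarrow> \<psi> x = 0" "\<And>x. \<psi> x \<ge> 0"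
    and \<eta>: "\<eta> \<in> borel_measurable borel" "\<And>x. 0 \<le> \<eta> x" "\<And>x. \<eta> x \<le> 1" "\<And>x y. \<bar>\<eta> x - \<eta> y\<bar> \<le> L * gdist M x y" "L \<ge> 0"
    and B: "B \<in> sets borel" "\<epsilon> > 0" "\<And>x y. gdist M x y < \<epsilon> \<Longrightarrow> \<eta> x \<noteq> 0 \<or> \<eta> y \<noteq> 0 \<Longrightarrow> x \<in> B"
  shows "\<bar>\<integral>x. \<eta> x * dv \<psi> x \<partial>vol M\<bar> \<le> 4 * CARD('m) * L * (\<integral>x. indicator B x * (\<psi> x * xn x) \<partial>vol M)"
proof -
  let ?K = "cball (cmap c p) \<rho>" and ?C = "cinv c ` cball (cmap c p) \<rho>"
  have Kc: "?K \<subseteq> cim c" using r by auto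
  have Cd: "?C \<subseteq> cdom c" using Kc cinv_in_cdom[OF c] by auto
  have clC: "closed ?C"
    by (intro compact_imp_closed compact_continuous_image continuous_on_subset[OF continuous_on_cinv[OF c] Kc]) auto
  have psi0: "\<psi> (cinv c y) = 0" if "y \<in> cim c" "y \<notin> ?K" for y
  proof (rule \<psi>(2))
    show "cinv c y \<notin> ?C"
    proof
      assume "cinv c y \<in> ?C"
      then obtain w where w: "w \<in> ?K" "cinv c y = cinv c w" by blast
      then have "cmap c (cinv c y) = cmap c (cinv c w)" by simp
      then have "y = w" using that(1) w(1) Kc c by (simp add: subset_iff)
      then show False using that(2) w(1) by simp
    qed
  qed
  define W where "W y = dens c y *\<^sub>R X (cinv c y) c" for y
  \<comment> \<open>The zero extension is C^1 because \<open>\<psi>\<close> already vanishes off a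
    closed ball inside the image of the chart.\<close>
  define Z where "Z y = (if y \<in> cim c then \<psi> (cinv c y) *\<^sub>R W y else 0)" for y
  have WC: "Ck_on 1 (cim c) W" unfolding W_def by (intro Ck_on_scaleR open_cim c dens_Ck XC)
  have Z0: "Z y = 0" if "y \<notin> ?K" for y using psi0 that by (simp add: Z_def)
  have ZC: "Ck_on 1 UNIV Z"
  proof (rule Ck_on_local[OF open_UNIV])
    fix y
    show "\<exists>T. open T \<and> y \<in> T \<and> Ck_on 1 T Z"
    proof (cases "y \<in> cim c")
      case True
      have "Ck_on 1 (cim c) (\<lambda>y. \<psi> (cinv c y) *\<^sub>R W y)" by (intro Ck_on_scaleR open_cim c C1funD[OF \<psi>(1) c] WC)
      then have "Ck_on 1 (cim c) Z" by (rule Ck_on_cong[OF open_cim[OF c], rotated]) (simp add: Z_def)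
      then show ?thesis using True open_cim[OF c] by blast
    next
      case False
      have "open (- ?K)" by auto
      then have "Ck_on 1 (- ?K) Z" by (rule Ck_on_cong[OF _ _ Ck_on_const[of _ _ 0]]) (simp add: Z0)
      then show ?thesis using False Kc by (intro exI[of _ "- ?K"]) auto
    qed
  qed
  have div: "(\<Sum>a\<in>UNIV. frechet_derivative Z (at y) (axis a 1) $ a) = dens c y * dv \<psi> (cinv c y)" for y
  proof (cases "y \<in> cim c")
    case True
    have ch: "c \<in> charts_at M (cinv c y)" by (rule chart_at_cinv[OF c True])
    let ?D = "frechet_derivative (\<lambda>y. \<psi> (cinv c y)) (at y)" and ?W = "frechet_derivative W (at y)"
    have D: "((\<lambda>y. \<psi> (cinv c y)) has_derivative ?D) (at y)" using C1fun_derivative[OF \<psi>(1) ch] c True by simp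
    have W: "(W has_derivative ?W) (at y)" using Ck_on_SucD[of 0 "cim c" W y] WC True by simp
    have "((\<lambda>y. \<psi> (cinv c y) *\<^sub>R W y) has_derivative (\<lambda>h. \<psi> (cinv c y) *\<^sub>R ?W h + ?D h *\<^sub>R W y)) (at y)"
      by (rule has_derivative_scaleR[OF D W])
    then have "(Z has_derivative (\<lambda>h. \<psi> (cinv c y) *\<^sub>R ?W h + ?D h *\<^sub>R W y)) (at y)"
      by (rule has_derivative_transform_within_open[OF _ open_cim[OF c] True]) (simp add: Z_def)
    from frechet_derivative_at[OF this]
    have fz: "frechet_derivative Z (at y) = (\<lambda>h. \<psi> (cinv c y) *\<^sub>R ?W h + ?D h *\<^sub>R W y)" by simp
    have WX: "(\<Sum>a\<in>UNIV. ?W (axis a 1) $ a) = dens c y * c0"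
      using Xdiv[OF ch, of ?W] W c True by (simp add: W_def[abs_def])
    have lD: "linear ?D" by (rule has_derivative_linear[OF D])
    have DX: "(\<Sum>a\<in>UNIV. ?D (axis a 1) * W y $ a) = dens c y * Xd \<psi> (cinv c y)"
    proof -
      have "(\<Sum>a\<in>UNIV. ?D (axis a 1) * W y $ a) = ?D (\<Sum>a\<in>UNIV. (W y $ a) *\<^sub>R axis a 1)"
        by (simp add: linear_sum[OF lD] linear_scale[OF lD] mult.commute)
      also have "\<dots> = ?D (W y)" using vec_axis_sum[of "W y"] by simp
      also have "\<dots> = dens c y * ?D (X (cinv c y) c)" by (simp add: W_def linear_scale[OF lD])
      also have "?D (X (cinv c y) c) = Xd \<psi> (cinv c y)" using Xd_chart[OF \<psi>(1) ch] c True by simp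
      finally show ?thesis .
    qed
    have "(\<Sum>a\<in>UNIV. frechet_derivative Z (at y) (axis a 1) $ a) = \<psi> (cinv c y) * (\<Sum>a\<in>UNIV. ?W (axis a 1) $ a) + (\<Sum>a\<in>UNIV. ?D (axis a 1) * W y $ a)"
      unfolding fz by (simp add: sum.distrib sum_distrib_left)
    then show ?thesis unfolding WX DX by (simp add: dv_def algebra_simps)
  next
    case False
    have "(Z has_derivative (\<lambda>h. 0)) (at y)"
      by (rule has_derivative_transform_within_open[OF has_derivative_const[of 0], of "- ?K"]) (use False Kc Z0 in auto)
    from frechet_derivative_at[OF this] have "frechet_derivative Z (at y) = (\<lambda>h. 0)" by simp
    then show ?thesis using False by (simp add: dens_def)
  qed
  have nZ: "sqrt (ginner M c (cinv c y) (Z y) (Z y)) = dens c y * (\<psi> (cinv c y) * xn (cinv c y))" for y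
  proof (cases "y \<in> cim c")
    case True
    let ?k = "\<psi> (cinv c y) * dens c y"
    have "ginner M c (cinv c y) (Z y) (Z y) = ?k\<^sup>2 * ginner M c (cinv c y) (X (cinv c y) c) (X (cinv c y) c)"
      using True by (simp add: Z_def W_def matrix_vector_mult_scaleR power2_eq_square)
    then have "sqrt (ginner M c (cinv c y) (Z y) (Z y)) = \<bar>?k\<bar> * xn (cinv c y)"
      using xn_chart[OF chart_at_cinv[OF c True]] by (simp add: real_sqrt_mult)
    then show ?thesis using \<psi>(3) dens_nonneg[OF c] by (simp add: abs_mult)
  qed (simp add: Z_def dens_def)
  have dm: "dv \<psi> \<in> borel_measurable borel" by (rule borel_measurable_continuous_onI[OF continuous_dv[OF \<psi>(1)]])
  have xm: "xn \<in> borel_measurable borel" by (rule borel_measurable_continuous_onI[OF continuous_xn])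
  have pm: "\<psi> \<in> borel_measurable borel"
    by (rule borel_measurable_continuous_onI, rule continuous_on_charts, rule Ck_on_continuous_on, rule C1funD[OF \<psi>(1)])
  have out: "dv \<psi> x = 0" "\<psi> x = 0" if "x \<notin> cdom c" for x
  proof -
    show "\<psi> x = 0" using that Cd \<psi>(2) by blast
    moreover have "Xd \<psi> x = 0"
      by (rule Xd_local_const[of "- ?C" _ _ 0]) (use clC Cd that \<psi>(2) in auto)
    ultimately show "dv \<psi> x = 0" by (simp add: dv_def)
  qed
  have i1: "(\<integral>x. \<eta> x * dv \<psi> x \<partial>vol M) = (\<integral>y. \<eta> (cinv c y) * (\<Sum>a\<in>UNIV. frechet_derivative Z (at y) (axis a 1) $ a) \<partial>lborel)"
    unfolding div using \<eta>(1) dm out by (subst integral_vol_chart[OF c]) (auto simp: mult_ac)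
  have i2: "(\<integral>x. indicator B x * (\<psi> x * xn x) \<partial>vol M) = (\<integral>y. indicator B (cinv c y) * sqrt (ginner M c (cinv c y) (Z y) (Z y)) \<partial>lborel)"
    unfolding nZ using B(1) pm xm out by (subst integral_vol_chart[OF c]) (auto simp: mult_ac)
  show ?thesis unfolding i1 i2
    by (rule local_estimate[OF c p r cmp ZC Z0 \<eta> B]; assumption)
qed

text \<open>Partition of unity in product form: with bumps \<open>\<beta>\<close> the function 1 -
  (product of the 1 - \<open>\<beta>\<close>) equals 1 on the union of the plateaus. It splits off
  one bump at a time with nonnegative weights, so the constant does not depend on how many charts
  are needed to cover K.\<close>

theorem vfield_estimate:
  fixes L :: real
  assumes \<eta>: "continuous_on UNIV \<eta>" "\<And>x. 0 \<le> \<eta> x" "\<And>x. \<eta> x \<le> 1" "\<And>x y. \<bar>\<eta> x - \<eta> y\<bar> \<le> L * gdist M x y" "L \<ge> 0"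
    and K: "compact K" "\<And>x. x \<notin> K \<Longrightarrow> \<eta> x = 0"
    and B: "B \<in> sets borel" "\<epsilon> > 0" "\<And>x y. gdist M x y < \<epsilon> \<Longrightarrow> \<eta> x \<noteq> 0 \<or> \<eta> y \<noteq> 0 \<Longrightarrow> x \<in> B"
    and K2: "compact K2" "B \<subseteq> K2"
  shows "\<bar>\<integral>x. \<eta> x * c0 \<partial>vol M\<bar> \<le> 4 * CARD('m) * L * (\<integral>x. indicator B x * xn x \<partial>vol M)"
proof -
  let ?k = "4 * CARD('m) * L"
  have \<eta>m: "\<eta> \<in> borel_measurable borel" by (rule borel_measurable_continuous_onI[OF \<eta>(1)])
  have Kb: "K \<in> sets borel" using compact_imp_closed[OF K(1)] by simp
  have int1: "integrable (vol M) (\<lambda>x. \<eta> x * f x)" if "continuous_on UNIV f" for f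
  proof -
    have "integrable (vol M) (\<lambda>x. indicator K x * (\<eta> x * f x))"
      by (rule integrable_vol_compact_support[OF K(1) _ Kb order_refl]) (intro continuous_intros \<eta>(1) that)
    also have "(\<lambda>x. indicator K x * (\<eta> x * f x)) = (\<lambda>x. \<eta> x * f x)" using K(2) by (auto simp: indicator_def fun_eq_iff)
    finally show ?thesis .
  qed
  have cC1: "continuous_on UNIV g" if "C1fun g" for g
    by (rule continuous_on_charts, rule Ck_on_continuous_on, rule C1funD[OF that])
  have int2: "integrable (vol M) (\<lambda>x. indicator B x * (g x * xn x))" if "C1fun g" for g
    by (rule integrable_vol_compact_support[OF K2(1) _ B(1) K2(2)]) (intro continuous_intros cC1 that continuous_xn)
  \<comment> \<open>The chart estimate is kept for every nonnegative C^1 weight g, since the weights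
    change during the induction.\<close>
  define G where "G p \<beta> V \<longleftrightarrow> open V \<and> p \<in> V \<and> C1fun \<beta> \<and> (\<forall>x. 0 \<le> \<beta> x \<and> \<beta> x \<le> 1) \<and> (\<forall>x\<in>V. \<beta> x = 1) \<and>
     (\<forall>g. C1fun g \<and> (\<forall>x. 0 \<le> g x) \<longrightarrow> \<bar>\<integral>x. \<eta> x * dv (\<lambda>x. g x * \<beta> x) x \<partial>vol M\<bar> \<le> ?k * (\<integral>x. indicator B x * (g x * \<beta> x * xn x) \<partial>vol M))" for p \<beta> V
  have "\<exists>\<beta> V. G p \<beta> V" for p
  proof -
    obtain c where c: "c \<in> atlas M" "p \<in> cdom c" using ex_chart charts_at_iff by blast
    obtain r where r: "r > 0" "cball (cmap c p) r \<subseteq> cim c" and cmp: "\<forall>w\<in>cball (cmap c p) r. \<forall>v.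
     ginner M c (cinv c w) v v \<le> 4 * ginner M c p v v \<and> ginner M c p v v \<le> 4 * ginner M c (cinv c w) v v"
      using local_comparison[OF c] by blast
    have h: "r / 2 > 0" "cball (cmap c p) (r / 2) \<subseteq> cim c"
      using r(1) by (auto intro!: subset_trans[OF _ r(2)])
    obtain \<beta> V where \<beta>: "open V" "p \<in> V" "C1fun \<beta>" "\<forall>x. 0 \<le> \<beta> x \<and> \<beta> x \<le> 1" "\<forall>x\<in>V. \<beta> x = 1"
      "\<forall>x. x \<notin> cinv c ` cball (cmap c p) (r / 2) \<longrightarrow> \<beta> x = 0"
      using ex_bump[OF c h] by blast
    have "\<bar>\<integral>x. \<eta> x * dv (\<lambda>x. g x * \<beta> x) x \<partial>vol M\<bar> \<le> ?k * (\<integral>x. indicator B x * (g x * \<beta> x * xn x) \<partial>vol M)"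
      if g: "C1fun g" "\<forall>x. 0 \<le> g x" for g
    proof (rule chart_estimate[OF c r(2), where \<epsilon>=\<epsilon> and \<rho>="r / 2"])
      show "C1fun (\<lambda>x. g x * \<beta> x)" by (intro C1fun_intros g \<beta>)
      show "x \<in> B" if "gdist M x y < \<epsilon>" "\<eta> x \<noteq> 0 \<or> \<eta> y \<noteq> 0" for x y by (rule B(3)[OF that])
    qed (use cmp r(1) g \<beta> \<eta>m \<eta> B(1,2) in auto)
    then have "G p \<beta> V" unfolding G_def using \<beta> by simp
    then show ?thesis by blast
  qed
  then obtain \<beta> V where G: "\<And>p. G p (\<beta> p) (V p)" by metis
  have V: "open (V p)" "p \<in> V p" "C1fun (\<beta> p)" "0 \<le> \<beta> p x \<and> \<beta> p x \<le> 1" "x \<in> V p \<Longrightarrow> \<beta> p x = 1" for p x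
    using G[of p] by (simp_all add: G_def)
  have est: "\<bar>\<integral>x. \<eta> x * dv (\<lambda>x. g x * \<beta> p x) x \<partial>vol M\<bar> \<le> ?k * (\<integral>x. indicator B x * (g x * \<beta> p x * xn x) \<partial>vol M)"
    if "C1fun g" "\<forall>x. 0 \<le> g x" for p g
    using G[of p] that by (simp add: G_def)
  have PC: "C1fun (\<lambda>x. 1 - (\<Prod>p\<in>F. 1 - \<beta> p x))" for F
    by (intro C1fun_intros C1fun_prod V(3))
  have P01: "0 \<le> (\<Prod>p\<in>F. 1 - \<beta> p x)" "(\<Prod>p\<in>F. 1 - \<beta> p x) \<le> 1" for F x
    using V(4) by (auto intro!: prod_nonneg prod_le_1)
  have ind: "\<forall>g. C1fun g \<and> (\<forall>x. 0 \<le> g x) \<longrightarrow> \<bar>\<integral>x. \<eta> x * dv (\<lambda>x. g x * (1 - (\<Prod>p\<in>F. 1 - \<beta> p x))) x \<partial>vol M\<bar>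
      \<le> ?k * (\<integral>x. indicator B x * (g x * (1 - (\<Prod>p\<in>F. 1 - \<beta> p x)) * xn x) \<partial>vol M)" if "finite F" for F
    using that
  proof (induction F rule: finite_induct)
    case empty
    have "dv (\<lambda>x. 0) p = 0" for p using Xd_local_const[of UNIV p "\<lambda>x. 0" 0] by (simp add: dv_def)
    then show ?case by simp
  next
    case (insert p F)
    show ?case
    proof (intro allI impI, elim conjE)
      fix g assume g: "C1fun g" "\<forall>x. 0 \<le> g x"
      let ?P = "\<lambda>x. \<Prod>p\<in>F. 1 - \<beta> p x"
      let ?h = "\<lambda>x. g x * (1 - \<beta> p x)"
      have hC: "C1fun ?h" by (intro C1fun_intros g V(3))
      have h0: "\<forall>x. 0 \<le> ?h x" using g V(4) by (auto intro!: mult_nonneg_nonneg)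
      have a: "C1fun (\<lambda>x. g x * \<beta> p x)" by (intro C1fun_intros g V(3))
      have b: "C1fun (\<lambda>x. ?h x * (1 - ?P x))" by (intro C1fun_intros(2)[OF hC PC])
      \<comment> \<open>Peels off the bump at p; what remains is the statement for F with the weight
        g (1 - \<open>\<beta> p\<close>), again nonnegative.\<close>
      have split: "(\<lambda>x. g x * (1 - (\<Prod>p\<in>insert p F. 1 - \<beta> p x))) = (\<lambda>x. g x * \<beta> p x + ?h x * (1 - ?P x))"
        using insert.hyps by (auto simp: fun_eq_iff algebra_simps)
      have s1: "(\<integral>x. \<eta> x * dv (\<lambda>x. g x * (1 - (\<Prod>p\<in>insert p F. 1 - \<beta> p x))) x \<partial>vol M)
         = (\<integral>x. \<eta> x * dv (\<lambda>x. g x * \<beta> p x) x \<partial>vol M) + (\<integral>x. \<eta> x * dv (\<lambda>x. ?h x * (1 - ?P x)) x \<partial>vol M)"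
        unfolding split dv_add[OF a b] distrib_left
        by (rule Bochner_Integration.integral_add[OF int1[OF continuous_dv[OF a]] int1[OF continuous_dv[OF b]]])
      have s2: "(\<integral>x. indicator B x * (g x * (1 - (\<Prod>p\<in>insert p F. 1 - \<beta> p x)) * xn x) \<partial>vol M)
         = (\<integral>x. indicator B x * (g x * \<beta> p x * xn x) \<partial>vol M) + (\<integral>x. indicator B x * (?h x * (1 - ?P x) * xn x) \<partial>vol M)"
        unfolding fun_cong[OF split] distrib_left distrib_right
        by (rule Bochner_Integration.integral_add[OF int2[OF a] int2[OF b]])
      have "\<bar>\<integral>x. \<eta> x * dv (\<lambda>x. ?h x * (1 - ?P x)) x \<partial>vol M\<bar> \<le> ?k * (\<integral>x. indicator B x * (?h x * (1 - ?P x) * xn x) \<partial>vol M)"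
        using insert.IH hC h0 by blast
      moreover have "\<bar>\<integral>x. \<eta> x * dv (\<lambda>x. g x * \<beta> p x) x \<partial>vol M\<bar> \<le> ?k * (\<integral>x. indicator B x * (g x * \<beta> p x * xn x) \<partial>vol M)"
        by (rule est[OF g])
      ultimately show "\<bar>\<integral>x. \<eta> x * dv (\<lambda>x. g x * (1 - (\<Prod>p\<in>insert p F. 1 - \<beta> p x))) x \<partial>vol M\<bar>
        \<le> ?k * (\<integral>x. indicator B x * (g x * (1 - (\<Prod>p\<in>insert p F. 1 - \<beta> p x)) * xn x) \<partial>vol M)"
        unfolding s1 s2 distrib_left by linarith
    qed
  qed
  obtain F where F: "F \<subseteq> K" "finite F" "K \<subseteq> (\<Union>p\<in>F. V p)"
    using compactE_image[OF K(1), of K V] V(1,2) by (metis UN_I subsetI)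
  let ?Q = "\<lambda>x. 1 * (1 - (\<Prod>p\<in>F. 1 - \<beta> p x))"
  have Q1: "?Q x = 1" if x: "x \<in> (\<Union>p\<in>F. V p)" for x
  proof -
    obtain p where "p \<in> F" "x \<in> V p" using x by blast
    then have "(\<Prod>p\<in>F. 1 - \<beta> p x) = 0" using F(2) V(5) by (intro prod_zero) auto
    then show ?thesis by simp
  qed
  \<comment> \<open>Where \<open>\<eta>\<close> does not vanish, the partition is identically 1 on
    an open set, so its derivative along X drops out.\<close>
  have dvQ: "\<eta> x * dv ?Q x = \<eta> x * c0" for x
  proof (cases "\<eta> x = 0")
    case False
    then have x: "x \<in> (\<Union>p\<in>F. V p)" using K(2) F(3) by blast
    have "Xd ?Q x = 0" by (rule Xd_local_const[OF _ x Q1]) (use V(1) in auto)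
    then show ?thesis using Q1[OF x] by (simp add: dv_def)
  qed simp
  have "C1fun (\<lambda>x. 1)" by (rule C1fun_intros)
  then have "\<bar>\<integral>x. \<eta> x * dv ?Q x \<partial>vol M\<bar> \<le> ?k * (\<integral>x. indicator B x * (?Q x * xn x) \<partial>vol M)"
    using ind[OF F(2), rule_format, of "\<lambda>x. 1"] by simp
  also have "\<dots> \<le> ?k * (\<integral>x. indicator B x * xn x \<partial>vol M)"
  proof (rule mult_left_mono)
    show "(\<integral>x. indicator B x * (?Q x * xn x) \<partial>vol M) \<le> (\<integral>x. indicator B x * xn x \<partial>vol M)"
    proof (rule integral_mono)
      show "integrable (vol M) (\<lambda>x. indicator B x * (?Q x * xn x))" using int2[OF PC] by simp
      show "integrable (vol M) (\<lambda>x. indicator B x * xn x)" using int2[OF C1fun_intros(1)[of 1]] by simp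
      fix x
      have "?Q x * xn x \<le> 1 * xn x" using P01[where F=F and x=x] xn_nonneg[of x] by (intro mult_right_mono) auto
      then show "indicator B x * (?Q x * xn x) \<le> indicator B x * xn x" by (simp add: indicator_def)
    qed
  qed (use \<eta>(5) in simp)
  finally show ?thesis unfolding dvQ .
qed

end

lemma (in stress) vfield_grad: "vfield M grad (snorm x0)"
proof
  show "grad p \<in> tangent_space M p" for p by (rule grad_tangent)
  show "Ck_on 1 (cim c) (\<lambda>y. grad (cinv c y) c)" if "c \<in> atlas M" for c by (rule grad_Ck[OF that])
  show "(\<Sum>a\<in>UNIV. D (axis a 1) $ a) = M.dens c (cmap c p) * snorm x0"
    if "c \<in> charts_at M p" "((\<lambda>y. M.dens c y *\<^sub>R grad (cinv c y) c) has_derivative D) (at (cmap c p))" for c p D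
    using grad_divergence[OF that] snorm_constant[of p x0] by simp
qed

text \<open>The divergence estimate with a radial cutoff. Its Lipschitz constant 1/R is the gain
  that later competes with the growth of \<open>\<phi>\<close>.\<close>

lemma (in stress) snorm_volume_bound:
  assumes "doubling M" "complete_riem M" "R > 0"
  shows "snorm x0 * measure (vol M) (gball M x0 R)
    \<le> 4 * CARD('m) / R * (\<integral>x. indicator (gball M x0 (4 * R)) x * sqrt (metric M x (grad x) (grad x)) \<partial>vol M)"
proof -
  interpret V: vfield M grad "snorm x0" by (rule vfield_grad)
  let ?d = "gdist M x0"
  \<comment> \<open>A piecewise linear function of the distance, so its Lipschitz constant comes
    from the triangle inequality alone.\<close>
  define \<eta> where "\<eta> x = max 0 (min 1 (2 - ?d x / R))" for x
  have lip: "\<bar>\<eta> x - \<eta> y\<bar> \<le> (1 / R) * gdist M x y" for x y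
  proof -
    have "\<bar>\<eta> x - \<eta> y\<bar> \<le> \<bar>?d x / R - ?d y / R\<bar>" by (simp add: \<eta>_def)
    also have "\<dots> = \<bar>?d x - ?d y\<bar> / R" using assms(3) by (simp add: diff_divide_distrib[symmetric] abs_divide)
    also have "\<dots> \<le> gdist M x y / R" using M.gdist_lipschitz assms(3) by (intro divide_right_mono) auto
    finally show ?thesis by simp
  qed
  have c\<eta>: "continuous_on UNIV \<eta>"
    unfolding \<eta>_def[abs_def] using assms(3) by (intro continuous_intros M.continuous_on_gdist) auto
  have small: "?d x < 2 * R" if "\<eta> x \<noteq> 0" for x
  proof (rule ccontr)
    assume "\<not> ?thesis"
    then have "?d x / R \<ge> 2" using assms(3) by (simp add: pos_le_divide_eq)
    then show False using that by (simp add: \<eta>_def)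
  qed
  \<comment> \<open>Points within R of the support lie in the ball of radius 3 R; 4 R is taken
    because it is two doublings of R.\<close>
  let ?B = "gball M x0 (4 * R)" and ?K = "{x. ?d x \<le> 4 * R}"
  have K: "compact ?K" by (rule M.gcball_compact[OF assms(1,2)])
  have inB: "x \<in> ?B" if "gdist M x y < R" "\<eta> x \<noteq> 0 \<or> \<eta> y \<noteq> 0" for x y
  proof -
    have "?d x < 3 * R"
      using that(2)
    proof
      assume "\<eta> x \<noteq> 0" then show ?thesis using small assms(3) by fastforce
    next
      assume "\<eta> y \<noteq> 0"
      then show ?thesis using small[of y] that(1) M.gdist_triangle[of x0 x y] M.gdist_commute[of x y] by simp
    qed
    then show ?thesis using assms(3) by (simp add: gball_def)
  qed
  have "\<bar>\<integral>x. \<eta> x * snorm x0 \<partial>vol M\<bar> \<le> 4 * CARD('m) * (1 / R) * (\<integral>x. indicator ?B x * V.xn x \<partial>vol M)"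
  proof (rule V.vfield_estimate[OF c\<eta> _ _ lip _ K _ _ assms(3) _ K])
    show "x \<notin> ?K \<Longrightarrow> \<eta> x = 0" for x using small[of x] assms(3) by fastforce
    show "x \<in> ?B" if "gdist M x y < R" "\<eta> x \<noteq> 0 \<or> \<eta> y \<noteq> 0" for x y by (rule inB[OF that])
  qed (use assms(3) in \<open>auto simp: \<eta>_def gball_def intro: M.gball_borel[unfolded gball_def]\<close>)
  moreover have "snorm x0 * measure (vol M) (gball M x0 R) \<le> (\<integral>x. \<eta> x * snorm x0 \<partial>vol M)"
  proof -
    have s0: "snorm x0 \<ge> 0" unfolding snorm_def by (rule N.metric_nonneg[OF s_tangent])
    have Kb: "?K \<in> sets borel" using compact_imp_closed[OF K] by simp
    have fin: "emeasure (vol M) (gball M x0 R) < \<infinity>" by (rule M.vol_gball_finite[OF assms(1)])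
    have i1: "integrable (vol M) (\<lambda>x. indicator (gball M x0 R) x * snorm x0)"
      using fin by (intro integrable_mult_left integrable_real_indicator) auto
    have i2: "integrable (vol M) (\<lambda>x. indicator ?K x * (\<eta> x * snorm x0))"
      by (rule M.integrable_vol_compact_support[OF K _ Kb order_refl]) (intro continuous_intros c\<eta>)
    have eK: "(\<lambda>x. indicator ?K x * (\<eta> x * snorm x0)) = (\<lambda>x. \<eta> x * snorm x0)"
    proof
      fix x
      show "indicator ?K x * (\<eta> x * snorm x0) = \<eta> x * snorm x0"
        using small[of x] assms(3) by (cases "\<eta> x = 0") (auto simp: indicator_def)
    qed
    have "(\<integral>x. indicator (gball M x0 R) x * snorm x0 \<partial>vol M) \<le> (\<integral>x. \<eta> x * snorm x0 \<partial>vol M)"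
    proof (rule integral_mono[OF i1 i2[unfolded eK]])
      fix x
      have "indicator (gball M x0 R) x \<le> \<eta> x"
      proof (cases "x \<in> gball M x0 R")
        case True
        then have "?d x / R \<le> 1" using assms(3) by (simp add: gball_def)
        then show ?thesis by (simp add: \<eta>_def indicator_def)
      qed (simp add: \<eta>_def)
      then show "indicator (gball M x0 R) x * snorm x0 \<le> \<eta> x * snorm x0" using s0 by (rule mult_right_mono)
    qed
    moreover have "(\<integral>x. indicator (gball M x0 R) x * snorm x0 \<partial>vol M) = snorm x0 * measure (vol M) (gball M x0 R)"
      using fin by (simp add: mult.commute)
    ultimately show ?thesis by (simp add: mult.commute)
  qed
  ultimately show ?thesis unfolding V.xn_def by (simp add: field_simps)
qed

text \<open>On the ball \<open>\<phi>\<close> of the distance is at most \<open>\<phi> R\<close> by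
  monotonicity, so the unweighted integral costs a factor \<open>\<phi> R\<close>. The inequality
  lives in the extended nonnegative reals because the weighted integral could be infinite.\<close>

lemma (in stress) weighted_bound:
  fixes \<phi> :: "real \<Rightarrow> real"
  assumes "doubling M" "complete_riem M" and \<phi>: "\<And>t. t > 0 \<Longrightarrow> \<phi> t > 0" "mono_on {0<..} \<phi>" and "R > 0" and s0: "snorm x0 > 0"
  shows "ennreal (\<integral>x. indicator (gball M x0 R) x * sqrt (metric M x (grad x) (grad x)) \<partial>vol M)
    \<le> ennreal (sqrt (snorm x0) * \<phi> R) * (\<integral>\<^sup>+x\<in>gball M x0 R. ennreal (hs_norm M N u (sigma_F F M N u) x / \<phi> (gdist M x0 x)) \<partial>vol M)"
proof -
  interpret V: vfield M grad "snorm x0" by (rule vfield_grad)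
  let ?B = "gball M x0 R" and ?hs = "hs_norm M N u (sigma_F F M N u)"
  define k where "k = sqrt (snorm x0) * \<phi> R"
  have k: "k > 0" using s0 \<phi>(1) \<open>R > 0\<close> by (simp add: k_def)
  have int: "integrable (vol M) (\<lambda>x. indicator ?B x * V.xn x)"
    by (rule M.integrable_vol_compact_support[OF M.gcball_compact[OF assms(1,2), of x0 R] V.continuous_xn])
       (auto simp: gball_def intro: M.gball_borel[unfolded gball_def])
  have hs0: "?hs x \<ge> 0" for x
    by (simp add: hs_norm_def Let_def sum_nonneg N.metric_nonneg sigma_F_tangent)
  have xh: "V.xn x \<le> sqrt (snorm x0) * ?hs x" for x
  proof -
    have "metric M x (grad x) (grad x) \<le> snorm x0 * (?hs x)\<^sup>2"
      using grad_norm[of x] snorm_constant[of x x0] by (simp add: snorm_def)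
    then have "sqrt (metric M x (grad x) (grad x)) \<le> sqrt (snorm x0 * (?hs x)\<^sup>2)" by (rule real_sqrt_le_mono)
    then show ?thesis using hs0[of x] by (simp add: V.xn_def real_sqrt_mult)
  qed
  have "ennreal (\<integral>x. indicator ?B x * V.xn x \<partial>vol M) = (\<integral>\<^sup>+x. ennreal (indicator ?B x * V.xn x) \<partial>vol M)"
    by (rule nn_integral_eq_integral[OF int, symmetric]) (simp add: V.xn_nonneg)
  also have "\<dots> = (\<integral>\<^sup>+x. ennreal k * ennreal (indicator ?B x * V.xn x / k) \<partial>vol M)"
    using k V.xn_nonneg by (intro nn_integral_cong) (simp add: ennreal_mult[symmetric])
  also have "\<dots> = ennreal k * (\<integral>\<^sup>+x. ennreal (indicator ?B x * V.xn x / k) \<partial>vol M)"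
  proof (rule nn_integral_cmult)
    have [measurable]: "V.xn \<in> borel_measurable borel" by (rule borel_measurable_continuous_onI[OF V.continuous_xn])
    have [measurable]: "?B \<in> sets borel" by simp
    show "(\<lambda>x. ennreal (indicator ?B x * V.xn x / k)) \<in> borel_measurable (vol M)"
      unfolding M.borel_measurable_vol by measurable
  qed
  also have "(\<integral>\<^sup>+x. ennreal (indicator ?B x * V.xn x / k) \<partial>vol M) \<le> (\<integral>\<^sup>+x\<in>?B. ennreal (?hs x / \<phi> (gdist M x0 x)) \<partial>vol M)"
  proof (rule nn_integral_mono_AE)
    \<comment> \<open>At the base point the distance is 0, where nothing is known about
      \<open>\<phi>\<close>; the pointwise comparison is made elsewhere.\<close>
    have "{x0} \<in> null_sets (vol M)" using M.vol_singleton[of x0] by (auto simp: null_sets_def)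
    then have "AE x in vol M. x \<notin> {x0}" by (rule AE_not_in)
    then show "AE x in vol M. ennreal (indicator ?B x * V.xn x / k) \<le> ennreal (?hs x / \<phi> (gdist M x0 x)) * indicator ?B x"
    proof eventually_elim
      fix x assume "x \<notin> {x0}"
      then have x: "x \<noteq> x0" by simp
      show "ennreal (indicator ?B x * V.xn x / k) \<le> ennreal (?hs x / \<phi> (gdist M x0 x)) * indicator ?B x"
      proof (cases "x \<in> ?B")
        case True
        have d: "gdist M x0 x > 0" "gdist M x0 x < R"
          using True M.gdist_nonneg[of x0 x] Metric_space.zero[OF M.metric_space_gdist, of x0 x] x by (auto simp: gball_def less_le)
        have pd: "\<phi> (gdist M x0 x) > 0" "\<phi> (gdist M x0 x) \<le> \<phi> R"
          using \<phi>(1)[OF d(1)] mono_onD[OF \<phi>(2), of "gdist M x0 x" R] d \<open>R > 0\<close> by auto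
        have "V.xn x / k \<le> (sqrt (snorm x0) * ?hs x) / k" using xh k by (intro divide_right_mono) auto
        also have "\<dots> = ?hs x / \<phi> R" using s0 by (simp add: k_def)
        also have "\<dots> \<le> ?hs x / \<phi> (gdist M x0 x)" using hs0[of x] pd by (intro divide_left_mono) auto
        finally show ?thesis using True by (simp add: ennreal_leI)
      qed simp
    qed
  qed
  then have "ennreal k * (\<integral>\<^sup>+x. ennreal (indicator ?B x * V.xn x / k) \<partial>vol M) \<le> ennreal k * (\<integral>\<^sup>+x\<in>?B. ennreal (?hs x / \<phi> (gdist M x0 x)) \<partial>vol M)"
    by (intro mult_left_mono) auto
  finally show ?thesis unfolding V.xn_def k_def .
qed

theorem corollary5p2:
  fixes M :: "('a::{t2_space, second_countable_topology}, 'm::finite) riem"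
    and N :: "('b::{t2_space, second_countable_topology}, 'n::finite) riem"
    and F \<phi> :: "real \<Rightarrow> real"
    and u :: "'a \<Rightarrow> 'b"
    and s :: "'a \<Rightarrow> ('b, 'n) tvec"
    and x0 :: 'a
  assumes "C2_halfline F"
    and "\<And>t. t \<ge> 0 \<Longrightarrow> F t \<ge> 0"
    and "F 0 = 0"
    and "\<And>t. t > 0 \<Longrightarrow> halfline_deriv F t > 0"
    and "F_degree F < \<infinity>"
    and "riemannian_manifold M"
    and "complete_riem M"
    and "\<not> compact (UNIV :: 'a set)"
    and "doubling M"
    and "riemannian_manifold N"
    and "Ck_map 2 M N u"
    and "parallel_section M N u s"
    and "\<And>p. divergence M N u (sigma_F F M N u) p = s p"
    and "\<And>t. t > 0 \<Longrightarrow> \<phi> t > 0"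
    and "mono_on {0<..} \<phi>"
    and "\<phi> \<in> o[at_top](\<lambda>R. R)"
    and "Limsup at_top (\<lambda>R. (\<integral>\<^sup>+x\<in>gball M x0 R.
             ennreal (hs_norm M N u (sigma_F F M N u) x / \<phi> (gdist M x0 x)) \<partial>vol M)
           / emeasure (vol M) (gball M x0 R)) < \<infinity>"
  shows "stationary F M N u"
proof -
  interpret S: stress M N F u s
    using assms by unfold_locales auto
  let ?I = "\<lambda>R. \<integral>\<^sup>+x\<in>gball M x0 R. ennreal (hs_norm M N u (sigma_F F M N u) x / \<phi> (gdist M x0 x)) \<partial>vol M"
  let ?V = "\<lambda>R. emeasure (vol M) (gball M x0 R)"
  let ?c = "S.snorm x0"
  have c0: "?c \<ge> 0" unfolding S.snorm_def by (rule S.N.metric_nonneg[OF S.s_tangent])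
  have "?c = 0"
  proof (rule ccontr)
    assume "?c \<noteq> 0"
    then have cpos: "?c > 0" using c0 by simp
    obtain D where D: "D > 0" "\<And>R x. R > 0 \<Longrightarrow> emeasure (vol M) (gball M x (2 * R)) \<le> ennreal D * emeasure (vol M) (gball M x R)"
      using assms(9) unfolding doubling_def by blast
    \<comment> \<open>A finite bound strictly above the limsup, so that the quotients themselves lie
      below it for all large radii.\<close>
    obtain L where L: "Limsup at_top (\<lambda>R. ?I R / ?V R) < L" "L < top"
      using dense[OF assms(17)] by (auto simp: infinity_ennreal_def)
    define C where "C = enn2real L"
    have LC: "L = ennreal C" "C \<ge> 0" using L(2) by (simp_all add: C_def)
    have ev1: "\<forall>\<^sub>F R in at_top. ?I R / ?V R < L" by (rule Limsup_lessD[OF L(1)])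
    \<comment> \<open>Collects every constant of the final chain: 4 m from the divergence estimate,
      the length of s, the growth bound C, and D squared from two doublings.\<close>
    define A where "A = 4 * CARD('m) * sqrt ?c * C * D\<^sup>2"
    have A0: "A \<ge> 0" using LC(2) c0 D(1) by (simp add: A_def)
    \<comment> \<open>Chosen so that 4 A e is at most half of the supposedly positive constant; the
      summand 1 covers the case A = 0.\<close>
    define e where "e = ?c / (4 * A + 1) / 2"
    have e: "e > 0" using cpos A0 by (simp add: e_def)
    have ev2: "\<forall>\<^sub>F R in at_top. norm (\<phi> R) \<le> e * norm R" by (rule landau_o.smallD[OF assms(16) e])
    obtain R0 where R0: "\<And>R. R \<ge> R0 \<Longrightarrow> ?I R / ?V R < L \<and> norm (\<phi> R) \<le> e * norm R"
      using eventually_conj[OF ev1 ev2] unfolding eventually_at_top_linorder by blast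
    define R where "R = max R0 1"
    have R: "R > 0" "4 * R \<ge> R0" by (auto simp: R_def)
    have Vfin: "?V r < \<infinity>" for r by (rule S.M.vol_gball_finite[OF assms(9)])
    have Vpos: "?V r > 0" if "r > 0" for r by (rule S.M.vol_gball_pos[OF that])
    define W where "W = measure (vol M) (gball M x0 R)"
    have VW: "?V R = ennreal W" unfolding W_def using Vfin[of R] by (intro emeasure_eq_ennreal_measure) (auto simp: less_top)
    have W: "W > 0" using Vpos[OF R(1)] unfolding VW by simp
    have V4: "?V (4 * R) \<le> ennreal (D\<^sup>2 * W)"
    proof -
      \<comment> \<open>Returns from the ball of radius 4 R, where the field is integrated, to the
        ball of radius R, so that its volume cancels at the end.\<close>
      have "?V (2 ^ 2 * R) \<le> ennreal D ^ 2 * ?V R" by (rule S.M.doubling_iterate[OF D(2) R(1)])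
      then show ?thesis using D(1) W by (simp add: VW ennreal_power ennreal_mult)
    qed
    have I4: "?I (4 * R) \<le> ennreal (C * (D\<^sup>2 * W))"
    proof -
      \<comment> \<open>Undoing the division by the volume is legitimate only for a positive finite
        volume.\<close>
      have v: "?V (4 * R) \<noteq> 0" "?V (4 * R) \<noteq> top" using Vpos[of "4 * R"] Vfin[of "4 * R"] R(1) by auto
      have "?I (4 * R) = ?V (4 * R) * (?I (4 * R) / ?V (4 * R))"
        using ennreal_mult_divide_eq[OF v, of "?I (4 * R)"] by (simp add: ennreal_times_divide mult.commute)
      also have "\<dots> \<le> ?V (4 * R) * L" using R0[OF R(2)] by (intro mult_left_mono) auto
      also have "\<dots> \<le> ennreal (D\<^sup>2 * W) * ennreal C" unfolding LC(1) by (rule mult_right_mono[OF V4]) simp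
      finally show ?thesis using LC(2) W by (simp add: ennreal_mult[symmetric] mult.commute)
    qed
    have p4: "\<phi> (4 * R) > 0" using assms(14) R(1) by simp
    let ?J = "\<integral>x. indicator (gball M x0 (4 * R)) x * sqrt (metric M x (S.grad x) (S.grad x)) \<partial>vol M"
    have "ennreal ?J \<le> ennreal (sqrt ?c * \<phi> (4 * R)) * ?I (4 * R)"
      by (rule S.weighted_bound[OF assms(9,7) assms(14,15) _ cpos]) (use R in auto)
    also have "\<dots> \<le> ennreal (sqrt ?c * \<phi> (4 * R)) * ennreal (C * (D\<^sup>2 * W))" by (rule mult_left_mono[OF I4]) simp
    also have "\<dots> = ennreal (sqrt ?c * \<phi> (4 * R) * (C * (D\<^sup>2 * W)))" using p4 c0 LC(2) W by (subst ennreal_mult) auto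
    finally have J: "?J \<le> sqrt ?c * \<phi> (4 * R) * (C * (D\<^sup>2 * W))"
      by (subst (asm) ennreal_le_iff) (use p4 c0 LC(2) W in auto)
    have "?c * W \<le> 4 * CARD('m) / R * ?J"
      unfolding W_def by (rule S.snorm_volume_bound[OF assms(9,7) R(1)])
    also have "\<dots> \<le> 4 * CARD('m) / R * (sqrt ?c * \<phi> (4 * R) * (C * (D\<^sup>2 * W)))"
      by (rule mult_left_mono[OF J]) (use R(1) in simp)
    also have "\<dots> = (A * \<phi> (4 * R) / R) * W" by (simp add: A_def)
    finally have "?c * W \<le> (A * \<phi> (4 * R) / R) * W" by simp
    then have "?c \<le> A * \<phi> (4 * R) / R" using W by (rule mult_right_le_imp_le)
    also have "\<dots> \<le> A * (e * (4 * R)) / R"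
      using R0[OF R(2)] p4 A0 R(1) by (intro divide_right_mono mult_left_mono) auto
    also have "\<dots> = 4 * A * e" using R(1) by simp
    also have "\<dots> \<le> (4 * A + 1) * e" using e by (simp add: algebra_simps)
    also have "\<dots> = ?c / 2" using A0 by (simp add: e_def divide_simps)
    finally show False using cpos by simp
  qed
  \<comment> \<open>The squared length of s is the same at all points, and it is 0 at the base
    point; positive definiteness of the metric of N makes s vanish.\<close>
  then have "s p = tzero" for p
    using S.snorm_constant[of p x0] S.N.metric_pos[OF S.s_tangent, of p] by (force simp: S.snorm_def)
  then show ?thesis using assms(13) by (simp add: stationary_def)
qed

end
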